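(* Let $\alpha\in(0,1)$. Consider the totally asymmetric simple exclusion process (TASEP) on $\mathbb Z$ with particles jumping to the left, started from independent Bernoulli($\alpha$) occupation variables at each site conditioned on the event that the origin is occupied. Label the particles in increasing order from left to right so that the particle at the origin at time $0$ has label $0$, and let $R^E_i(t)$ be the position of the $i$-th particle at time $t$ (so $R^E_0(0)=0$). Put $\varrho=1/\alpha-1$ and $V^\varrho=\frac1{(1+\varrho)^2}=\alpha^2$. Then there exists a constant $0<C<\infty$ such that $$C^{-1}\;\le\;\liminf_{t\to\infty}\frac{\mathbf{Var}\big(R^E_{[V^\varrho t]}(t)\big)}{t^{2/3}}\;\le\;\limsup_{t\to\infty}\frac{\mathbf{Var}\big(R^E_{[V^\varrho t]}(t)\big)}{t^{2/3}}\;\le\; C.$$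
   Context: In this TASEP each site $i\in\mathbb Z$ has occupation $\omega^E_i\in\{0,1\}$, and independently for different sites a particle at site $i$ jumps to site $i-1$ with rate $\mathbb I_{\{\omega^E_i=1\}}\cdot\mathbb I_{\{\omega^E_{i-1}=0\}}$. Particles cannot pass each other, so their ordering and labels are preserved over time. $[x]$ denotes the first integer from $x$ towards the origin, so $[x]=\lfloor x\rfloor$ for $x\ge0$. *)

theory Defs
  imports "HOL-Probability.Probability"
begin

definition toward_origin :: "real \<Rightarrow> int" where
  "toward_origin x = (if 0 \<le> x then \<lfloor>x\<rfloor> else \<lceil>x\<rceil>)"

definition bernoulli_origin_occupied :: "real \<Rightarrow> (int \<Rightarrow> bool) measure" where
  "bernoulli_origin_occupied \<alpha> =
     uniform_measure (\<Pi>\<^sub>M x\<in>(UNIV :: int set). measure_pmf (bernoulli_pmf \<alpha>)) {\<omega>. \<omega> 0}"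

definition occupied :: "(int \<Rightarrow> int) \<Rightarrow> int \<Rightarrow> bool" where
  "occupied r x \<longleftrightarrow> (\<exists>i. r i = x)"

(* The argument e lists the successive waiting times of a clock. *)
definition rings_at :: "(nat \<Rightarrow> real) \<Rightarrow> real \<Rightarrow> bool" where
  "rings_at e t \<longleftrightarrow> (\<exists>n. t = (\<Sum>k\<le>n. e k))"

(* Harris' graphical description of the dynamics, for one realisation. Every site x carries a
   clock with waiting times e x; when it rings, a particle at x jumps to x - 1 if that site is
   vacant. r i t is the position at time t of the particle with label i, and l collects the
   positions just before time t. Positions are integers, so left limits and right continuity
   amount to being eventually constant. *)
definition tasep_path :: "(int \<Rightarrow> nat \<Rightarrow> real) \<Rightarrow> (int \<Rightarrow> real \<Rightarrow> int) \<Rightarrow> bool" where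
  "tasep_path e r \<longleftrightarrow>
     strict_mono (\<lambda>i. r i 0) \<and> r 0 0 = 0 \<and>
     (\<forall>i. \<forall>t\<ge>0. \<forall>\<^sub>F s in at_right t. r i s = r i t) \<and>
     (\<forall>t>0. \<exists>l. \<forall>i.
        (\<forall>\<^sub>F s in at_left t. r i s = l i) \<and>
        r i t = (if rings_at (e (l i)) t \<and> \<not> occupied l (l i - 1) then l i - 1 else l i))"

(* The clocks are independent rate 1 Poisson processes (i.i.d. exponential waiting times),
   independent of the initial occupation variables, so that a particle at x jumps to x - 1 with
   rate 1 precisely while x - 1 is vacant. The paths are determined by the initial configuration
   and the clocks only outside a null set, hence the measurability assumption on R. *)
locale bernoulli_tasep = prob_space M
  for M :: "'a measure" +
  fixes \<alpha> :: real
    and E :: "int \<Rightarrow> nat \<Rightarrow> 'a \<Rightarrow> real"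
    and R :: "int \<Rightarrow> real \<Rightarrow> 'a \<Rightarrow> int"
  assumes waiting_times_exponential:
      "\<And>x k. distributed M lborel (E x k) (exponential_density 1)"
    and waiting_times_indep:
      "indep_vars (\<lambda>_. borel) (\<lambda>(x, k). E x k) (UNIV :: (int \<times> nat) set)"
    and initial_law:
      "distr M (\<Pi>\<^sub>M x\<in>(UNIV :: int set). count_space (UNIV :: bool set))
         (\<lambda>w. occupied (\<lambda>i. R i 0 w)) = bernoulli_origin_occupied \<alpha>"
    and initial_indep_clocks:
      "indep_set
         (sets (vimage_algebra (space M) (\<lambda>w. occupied (\<lambda>i. R i 0 w))
            (\<Pi>\<^sub>M x\<in>(UNIV :: int set). count_space (UNIV :: bool set))))
         (sets (vimage_algebra (space M) (\<lambda>w (x, k). E x k w)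
            (\<Pi>\<^sub>M p\<in>(UNIV :: (int \<times> nat) set). (borel :: real measure))))"
    and measurable_positions:
      "\<And>i t. 0 \<le> t \<Longrightarrow> R i t \<in> measurable M (count_space UNIV)"
    and paths:
      "AE w in M. tasep_path (\<lambda>x k. E x k w) (\<lambda>i t. R i t w)"

end

theory Submission imports Defs
begin

text \<open>Let \<open>n = \<lfloor>\<alpha>\<^sup>2 t\<rfloor>\<close> and let \<open>n - H\<close> be the position of particle \<open>n\<close> at time \<open>t\<close>; a positive \<open>H\<close>
  counts the holes from the left of the origin that it has overtaken.  For \<open>k \<ge> 1\<close>, \<open>H \<ge> k\<close> iff a last passage time
  \<open>T(n,k)\<close> with unit exponential weights is at most \<open>t\<close>.  Averaging over the Bernoulli configurations on the two
  half lines turns the boundary of this percolation problem into the stationary one up to a single exponential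
  variable, so \<open>T\<close> can be replaced by the passage time \<open>L\<close> with boundary rates \<open>\<alpha>\<close> and \<open>1 - \<alpha>\<close>.

  For boundary rates \<open>z\<close> and \<open>1 - w\<close> Burke's property gives
  \<open>E exp ((z - w) L(m,n)) = (z / w)\<^sup>m ((1 - w) / (1 - z))\<^sup>n\<close>.  In the characteristic direction, with
  \<open>z\<close> and \<open>w\<close> within \<open>O(t\<^sup>-\<^sup>1\<^sup>/\<^sup>3)\<close> of \<open>\<alpha>\<close>, the logarithm is \<open>(z - w) t + O(1)\<close>; this yields the right tail
  of \<open>L - t\<close> on the scale \<open>t\<^sup>1\<^sup>/\<^sup>3\<close>, and convexity in the boundary weights the left tail.  For the lower bound,
  changing the rate by \<open>t\<^sup>-\<^sup>1\<^sup>/\<^sup>3\<close> raises the mean by a multiple of \<open>t\<^sup>1\<^sup>/\<^sup>3\<close>, and only the first \<open>O(t\<^sup>2\<^sup>/\<^sup>3)\<close>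
  boundary weights matter, for which the change of measure has bounded second moment.  As the vertical increments of
  \<open>L\<close> are independent exponential variables, fluctuations of \<open>L\<close> at fixed \<open>k\<close> become fluctuations of \<open>H\<close>
  at fixed \<open>t\<close>.\<close>

section \<open>Exponential variables\<close>

text \<open>Clocks sit at sites, but percolation weights belong to particle-hole pairs, and an
  infinite system has no first jump to start from. So the pairs of a finite window are swept in an
  order that consumes each clock chronologically; lack of memory makes every revealed wait a fresh
  unit exponential. The initial configuration is treated alike: partial sums of exponentials,
  lowered by an independent exponential variable and cut at 0, keep their law when one more
  Bernoulli site is read, so this sequence can close off a window of any size and growing windows
  give an exact law. The particle at the origin adds one line on the left, which removes the
  exponential variable there; the one on the right remains and shifts times only by O(1). The index
  n = \<alpha>^2 t marks the characteristic direction: the mean of the stationary passage time, as a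
  function of the density, is minimal there up to O(1), so a change d of the density costs only
  about t d^2. Tilting by d resolves fluctuations of size 1/d, and t d^2 = 1/d gives d = t^(-1/3).
  Throughout, \<tau> as a scale stands for t^(1/3).\<close>

definition expm :: "real \<Rightarrow> real measure" where
  "expm r = density lborel (exponential_density r)"

lemma sets_expm [measurable_cong, simp]: "sets (expm r) = sets borel"
  by (simp add: expm_def)

lemma space_expm [simp]: "space (expm r) = UNIV"
  by (simp add: expm_def)

lemma prob_space_expm: "0 < r \<Longrightarrow> prob_space (expm r)"
  unfolding expm_def by (rule prob_space_exponential_density)

lemma nn_integral_expm:
  assumes [measurable]: "f \<in> borel_measurable borel"
  shows "(\<integral>\<^sup>+x. f x \<partial>expm r) = (\<integral>\<^sup>+x. ennreal (exponential_density r x) * f x \<partial>lborel)"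
  unfolding expm_def by (subst nn_integral_density) auto

lemma AE_expm_pos: "0 < r \<Longrightarrow> AE x in expm r. 0 < x"
proof -
  have "AE x in lborel. x \<noteq> (0::real)"
    by (simp add: AE_lborel_singleton)
  then show ?thesis
    unfolding expm_def by (subst AE_density) (auto simp: exponential_density_def)
qed

text \<open>Lack of memory. The integrand is arbitrary so that the formula can be used inside
  iterated integrals.\<close>

lemma expm_tail_le:
  assumes r: "0 < r" and u: "0 \<le> u" and [measurable]: "f \<in> borel_measurable borel"
  shows "(\<integral>\<^sup>+x. indicator {u..} x * f x \<partial>expm r) = ennreal (exp (- r * u)) * (\<integral>\<^sup>+x. f (u + x) \<partial>expm r)"
proof -
  have "(\<integral>\<^sup>+x. indicator {u..} x * f x \<partial>expm r) =
      (\<integral>\<^sup>+x. ennreal (exponential_density r x) * (indicator {u..} x * f x) \<partial>lborel)"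
    by (subst nn_integral_expm) auto
  also have "\<dots> = (\<integral>\<^sup>+x. ennreal (exponential_density r (u + 1 * x)) * (indicator {u..} (u + 1 * x) * f (u + 1 * x)) \<partial>lborel)"
    by (subst nn_integral_real_affine[where c=1 and t=u]) auto
  also have "\<dots> = (\<integral>\<^sup>+x. ennreal (exp (- r * u)) * (ennreal (exponential_density r x) * f (u + x)) \<partial>lborel)"
  proof (intro nn_integral_cong)
    fix x :: real
    show "ennreal (exponential_density r (u + 1 * x)) * (indicator {u..} (u + 1 * x) * f (u + 1 * x)) =
      ennreal (exp (- r * u)) * (ennreal (exponential_density r x) * f (u + x))"
    proof (cases "x < 0")
      case True then show ?thesis by (simp add: exponential_density_def)
    next
      case False
      have "r * exp (- (u + x) * r) = exp (- r * u) * (r * exp (- x * r))"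
        by (simp add: exp_add[symmetric] algebra_simps)
      then have "ennreal (exponential_density r (u + x)) = ennreal (exp (- r * u)) * ennreal (exponential_density r x)"
        using False u r by (simp add: exponential_density_def ennreal_mult'[symmetric])
      then show ?thesis using False by (simp add: mult.assoc)
    qed
  qed
  also have "\<dots> = ennreal (exp (- r * u)) * (\<integral>\<^sup>+x. f (u + x) \<partial>expm r)"
    by (subst nn_integral_cmult) (auto simp: nn_integral_expm)
  finally show ?thesis .
qed

lemma expm_AE_neq: "AE x in expm r. x \<noteq> u"
proof -
  have "AE x in lborel. x \<noteq> u"
    by (simp add: AE_lborel_singleton)
  then show ?thesis
    unfolding expm_def by (subst AE_density) auto
qed

lemma expm_tail_less:
  assumes r: "0 < r" and u: "0 \<le> u" and [measurable]: "f \<in> borel_measurable borel"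
  shows "(\<integral>\<^sup>+x. indicator {u<..} x * f x \<partial>expm r) = ennreal (exp (- r * u)) * (\<integral>\<^sup>+x. f (u + x) \<partial>expm r)"
proof -
  have "(\<integral>\<^sup>+x. indicator {u<..} x * f x \<partial>expm r) = (\<integral>\<^sup>+x. indicator {u..} x * f x \<partial>expm r)"
  proof (rule nn_integral_cong_AE)
    show "AE x in expm r. indicator {u<..} x * f x = indicator {u..} x * f x"
      using expm_AE_neq[of u r] by eventually_elim (auto simp: indicator_def)
  qed
  then show ?thesis using expm_tail_le[OF assms] by simp
qed

text \<open>An exponential factor only moves the rate, at the price \<open>z / (z - c)\<close>;
  \<open>c\<close> may be negative. The exact generating functions and the change of measure below
  rest on this.\<close>

lemma expm_tilt:
  assumes "0 < z" "c < z" and [measurable]: "f \<in> borel_measurable borel"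
  shows "(\<integral>\<^sup>+x. ennreal (exp (c * x)) * f x \<partial>expm z) = ennreal (z / (z - c)) * (\<integral>\<^sup>+x. f x \<partial>expm (z - c))"
proof -
  have "(\<integral>\<^sup>+x. ennreal (exp (c * x)) * f x \<partial>expm z) =
    (\<integral>\<^sup>+x. ennreal (z / (z - c)) * (ennreal (exponential_density (z - c) x) * f x) \<partial>lborel)"
  proof (subst nn_integral_expm, measurable, intro nn_integral_cong)
    fix x :: real
    have "exponential_density z x * exp (c * x) = z / (z - c) * exponential_density (z - c) x"
    proof (cases "x < 0")
      case False
      have "z * exp (- x * z) * exp (c * x) = z * exp (- x * (z - c))"
        by (simp add: exp_add[symmetric] algebra_simps)
      also have "\<dots> = z / (z - c) * ((z - c) * exp (- x * (z - c)))"
        using assms by simp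
      finally have "z * exp (- x * z) * exp (c * x) = z / (z - c) * ((z - c) * exp (- x * (z - c)))" .
      then show ?thesis using False by (simp add: exponential_density_def)
    qed (simp add: exponential_density_def)
    then have "ennreal (exponential_density z x) * ennreal (exp (c * x)) = ennreal (z / (z - c)) * ennreal (exponential_density (z - c) x)"
      using assms by (simp add: ennreal_mult'[symmetric] ennreal_mult''[symmetric])
    then show "ennreal (exponential_density z x) * (ennreal (exp (c * x)) * f x) =
      ennreal (z / (z - c)) * (ennreal (exponential_density (z - c) x) * f x)"
      by (simp add: mult.assoc[symmetric])
  qed
  then show ?thesis
    by (subst (asm) nn_integral_cmult) (auto simp: nn_integral_expm)
qed

lemma expm_scale:
  assumes r: "0 < r" and [measurable]: "f \<in> borel_measurable borel"
  shows "(\<integral>\<^sup>+x. f (x / r) \<partial>expm 1) = (\<integral>\<^sup>+x. f x \<partial>expm r)"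
proof -
  have "(\<integral>\<^sup>+x. f (x / r) \<partial>expm 1) = (\<integral>\<^sup>+x. ennreal (exponential_density 1 x) * f (x / r) \<partial>lborel)"
    by (subst nn_integral_expm) auto
  also have "\<dots> = ennreal \<bar>r\<bar> * (\<integral>\<^sup>+x. ennreal (exponential_density 1 (0 + r * x)) * f ((0 + r * x) / r) \<partial>lborel)"
    using r by (subst nn_integral_real_affine[where c=r and t=0]) auto
  also have "\<dots> = (\<integral>\<^sup>+x. ennreal \<bar>r\<bar> * (ennreal (exponential_density 1 (0 + r * x)) * f ((0 + r * x) / r)) \<partial>lborel)"
    by (subst nn_integral_cmult) auto
  also have "\<dots> = (\<integral>\<^sup>+x. ennreal (exponential_density r x) * f x \<partial>lborel)"
  proof (intro nn_integral_cong)
    fix x :: real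
    have "\<bar>r\<bar> * exponential_density 1 (r * x) = exponential_density r x"
      using r by (simp add: exponential_density_def mult_less_0_iff mult.commute)
    then have "ennreal \<bar>r\<bar> * ennreal (exponential_density 1 (r * x)) = ennreal (exponential_density r x)"
      by (simp add: ennreal_mult'[symmetric])
    then show "ennreal \<bar>r\<bar> * (ennreal (exponential_density 1 (0 + r * x)) * f ((0 + r * x) / r)) = ennreal (exponential_density r x) * f x"
      using r by (simp add: mult.assoc[symmetric])
  qed
  finally show ?thesis by (simp add: nn_integral_expm)
qed

text \<open>Condition on which of the two variables is smaller: the minimum is a unit exponential variable
  and, by lack of memory, the excess of the larger one is independent of it.\<close>

lemma expm_split:
  assumes ab: "0 < a" "0 < b" "a + b = 1"
    and F [measurable]: "case_prod F \<in> borel_measurable (borel \<Otimes>\<^sub>M borel)"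
  shows "(\<integral>\<^sup>+u. (\<integral>\<^sup>+v. F u v \<partial>expm b) \<partial>expm a) =
    ennreal b * (\<integral>\<^sup>+m. (\<integral>\<^sup>+d. F (m + d) m \<partial>expm a) \<partial>expm 1) +
    ennreal a * (\<integral>\<^sup>+m. (\<integral>\<^sup>+d. F m (m + d) \<partial>expm b) \<partial>expm 1)"
proof -
  interpret A: prob_space "expm a" using ab by (intro prob_space_expm)
  interpret B: prob_space "expm b" using ab by (intro prob_space_expm)
  interpret PS: pair_sigma_finite "expm a" "expm b" ..
  have [measurable]: "(\<lambda>(x, y). F x y) \<in> borel_measurable (expm a \<Otimes>\<^sub>M expm b)"
    using F by (simp cong: measurable_cong_sets)
  have "(\<integral>\<^sup>+u. (\<integral>\<^sup>+v. F u v \<partial>expm b) \<partial>expm a) =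
    (\<integral>\<^sup>+u. (\<integral>\<^sup>+v. indicator {..u} v * F u v + indicator {u<..} v * F u v \<partial>expm b) \<partial>expm a)"
    by (intro nn_integral_cong) (auto simp: indicator_def)
  also have "\<dots> = (\<integral>\<^sup>+u. (\<integral>\<^sup>+v. indicator {v..} u * F u v \<partial>expm b) + (\<integral>\<^sup>+v. indicator {u<..} v * F u v \<partial>expm b) \<partial>expm a)"
    by (intro nn_integral_cong, subst nn_integral_add) (auto simp: indicator_def intro!: arg_cong2[where f="(+)"] nn_integral_cong)
  also have "\<dots> = (\<integral>\<^sup>+u. (\<integral>\<^sup>+v. indicator {v..} u * F u v \<partial>expm b) \<partial>expm a) + (\<integral>\<^sup>+u. (\<integral>\<^sup>+v. indicator {u<..} v * F u v \<partial>expm b) \<partial>expm a)"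
    by (subst nn_integral_add) (auto simp: indicator_def)
  also have "(\<integral>\<^sup>+u. (\<integral>\<^sup>+v. indicator {v..} u * F u v \<partial>expm b) \<partial>expm a) = (\<integral>\<^sup>+v. (\<integral>\<^sup>+u. indicator {v..} u * F u v \<partial>expm a) \<partial>expm b)"
    by (subst PS.Fubini'[symmetric]) (auto simp: indicator_def)
  also have "\<dots> = (\<integral>\<^sup>+v. ennreal (exp (- a * v)) * (\<integral>\<^sup>+d. F (v + d) v \<partial>expm a) \<partial>expm b)"
  proof (rule nn_integral_cong_AE)
    show "AE v in expm b. (\<integral>\<^sup>+u. indicator {v..} u * F u v \<partial>expm a) = ennreal (exp (- a * v)) * (\<integral>\<^sup>+d. F (v + d) v \<partial>expm a)"
      using AE_expm_pos[OF ab(2)] by eventually_elim (rule expm_tail_le, use ab in auto)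
  qed
  also have "\<dots> = ennreal (b / (b - (-a))) * (\<integral>\<^sup>+v. (\<integral>\<^sup>+d. F (v + d) v \<partial>expm a) \<partial>expm (b - (-a)))"
    using ab by (intro expm_tilt) auto
  also have "(\<integral>\<^sup>+u. (\<integral>\<^sup>+v. indicator {u<..} v * F u v \<partial>expm b) \<partial>expm a) = (\<integral>\<^sup>+v. ennreal (exp (- b * v)) * (\<integral>\<^sup>+d. F v (v + d) \<partial>expm b) \<partial>expm a)"
  proof (rule nn_integral_cong_AE)
    show "AE u in expm a. (\<integral>\<^sup>+v. indicator {u<..} v * F u v \<partial>expm b) = ennreal (exp (- b * u)) * (\<integral>\<^sup>+d. F u (u + d) \<partial>expm b)"
      using AE_expm_pos[OF ab(1)] by eventually_elim (rule expm_tail_less, use ab in auto)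
  qed
  also have "\<dots> = ennreal (a / (a - (-b))) * (\<integral>\<^sup>+v. (\<integral>\<^sup>+d. F v (v + d) \<partial>expm b) \<partial>expm (a - (-b)))"
    using ab by (intro expm_tilt) auto
  finally show ?thesis using ab by (simp add: add.commute)
qed

text \<open>Split at the minimum of \<open>u\<close> and \<open>v\<close>. The outputs depend only
  on the excess, so the minimum, a unit exponential, can be discarded and the fresh weight
  \<open>w\<close> of the same law takes its place. The condition a + b = 1 is what gives the
  minimum the law of the weight.\<close>

lemma cell_law:
  assumes ab: "0 < a" "0 < b" "a + b = 1"
    and F [measurable]: "case_prod F \<in> borel_measurable (borel \<Otimes>\<^sub>M borel)"
  shows "(\<integral>\<^sup>+u. (\<integral>\<^sup>+v. (\<integral>\<^sup>+w. F (w + max 0 (u - v)) (w + max 0 (v - u)) \<partial>expm 1) \<partial>expm b) \<partial>expm a) =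
    (\<integral>\<^sup>+u. (\<integral>\<^sup>+v. F u v \<partial>expm b) \<partial>expm a)"
proof -
  interpret A: prob_space "expm a" using ab by (intro prob_space_expm)
  interpret B: prob_space "expm b" using ab by (intro prob_space_expm)
  interpret C: prob_space "expm 1" by (intro prob_space_expm) simp
  interpret AC: pair_sigma_finite "expm a" "expm 1" ..
  interpret BC: pair_sigma_finite "expm b" "expm 1" ..
  have pos_a: "AE d in expm a. 0 < d" and pos_b: "AE d in expm b. 0 < d"
    using ab by (auto intro: AE_expm_pos)
  have [measurable]: "(\<lambda>(x, y). F x y) \<in> borel_measurable (expm a \<Otimes>\<^sub>M expm b)"
    using F by (simp cong: measurable_cong_sets)
  have "(\<integral>\<^sup>+u. (\<integral>\<^sup>+v. (\<integral>\<^sup>+w. F (w + max 0 (u - v)) (w + max 0 (v - u)) \<partial>expm 1) \<partial>expm b) \<partial>expm a) =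
    ennreal b * (\<integral>\<^sup>+m. (\<integral>\<^sup>+d. (\<integral>\<^sup>+w. F (w + max 0 ((m + d) - m)) (w + max 0 (m - (m + d))) \<partial>expm 1) \<partial>expm a) \<partial>expm 1) +
    ennreal a * (\<integral>\<^sup>+m. (\<integral>\<^sup>+d. (\<integral>\<^sup>+w. F (w + max 0 (m - (m + d))) (w + max 0 ((m + d) - m)) \<partial>expm 1) \<partial>expm b) \<partial>expm 1)"
    by (rule expm_split[OF ab]) measurable
  also have "(\<integral>\<^sup>+m. (\<integral>\<^sup>+d. (\<integral>\<^sup>+w. F (w + max 0 ((m + d) - m)) (w + max 0 (m - (m + d))) \<partial>expm 1) \<partial>expm a) \<partial>expm 1)
     = (\<integral>\<^sup>+d. (\<integral>\<^sup>+w. F (w + d) w \<partial>expm 1) \<partial>expm a)"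
  proof -
    have "(\<integral>\<^sup>+d. (\<integral>\<^sup>+w. F (w + max 0 ((m + d) - m)) (w + max 0 (m - (m + d))) \<partial>expm 1) \<partial>expm a) = (\<integral>\<^sup>+d. (\<integral>\<^sup>+w. F (w + d) w \<partial>expm 1) \<partial>expm a)" for m :: real
      by (rule nn_integral_cong_AE) (use pos_a in \<open>eventually_elim, simp\<close>)
    then show ?thesis by (simp add: C.emeasure_space_1[unfolded space_expm])
  qed
  also have "\<dots> = (\<integral>\<^sup>+w. (\<integral>\<^sup>+d. F (w + d) w \<partial>expm a) \<partial>expm 1)"
    by (subst AC.Fubini'[symmetric]) auto
  also have "(\<integral>\<^sup>+m. (\<integral>\<^sup>+d. (\<integral>\<^sup>+w. F (w + max 0 (m - (m + d))) (w + max 0 ((m + d) - m)) \<partial>expm 1) \<partial>expm b) \<partial>expm 1)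
     = (\<integral>\<^sup>+d. (\<integral>\<^sup>+w. F w (w + d) \<partial>expm 1) \<partial>expm b)"
  proof -
    have "(\<integral>\<^sup>+d. (\<integral>\<^sup>+w. F (w + max 0 (m - (m + d))) (w + max 0 ((m + d) - m)) \<partial>expm 1) \<partial>expm b) = (\<integral>\<^sup>+d. (\<integral>\<^sup>+w. F w (w + d) \<partial>expm 1) \<partial>expm b)" for m :: real
      by (rule nn_integral_cong_AE) (use pos_b in \<open>eventually_elim, simp\<close>)
    then show ?thesis by (simp add: C.emeasure_space_1[unfolded space_expm])
  qed
  also have "\<dots> = (\<integral>\<^sup>+w. (\<integral>\<^sup>+d. F w (w + d) \<partial>expm b) \<partial>expm 1)"
    by (subst BC.Fubini'[symmetric]) auto
  finally show ?thesis
    by (subst expm_split[OF ab]) auto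
qed

section \<open>Sequences of independent variables with a common law\<close>

abbreviation seqm :: "'b measure \<Rightarrow> (nat \<Rightarrow> 'b) measure" where
  "seqm M \<equiv> PiM UNIV (\<lambda>_. M)"

lemma prob_space_seqm: "prob_space M \<Longrightarrow> prob_space (seqm M)"
  by (rule prob_space_PiM)

lemma nn_integral_seqm:
  assumes M: "prob_space M" and f [measurable]: "f \<in> borel_measurable (seqm M)"
  shows "(\<integral>\<^sup>+s. f s \<partial>seqm M) = (\<integral>\<^sup>+x. (\<integral>\<^sup>+s. f (case_nat x s) \<partial>seqm M) \<partial>M)"
proof -
  interpret M: prob_space M by fact
  interpret sequence_space M ..
  interpret S: prob_space "seqm M" by (rule prob_space_seqm) fact
  have eq: "distr (M \<Otimes>\<^sub>M seqm M) (seqm M) (\<lambda>(s, \<omega>). case_nat s \<omega>) = seqm M"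
    by (rule PiM_iter)
  have [measurable]: "(\<lambda>(s, \<omega>). case_nat s \<omega>) \<in> measurable (M \<Otimes>\<^sub>M seqm M) (seqm M)"
    by measurable
  have "(\<integral>\<^sup>+s. f s \<partial>seqm M) = (\<integral>\<^sup>+s. f s \<partial>distr (M \<Otimes>\<^sub>M seqm M) (seqm M) (\<lambda>(s, \<omega>). case_nat s \<omega>))"
    by (simp add: eq)
  also have "\<dots> = (\<integral>\<^sup>+x. f (case x of (s, \<omega>) \<Rightarrow> case_nat s \<omega>) \<partial>(M \<Otimes>\<^sub>M seqm M))"
    by (subst nn_integral_distr) auto
  also have "\<dots> = (\<integral>\<^sup>+x. (\<integral>\<^sup>+s. f (case_nat x s) \<partial>seqm M) \<partial>M)"
    by (subst P.nn_integral_fst[symmetric]) auto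
  finally show ?thesis .
qed

lemma seqm_eqI:
  assumes M: "prob_space M" and N: "sets N = sets (seqm M)"
    and eq: "\<And>n A. (\<And>j. A j \<in> sets M) \<Longrightarrow>
       emeasure N {s \<in> space N. \<forall>j<n. s j \<in> A j} = (\<Prod>j<n. emeasure M (A j))"
  shows "N = seqm M"
proof -
  interpret M: prob_space M by fact
  interpret product_prob_space "\<lambda>_. M" "UNIV :: nat set" ..
  show ?thesis
  proof (rule PiM_eq)
    show "sets N = sets (PiM UNIV (\<lambda>_::nat. M))" using N by simp
    fix J :: "nat set" and F assume J: "finite J" and F: "\<And>j. j \<in> J \<Longrightarrow> F j \<in> sets M"
    define A where "A j = (if j \<in> J then F j else space M)" for j
    obtain n where n: "J \<subseteq> {..<n}" using J by (meson finite_nat_iff_bounded)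
    have sp: "space N = space (PiM UNIV (\<lambda>_::nat. M))" by (rule sets_eq_imp_space_eq[OF N])
    have "prod_emb UNIV (\<lambda>_. M) J (Pi\<^sub>E J F) = {s \<in> space N. \<forall>j<n. s j \<in> A j}"
      using n unfolding prod_emb_def sp by (fastforce simp: A_def space_PiM PiE_iff split: if_split_asm)
    then have "emeasure N (prod_emb UNIV (\<lambda>_. M) J (Pi\<^sub>E J F)) = (\<Prod>j<n. emeasure M (A j))"
      using F by (simp add: eq A_def)
    also have "\<dots> = (\<Prod>j\<in>J. emeasure M (F j))"
      using n by (intro prod.mono_neutral_cong_right) (auto simp: A_def M.emeasure_space_1)
    finally show "emeasure N (prod_emb UNIV (\<lambda>_. M) J (Pi\<^sub>E J F)) = (\<Prod>j\<in>J. emeasure M (F j))" .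
  qed
qed

section \<open>Last passage times and Burke's property\<close>

declare measurable_abs_UNIV [measurable (raw)]

lemma sets_seqm_expm [measurable_cong]: "sets (seqm (expm r)) = sets (seqm borel)"
  by (intro sets_PiM_cong) auto

lemma sets_seqm_seqm_expm [measurable_cong]: "sets (seqm (seqm (expm r))) = sets (seqm (seqm borel))"
  by (intro sets_PiM_cong) (auto simp: sets_seqm_expm)

lemma nn_integral_swap:
  assumes "prob_space M" "prob_space N" and [measurable]: "case_prod F \<in> borel_measurable (M \<Otimes>\<^sub>M N)"
  shows "(\<integral>\<^sup>+x. (\<integral>\<^sup>+y. F x y \<partial>N) \<partial>M) = (\<integral>\<^sup>+y. (\<integral>\<^sup>+x. F x y \<partial>M) \<partial>N)"
proof -
  interpret M: prob_space M by fact
  interpret N: prob_space N by fact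
  interpret pair_sigma_finite M N ..
  show ?thesis by (subst Fubini'[symmetric]) auto
qed

lemma nn_integral_prob_const: "prob_space M \<Longrightarrow> (\<integral>\<^sup>+x. c \<partial>M) = c"
  by (simp add: prob_space.emeasure_space_1)

lemma measure_eqI_nn_integral:
  assumes "sets M = sets N" and "\<And>f. f \<in> borel_measurable N \<Longrightarrow> (\<integral>\<^sup>+x. f x \<partial>M) = (\<integral>\<^sup>+x. f x \<partial>N)"
  shows "M = N"
proof (rule measure_eqI)
  fix A assume "A \<in> sets M"
  then show "emeasure M A = emeasure N A"
    using assms(2)[of "indicator A"] assms(1) by simp
qed fact

lemma prob_seqm_expm: "0 < r \<Longrightarrow> prob_space (seqm (expm r))"
  by (intro prob_space_seqm prob_space_expm)

lemma prob_bulk: "prob_space (seqm (seqm (expm 1)))"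
  by (intro prob_space_seqm prob_space_expm) simp

text \<open>One column of the last passage recursion in terms of increments: \<open>colu\<close> are the horizontal increments
  crossing the column, started from \<open>u\<close> on the bottom boundary, and \<open>col\<close> the vertical increments it
  emits when it receives \<open>y\<close>.\<close>

primrec colu :: "real \<Rightarrow> (nat \<Rightarrow> real) \<Rightarrow> (nat \<Rightarrow> real) \<Rightarrow> nat \<Rightarrow> real" where
  "colu u y w 0 = u"
| "colu u y w (Suc j) = w j + max 0 (colu u y w j - y j)"

definition col :: "real \<Rightarrow> (nat \<Rightarrow> real) \<Rightarrow> (nat \<Rightarrow> real) \<Rightarrow> nat \<Rightarrow> real" where
  "col u y w j = w j + max 0 (y j - colu u y w j)"

lemma colu_shift:
  "colu u (case_nat y0 y) (case_nat w0 w) (Suc j) = colu (w0 + max 0 (u - y0)) y w j"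
  by (induction j) auto

lemma col_0: "col u (case_nat y0 y) (case_nat w0 w) 0 = w0 + max 0 (y0 - u)"
  by (simp add: col_def)

lemma col_Suc: "col u (case_nat y0 y) (case_nat w0 w) (Suc j) = col (w0 + max 0 (u - y0)) y w j"
  unfolding col_def by (simp only: colu_shift) simp

lemma measurable_colu [measurable (raw)]:
  assumes [measurable]: "f \<in> borel_measurable M" "g \<in> measurable M (seqm borel)" "h \<in> measurable M (seqm borel)"
  shows "(\<lambda>x. colu (f x) (g x) (h x) j) \<in> borel_measurable M"
  by (induction j) auto

lemma measurable_col_component [measurable (raw)]:
  assumes [measurable]: "f \<in> borel_measurable M" "g \<in> measurable M (seqm borel)" "h \<in> measurable M (seqm borel)"
  shows "(\<lambda>x. col (f x) (g x) (h x) j) \<in> borel_measurable M"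
  unfolding col_def by measurable

text \<open>Peel off the lowest cell. By \<open>cell_law\<close> its outgoing horizontal increment
  has rate \<open>a\<close> again and is independent of the vertical increment it emits, so the rest
  of the column starts afresh.\<close>

lemma col_law_cylinder:
  assumes ab: "0 < a" "0 < b" "a + b = 1" and A [measurable]: "\<And>j. A j \<in> sets borel"
  shows "(\<integral>\<^sup>+u. (\<integral>\<^sup>+y. (\<integral>\<^sup>+w. (\<Prod>j<n. indicator (A j) (col u y w j)) \<partial>seqm (expm 1)) \<partial>seqm (expm b)) \<partial>expm a) =
    (\<Prod>j<n. emeasure (expm b) (A j))"
  using A
proof (induction n arbitrary: A)
  case 0
  then show ?case
    using ab by (simp add: nn_integral_prob_const prob_seqm_expm prob_space_expm del: nn_integral_const)
next
  case (Suc n)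
  note [measurable] = Suc.prems
  define \<Phi> where "\<Phi> u = (\<integral>\<^sup>+y. (\<integral>\<^sup>+w. (\<Prod>j<n. indicator (A (Suc j)) (col u y w j)) \<partial>seqm (expm 1)) \<partial>seqm (expm b))" for u
  interpret W: prob_space "seqm (expm 1)" by (rule prob_seqm_expm) simp
  interpret Y: prob_space "seqm (expm b)" by (rule prob_seqm_expm) fact
  have m[measurable]: "(\<lambda>x. \<Phi> (g x)) \<in> borel_measurable M" if "g \<in> borel_measurable M" for g :: "'z \<Rightarrow> real" and M :: "'z measure"
    using that unfolding \<Phi>_def by measurable
  have pE: "prob_space (expm b)" "prob_space (expm 1)" using ab by (auto intro: prob_space_expm)
  have "(\<integral>\<^sup>+u. (\<integral>\<^sup>+y. (\<integral>\<^sup>+w. (\<Prod>j<Suc n. indicator (A j) (col u y w j)) \<partial>seqm (expm 1)) \<partial>seqm (expm b)) \<partial>expm a) =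
    (\<integral>\<^sup>+u. (\<integral>\<^sup>+y0. (\<integral>\<^sup>+y. (\<integral>\<^sup>+w0. (\<integral>\<^sup>+w. (\<Prod>j<Suc n. indicator (A j) (col u (case_nat y0 y) (case_nat w0 w) j)) \<partial>seqm (expm 1)) \<partial>expm 1) \<partial>seqm (expm b)) \<partial>expm b) \<partial>expm a)"
    by (subst nn_integral_seqm[OF pE(1)], measurable, subst nn_integral_seqm[OF pE(2)]) measurable
  also have "\<dots> = (\<integral>\<^sup>+u. (\<integral>\<^sup>+y0. (\<integral>\<^sup>+y. (\<integral>\<^sup>+w0. (\<integral>\<^sup>+w. indicator (A 0) (w0 + max 0 (y0 - u)) * (\<Prod>j<n. indicator (A (Suc j)) (col (w0 + max 0 (u - y0)) y w j)) \<partial>seqm (expm 1)) \<partial>expm 1) \<partial>seqm (expm b)) \<partial>expm b) \<partial>expm a)"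
    by (simp only: prod.lessThan_Suc_shift col_0 col_Suc)
  also have "\<dots> = (\<integral>\<^sup>+u. (\<integral>\<^sup>+y0. (\<integral>\<^sup>+w0. (\<integral>\<^sup>+y. (\<integral>\<^sup>+w. indicator (A 0) (w0 + max 0 (y0 - u)) * (\<Prod>j<n. indicator (A (Suc j)) (col (w0 + max 0 (u - y0)) y w j)) \<partial>seqm (expm 1)) \<partial>seqm (expm b)) \<partial>expm 1) \<partial>expm b) \<partial>expm a)"
    by (intro nn_integral_cong nn_integral_swap prob_seqm_expm prob_space_expm ab) (auto simp: ab)
  also have "\<dots> = (\<integral>\<^sup>+u. (\<integral>\<^sup>+y0. (\<integral>\<^sup>+w0. indicator (A 0) (w0 + max 0 (y0 - u)) * \<Phi> (w0 + max 0 (u - y0)) \<partial>expm 1) \<partial>expm b) \<partial>expm a)"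
    unfolding \<Phi>_def by (simp add: nn_integral_cmult)
  also have "\<dots> = (\<integral>\<^sup>+u. (\<integral>\<^sup>+v. indicator (A 0) v * \<Phi> u \<partial>expm b) \<partial>expm a)"
    by (rule cell_law[OF ab, where F="\<lambda>u v. indicator (A 0) v * \<Phi> u"]) measurable
  also have "\<dots> = (\<integral>\<^sup>+u. emeasure (expm b) (A 0) * \<Phi> u \<partial>expm a)"
    by (subst nn_integral_multc) auto
  also have "\<dots> = emeasure (expm b) (A 0) * (\<Prod>j<n. emeasure (expm b) (A (Suc j)))"
  proof -
    have "(\<integral>\<^sup>+u. \<Phi> u \<partial>expm a) = (\<Prod>j<n. emeasure (expm b) (A (Suc j)))"
      unfolding \<Phi>_def by (rule Suc.IH) (rule Suc.prems)
    then show ?thesis by (subst nn_integral_cmult) auto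
  qed
  finally show ?case by (simp only: prod.lessThan_Suc_shift)
qed

lemma prod_indicator_Collect:
  "(\<Prod>j<(n::nat). indicator (A j) (s j)) = (indicator {s. \<forall>j<n. s j \<in> A j} s :: ennreal)"
  by (induction n) (auto simp: indicator_def less_Suc_eq)

lemma col_law:
  assumes ab: "0 < a" "0 < b" "a + b = 1" and F [measurable]: "F \<in> borel_measurable (seqm borel)"
  shows "(\<integral>\<^sup>+u. (\<integral>\<^sup>+y. (\<integral>\<^sup>+w. F (col u y w) \<partial>seqm (expm 1)) \<partial>seqm (expm b)) \<partial>expm a) = (\<integral>\<^sup>+y. F y \<partial>seqm (expm b))"
proof -
  interpret W: prob_space "seqm (expm 1)" by (rule prob_seqm_expm) simp
  interpret Y: prob_space "seqm (expm b)" by (rule prob_seqm_expm) fact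
  interpret YW: pair_prob_space "seqm (expm b)" "seqm (expm 1)" ..
  define N where "N = distr (expm a \<Otimes>\<^sub>M (seqm (expm b) \<Otimes>\<^sub>M seqm (expm 1))) (seqm (expm b)) (\<lambda>(u, y, w). col u y w)"
  have N: "(\<integral>\<^sup>+s. G s \<partial>N) = (\<integral>\<^sup>+u. (\<integral>\<^sup>+y. (\<integral>\<^sup>+w. G (col u y w) \<partial>seqm (expm 1)) \<partial>seqm (expm b)) \<partial>expm a)"
    if [measurable]: "G \<in> borel_measurable (seqm borel)" for G
  proof -
    have "(\<integral>\<^sup>+s. G s \<partial>N) = (\<integral>\<^sup>+p. G (case p of (u, y, w) \<Rightarrow> col u y w) \<partial>(expm a \<Otimes>\<^sub>M (seqm (expm b) \<Otimes>\<^sub>M seqm (expm 1))))"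
      unfolding N_def by (subst nn_integral_distr) auto
    also have "\<dots> = (\<integral>\<^sup>+u. (\<integral>\<^sup>+q. G (case q of (y, w) \<Rightarrow> col u y w) \<partial>(seqm (expm b) \<Otimes>\<^sub>M seqm (expm 1))) \<partial>expm a)"
      by (subst YW.nn_integral_fst[symmetric]) auto
    also have "\<dots> = (\<integral>\<^sup>+u. (\<integral>\<^sup>+y. (\<integral>\<^sup>+w. G (col u y w) \<partial>seqm (expm 1)) \<partial>seqm (expm b)) \<partial>expm a)"
      by (intro nn_integral_cong, subst W.nn_integral_fst[symmetric]) auto
    finally show ?thesis .
  qed
  have "N = seqm (expm b)"
  proof (rule seqm_eqI)
    show "prob_space (expm b)" using ab by (intro prob_space_expm)
    fix n and A :: "nat \<Rightarrow> real set" assume A: "\<And>j. A j \<in> sets (expm b)"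
    then have [measurable]: "\<And>j. A j \<in> sets borel" by simp
    have sp: "space N = UNIV" by (simp add: N_def space_PiM)
    have "emeasure N {s \<in> space N. \<forall>j<n. s j \<in> A j} = (\<integral>\<^sup>+s. indicator {s. \<forall>j<n. s j \<in> A j} s \<partial>N)"
    proof -
      have "{s \<in> space (seqm (expm b)). \<forall>j\<in>{..<n}. s j \<in> A j} \<in> sets (seqm (expm b))" by measurable
      then have "{s. \<forall>j<n. s j \<in> A j} \<in> sets N" by (simp add: N_def space_PiM Ball_def)
      then show ?thesis unfolding sp by simp
    qed
    also have "\<dots> = (\<integral>\<^sup>+s. (\<Prod>j<n. indicator (A j) (s j)) \<partial>N)"
      by (simp only: prod_indicator_Collect)
    also have "\<dots> = (\<Prod>j<n. emeasure (expm b) (A j))"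
      by (subst N, measurable, rule col_law_cylinder[OF ab]) auto
    finally show "emeasure N {s \<in> space N. \<forall>j<n. s j \<in> A j} = (\<Prod>j<n. emeasure (expm b) (A j))" .
  qed (simp add: N_def)
  with N[OF F] show ?thesis by simp
qed

text \<open>Paths start at a corner without weight; \<open>x\<close> and \<open>y\<close> are the
  weights along the bottom and the left axis, so \<open>w i j\<close> sits at the point (i + 1, j +
  1).\<close>

fun lpp :: "(nat \<Rightarrow> real) \<Rightarrow> (nat \<Rightarrow> real) \<Rightarrow> (nat \<Rightarrow> nat \<Rightarrow> real) \<Rightarrow> nat \<Rightarrow> nat \<Rightarrow> real" where
  "lpp x y w i 0 = (\<Sum>k<i. x k)"
| "lpp x y w 0 (Suc j) = (\<Sum>k<Suc j. y k)"
| "lpp x y w (Suc i) (Suc j) = max (lpp x y w i (Suc j)) (lpp x y w (Suc i) j) + w i j"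

lemma lpp_0_left: "lpp x y w 0 j = (\<Sum>k<j. y k)"
  by (cases j) auto

lemma colu_lpp: "colu (x 0) y (w 0) j = lpp x y w (Suc 0) j - lpp x y w 0 j"
  by (induction j) (auto simp: lpp_0_left max_def)

text \<open>The first column acts on the rest of the quadrant only through the vertical increments
  it emits; they become the left axis of a problem with one column fewer. This carries Burke's
  property from columns to passage times.\<close>

lemma lpp_first_column:
  "lpp x y w (Suc i) j = x 0 + lpp (\<lambda>k. x (Suc k)) (col (x 0) y (w 0)) (\<lambda>k. w (Suc k)) i j"
proof (induction "\<lambda>k. x (Suc k)" "col (x 0) y (w 0)" "\<lambda>k. w (Suc k)" i j rule: lpp.induct)
  case (1 i) show ?case by (simp add: sum.lessThan_Suc_shift del: sum.lessThan_Suc)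
next
  case (2 j)
  have "lpp x y w (Suc 0) n = x 0 + (\<Sum>k<n. col (x 0) y (w 0) k)" for n
    by (induction n) (auto simp: col_def colu_lpp lpp_0_left max_def)
  from this[of "Suc j"] show ?case by (simp only: lpp_0_left)
next
  case (3 i j) then show ?case by simp
qed

primrec vcol :: "nat \<Rightarrow> (nat \<Rightarrow> real) \<Rightarrow> (nat \<Rightarrow> real) \<Rightarrow> (nat \<Rightarrow> nat \<Rightarrow> real) \<Rightarrow> nat \<Rightarrow> real" where
  "vcol 0 x y w = y"
| "vcol (Suc m) x y w = vcol m (\<lambda>k. x (Suc k)) (col (x 0) y (w 0)) (\<lambda>k. w (Suc k))"

text \<open>The increments telescope along the bottom axis and then up column \<open>m\<close>. The
  first sum consists of plain boundary weights, and Burke's property governs the second.\<close>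

lemma lpp_vcol: "lpp x y w m n = (\<Sum>i<m. x i) + (\<Sum>j<n. vcol m x y w j)"
  by (induction m arbitrary: x y w)
     (simp_all add: lpp_0_left lpp_first_column sum.lessThan_Suc_shift del: sum.lessThan_Suc)

lemma measurable_vcol [measurable (raw)]:
  assumes [measurable]: "f \<in> measurable M (seqm borel)" "g \<in> measurable M (seqm borel)" "h \<in> measurable M (seqm (seqm borel))"
  shows "(\<lambda>x. vcol m (f x) (g x) (h x)) \<in> measurable M (seqm borel)"
  using assms
proof (induction m arbitrary: f g h)
  case (Suc m)
  note [measurable] = Suc.prems
  show ?case unfolding vcol.simps by (intro Suc.IH) measurable
qed simp

lemma measurable_vcol_component [measurable (raw)]:
  assumes "f \<in> measurable M (seqm borel)" "g \<in> measurable M (seqm borel)" "h \<in> measurable M (seqm (seqm borel))"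
  shows "(\<lambda>x. vcol m (f x) (g x) (h x) j) \<in> borel_measurable M"
  using measurable_compose[OF measurable_vcol[OF assms, of m] measurable_component_singleton[of j]] by simp

lemma measurable_lpp [measurable (raw)]:
  assumes [measurable]: "f \<in> measurable M (seqm borel)" "g \<in> measurable M (seqm borel)" "h \<in> measurable M (seqm (seqm borel))"
  shows "(\<lambda>x. lpp (f x) (g x) (h x) m n) \<in> borel_measurable M"
  unfolding lpp_vcol by measurable

text \<open>The factor exp (c x) of the first bottom weight moves its rate from a + c to a, at the
  price (a + c) / a. Now a + b = 1 holds, the column preserves the law of the left axis, and
  induction treats the remaining columns. For c = 0 this is Burke's property of the quadrant; other
  values of c reach boundaries that are not stationary.\<close>

lemma tilted_vcol_law:
  assumes ab: "0 < a" "0 < b" "a + b = 1" "0 < a + c" and F: "F \<in> borel_measurable (seqm borel)"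
  shows "(\<integral>\<^sup>+y. (\<integral>\<^sup>+x. (\<integral>\<^sup>+w. ennreal (exp (c * (\<Sum>i<m. x i))) * F (vcol m x y w) \<partial>seqm (seqm (expm 1))) \<partial>seqm (expm (a + c))) \<partial>seqm (expm b)) =
    ennreal (((a + c) / a) ^ m) * (\<integral>\<^sup>+y. F y \<partial>seqm (expm b))"
proof (induction m)
  case 0
  show ?case
    using ab by (simp add: nn_integral_prob_const prob_seqm_expm prob_bulk del: nn_integral_const)
next
  case (Suc m)
  note [measurable] = F
  define \<Phi> where "\<Phi> y = (\<integral>\<^sup>+x. (\<integral>\<^sup>+w. ennreal (exp (c * (\<Sum>i<m. x i))) * F (vcol m x y w) \<partial>seqm (seqm (expm 1))) \<partial>seqm (expm (a + c)))" for y
  interpret W: prob_space "seqm (expm 1)" by (rule prob_seqm_expm) simp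
  interpret WW: prob_space "seqm (seqm (expm 1))" by (rule prob_bulk)
  interpret Y: prob_space "seqm (expm b)" by (rule prob_seqm_expm) fact
  interpret X: prob_space "seqm (expm (a + c))" by (rule prob_seqm_expm) fact
  have m[measurable]: "(\<lambda>x. \<Phi> (g x)) \<in> borel_measurable M" if "g \<in> measurable M (seqm borel)" for g :: "'z \<Rightarrow> nat \<Rightarrow> real" and M :: "'z measure"
    using that unfolding \<Phi>_def by measurable
  have pE: "prob_space (expm (a + c))" "prob_space (seqm (expm 1))" "prob_space (expm b)"
    using ab by (auto intro: prob_space_expm prob_seqm_expm)
  have "(\<integral>\<^sup>+y. (\<integral>\<^sup>+x. (\<integral>\<^sup>+w. ennreal (exp (c * (\<Sum>i<Suc m. x i))) * F (vcol (Suc m) x y w) \<partial>seqm (seqm (expm 1))) \<partial>seqm (expm (a + c))) \<partial>seqm (expm b)) =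
   (\<integral>\<^sup>+y. (\<integral>\<^sup>+x0. (\<integral>\<^sup>+x. (\<integral>\<^sup>+w0. (\<integral>\<^sup>+w. ennreal (exp (c * (\<Sum>i<Suc m. case_nat x0 x i))) * F (vcol (Suc m) (case_nat x0 x) y (case_nat w0 w)) \<partial>seqm (seqm (expm 1))) \<partial>seqm (expm 1)) \<partial>seqm (expm (a + c))) \<partial>expm (a + c)) \<partial>seqm (expm b))"
  proof -
    define H where "H x y w = ennreal (exp (c * (\<Sum>i<Suc m. x i))) * F (vcol (Suc m) x y w)" for x y w
    have [measurable]: "(\<lambda>x. H (f x) (g x) (h x)) \<in> borel_measurable M"
      if [measurable]: "f \<in> measurable M (seqm borel)" "g \<in> measurable M (seqm borel)" "h \<in> measurable M (seqm (seqm borel))"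
      for f g h and M :: "'z measure"
      unfolding H_def by (intro borel_measurable_times_ennreal measurable_compose[OF measurable_vcol F]) measurable
    have "(\<integral>\<^sup>+x. (\<integral>\<^sup>+w. H x y w \<partial>seqm (seqm (expm 1))) \<partial>seqm (expm (a + c))) =
      (\<integral>\<^sup>+x0. (\<integral>\<^sup>+x. (\<integral>\<^sup>+w. H (case_nat x0 x) y w \<partial>seqm (seqm (expm 1))) \<partial>seqm (expm (a + c))) \<partial>expm (a + c))" for y
      by (intro nn_integral_seqm pE) measurable
    moreover have "(\<integral>\<^sup>+w. H x y w \<partial>seqm (seqm (expm 1))) = (\<integral>\<^sup>+w0. (\<integral>\<^sup>+w. H x y (case_nat w0 w) \<partial>seqm (seqm (expm 1))) \<partial>seqm (expm 1))" for x y
      by (intro nn_integral_seqm pE) (measurable, auto simp: space_PiM intro: measurable_ident_sets[OF sets_seqm_seqm_expm])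
    ultimately show ?thesis by (simp only: H_def)
  qed
  also have "\<dots> = (\<integral>\<^sup>+y. (\<integral>\<^sup>+x0. (\<integral>\<^sup>+x. (\<integral>\<^sup>+w0. (\<integral>\<^sup>+w. ennreal (exp (c * x0)) * (ennreal (exp (c * (\<Sum>i<m. x i))) * F (vcol m x (col x0 y w0) w)) \<partial>seqm (seqm (expm 1))) \<partial>seqm (expm 1)) \<partial>seqm (expm (a + c))) \<partial>expm (a + c)) \<partial>seqm (expm b))"
    by (simp add: sum.lessThan_Suc_shift distrib_left exp_add ennreal_mult mult.assoc del: sum.lessThan_Suc)
  also have "\<dots> = (\<integral>\<^sup>+y. (\<integral>\<^sup>+x0. (\<integral>\<^sup>+w0. (\<integral>\<^sup>+x. (\<integral>\<^sup>+w. ennreal (exp (c * x0)) * (ennreal (exp (c * (\<Sum>i<m. x i))) * F (vcol m x (col x0 y w0) w)) \<partial>seqm (seqm (expm 1))) \<partial>seqm (expm (a + c))) \<partial>seqm (expm 1)) \<partial>expm (a + c)) \<partial>seqm (expm b))"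
    by (intro nn_integral_cong nn_integral_swap prob_seqm_expm ab) auto
  also have "\<dots> = (\<integral>\<^sup>+y. (\<integral>\<^sup>+x0. (\<integral>\<^sup>+w0. ennreal (exp (c * x0)) * \<Phi> (col x0 y w0) \<partial>seqm (expm 1)) \<partial>expm (a + c)) \<partial>seqm (expm b))"
  proof -
    define H where "H x y w = ennreal (exp (c * (\<Sum>i<m. x i))) * F (vcol m x y w)" for x y w
    have [measurable]: "(\<lambda>x. H (f x) (g x) (h x)) \<in> borel_measurable M"
      if [measurable]: "f \<in> measurable M (seqm borel)" "g \<in> measurable M (seqm borel)" "h \<in> measurable M (seqm (seqm borel))"
      for f g h and M :: "'z measure"
      unfolding H_def by (intro borel_measurable_times_ennreal measurable_compose[OF measurable_vcol F]) measurable
    have "(\<integral>\<^sup>+w. e * H x y w \<partial>seqm (seqm (expm 1))) = e * (\<integral>\<^sup>+w. H x y w \<partial>seqm (seqm (expm 1)))" for e x y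
      by (rule nn_integral_cmult) (measurable, auto simp: space_PiM intro: measurable_ident_sets[OF sets_seqm_seqm_expm])
    moreover have "(\<integral>\<^sup>+x. e * (\<integral>\<^sup>+w. H x y w \<partial>seqm (seqm (expm 1))) \<partial>seqm (expm (a + c))) =
       e * (\<integral>\<^sup>+x. (\<integral>\<^sup>+w. H x y w \<partial>seqm (seqm (expm 1))) \<partial>seqm (expm (a + c)))" for e y
      by (rule nn_integral_cmult) (measurable, auto simp: space_PiM)
    ultimately show ?thesis unfolding \<Phi>_def H_def by simp
  qed
  also have "\<dots> = (\<integral>\<^sup>+x0. (\<integral>\<^sup>+y. (\<integral>\<^sup>+w0. ennreal (exp (c * x0)) * \<Phi> (col x0 y w0) \<partial>seqm (expm 1)) \<partial>seqm (expm b)) \<partial>expm (a + c))"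
    using ab by (intro nn_integral_swap prob_seqm_expm prob_space_expm) auto
  also have "\<dots> = (\<integral>\<^sup>+x0. ennreal (exp (c * x0)) * (\<integral>\<^sup>+y. (\<integral>\<^sup>+w0. \<Phi> (col x0 y w0) \<partial>seqm (expm 1)) \<partial>seqm (expm b)) \<partial>expm (a + c))"
    by (simp add: nn_integral_cmult)
  also have "\<dots> = ennreal ((a + c) / (a + c - c)) * (\<integral>\<^sup>+x0. (\<integral>\<^sup>+y. (\<integral>\<^sup>+w0. \<Phi> (col x0 y w0) \<partial>seqm (expm 1)) \<partial>seqm (expm b)) \<partial>expm (a + c - c))"
    using ab by (intro expm_tilt) auto
  also have "\<dots> = ennreal ((a + c) / a) * (\<integral>\<^sup>+y. \<Phi> y \<partial>seqm (expm b))"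
    using col_law[OF ab(1-3), of \<Phi>] by simp
  also have "\<dots> = ennreal ((a + c) / a) * (ennreal (((a + c) / a) ^ m) * (\<integral>\<^sup>+y. F y \<partial>seqm (expm b)))"
    unfolding \<Phi>_def Suc ..
  finally show ?case
    using ab by (simp add: mult.assoc[symmetric] ennreal_mult'[symmetric])
qed

lemma nn_integral_exp_sum:
  assumes "0 < b" "c < b"
  shows "(\<integral>\<^sup>+y. ennreal (exp (c * (\<Sum>j<n. y j))) \<partial>seqm (expm b)) = ennreal ((b / (b - c)) ^ n)"
proof (induction n)
  case 0 show ?case using assms by (simp add: nn_integral_prob_const prob_seqm_expm del: nn_integral_const)
next
  case (Suc n)
  have "(\<integral>\<^sup>+y. ennreal (exp (c * (\<Sum>j<Suc n. y j))) \<partial>seqm (expm b)) =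
    (\<integral>\<^sup>+y0. (\<integral>\<^sup>+y. ennreal (exp (c * (\<Sum>j<Suc n. case_nat y0 y j))) \<partial>seqm (expm b)) \<partial>expm b)"
    using assms by (intro nn_integral_seqm prob_space_expm) auto
  also have "\<dots> = (\<integral>\<^sup>+y0. (\<integral>\<^sup>+y. ennreal (exp (c * y0)) * ennreal (exp (c * (\<Sum>j<n. y j))) \<partial>seqm (expm b)) \<partial>expm b)"
    by (simp add: sum.lessThan_Suc_shift distrib_left exp_add ennreal_mult del: sum.lessThan_Suc)
  also have "\<dots> = (\<integral>\<^sup>+y0. ennreal (exp (c * y0)) * ennreal ((b / (b - c)) ^ n) \<partial>expm b)"
    by (subst nn_integral_cmult) (auto simp: Suc)
  also have "\<dots> = ennreal (b / (b - c)) * (\<integral>\<^sup>+y0. ennreal ((b / (b - c)) ^ n) \<partial>expm (b - c))"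
    using assms by (intro expm_tilt) auto
  also have "\<dots> = ennreal (b / (b - c)) * ennreal ((b / (b - c)) ^ n)"
    using assms by (subst nn_integral_prob_const) (auto intro: prob_space_expm)
  finally show ?case using assms by (simp add: ennreal_mult'[symmetric])
qed

lemma seqm_distr:
  assumes M: "prob_space M" and f [measurable]: "f \<in> measurable M N"
  shows "distr (seqm M) (seqm N) (\<lambda>s i. f (s i)) = seqm (distr M N f)"
proof (rule seqm_eqI)
  interpret M: prob_space M by fact
  interpret product_prob_space "\<lambda>_. M" "UNIV :: nat set" ..
  show "prob_space (distr M N f)" by (rule M.prob_space_distr) fact
  have s: "sets (seqm (distr M N f)) = sets (seqm N)"
    by (intro sets_PiM_cong) auto
  then show "sets (distr (seqm M) (seqm N) (\<lambda>s i. f (s i))) = sets (seqm (distr M N f))" by simp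
  fix n and A :: "nat \<Rightarrow> 'b set" assume "\<And>j. A j \<in> sets (distr M N f)"
  then have A [measurable]: "\<And>j. A j \<in> sets N" by simp
  have "emeasure (distr (seqm M) (seqm N) (\<lambda>s i. f (s i))) {s \<in> space (seqm N). \<forall>j<n. s j \<in> A j} =
     emeasure (seqm M) {s \<in> space (seqm M). \<forall>j\<in>{..<n}. s j \<in> f -` A j \<inter> space M}"
  proof -
    have "{s \<in> space (seqm N). \<forall>j\<in>{..<n}. s j \<in> A j} \<in> sets (seqm N)" by measurable
    then show ?thesis
      by (subst emeasure_distr) (auto intro!: arg_cong2[where f=emeasure] measurable_space[OF f] simp: space_PiM PiE_iff Ball_def)
  qed
  also have "\<dots> = (\<Prod>j<n. emeasure M (f -` A j \<inter> space M))"
    by (subst emeasure_PiM_Collect) auto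
  finally show "emeasure (distr (seqm M) (seqm N) (\<lambda>s i. f (s i))) {s \<in> space (distr (seqm M) (seqm N) (\<lambda>s i. f (s i))). \<forall>j<n. s j \<in> A j} =
      (\<Prod>j<n. emeasure (distr M N f) (A j))"
    by (simp add: emeasure_distr)
qed

lemma seqm_scale:
  assumes r: "0 < r" and F [measurable]: "F \<in> borel_measurable (seqm borel)"
  shows "(\<integral>\<^sup>+x. F (\<lambda>i. x i / r) \<partial>seqm (expm 1)) = (\<integral>\<^sup>+x. F x \<partial>seqm (expm r))"
proof -
  have "distr (expm 1) (expm r) (\<lambda>x. x / r) = expm r"
    by (rule measure_eqI_nn_integral) (auto simp: nn_integral_distr expm_scale[OF r])
  then have "distr (seqm (expm 1)) (seqm (expm r)) (\<lambda>s i. s i / r) = seqm (expm r)"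
    using seqm_distr[of "expm 1" "\<lambda>x. x / r" "expm r"] by (simp add: prob_space_expm)
  then have "(\<integral>\<^sup>+x. F x \<partial>seqm (expm r)) = (\<integral>\<^sup>+x. F x \<partial>distr (seqm (expm 1)) (seqm (expm r)) (\<lambda>s i. s i / r))"
    by simp
  then show ?thesis by (subst (asm) nn_integral_distr) auto
qed

section \<open>Comparison of passage times with different boundary weights\<close>

lemma grid_induct [case_names row column step]:
  assumes "\<And>i. P i 0" "\<And>j. P 0 (Suc j)" "\<And>i j. P i (Suc j) \<Longrightarrow> P (Suc i) j \<Longrightarrow> P (Suc i) (Suc j)"
  shows "P (i :: nat) (j :: nat)"
proof (induction i arbitrary: j)
  case 0 show ?case using assms(1,2) by (cases j) auto
next
  case (Suc i) then show ?case by (induction j) (auto intro: assms)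
qed

lemma lpp_mono:
  assumes "\<And>k. x k \<le> x' k" "\<And>k. y k \<le> y' k"
  shows "lpp x y w i j \<le> lpp x' y' w i j"
proof (induction i j rule: grid_induct)
  case (step i j)
  then show ?case by (simp add: max.coboundedI1 max.coboundedI2)
qed (auto intro!: sum_mono assms add_mono)

text \<open>A passage time is a maximum over paths of sums of weights, hence convex in the boundary
  weights; midpoints suffice below.\<close>

lemma lpp_convex:
  assumes "\<And>k. 2 * x1 k = x0 k + x2 k" "\<And>k. 2 * y1 k = y0 k + y2 k"
  shows "2 * lpp x1 y1 w i j \<le> lpp x0 y0 w i j + lpp x2 y2 w i j"
proof (induction i j rule: grid_induct)
  case (row i)
  then show ?case by (simp add: sum_distrib_left assms sum.distrib)
next
  case (column j)
  have "2 * (\<Sum>k<Suc j. y1 k) = (\<Sum>k<Suc j. y0 k) + (\<Sum>k<Suc j. y2 k)"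
    by (simp only: sum_distrib_left assms sum.distrib)
  then show ?case by (simp only: lpp.simps)
next
  case (step i j)
  then show ?case by (simp add: max_def split: if_splits)
qed

text \<open>An optimal path leaves the corner along one axis and never meets the other one, whose
  weights may then be replaced.\<close>

lemma lpp_le_max: "lpp x y w i j \<le> max (lpp x y' w i j) (lpp x' y w i j)"
  by (induction i j rule: grid_induct) (auto simp: max_def split: if_splits)

text \<open>Either the maximising path leaves the horizontal axis before \<open>k\<close>, so that the later boundary weights
  may be replaced, or it collects any extra weight \<open>d\<close> put on the first \<open>k\<close> of them.\<close>

lemma lpp_exit:
  assumes "\<And>l. l < k \<Longrightarrow> xm l = x l"
  shows "lpp x y w i j \<le> lpp xm y w i j \<or>
    lpp x y w i j + (\<Sum>l<k. d l) \<le> lpp (\<lambda>l. x l + (if l < k then d l else 0)) y w i j"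
proof (induction i j rule: grid_induct)
  case (row i)
  show ?case
  proof (cases "i \<le> k")
    case True
    then have "(\<Sum>l<i. x l) = (\<Sum>l<i. xm l)" using assms by (intro sum.cong) auto
    then show ?thesis by simp
  next
    case False
    then have "(\<Sum>l<i. if l < k then d l else 0) = (\<Sum>l<k. d l)"
      by (subst sum.inter_filter[symmetric]) (auto intro!: sum.cong)
    then show ?thesis by (simp add: sum.distrib)
  qed
next
  case (step i j)
  then show ?case by (auto simp: max_def split: if_splits)
qed auto

section \<open>The unit exponential environment and its scaled boundaries\<close>

definition lppm :: "((nat \<Rightarrow> real) \<times> (nat \<Rightarrow> real) \<times> (nat \<Rightarrow> nat \<Rightarrow> real)) measure" where
  "lppm = seqm (expm 1) \<Otimes>\<^sub>M (seqm (expm 1) \<Otimes>\<^sub>M seqm (seqm (expm 1)))"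

lemma sets_lppm [measurable_cong]:
  "sets lppm = sets (seqm borel \<Otimes>\<^sub>M (seqm borel \<Otimes>\<^sub>M seqm (seqm borel)))"
  unfolding lppm_def by (intro sets_pair_measure_cong sets_seqm_expm sets_seqm_seqm_expm)

lemma space_lppm [simp]: "space lppm = UNIV"
  by (simp add: lppm_def space_pair_measure space_PiM)

lemma prob_space_lppm: "prob_space lppm"
proof -
  interpret A: prob_space "seqm (expm 1)" by (rule prob_seqm_expm) simp
  interpret B: prob_space "seqm (seqm (expm 1))" by (rule prob_bulk)
  interpret AB: pair_prob_space "seqm (expm 1)" "seqm (seqm (expm 1))" ..
  interpret AAB: pair_prob_space "seqm (expm 1)" "seqm (expm 1) \<Otimes>\<^sub>M seqm (seqm (expm 1))" ..
  show ?thesis unfolding lppm_def by unfold_locales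
qed

interpretation L: prob_space lppm by (rule prob_space_lppm)

lemma nn_integral_lppm:
  assumes [measurable]: "F \<in> borel_measurable lppm"
  shows "(\<integral>\<^sup>+p. F p \<partial>lppm) = (\<integral>\<^sup>+y. (\<integral>\<^sup>+x. (\<integral>\<^sup>+w. F (y, x, w) \<partial>seqm (seqm (expm 1))) \<partial>seqm (expm 1)) \<partial>seqm (expm 1))"
proof -
  interpret A: prob_space "seqm (expm 1)" by (rule prob_seqm_expm) simp
  interpret B: prob_space "seqm (seqm (expm 1))" by (rule prob_bulk)
  interpret AB: pair_prob_space "seqm (expm 1)" "seqm (seqm (expm 1))" ..
  have [measurable]: "F \<in> borel_measurable (seqm (expm 1) \<Otimes>\<^sub>M (seqm (expm 1) \<Otimes>\<^sub>M seqm (seqm (expm 1))))"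
    using assms unfolding lppm_def .
  have "(\<integral>\<^sup>+p. F p \<partial>lppm) = (\<integral>\<^sup>+y. (\<integral>\<^sup>+q. F (y, q) \<partial>(seqm (expm 1) \<Otimes>\<^sub>M seqm (seqm (expm 1)))) \<partial>seqm (expm 1))"
    unfolding lppm_def by (subst AB.nn_integral_fst[symmetric]) auto
  also have "\<dots> = (\<integral>\<^sup>+y. (\<integral>\<^sup>+x. (\<integral>\<^sup>+w. F (y, x, w) \<partial>seqm (seqm (expm 1))) \<partial>seqm (expm 1)) \<partial>seqm (expm 1))"
    by (intro nn_integral_cong, subst B.nn_integral_fst[symmetric]) (auto simp: space_PiM)
  finally show ?thesis .
qed

text \<open>Boundaries of all rates are coupled by scaling unit exponential variables; \<open>a + b = 1\<close> is the stationary case.\<close>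

definition lppg :: "real \<Rightarrow> real \<Rightarrow> nat \<Rightarrow> nat \<Rightarrow> (nat \<Rightarrow> real) \<times> (nat \<Rightarrow> real) \<times> (nat \<Rightarrow> nat \<Rightarrow> real) \<Rightarrow> real" where
  "lppg a b m n = (\<lambda>(y, x, w). lpp (\<lambda>i. x i / a) (\<lambda>j. y j / b) w m n)"

definition vinc :: "real \<Rightarrow> real \<Rightarrow> nat \<Rightarrow> (nat \<Rightarrow> real) \<times> (nat \<Rightarrow> real) \<times> (nat \<Rightarrow> nat \<Rightarrow> real) \<Rightarrow> nat \<Rightarrow> real" where
  "vinc a b m = (\<lambda>(y, x, w). vcol m (\<lambda>i. x i / a) (\<lambda>j. y j / b) w)"

lemma measurable_lppg [measurable]: "lppg a b m n \<in> borel_measurable lppm"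
  unfolding lppg_def by measurable

lemma measurable_vinc [measurable]: "vinc a b m \<in> measurable lppm (seqm borel)"
  unfolding vinc_def by measurable

lemma lppg_vinc: "lppg a b m (n + s) p = lppg a b m n p + (\<Sum>j<s. vinc a b m p (n + j))"
proof -
  obtain y x w where p: "p = (y, x, w)" by (cases p) auto
  show ?thesis
    unfolding p lppg_def vinc_def prod.case lpp_vcol
    by (induction s) auto
qed

lemma nn_integral_lppm_scaled:
  assumes ab: "0 < a" "0 < b" and F [measurable]: "F \<in> borel_measurable (seqm borel \<Otimes>\<^sub>M (seqm borel \<Otimes>\<^sub>M seqm (seqm borel)))"
  shows "(\<integral>\<^sup>+(y, x, w). F (\<lambda>j. y j / b, \<lambda>i. x i / a, w) \<partial>lppm) =
    (\<integral>\<^sup>+y. (\<integral>\<^sup>+x. (\<integral>\<^sup>+w. F (y, x, w) \<partial>seqm (seqm (expm 1))) \<partial>seqm (expm a)) \<partial>seqm (expm b))"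
proof -
  interpret B: prob_space "seqm (seqm (expm 1))" by (rule prob_bulk)
  interpret A: prob_space "seqm (expm a)" by (rule prob_seqm_expm) fact
  interpret A1: prob_space "seqm (expm 1)" by (rule prob_seqm_expm) simp
  have "(\<integral>\<^sup>+(y, x, w). F (\<lambda>j. y j / b, \<lambda>i. x i / a, w) \<partial>lppm) =
    (\<integral>\<^sup>+y. (\<integral>\<^sup>+x. (\<integral>\<^sup>+w. F (\<lambda>j. y j / b, \<lambda>i. x i / a, w) \<partial>seqm (seqm (expm 1))) \<partial>seqm (expm 1)) \<partial>seqm (expm 1))"
    by (subst nn_integral_lppm) auto
  also have "\<dots> = (\<integral>\<^sup>+y. (\<integral>\<^sup>+x. (\<integral>\<^sup>+w. F (\<lambda>j. y j / b, x, w) \<partial>seqm (seqm (expm 1))) \<partial>seqm (expm a)) \<partial>seqm (expm 1))"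
    by (intro nn_integral_cong seqm_scale[OF ab(1)]) (measurable, auto simp: space_PiM)
  also have "\<dots> = (\<integral>\<^sup>+y. (\<integral>\<^sup>+x. (\<integral>\<^sup>+w. F (y, x, w) \<partial>seqm (seqm (expm 1))) \<partial>seqm (expm a)) \<partial>seqm (expm b))"
    by (intro seqm_scale[OF ab(2), where F="\<lambda>y. (\<integral>\<^sup>+x. (\<integral>\<^sup>+w. F (y, x, w) \<partial>seqm (seqm (expm 1))) \<partial>seqm (expm a))"]) measurable
  finally show ?thesis .
qed

text \<open>The rates 1 - b and b would be stationary. The exponent c = a + b - 1 is the tilt that
  moves the bottom rate from a to 1 - b, so Burke's property applies under the tilted law and leaves
  the generating function of a sum of n exponentials of rate b; it is finite since a < 1 means c <
  b.\<close>

lemma lppg_mgf: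
  assumes "0 < a" "a < 1" "0 < b" "b < 1"
  shows "(\<integral>\<^sup>+p. ennreal (exp ((a + b - 1) * lppg a b m n p)) \<partial>lppm) = ennreal ((a / (1 - b)) ^ m * (b / (1 - a)) ^ n)"
proof -
  define c where "c = a + b - 1"
  have ac: "(1 - b) + c = a" "b - c = 1 - a" by (auto simp: c_def)
  have "(\<integral>\<^sup>+p. ennreal (exp (c * lppg a b m n p)) \<partial>lppm) =
    (\<integral>\<^sup>+(y, x, w). (case (\<lambda>j. y j / b, \<lambda>i. x i / a, w) of (y, x, w) \<Rightarrow> ennreal (exp (c * lpp x y w m n))) \<partial>lppm)"
    by (intro nn_integral_cong) (auto simp: lppg_def)
  also have "\<dots> = (\<integral>\<^sup>+y. (\<integral>\<^sup>+x. (\<integral>\<^sup>+w. ennreal (exp (c * lpp x y w m n)) \<partial>seqm (seqm (expm 1))) \<partial>seqm (expm a)) \<partial>seqm (expm b))"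
    using assms by (subst nn_integral_lppm_scaled) auto
  also have "\<dots> = (\<integral>\<^sup>+y. (\<integral>\<^sup>+x. (\<integral>\<^sup>+w. ennreal (exp (c * (\<Sum>i<m. x i))) * ennreal (exp (c * (\<Sum>j<n. vcol m x y w j))) \<partial>seqm (seqm (expm 1))) \<partial>seqm (expm ((1 - b) + c))) \<partial>seqm (expm b))"
    by (simp add: lpp_vcol distrib_left exp_add ennreal_mult ac)
  also have "\<dots> = ennreal ((((1 - b) + c) / (1 - b)) ^ m) * (\<integral>\<^sup>+y. ennreal (exp (c * (\<Sum>j<n. y j))) \<partial>seqm (expm b))"
    using assms ac by (intro tilted_vcol_law[where F="\<lambda>y. ennreal (exp (c * (\<Sum>j<n. y j)))"]) auto
  also have "\<dots> = ennreal ((a / (1 - b)) ^ m) * ennreal ((b / (b - c)) ^ n)"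
    using assms by (subst nn_integral_exp_sum) (auto simp: c_def)
  finally show ?thesis using assms ac by (simp add: c_def ennreal_mult'[symmetric])
qed

lemma vinc_law:
  assumes ab: "0 < a" "0 < b" "a + b = 1" and F [measurable]: "F \<in> borel_measurable (seqm borel)"
  shows "(\<integral>\<^sup>+p. F (vinc a b m p) \<partial>lppm) = (\<integral>\<^sup>+y. F y \<partial>seqm (expm b))"
proof -
  have "(\<integral>\<^sup>+p. F (vinc a b m p) \<partial>lppm) =
    (\<integral>\<^sup>+(y, x, w). (case (\<lambda>j. y j / b, \<lambda>i. x i / a, w) of (y, x, w) \<Rightarrow> F (vcol m x y w)) \<partial>lppm)"
    by (intro nn_integral_cong) (auto simp: vinc_def)
  also have "\<dots> = (\<integral>\<^sup>+y. (\<integral>\<^sup>+x. (\<integral>\<^sup>+w. F (vcol m x y w) \<partial>seqm (seqm (expm 1))) \<partial>seqm (expm a)) \<partial>seqm (expm b))"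
    using assms by (subst nn_integral_lppm_scaled) auto
  also have "\<dots> = (\<integral>\<^sup>+y. F y \<partial>seqm (expm b))"
    using tilted_vcol_law[OF ab, of 0 F m] ab by simp
  finally show ?thesis .
qed

lemma AE_seqm_expm_pos: "0 < r \<Longrightarrow> AE x in seqm (expm r). \<forall>i. 0 < x i"
  by (subst AE_all_countable, intro allI AE_PiM_component) (auto intro: AE_expm_pos prob_space_expm)

lemma measurable_component2:
  assumes "f \<in> measurable M (seqm (seqm borel))"
  shows "(\<lambda>x. f x i j) \<in> borel_measurable M"
  using measurable_compose[OF measurable_compose[OF assms measurable_component_singleton[of i]] measurable_component_singleton[of j]] by simp

lemma AE_lppm_pos: "AE p in lppm. (\<forall>j. 0 < fst p j) \<and> (\<forall>i. 0 < fst (snd p) i) \<and> (\<forall>i j. 0 < snd (snd p) i j)"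
proof -
  interpret A: prob_space "seqm (expm 1)" by (rule prob_seqm_expm) simp
  interpret B: prob_space "seqm (seqm (expm 1))" by (rule prob_bulk)
  interpret AB: pair_prob_space "seqm (expm 1)" "seqm (seqm (expm 1))" ..
  interpret AAB: pair_prob_space "seqm (expm 1)" "seqm (expm 1) \<Otimes>\<^sub>M seqm (seqm (expm 1))" ..
  have 1: "AE x in seqm (expm 1). \<forall>i. 0 < x i" by (rule AE_seqm_expm_pos) simp
  have 2: "AE w in seqm (seqm (expm 1)). \<forall>i j. 0 < w i j"
    by (subst AE_all_countable, intro allI AE_PiM_component[where P="\<lambda>v. \<forall>j. 0 < v j"])
       (auto intro: AE_seqm_expm_pos prob_seqm_expm)
  have 3: "AE q in seqm (expm 1) \<Otimes>\<^sub>M seqm (seqm (expm 1)). (\<forall>i. 0 < fst q i) \<and> (\<forall>i j. 0 < snd q i j)"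
  proof (rule AB.AE_pair_measure)
    show "{q \<in> space (seqm (expm 1) \<Otimes>\<^sub>M seqm (seqm (expm 1))). (\<forall>i. 0 < fst q i) \<and> (\<forall>i j. 0 < snd q i j)} \<in> sets (seqm (expm 1) \<Otimes>\<^sub>M seqm (seqm (expm 1)))"
    proof -
      have [measurable]: "(\<lambda>q. snd q i j) \<in> borel_measurable (seqm (expm 1) \<Otimes>\<^sub>M seqm (seqm (expm 1)))" for i j
        by (rule measurable_component2) measurable
      show ?thesis by measurable
    qed
  qed (use 1 2 in \<open>auto elim: AE_mp\<close>)
  show ?thesis unfolding lppm_def
  proof (rule AAB.AE_pair_measure)
    show "{p \<in> space (seqm (expm 1) \<Otimes>\<^sub>M (seqm (expm 1) \<Otimes>\<^sub>M seqm (seqm (expm 1)))).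
       (\<forall>j. 0 < fst p j) \<and> (\<forall>i. 0 < fst (snd p) i) \<and> (\<forall>i j. 0 < snd (snd p) i j)} \<in> sets (seqm (expm 1) \<Otimes>\<^sub>M (seqm (expm 1) \<Otimes>\<^sub>M seqm (seqm (expm 1))))"
    proof -
      have [measurable]: "(\<lambda>q. snd (snd q) i j) \<in> borel_measurable (seqm (expm 1) \<Otimes>\<^sub>M (seqm (expm 1) \<Otimes>\<^sub>M seqm (seqm (expm 1))))" for i j
        by (rule measurable_component2) measurable
      show ?thesis by measurable
    qed
  qed (use 1 3 in \<open>auto elim: AE_mp\<close>)
qed

lemma vcol_nonneg:
  "(\<And>j. 0 \<le> y j) \<Longrightarrow> (\<And>i j. 0 \<le> w i j) \<Longrightarrow> 0 \<le> vcol m x y w j"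
proof (induction m arbitrary: x y w j)
  case (Suc m)
  then show ?case unfolding vcol.simps by (intro Suc.IH) (auto simp: col_def intro!: add_nonneg_nonneg)
qed simp

lemma AE_lppg_nonneg:
  assumes "0 < a" "0 < b"
  shows "AE p in lppm. 0 \<le> lppg a b m n p \<and> (\<forall>j. 0 \<le> vinc a b m p j) \<and> (\<forall>i. 0 \<le> fst (snd p) i)"
  using AE_lppm_pos
proof eventually_elim
  case (elim p)
  obtain y x w where p: "p = (y, x, w)" by (cases p) auto
  have "0 \<le> vcol m (\<lambda>i. x i / a) (\<lambda>j. y j / b) w j" for j
    using elim assms unfolding p by (intro vcol_nonneg) (auto intro: less_imp_le)
  then show ?case
    using elim assms unfolding p lppg_def vinc_def prod.case lpp_vcol
    by (auto intro!: add_nonneg_nonneg sum_nonneg intro: less_imp_le)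
qed

lemma expm_mean: "0 < r \<Longrightarrow> (\<integral>\<^sup>+x. ennreal x \<partial>expm r) = ennreal (1 / r)"
proof -
  assume r: "0 < r"
  interpret prob_space "expm r" by (rule prob_space_expm) fact
  have D: "distributed (expm r) lborel (\<lambda>x. x) (exponential_density r)"
    unfolding distributed_def using r
    by (auto simp: expm_def exponential_density_nonneg intro!: measure_eqI)
       (subst emeasure_distr, auto)
  have "integrable (expm r) (\<lambda>x. x)"
    using erlang_ith_moment_integrable[OF r D, of 1] by simp
  moreover have "expectation (\<lambda>x. x) = 1 / r"
    using exponential_distributed_expectation[OF r D] by simp
  ultimately show ?thesis
    using AE_expm_pos[OF r] by (subst nn_integral_eq_integral) (auto elim: AE_mp)
qed

lemma nn_integral_sum_expm:
  assumes "0 < r"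
  shows "(\<integral>\<^sup>+x. ennreal (\<Sum>i<n. x i) \<partial>seqm (expm r)) = ennreal (real n / r)"
proof -
  have p: "prob_space (expm r)" using assms by (rule prob_space_expm)
  have 1: "(\<integral>\<^sup>+x. ennreal (x i) \<partial>seqm (expm r)) = ennreal (1 / r)" for i
  proof -
    have "(\<integral>\<^sup>+x. ennreal (x i) \<partial>seqm (expm r)) = (\<integral>\<^sup>+x. ennreal x \<partial>distr (seqm (expm r)) (expm r) (\<lambda>x. x i))"
      by (subst nn_integral_distr) auto
    also have "distr (seqm (expm r)) (expm r) (\<lambda>x. x i) = expm r"
      using p by (intro distr_PiM_component) auto
    finally show ?thesis using expm_mean[OF assms] by simp
  qed
  have "(\<integral>\<^sup>+x. ennreal (\<Sum>i<n. x i) \<partial>seqm (expm r)) = (\<integral>\<^sup>+x. (\<Sum>i<n. ennreal (x i)) \<partial>seqm (expm r))"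
  proof (rule nn_integral_cong_AE)
    show "AE x in seqm (expm r). ennreal (\<Sum>i<n. x i) = (\<Sum>i<n. ennreal (x i))"
      using AE_seqm_expm_pos[OF assms] by eventually_elim (simp add: sum_ennreal less_imp_le)
  qed
  also have "\<dots> = (\<Sum>i<n. ennreal (1 / r))"
    by (subst nn_integral_sum) (auto simp: 1)
  also have "\<dots> = ennreal (real n / r)"
    using assms by (subst sum_ennreal) auto
  finally show ?thesis .
qed

text \<open>The two sums in \<open>lpp_vcol\<close> are dependent, but the mean needs only their
  separate laws.\<close>

lemma lppg_mean:
  assumes ab: "0 < a" "0 < b" "a + b = 1"
  shows "(\<integral>\<^sup>+p. ennreal (lppg a b m n p) \<partial>lppm) = ennreal (real m / a + real n / b)"
proof -
  have "(\<integral>\<^sup>+p. ennreal (lppg a b m n p) \<partial>lppm) =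
    (\<integral>\<^sup>+p. ennreal (\<Sum>i<m. fst (snd p) i / a) + ennreal (\<Sum>j<n. vinc a b m p j) \<partial>lppm)"
  proof (rule nn_integral_cong_AE)
    show "AE p in lppm. ennreal (lppg a b m n p) = ennreal (\<Sum>i<m. fst (snd p) i / a) + ennreal (\<Sum>j<n. vinc a b m p j)"
      using AE_lppg_nonneg[OF ab(1,2), of m n]
      by eventually_elim
         (use ab in \<open>auto simp: lppg_def vinc_def lpp_vcol split: prod.splits intro!: ennreal_plus sum_nonneg\<close>)
  qed
  also have "\<dots> = (\<integral>\<^sup>+p. ennreal (\<Sum>i<m. fst (snd p) i / a) \<partial>lppm) + (\<integral>\<^sup>+p. ennreal (\<Sum>j<n. vinc a b m p j) \<partial>lppm)"
    by (rule nn_integral_add) auto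
  also have "(\<integral>\<^sup>+p. ennreal (\<Sum>j<n. vinc a b m p j) \<partial>lppm) = ennreal (real n / b)"
    using vinc_law[OF ab, of "\<lambda>y. ennreal (\<Sum>j<n. y j)" m] nn_integral_sum_expm[OF ab(2), of n] by simp
  also have "(\<integral>\<^sup>+p. ennreal (\<Sum>i<m. fst (snd p) i / a) \<partial>lppm) =
     (\<integral>\<^sup>+(y, x, w). (case (\<lambda>j. y j / b, \<lambda>i. x i / a, w) of (y, x, w) \<Rightarrow> ennreal (\<Sum>i<m. x i)) \<partial>lppm)"
    by (intro nn_integral_cong) auto
  also have "\<dots> = ennreal (real m / a)"
    using ab by (subst nn_integral_lppm_scaled)
      (auto simp: nn_integral_prob_const prob_bulk prob_seqm_expm nn_integral_sum_expm simp del: nn_integral_const)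
  finally show ?thesis using ab by (simp add: ennreal_plus)
qed

section \<open>Tails on the scale \<open>t\<^sup>1\<^sup>/\<^sup>3\<close>\<close>

text \<open>The time is \<tau> ^ 3, so \<tau> is the scale of the fluctuations. The tolerance 1
  admits the integer parts of both coordinates.\<close>

definition near_char :: "real \<Rightarrow> real \<Rightarrow> nat \<Rightarrow> nat \<Rightarrow> bool" where
  "near_char \<rho> \<tau> m n \<longleftrightarrow> 1 \<le> \<tau> \<and> \<bar>real m - \<rho>\<^sup>2 * \<tau> ^ 3\<bar> \<le> 1 \<and> \<bar>real n - (1 - \<rho>)\<^sup>2 * \<tau> ^ 3\<bar> \<le> 1"

text \<open>For T = \<tau> ^ 3 the left side is both the derivative of the logarithmic generating
  function and the excess of the stationary mean at density s. On the characteristic the linear term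
  in s - \<rho> cancels; this is the source of the exponent 1/3.\<close>

lemma mean_expand:
  fixes s :: real
  assumes "0 < s" "s < 1"
  shows "m / s + n / (1 - s) - T =
    T * (s - \<rho>)\<^sup>2 / (s * (1 - s)) + (m - \<rho>\<^sup>2 * T) / s + (n - (1 - \<rho>)\<^sup>2 * T) / (1 - s)"
proof -
  have e: "\<rho>\<^sup>2 * (1 - s) + (1 - \<rho>)\<^sup>2 * s - s * (1 - s) = (s - \<rho>)\<^sup>2"
    by (simp add: power2_eq_square algebra_simps)
  have "(s - \<rho>)\<^sup>2 / (s * (1 - s)) = \<rho>\<^sup>2 / s + (1 - \<rho>)\<^sup>2 / (1 - s) - 1"
    unfolding e[symmetric] using assms by (simp add: add_divide_distrib diff_divide_distrib)
  then have "T * (s - \<rho>)\<^sup>2 / (s * (1 - s)) = T * \<rho>\<^sup>2 / s + T * (1 - \<rho>)\<^sup>2 / (1 - s) - T"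
    by (simp add: times_divide_eq_right[symmetric] distrib_left right_diff_distrib del: times_divide_eq_right)
  then show ?thesis by (simp add: diff_divide_distrib mult.commute)
qed

text \<open>The expression is f z - f w. By \<open>mean_expand\<close> the derivative of f is of
  order \<tau> on an interval of length of order 1 / \<tau>, so the difference stays bounded. The
  margin \<theta> keeps the interval away from 0 and 1.\<close>

lemma log_mgf_bound:
  assumes nc: "near_char \<rho> \<tau> m n" and \<theta>: "0 < \<theta>" "2 * \<theta> \<le> \<rho>" "2 * \<theta> \<le> 1 - \<rho>" and \<kappa>: "0 \<le> \<kappa>" "\<kappa> / \<tau> \<le> \<theta>"
    and zw: "\<bar>z - \<rho>\<bar> \<le> \<kappa> / \<tau>" "\<bar>w - \<rho>\<bar> \<le> \<kappa> / \<tau>"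
  shows "\<bar>m * ln (z / w) + n * ln ((1 - w) / (1 - z)) - (z - w) * \<tau> ^ 3\<bar> \<le> 2 * \<kappa> * (\<kappa>\<^sup>2 / \<theta>\<^sup>2 + 2 / \<theta>)"
proof -
  define S where "S = {\<rho> - \<kappa> / \<tau>..\<rho> + \<kappa> / \<tau>}"
  define f where "f s = m * ln s - n * ln (1 - s) - s * \<tau> ^ 3" for s
  define f' where "f' s = m / s + n / (1 - s) - \<tau> ^ 3" for s
  define B where "B = \<tau> * (\<kappa>\<^sup>2 / \<theta>\<^sup>2 + 2 / \<theta>)"
  have \<tau>: "1 \<le> \<tau>" "0 < \<tau>" using nc by (auto simp: near_char_def)
  have S: "\<theta> \<le> s \<and> \<theta> \<le> 1 - s \<and> \<bar>s - \<rho>\<bar> \<le> \<kappa> / \<tau>" if "s \<in> S" for s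
    using that \<theta> \<kappa> unfolding S_def by (auto simp: abs_le_iff)
  have der: "(f has_field_derivative f' s) (at s within S)" if "s \<in> S" for s
    unfolding f_def[abs_def] f'_def using S[OF that] \<theta>(1)
    by (auto intro!: derivative_eq_intros simp: field_simps)
  have bnd: "norm (f' s) \<le> B" if "s \<in> S" for s
  proof -
    note s = S[OF that]
    have 1: "\<bar>\<tau> ^ 3 * (s - \<rho>)\<^sup>2 / (s * (1 - s))\<bar> \<le> \<tau> * (\<kappa>\<^sup>2 / \<theta>\<^sup>2)"
    proof -
      have "(s - \<rho>)\<^sup>2 \<le> (\<kappa> / \<tau>)\<^sup>2"
        using s by (metis abs_ge_zero power2_abs power_mono)
      then have "\<tau> ^ 3 * (s - \<rho>)\<^sup>2 \<le> \<tau> ^ 3 * (\<kappa> / \<tau>)\<^sup>2" using \<tau> by simp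
      also have "\<dots> = \<tau> * \<kappa>\<^sup>2" using \<tau> by (simp add: field_simps power2_eq_square power3_eq_cube)
      finally have a: "\<tau> ^ 3 * (s - \<rho>)\<^sup>2 \<le> \<tau> * \<kappa>\<^sup>2" .
      have "\<theta>\<^sup>2 \<le> s * (1 - s)" unfolding power2_eq_square using s \<theta>(1) by (intro mult_mono) auto
      with a have "\<tau> ^ 3 * (s - \<rho>)\<^sup>2 / (s * (1 - s)) \<le> \<tau> * \<kappa>\<^sup>2 / \<theta>\<^sup>2"
        using \<theta>(1) \<tau> by (intro frac_le) auto
      moreover have "0 \<le> \<tau> ^ 3 * (s - \<rho>)\<^sup>2 / (s * (1 - s))"
        using s \<theta>(1) \<tau> by (intro divide_nonneg_nonneg mult_nonneg_nonneg) auto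
      ultimately show ?thesis by (subst abs_of_nonneg) auto
    qed
    have 2: "\<bar>(m - \<rho>\<^sup>2 * \<tau> ^ 3) / s\<bar> \<le> 1 / \<theta>"
      using nc s \<theta>(1) unfolding abs_divide near_char_def by (intro frac_le) auto
    have 3: "\<bar>(n - (1 - \<rho>)\<^sup>2 * \<tau> ^ 3) / (1 - s)\<bar> \<le> 1 / \<theta>"
      using nc s \<theta>(1) unfolding abs_divide near_char_def by (intro frac_le) auto
    have e: "f' s = \<tau> ^ 3 * (s - \<rho>)\<^sup>2 / (s * (1 - s)) + (m - \<rho>\<^sup>2 * \<tau> ^ 3) / s + (n - (1 - \<rho>)\<^sup>2 * \<tau> ^ 3) / (1 - s)"
      unfolding f'_def using s \<theta>(1) by (intro mean_expand) auto
    have "\<bar>f' s\<bar> \<le> \<tau> * (\<kappa>\<^sup>2 / \<theta>\<^sup>2) + 1 / \<theta> + 1 / \<theta>"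
      unfolding e using 1 2 3 by (intro order_trans[OF abs_triangle_ineq] add_mono) auto
    also have "\<dots> \<le> B"
    proof -
      have "2 / \<theta> \<le> \<tau> * (2 / \<theta>)" using \<tau> \<theta>(1) by (simp add: field_simps)
      then show ?thesis unfolding B_def by (simp add: distrib_left)
    qed
    finally show ?thesis by simp
  qed
  have zS: "z \<in> S" "w \<in> S" using zw unfolding S_def by (auto simp: abs_le_iff)
  have "norm (f z - f w) \<le> B * norm (z - w)"
    by (rule field_differentiable_bound[of S f f']) (use der bnd zS in \<open>auto simp: S_def\<close>)
  also have "\<dots> \<le> B * (2 * (\<kappa> / \<tau>))"
  proof (rule mult_left_mono)
    show "norm (z - w) \<le> 2 * (\<kappa> / \<tau>)" using zw by auto
    show "0 \<le> B" using \<tau> \<theta>(1) by (auto simp: B_def)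
  qed
  also have "\<dots> = 2 * \<kappa> * (\<kappa>\<^sup>2 / \<theta>\<^sup>2 + 2 / \<theta>)"
    using \<tau> by (simp add: B_def)
  finally have "\<bar>f z - f w\<bar> \<le> 2 * \<kappa> * (\<kappa>\<^sup>2 / \<theta>\<^sup>2 + 2 / \<theta>)" by simp
  moreover have "f z - f w = m * ln (z / w) + n * ln ((1 - w) / (1 - z)) - (z - w) * \<tau> ^ 3"
    using S[OF zS(1)] S[OF zS(2)] \<theta>(1) unfolding f_def by (simp add: ln_div algebra_simps)
  ultimately show ?thesis by simp
qed

lemma lppg_mgf_le:
  assumes nc: "near_char \<rho> \<tau> m n" and \<theta>: "0 < \<theta>" "2 * \<theta> \<le> \<rho>" "2 * \<theta> \<le> 1 - \<rho>" and \<kappa>: "0 \<le> \<kappa>" "\<kappa> / \<tau> \<le> \<theta>"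
    and zw: "\<bar>z - \<rho>\<bar> \<le> \<kappa> / \<tau>" "\<bar>w - \<rho>\<bar> \<le> \<kappa> / \<tau>"
  shows "(\<integral>\<^sup>+p. ennreal (exp ((z - w) * (lppg z (1 - w) m n p - \<tau> ^ 3))) \<partial>lppm) \<le> ennreal (exp (2 * \<kappa> * (\<kappa>\<^sup>2 / \<theta>\<^sup>2 + 2 / \<theta>)))"
proof -
  have zw': "0 < z" "z < 1" "0 < w" "w < 1" using zw \<theta> \<kappa> by (auto simp: abs_le_iff)
  have "(\<integral>\<^sup>+p. ennreal (exp ((z - w) * (lppg z (1 - w) m n p - \<tau> ^ 3))) \<partial>lppm) =
    (\<integral>\<^sup>+p. ennreal (exp (- ((z - w) * \<tau> ^ 3))) * ennreal (exp ((z + (1 - w) - 1) * lppg z (1 - w) m n p)) \<partial>lppm)"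
    by (intro nn_integral_cong) (simp add: ennreal_mult'[symmetric] exp_add[symmetric] algebra_simps)
  also have "\<dots> = ennreal (exp (- ((z - w) * \<tau> ^ 3))) * ennreal ((z / w) ^ m * ((1 - w) / (1 - z)) ^ n)"
    using lppg_mgf[of z "1 - w" m n] zw' by (subst nn_integral_cmult) auto
  also have "(z / w) ^ m * ((1 - w) / (1 - z)) ^ n = exp (m * ln (z / w) + n * ln ((1 - w) / (1 - z)))"
    using zw' by (simp add: exp_add exp_of_nat_mult)
  also have "ennreal (exp (- ((z - w) * \<tau> ^ 3))) * ennreal (exp (m * ln (z / w) + n * ln ((1 - w) / (1 - z)))) =
     ennreal (exp (m * ln (z / w) + n * ln ((1 - w) / (1 - z)) - (z - w) * \<tau> ^ 3))"
    by (simp add: ennreal_mult'[symmetric] exp_add[symmetric] algebra_simps)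
  also have "\<dots> \<le> ennreal (exp (2 * \<kappa> * (\<kappa>\<^sup>2 / \<theta>\<^sup>2 + 2 / \<theta>)))"
    using log_mgf_bound[OF assms] by (intro ennreal_leI) auto
  finally show ?thesis .
qed

lemma exp_max_le: "exp (max a b) \<le> exp a + exp (b::real)"
  by (simp add: max_def)

text \<open>For z = w the exact formula has exponent 0 and says nothing. With
  \<open>lpp_le_max\<close> one axis at a time is replaced: either w by z - 1 / \<tau> or z by w + 1
  / \<tau>, and both times the exponent becomes 1 / \<tau>. The shift is why \<kappa> + 1
  appears.\<close>

lemma lppg_right:
  assumes \<theta>: "0 < \<theta>" "2 * \<theta> \<le> \<rho>" "2 * \<theta> \<le> 1 - \<rho>" and \<kappa>: "0 \<le> \<kappa>"
  obtains C where "0 < C" "\<And>\<tau> m n z w. near_char \<rho> \<tau> m n \<Longrightarrow> (\<kappa> + 1) / \<tau> \<le> \<theta> \<Longrightarrow>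
     \<bar>z - \<rho>\<bar> \<le> \<kappa> / \<tau> \<Longrightarrow> \<bar>w - \<rho>\<bar> \<le> \<kappa> / \<tau> \<Longrightarrow>
     (\<integral>\<^sup>+p. ennreal (exp ((lppg z (1 - w) m n p - \<tau> ^ 3) / \<tau>)) \<partial>lppm) \<le> ennreal C"
proof
  define C where "C = exp (2 * (\<kappa> + 1) * ((\<kappa> + 1)\<^sup>2 / \<theta>\<^sup>2 + 2 / \<theta>))"
  show "0 < 2 * C" by (simp add: C_def)
  fix \<tau> m n z w
  assume nc: "near_char \<rho> \<tau> m n" and \<tau>1: "(\<kappa> + 1) / \<tau> \<le> \<theta>" and zw: "\<bar>z - \<rho>\<bar> \<le> \<kappa> / \<tau>" "\<bar>w - \<rho>\<bar> \<le> \<kappa> / \<tau>"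
  have \<tau>: "0 < \<tau>" using nc by (auto simp: near_char_def)
  define w' where "w' = z - 1 / \<tau>"
  define z' where "z' = w + 1 / \<tau>"
  have b: "\<bar>z - \<rho>\<bar> \<le> (\<kappa> + 1) / \<tau>" "\<bar>w - \<rho>\<bar> \<le> (\<kappa> + 1) / \<tau>" "\<bar>z' - \<rho>\<bar> \<le> (\<kappa> + 1) / \<tau>" "\<bar>w' - \<rho>\<bar> \<le> (\<kappa> + 1) / \<tau>"
  proof -
    have "0 < 1 / \<tau>" using \<tau> by simp
    with zw show "\<bar>z - \<rho>\<bar> \<le> (\<kappa> + 1) / \<tau>" "\<bar>w - \<rho>\<bar> \<le> (\<kappa> + 1) / \<tau>" "\<bar>z' - \<rho>\<bar> \<le> (\<kappa> + 1) / \<tau>" "\<bar>w' - \<rho>\<bar> \<le> (\<kappa> + 1) / \<tau>"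
      unfolding z'_def w'_def add_divide_distrib by linarith+
  qed
  have \<kappa>1: "0 \<le> \<kappa> + 1" using \<kappa> by simp
  have 1: "(\<integral>\<^sup>+p. ennreal (exp ((lppg z (1 - w') m n p - \<tau> ^ 3) / \<tau>)) \<partial>lppm) \<le> ennreal C"
    using lppg_mgf_le[OF nc \<theta> \<kappa>1 \<tau>1 b(1) b(4)] unfolding C_def by (simp add: w'_def)
  have 2: "(\<integral>\<^sup>+p. ennreal (exp ((lppg z' (1 - w) m n p - \<tau> ^ 3) / \<tau>)) \<partial>lppm) \<le> ennreal C"
    using lppg_mgf_le[OF nc \<theta> \<kappa>1 \<tau>1 b(3) b(2)] unfolding C_def by (simp add: z'_def)
  have "(\<integral>\<^sup>+p. ennreal (exp ((lppg z (1 - w) m n p - \<tau> ^ 3) / \<tau>)) \<partial>lppm) \<le>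
    (\<integral>\<^sup>+p. ennreal (exp ((lppg z (1 - w') m n p - \<tau> ^ 3) / \<tau>)) + ennreal (exp ((lppg z' (1 - w) m n p - \<tau> ^ 3) / \<tau>)) \<partial>lppm)"
  proof (rule nn_integral_mono)
    fix p
    have "lppg z (1 - w) m n p \<le> max (lppg z (1 - w') m n p) (lppg z' (1 - w) m n p)"
      unfolding lppg_def by (auto split: prod.splits intro!: lpp_le_max)
    then have "(lppg z (1 - w) m n p - \<tau> ^ 3) / \<tau> \<le> max ((lppg z (1 - w') m n p - \<tau> ^ 3) / \<tau>) ((lppg z' (1 - w) m n p - \<tau> ^ 3) / \<tau>)"
      using \<tau> by (auto simp: max_def divide_le_cancel split: if_splits)
    then have "exp ((lppg z (1 - w) m n p - \<tau> ^ 3) / \<tau>) \<le> exp ((lppg z (1 - w') m n p - \<tau> ^ 3) / \<tau>) + exp ((lppg z' (1 - w) m n p - \<tau> ^ 3) / \<tau>)"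
      using exp_max_le by (meson exp_le_cancel_iff order_trans)
    then show "ennreal (exp ((lppg z (1 - w) m n p - \<tau> ^ 3) / \<tau>)) \<le> ennreal (exp ((lppg z (1 - w') m n p - \<tau> ^ 3) / \<tau>)) + ennreal (exp ((lppg z' (1 - w) m n p - \<tau> ^ 3) / \<tau>))"
      by (metis ennreal_leI ennreal_plus exp_ge_zero)
  qed
  also have "\<dots> \<le> ennreal C + ennreal C"
    by (subst nn_integral_add) (auto intro!: add_mono 1 2)
  also have "\<dots> = ennreal (2 * C)" by (subst ennreal_plus[symmetric]) (auto simp: C_def)
  finally show "(\<integral>\<^sup>+p. ennreal (exp ((lppg z (1 - w) m n p - \<tau> ^ 3) / \<tau>)) \<partial>lppm) \<le> ennreal (2 * C)" .
qed

text \<open>Along the segment of boundary means \<open>1/\<rho> (1 + a\<delta>)\<close>, \<open>1/(1-\<rho>) (1 + a\<delta>)\<close> the passage time is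
  convex in \<open>a\<close>, so \<open>G(0) \<ge> 2 G(1) - G(2)\<close>; \<open>G(1)\<close> has boundaries larger than stationary, for which
  the exact moment generating function controls the left tail.\<close>

lemma lppg_left:
  assumes \<theta>: "0 < \<theta>" "2 * \<theta> \<le> \<rho>" "2 * \<theta> \<le> 1 - \<rho>"
  obtains C where "0 < C" "\<And>\<tau> m n. near_char \<rho> \<tau> m n \<Longrightarrow> 3 / \<tau> \<le> \<theta> \<Longrightarrow>
     (\<integral>\<^sup>+p. ennreal (exp ((\<tau> ^ 3 - lppg \<rho> (1 - \<rho>) m n p) / (8 * \<tau>))) \<partial>lppm) \<le> ennreal C"
proof -
  have "0 \<le> (2::real)" by simp
  from lppg_right[OF \<theta> this] obtain C2 where C2: "0 < C2"
    "\<And>\<tau> m n z w. near_char \<rho> \<tau> m n \<Longrightarrow> (2 + 1) / \<tau> \<le> \<theta> \<Longrightarrow>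
     \<bar>z - \<rho>\<bar> \<le> 2 / \<tau> \<Longrightarrow> \<bar>w - \<rho>\<bar> \<le> 2 / \<tau> \<Longrightarrow>
     (\<integral>\<^sup>+p. ennreal (exp ((lppg z (1 - w) m n p - \<tau> ^ 3) / \<tau>)) \<partial>lppm) \<le> ennreal C2"
    by metis
  define C1 where "C1 = exp (2 * 1 * (1\<^sup>2 / \<theta>\<^sup>2 + 2 / \<theta>))"
  have main: "(\<integral>\<^sup>+p. ennreal (exp ((\<tau> ^ 3 - lppg \<rho> (1 - \<rho>) m n p) / (8 * \<tau>))) \<partial>lppm) \<le> ennreal (2 + C1 + C2)"
    if nc: "near_char \<rho> \<tau> m n" and \<tau>3: "3 / \<tau> \<le> \<theta>" for \<tau> m n
  proof -
    have \<tau>: "0 < \<tau>" "1 \<le> \<tau>" using nc by (auto simp: near_char_def)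
    have \<rho>: "0 < \<rho>" "\<rho> < 1" using \<theta> by auto
    define \<delta> where "\<delta> = 1 / \<tau>"
    have \<delta>: "0 < \<delta>" "\<delta> \<le> 1" using \<tau> by (auto simp: \<delta>_def)
    \<comment> \<open>Dividing both rates by 1 + a \<delta> multiplies the boundary weights by it,
      so these depend linearly on a, as convexity in a requires.\<close>
    define z where "z a = \<rho> / (1 + a * \<delta>)" for a :: real
    define w where "w a = 1 - (1 - \<rho>) / (1 + a * \<delta>)" for a :: real
    have zb: "\<bar>z a - \<rho>\<bar> \<le> a / \<tau>" "\<bar>w a - \<rho>\<bar> \<le> a / \<tau>" if "0 < a" for a
    proof -
      have p: "0 < 1 + a * \<delta>" using that \<delta> by (simp add: add_pos_pos)
      define X where "X = a * \<delta> / (1 + a * \<delta>)"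
      have q: "X \<le> a / \<tau>" unfolding X_def using that \<delta> p \<tau>
        by (simp add: \<delta>_def field_simps)
      have "z a - \<rho> = - \<rho> * X" "w a - \<rho> = (1 - \<rho>) * X"
        using p by (auto simp: X_def z_def w_def field_simps)
      moreover have X: "0 \<le> X" unfolding X_def using that \<delta> by simp
      moreover have "\<rho> * X \<le> 1 * (a / \<tau>)" "(1 - \<rho>) * X \<le> 1 * (a / \<tau>)"
        using that \<delta> \<rho> X by (intro mult_mono q; simp)+
      ultimately show "\<bar>z a - \<rho>\<bar> \<le> a / \<tau>" "\<bar>w a - \<rho>\<bar> \<le> a / \<tau>"
        using \<rho> by (auto simp: abs_mult)
    qed
    \<comment> \<open>Both rates are lowered, so they add up to less than 1 and the exponent of the
      exact formula is negative: it controls the left tail of G(1).\<close>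
    have zw: "z 1 - w 1 = - (1 / (\<tau> + 1))"
    proof -
      have "z 1 - w 1 = 1 / (1 + \<delta>) - 1"
        by (simp add: z_def w_def diff_divide_distrib)
      also have "1 / (1 + \<delta>) = \<tau> / (\<tau> + 1)" using \<tau> by (simp add: \<delta>_def field_simps)
      also have "\<tau> / (\<tau> + 1) - 1 = - (1 / (\<tau> + 1))"
        using \<tau> by (simp add: divide_simps)
      finally show ?thesis .
    qed
    have i1: "(\<integral>\<^sup>+p. ennreal (exp ((\<tau> ^ 3 - lppg (z 1) (1 - w 1) m n p) / (\<tau> + 1))) \<partial>lppm) \<le> ennreal C1"
    proof -
      have "1 / \<tau> \<le> \<theta>" using \<tau>3 \<tau> by (simp add: field_simps)
      from lppg_mgf_le[OF nc \<theta> _ this zb(1)[of 1] zb(2)[of 1]]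
      have "(\<integral>\<^sup>+p. ennreal (exp ((z 1 - w 1) * (lppg (z 1) (1 - w 1) m n p - \<tau> ^ 3))) \<partial>lppm) \<le> ennreal C1"
        by (simp add: C1_def)
      moreover have "(z 1 - w 1) * (x - \<tau> ^ 3) = (\<tau> ^ 3 - x) / (\<tau> + 1)" for x
        unfolding zw by (simp add: diff_divide_distrib)
      ultimately show ?thesis by simp
    qed
    have i2: "(\<integral>\<^sup>+p. ennreal (exp ((lppg (z 2) (1 - w 2) m n p - \<tau> ^ 3) / \<tau>)) \<partial>lppm) \<le> ennreal C2"
      using \<tau>3 by (intro C2(2) nc zb) auto
    have "(\<integral>\<^sup>+p. ennreal (exp ((\<tau> ^ 3 - lppg \<rho> (1 - \<rho>) m n p) / (8 * \<tau>))) \<partial>lppm) \<le>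
      (\<integral>\<^sup>+p. 2 + (ennreal (exp ((\<tau> ^ 3 - lppg (z 1) (1 - w 1) m n p) / (\<tau> + 1))) + ennreal (exp ((lppg (z 2) (1 - w 2) m n p - \<tau> ^ 3) / \<tau>))) \<partial>lppm)"
    proof (rule nn_integral_mono)
      fix p
      let ?A = "\<tau> ^ 3 - lppg (z 1) (1 - w 1) m n p" and ?B = "lppg (z 2) (1 - w 2) m n p - \<tau> ^ 3"
      have "2 * lppg (z 1) (1 - w 1) m n p \<le> lppg \<rho> (1 - \<rho>) m n p + lppg (z 2) (1 - w 2) m n p"
      proof -
        have "v / z a = v / \<rho> + a * (\<delta> * v / \<rho>)" "v / (1 - w a) = v / (1 - \<rho>) + a * (\<delta> * v / (1 - \<rho>))" for v a
          using \<rho> by (auto simp: z_def w_def add_divide_distrib algebra_simps)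
        then show ?thesis
          unfolding lppg_def by (auto split: prod.splits intro!: lpp_convex)
      qed
      \<comment> \<open>The divisor 8 \<tau> writes the bound as the average of A / (2 \<tau>) and B
        / (4 \<tau>). When positive, these are at most A / (\<tau> + 1) and B / \<tau>, whose
        exponential moments are known.\<close>
      then have "(\<tau> ^ 3 - lppg \<rho> (1 - \<rho>) m n p) / (8 * \<tau>) \<le> (2 * ?A + ?B) / (8 * \<tau>)"
        using \<tau> by (intro divide_right_mono) auto
      also have "\<dots> = ?A / (4 * \<tau>) + ?B / (8 * \<tau>)" using \<tau> by (simp add: field_simps)
      also have "\<dots> \<le> max (?A / (2 * \<tau>)) (?B / (4 * \<tau>))"
        by (simp add: max_def)
      also have "\<dots> \<le> max 0 (max (?A / (\<tau> + 1)) (?B / \<tau>))"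
      proof -
        have "?A / (2 * \<tau>) \<le> max 0 (?A / (\<tau> + 1))"
        proof (cases "0 \<le> ?A")
          case True
          then have "?A / (2 * \<tau>) \<le> ?A / (\<tau> + 1)" using \<tau> by (intro divide_left_mono) auto
          then show ?thesis by simp
        next
          case False
          then have "?A / (2 * \<tau>) \<le> 0" using \<tau> by (simp add: divide_le_0_iff)
          then show ?thesis by simp
        qed
        moreover have "?B / (4 * \<tau>) \<le> max 0 (?B / \<tau>)"
        proof (cases "0 \<le> ?B")
          case True
          then have "?B / (4 * \<tau>) \<le> ?B / \<tau>" using \<tau> by (intro divide_left_mono) auto
          then show ?thesis by simp
        next
          case False
          then have "?B / (4 * \<tau>) \<le> 0" using \<tau> by (simp add: divide_le_0_iff)
          then show ?thesis by simp
        qed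
        ultimately show ?thesis by (auto simp: max_def split: if_splits)
      qed
      finally have "exp ((\<tau> ^ 3 - lppg \<rho> (1 - \<rho>) m n p) / (8 * \<tau>)) \<le> exp (max 0 (max (?A / (\<tau> + 1)) (?B / \<tau>)))"
        by simp
      also have "\<dots> \<le> 2 + (exp (?A / (\<tau> + 1)) + exp (?B / \<tau>))"
        using exp_max_le[of 0 "max (?A / (\<tau> + 1)) (?B / \<tau>)"] exp_max_le[of "?A / (\<tau> + 1)" "?B / \<tau>"] by simp
      finally have "ennreal (exp ((\<tau> ^ 3 - lppg \<rho> (1 - \<rho>) m n p) / (8 * \<tau>))) \<le> ennreal (2 + (exp (?A / (\<tau> + 1)) + exp (?B / \<tau>)))"
        by (rule ennreal_leI)
      then show "ennreal (exp ((\<tau> ^ 3 - lppg \<rho> (1 - \<rho>) m n p) / (8 * \<tau>))) \<le> 2 + (ennreal (exp (?A / (\<tau> + 1))) + ennreal (exp (?B / \<tau>)))"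
        by (simp add: ennreal_plus)
    qed
    also have "\<dots> = 2 + ((\<integral>\<^sup>+p. ennreal (exp ((\<tau> ^ 3 - lppg (z 1) (1 - w 1) m n p) / (\<tau> + 1))) \<partial>lppm) +
       (\<integral>\<^sup>+p. ennreal (exp ((lppg (z 2) (1 - w 2) m n p - \<tau> ^ 3) / \<tau>)) \<partial>lppm))"
      using L.emeasure_space_1 by (subst nn_integral_add, measurable, subst nn_integral_add) auto
    also have "\<dots> \<le> 2 + (ennreal C1 + ennreal C2)"
      by (intro add_mono i1 i2 order_refl)
    also have "\<dots> = ennreal (2 + C1 + C2)"
      using C2(1) by (simp add: ennreal_plus C1_def add.assoc)
    finally show ?thesis .
  qed
  have "0 < 2 + C1 + C2" using C2(1) by (simp add: C1_def add_pos_pos)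
  from that[OF this main] show ?thesis .
qed

lemma (in prob_space) exp_markov:
  assumes [measurable]: "f \<in> borel_measurable M" and C: "(\<integral>\<^sup>+\<omega>. ennreal (exp (s * f \<omega>)) \<partial>M) \<le> ennreal C" "0 \<le> C" and s: "0 < s"
  shows "prob {\<omega>\<in>space M. x \<le> f \<omega>} \<le> C * exp (- (s * x))"
proof -
  have "emeasure M {\<omega>\<in>space M. x \<le> f \<omega>} \<le> (\<integral>\<^sup>+\<omega>. ennreal (exp (- (s * x))) * ennreal (exp (s * f \<omega>)) \<partial>M)"
  proof -
    have "emeasure M {\<omega>\<in>space M. x \<le> f \<omega>} = (\<integral>\<^sup>+\<omega>. indicator {\<omega>\<in>space M. x \<le> f \<omega>} \<omega> \<partial>M)"
      by simp
    also have "\<dots> \<le> (\<integral>\<^sup>+\<omega>. ennreal (exp (- (s * x))) * ennreal (exp (s * f \<omega>)) \<partial>M)"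
    proof (intro nn_integral_mono)
      fix \<omega>
      show "indicator {\<omega>\<in>space M. x \<le> f \<omega>} \<omega> \<le> ennreal (exp (- (s * x))) * ennreal (exp (s * f \<omega>))"
        using s by (auto simp: indicator_def ennreal_mult'[symmetric] exp_add[symmetric] simp flip: ennreal_1 intro!: ennreal_leI)
    qed
    finally show ?thesis .
  qed
  also have "\<dots> = ennreal (exp (- (s * x))) * (\<integral>\<^sup>+\<omega>. ennreal (exp (s * f \<omega>)) \<partial>M)"
    by (rule nn_integral_cmult) auto
  also have "\<dots> \<le> ennreal (exp (- (s * x))) * ennreal C"
    by (intro mult_left_mono C) auto
  also have "\<dots> = ennreal (C * exp (- (s * x)))"
    using C by (simp add: ennreal_mult'[symmetric] mult.commute)
  finally show ?thesis using C by (simp add: emeasure_eq_measure)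
qed

section \<open>Lower bounds on the scale \<open>t\<^sup>1\<^sup>/\<^sup>3\<close>\<close>

text \<open>The factor is the likelihood ratio of k exponentials of rate l against rate r, written
  in unit exponentials through u = x / r: each coordinate contributes (l / r) exp ((r - l)
  u).\<close>

lemma nn_integral_two_rates:
  assumes "0 < l" "l \<le> r" and F: "F \<in> borel_measurable (seqm borel)"
  shows "(\<integral>\<^sup>+x. F (\<lambda>i. if i < k then x i / l else x i / r) \<partial>seqm (expm 1)) =
    (\<integral>\<^sup>+x. ennreal ((l / r) ^ k * exp ((r - l) / r * (\<Sum>i<k. x i))) * F (\<lambda>i. x i / r) \<partial>seqm (expm 1))"
  using F
proof (induction k arbitrary: F)
  case (Suc k)
  note [measurable] = Suc.prems
  interpret X: prob_space "seqm (expm 1)" by (rule prob_seqm_expm) simp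
  have p: "prob_space (expm 1)" by (rule prob_space_expm) simp
  have cons: "(\<lambda>i. if i < Suc k then case_nat x0 x i / l else case_nat x0 x i / r) =
    case_nat (x0 / l) (\<lambda>i. if i < k then x i / l else x i / r)" for x0 :: real and x
    by (auto split: nat.split)
  have cons2: "(\<lambda>i. case_nat x0 x i / r) = case_nat (x0 / r) (\<lambda>i. x i / r)" for x0 :: real and x
    by (auto split: nat.split)
  define h where "h u = (\<integral>\<^sup>+x. ennreal ((l / r) ^ k * exp ((r - l) / r * (\<Sum>i<k. x i))) * F (case_nat u (\<lambda>i. x i / r)) \<partial>seqm (expm 1))" for u
  have [measurable]: "h \<in> borel_measurable borel" unfolding h_def by measurable
  have "(\<integral>\<^sup>+x. F (\<lambda>i. if i < Suc k then x i / l else x i / r) \<partial>seqm (expm 1)) =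
    (\<integral>\<^sup>+x0. (\<integral>\<^sup>+x. F (\<lambda>i. if i < Suc k then case_nat x0 x i / l else case_nat x0 x i / r) \<partial>seqm (expm 1)) \<partial>expm 1)"
    by (intro nn_integral_seqm p) measurable
  also have "\<dots> = (\<integral>\<^sup>+x0. (\<integral>\<^sup>+x. F (case_nat (x0 / l) (\<lambda>i. if i < k then x i / l else x i / r)) \<partial>seqm (expm 1)) \<partial>expm 1)"
    by (simp only: cons)
  also have "\<dots> = (\<integral>\<^sup>+x0. h (x0 / l) \<partial>expm 1)"
    unfolding h_def by (intro nn_integral_cong Suc.IH) measurable
  also have "\<dots> = (\<integral>\<^sup>+u. h u \<partial>expm (r - (r - l)))"
    using assms by (subst expm_scale) auto
  also have "\<dots> = ennreal (l / r) * (ennreal (r / (r - (r - l))) * (\<integral>\<^sup>+u. h u \<partial>expm (r - (r - l))))"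
    using assms by (simp add: mult.assoc[symmetric] ennreal_mult'[symmetric])
  also have "ennreal (r / (r - (r - l))) * (\<integral>\<^sup>+u. h u \<partial>expm (r - (r - l))) = (\<integral>\<^sup>+u. ennreal (exp ((r - l) * u)) * h u \<partial>expm r)"
    using assms by (subst expm_tilt) auto
  also have "\<dots> = (\<integral>\<^sup>+x0. ennreal (exp ((r - l) * (x0 / r))) * h (x0 / r) \<partial>expm 1)"
    using assms by (subst expm_scale[where f="\<lambda>u. ennreal (exp ((r - l) * u)) * h u"]) auto
  also have "ennreal (l / r) * \<dots> = (\<integral>\<^sup>+x0. ennreal (l / r) * (ennreal (exp ((r - l) * (x0 / r))) * h (x0 / r)) \<partial>expm 1)"
    by (subst nn_integral_cmult) auto
  also have "\<dots> = (\<integral>\<^sup>+x0. (\<integral>\<^sup>+x. ennreal ((l / r) ^ Suc k * exp ((r - l) / r * (\<Sum>i<Suc k. case_nat x0 x i))) * F (\<lambda>i. case_nat x0 x i / r) \<partial>seqm (expm 1)) \<partial>expm 1)"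
  proof (rule nn_integral_cong)
    fix x0 :: real
    have e: "ennreal ((l / r) ^ Suc k * exp ((r - l) / r * (\<Sum>i<Suc k. case_nat x0 x i))) * F (\<lambda>i. case_nat x0 x i / r) =
      ennreal (l / r) * (ennreal (exp ((r - l) * (x0 / r))) * (ennreal ((l / r) ^ k * exp ((r - l) / r * (\<Sum>i<k. x i))) * F (case_nat (x0 / r) (\<lambda>i. x i / r))))" for x
    proof -
      have "exp ((r - l) / r * (\<Sum>i<Suc k. case_nat x0 x i)) = exp ((r - l) * (x0 / r)) * exp ((r - l) / r * (\<Sum>i<k. x i))"
        by (simp add: sum.lessThan_Suc_shift distrib_left exp_add[symmetric] del: sum.lessThan_Suc)
      then have D: "(l / r) ^ Suc k * exp ((r - l) / r * (\<Sum>i<Suc k. case_nat x0 x i)) =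
         (l / r) * (exp ((r - l) * (x0 / r)) * ((l / r) ^ k * exp ((r - l) / r * (\<Sum>i<k. x i))))"
        by (simp only: power_Suc mult_ac)
      have E: "ennreal (a * (b * c)) * z = ennreal a * (ennreal b * (ennreal c * z))"
        if "0 \<le> a" "0 \<le> b" "0 \<le> c" for a b c z
        using that by (simp add: ennreal_mult mult.assoc)
      show ?thesis
        unfolding D cons2 by (rule E) (use assms in auto)
    qed
    have [measurable]: "(\<lambda>x. F (case_nat (x0 / r) (\<lambda>i. x i / r))) \<in> borel_measurable (seqm borel)" by measurable
    show "ennreal (l / r) * (ennreal (exp ((r - l) * (x0 / r))) * h (x0 / r)) =
       (\<integral>\<^sup>+x. ennreal ((l / r) ^ Suc k * exp ((r - l) / r * (\<Sum>i<Suc k. case_nat x0 x i))) * F (\<lambda>i. case_nat x0 x i / r) \<partial>seqm (expm 1))"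
      unfolding e h_def by (subst nn_integral_cmult, simp, subst nn_integral_cmult, simp_all)
  qed
  also have "\<dots> = (\<integral>\<^sup>+x. ennreal ((l / r) ^ Suc k * exp ((r - l) / r * (\<Sum>i<Suc k. x i))) * F (\<lambda>i. x i / r) \<partial>seqm (expm 1))"
    by (intro nn_integral_seqm[symmetric] p) measurable
  finally show ?case .
qed simp

text \<open>For d = (r - l) / r one coordinate contributes exactly (1 - d)^2 / (1 - 2 d) = 1 + d^2 /
  (1 - 2 d). The product stays bounded as long as k d^2 does, which permits a change of rate by 1 /
  \<tau> on about \<tau>^2 weights.\<close>

lemma two_rates_density_square:
  assumes "0 < r" "r - 2 * (r - l) > 0" "4 * (r - l) \<le> r" "l \<le> r"
  shows "(\<integral>\<^sup>+x. ennreal (((l / r) ^ k * exp ((r - l) / r * (\<Sum>i<k. x i)))\<^sup>2) \<partial>seqm (expm 1)) \<le> ennreal (exp (2 * real k * ((r - l) / r)\<^sup>2))"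
proof -
  define d where "d = (r - l) / r"
  have d: "0 \<le> d" "d \<le> 1/4" using assms by (auto simp: d_def field_simps)
  have lr: "l / r = 1 - d" using assms by (simp add: d_def field_simps)
  have "(\<integral>\<^sup>+x. ennreal (((l / r) ^ k * exp ((r - l) / r * (\<Sum>i<k. x i)))\<^sup>2) \<partial>seqm (expm 1)) =
    (\<integral>\<^sup>+x. ennreal ((1 - d) ^ (2 * k)) * ennreal (exp ((2 * d) * (\<Sum>i<k. x i))) \<partial>seqm (expm 1))"
    unfolding lr d_def[symmetric]
  proof (intro nn_integral_cong)
    fix x :: "nat \<Rightarrow> real"
    have "((1 - d) ^ k * exp (d * (\<Sum>i<k. x i)))\<^sup>2 = (1 - d) ^ (2 * k) * exp ((2 * d) * (\<Sum>i<k. x i))"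
      by (simp only: power_mult_distrib power_mult[symmetric] exp_double[symmetric] mult.commute[of k 2] mult.assoc)
    then show "ennreal (((1 - d) ^ k * exp (d * (\<Sum>i<k. x i)))\<^sup>2) = ennreal ((1 - d) ^ (2 * k)) * ennreal (exp ((2 * d) * (\<Sum>i<k. x i)))"
      by (simp add: ennreal_mult''[symmetric])
  qed
  also have "\<dots> = ennreal ((1 - d) ^ (2 * k)) * ennreal ((1 / (1 - 2 * d)) ^ k)"
    using d by (subst nn_integral_cmult) (auto simp: nn_integral_exp_sum)
  also have "\<dots> = ennreal (((1 - d)\<^sup>2 / (1 - 2 * d)) ^ k)"
    using d by (simp add: ennreal_mult''[symmetric] power_mult power_divide)
  also have "\<dots> \<le> ennreal (exp (2 * d\<^sup>2) ^ k)"
  proof (intro ennreal_leI power_mono)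
    have "(1 - d)\<^sup>2 / (1 - 2 * d) = 1 + d\<^sup>2 / (1 - 2 * d)"
      using d by (simp add: field_simps power2_eq_square)
    also have "d\<^sup>2 / (1 - 2 * d) \<le> d\<^sup>2 / (1 / 2)"
      using d by (intro divide_left_mono) auto
    also have "1 + d\<^sup>2 / (1 / 2) \<le> exp (2 * d\<^sup>2)"
      using exp_ge_add_one_self[of "2 * d\<^sup>2"] by (simp add: mult.commute)
    finally show "(1 - d)\<^sup>2 / (1 - 2 * d) \<le> exp (2 * d\<^sup>2)" by simp
  qed (use d in auto)
  also have "exp (2 * d\<^sup>2) ^ k = exp (2 * real k * d\<^sup>2)"
    by (simp add: exp_of_nat_mult[symmetric] algebra_simps)
  finally show ?thesis by (simp add: d_def)
qed

text \<open>A lower bound for the mean together with an exponential moment bounds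
  \<open>prob A\<close> from below; \<open>mean_lower\<close> does the same from an upper bound for
  the mean. Nonnegative integrals, which cut f at 0, spare a proof of integrability.\<close>

lemma (in prob_space) mean_upper:
  fixes f g :: "'a \<Rightarrow> real"
  assumes [measurable]: "f \<in> borel_measurable M" "g \<in> borel_measurable M" "A \<in> events"
    and le: "\<And>\<omega>. f \<omega> \<le> a + b * indicator A \<omega> + c * exp (g \<omega>)"
    and nn: "0 \<le> a" "0 \<le> b" "0 \<le> c" "0 \<le> C"
    and \<mu>: "ennreal \<mu> \<le> (\<integral>\<^sup>+\<omega>. ennreal (f \<omega>) \<partial>M)" and C: "(\<integral>\<^sup>+\<omega>. ennreal (exp (g \<omega>)) \<partial>M) \<le> ennreal C"
  shows "\<mu> \<le> a + b * prob A + c * C"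
proof -
  have "ennreal \<mu> \<le> (\<integral>\<^sup>+\<omega>. ennreal a + (ennreal b * indicator A \<omega> + ennreal c * ennreal (exp (g \<omega>))) \<partial>M)"
  proof (rule order_trans[OF \<mu> nn_integral_mono])
    fix \<omega>
    have "ennreal (f \<omega>) \<le> ennreal (a + (b * indicator A \<omega> + c * exp (g \<omega>)))"
      using le[of \<omega>] by (intro ennreal_leI) auto
    also have "\<dots> = ennreal a + (ennreal b * ennreal (indicator A \<omega>) + ennreal c * ennreal (exp (g \<omega>)))"
      using nn by (simp add: ennreal_plus ennreal_mult')
    finally show "ennreal (f \<omega>) \<le> ennreal a + (ennreal b * indicator A \<omega> + ennreal c * ennreal (exp (g \<omega>)))"
      by (simp add: ennreal_indicator)
  qed
  also have "\<dots> = ennreal a + (ennreal b * emeasure M A + ennreal c * (\<integral>\<^sup>+\<omega>. ennreal (exp (g \<omega>)) \<partial>M))"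
    by (simp add: nn_integral_add nn_integral_cmult emeasure_space_1)
  also have "\<dots> \<le> ennreal a + (ennreal b * ennreal (prob A) + ennreal c * ennreal C)"
    by (intro add_mono mult_left_mono C) (auto simp: emeasure_eq_measure)
  also have "\<dots> = ennreal (a + b * prob A + c * C)"
    using nn by (simp add: ennreal_plus ennreal_mult' add.assoc)
  finally show ?thesis using nn by (subst (asm) ennreal_le_iff) auto
qed

lemma (in prob_space) mean_lower:
  fixes f g :: "'a \<Rightarrow> real"
  assumes [measurable]: "f \<in> borel_measurable M" "g \<in> borel_measurable M" "A \<in> events"
    and le: "\<And>\<omega>. a \<le> f \<omega> + b * indicator A \<omega> + c * exp (g \<omega>)"
    and nn: "0 \<le> \<mu>" "0 \<le> b" "0 \<le> c" "0 \<le> C"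
    and \<mu>: "(\<integral>\<^sup>+\<omega>. ennreal (f \<omega>) \<partial>M) \<le> ennreal \<mu>" and C: "(\<integral>\<^sup>+\<omega>. ennreal (exp (g \<omega>)) \<partial>M) \<le> ennreal C"
  shows "a \<le> \<mu> + b * prob A + c * C"
proof -
  have "ennreal a = (\<integral>\<^sup>+\<omega>. ennreal a \<partial>M)"
    by (simp add: emeasure_space_1)
  also have "\<dots> \<le> (\<integral>\<^sup>+\<omega>. ennreal (f \<omega>) + (ennreal b * indicator A \<omega> + ennreal c * ennreal (exp (g \<omega>))) \<partial>M)"
  proof (rule nn_integral_mono)
    fix \<omega>
    have "ennreal a \<le> ennreal (max 0 (f \<omega>) + (b * indicator A \<omega> + c * exp (g \<omega>)))"
      using le[of \<omega>] by (intro ennreal_leI) auto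
    also have "\<dots> = ennreal (max 0 (f \<omega>)) + (ennreal b * ennreal (indicator A \<omega>) + ennreal c * ennreal (exp (g \<omega>)))"
      using nn by (simp add: ennreal_plus ennreal_mult')
    finally show "ennreal a \<le> ennreal (f \<omega>) + (ennreal b * indicator A \<omega> + ennreal c * ennreal (exp (g \<omega>)))"
      by (simp add: ennreal_indicator max_def ennreal_neg split: if_splits)
  qed
  also have "\<dots> = (\<integral>\<^sup>+\<omega>. ennreal (f \<omega>) \<partial>M) + (ennreal b * emeasure M A + ennreal c * (\<integral>\<^sup>+\<omega>. ennreal (exp (g \<omega>)) \<partial>M))"
    by (simp add: nn_integral_add nn_integral_cmult)
  also have "\<dots> \<le> ennreal \<mu> + (ennreal b * ennreal (prob A) + ennreal c * ennreal C)"
    by (intro add_mono mult_left_mono C \<mu>) (auto simp: emeasure_eq_measure)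
  also have "\<dots> = ennreal (\<mu> + b * prob A + c * C)"
    using nn by (simp add: ennreal_plus ennreal_mult' add.assoc)
  finally show ?thesis using nn by (subst (asm) ennreal_le_iff) auto
qed

text \<open>At s = \<rho> - 1 / \<tau> the quadratic term of \<open>mean_expand\<close> equals
  \<tau> / (s (1 - s)), and s (1 - s) is at most 1/4.\<close>

lemma stationary_mean_shifted:
  assumes nc: "near_char \<rho> \<tau> m n" and \<theta>: "0 < \<theta>" "2 * \<theta> \<le> \<rho>" "2 * \<theta> \<le> 1 - \<rho>" and t: "1 / \<tau> \<le> \<theta>"
  shows "\<tau> ^ 3 + 4 * \<tau> - 2 / \<theta> \<le> real m / (\<rho> - 1 / \<tau>) + real n / (1 - (\<rho> - 1 / \<tau>))"
proof -
  define s where "s = \<rho> - 1 / \<tau>"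
  have \<tau>: "0 < \<tau>" using nc by (simp add: near_char_def)
  then have s: "\<theta> \<le> s" "\<theta> \<le> 1 - s" using t \<theta> by (auto simp: s_def) (smt (verit) zero_less_divide_1_iff)
  have e: "m / s + n / (1 - s) - \<tau> ^ 3 =
    \<tau> ^ 3 * (s - \<rho>)\<^sup>2 / (s * (1 - s)) + (m - \<rho>\<^sup>2 * \<tau> ^ 3) / s + (n - (1 - \<rho>)\<^sup>2 * \<tau> ^ 3) / (1 - s)"
    using s \<theta> by (intro mean_expand) auto
  have h: "\<tau> ^ 3 * (s - \<rho>)\<^sup>2 = \<tau>" using \<tau> by (simp add: s_def power2_eq_square power3_eq_cube field_simps)
  have "4 * \<tau> \<le> \<tau> / (s * (1 - s))"
  proof -
    have "4 * (s * (1 - s)) \<le> 1" using zero_le_power2[of "2 * s - 1"] by (simp add: power2_eq_square algebra_simps)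
    then have "\<tau> * (4 * (s * (1 - s))) \<le> \<tau> * 1" using \<tau> by (intro mult_left_mono) auto
    then show ?thesis using s \<theta> \<tau> by (simp add: pos_le_divide_eq mult_ac)
  qed
  moreover have "\<bar>(m - \<rho>\<^sup>2 * \<tau> ^ 3) / s\<bar> \<le> 1 / \<theta>" "\<bar>(n - (1 - \<rho>)\<^sup>2 * \<tau> ^ 3) / (1 - s)\<bar> \<le> 1 / \<theta>"
    using nc s \<theta>(1) unfolding abs_divide near_char_def by (auto intro!: frac_le)
  ultimately have "m / s + n / (1 - s) - \<tau> ^ 3 \<ge> 4 * \<tau> - 1 / \<theta> - 1 / \<theta>"
    unfolding e h by linarith
  then show ?thesis unfolding s_def[symmetric] by (simp add: field_simps)
qed

lemma stationary_mean:
  assumes nc: "near_char \<rho> \<tau> m n" and \<theta>: "0 < \<theta>" "2 * \<theta> \<le> \<rho>" "2 * \<theta> \<le> 1 - \<rho>"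
  shows "real m / \<rho> + real n / (1 - \<rho>) \<le> \<tau> ^ 3 + 2 / \<theta>"
proof -
  have e: "m / \<rho> + n / (1 - \<rho>) - \<tau> ^ 3 =
    \<tau> ^ 3 * (\<rho> - \<rho>)\<^sup>2 / (\<rho> * (1 - \<rho>)) + (m - \<rho>\<^sup>2 * \<tau> ^ 3) / \<rho> + (n - (1 - \<rho>)\<^sup>2 * \<tau> ^ 3) / (1 - \<rho>)"
    using \<theta> by (intro mean_expand) auto
  have "\<bar>(m - \<rho>\<^sup>2 * \<tau> ^ 3) / \<rho>\<bar> \<le> 1 / \<theta>" "\<bar>(n - (1 - \<rho>)\<^sup>2 * \<tau> ^ 3) / (1 - \<rho>)\<bar> \<le> 1 / \<theta>"
    using nc \<theta> unfolding abs_divide near_char_def by (auto intro!: frac_le)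
  moreover have "\<tau> ^ 3 * (\<rho> - \<rho>)\<^sup>2 / (\<rho> * (1 - \<rho>)) = 0" "2 / \<theta> = 1 / \<theta> + 1 / \<theta>" by simp_all
  ultimately show ?thesis using e by linarith
qed

lemma square_le_exp: "0 \<le> (x::real) \<Longrightarrow> x\<^sup>2 \<le> 2 * exp x"
proof -
  assume x: "0 \<le> x"
  have "1 + x + x\<^sup>2 / 2 \<le> exp x" using exp_lower_Taylor_quadratic[OF x] .
  then show ?thesis using x by simp
qed

text \<open>Above the level K \<sigma> use z \<le> z^2 / (K \<sigma>). In the mean, the part beyond
  that level is then only of order \<sigma> / K.\<close>

lemma truncation_exp_le:
  assumes "0 < (\<sigma>::real)" "0 < K"
  shows "z \<le> K * \<sigma> + 2 * \<sigma> / K * exp (z / \<sigma>)"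
proof (cases "z \<le> K * \<sigma>")
  case True
  then show ?thesis using assms by (simp add: add_increasing2)
next
  case False
  then have z: "K * \<sigma> < z" "0 < z" using assms by (auto simp: not_le) (smt (verit) mult_pos_pos)
  have "z * (K * \<sigma>) \<le> z * z" using z by (intro mult_left_mono) auto
  also have "z * z = \<sigma>\<^sup>2 * (z / \<sigma>)\<^sup>2" using assms by (simp add: power2_eq_square)
  also have "\<dots> \<le> \<sigma>\<^sup>2 * (2 * exp (z / \<sigma>))" using z assms by (intro mult_left_mono square_le_exp) auto
  finally have "z \<le> \<sigma>\<^sup>2 * (2 * exp (z / \<sigma>)) / (K * \<sigma>)" using assms by (simp add: pos_le_divide_eq)
  also have "\<dots> = 2 * \<sigma> / K * exp (z / \<sigma>)" using assms by (simp add: power2_eq_square)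
  finally show ?thesis using assms by (simp add: add_increasing)
qed

text \<open>The mean is at most \<tau> ^ 3 + O(1) and the left tail is integrable on the scale
  \<tau>, so the passage time cannot exceed \<tau> ^ 3 + c \<tau> with probability close to
  one.\<close>

lemma lppg_mid:
  assumes \<theta>: "0 < \<theta>" "2 * \<theta> \<le> \<rho>" "2 * \<theta> \<le> 1 - \<rho>" and c: "0 < c"
  obtains q \<tau>0 where "0 < q" "\<And>\<tau> m n. near_char \<rho> \<tau> m n \<Longrightarrow> \<tau>0 \<le> \<tau> \<Longrightarrow>
    q \<le> L.prob {p. lppg \<rho> (1 - \<rho>) m n p \<le> \<tau> ^ 3 + c * \<tau>}"
proof -
  from lppg_left[OF \<theta>] obtain C where C: "0 < C" and int: "\<And>\<tau> m n. near_char \<rho> \<tau> m n \<Longrightarrow> 3 / \<tau> \<le> \<theta> \<Longrightarrow>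
     (\<integral>\<^sup>+p. ennreal (exp ((\<tau> ^ 3 - lppg \<rho> (1 - \<rho>) m n p) / (8 * \<tau>))) \<partial>lppm) \<le> ennreal C"
    by metis
  \<comment> \<open>With this K the truncation error 16 \<tau> C / K is c \<tau> / 4.\<close>
  define K where "K = 64 * C / c"
  have K: "0 < K" using C c by (simp add: K_def)
  define q where "q = (c / 2) / (c + 8 * K)"
  define \<tau>0 where "\<tau>0 = 3 / \<theta> + 8 / (\<theta> * c)"
  have main: "q \<le> L.prob {p. lppg \<rho> (1 - \<rho>) m n p \<le> \<tau> ^ 3 + c * \<tau>}"
    if nc: "near_char \<rho> \<tau> m n" and \<tau>0: "\<tau>0 \<le> \<tau>" for \<tau> m n
  proof -
    have \<tau>: "0 < \<tau>" using nc by (simp add: near_char_def)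
    have "0 < 3 / \<theta>" "0 < 8 / (\<theta> * c)" using \<theta> c by auto
    then have "3 / \<theta> \<le> \<tau>" "8 / (\<theta> * c) \<le> \<tau>" using \<tau>0 unfolding \<tau>0_def by linarith+
    then have t: "3 / \<tau> \<le> \<theta>" "2 / \<theta> \<le> c * \<tau> / 4" using \<tau> \<theta> c by (auto simp: field_simps)
    define A where "A = {p. lppg \<rho> (1 - \<rho>) m n p \<le> \<tau> ^ 3 + c * \<tau>}"
    have [measurable]: "A \<in> L.events"
      using measurable_sets[of "lppg \<rho> (1 - \<rho>) m n" lppm borel "{..\<tau> ^ 3 + c * \<tau>}"] by (simp add: A_def vimage_def)
    have le: "\<tau> ^ 3 + c * \<tau> \<le> lppg \<rho> (1 - \<rho>) m n p + (c * \<tau> + K * (8 * \<tau>)) * indicator A p + 2 * (8 * \<tau>) / K * exp ((\<tau> ^ 3 - lppg \<rho> (1 - \<rho>) m n p) / (8 * \<tau>))" for p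
      using truncation_exp_le[of "8 * \<tau>" K "\<tau> ^ 3 - lppg \<rho> (1 - \<rho>) m n p"] \<tau> K
      by (auto simp: A_def indicator_def add_increasing2)
    have "\<tau> ^ 3 + c * \<tau> \<le> (real m / \<rho> + real n / (1 - \<rho>)) + (c * \<tau> + K * (8 * \<tau>)) * L.prob A + 2 * (8 * \<tau>) / K * C"
      by (rule L.mean_lower[OF _ _ _ le])
         (use \<theta> \<tau> c K C int[OF nc t(1)] lppg_mean[of \<rho> "1 - \<rho>" m n] in auto)
    also have "2 * (8 * \<tau>) / K * C = c * \<tau> / 4" using C c by (simp add: K_def)
    finally have "\<tau> * (c / 2) \<le> \<tau> * ((c + 8 * K) * L.prob A)"
      using stationary_mean[OF nc \<theta>] t(2) by (simp add: algebra_simps)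
    then have "c / 2 \<le> (c + 8 * K) * L.prob A" using \<tau> by simp
    then show ?thesis unfolding q_def A_def[symmetric] using c K by (simp add: pos_divide_le_eq algebra_simps)
  qed
  have "0 < q" using c K by (simp add: q_def)
  from that[OF this main] show ?thesis .
qed

lemma lppm_two_rates:
  assumes "0 < l" "l \<le> r" and [measurable]: "F \<in> borel_measurable (seqm borel \<Otimes>\<^sub>M (seqm borel \<Otimes>\<^sub>M seqm (seqm borel)))"
  shows "(\<integral>\<^sup>+(y, x, w). F (y, (\<lambda>i. if i < k then x i / l else x i / r), w) \<partial>lppm) =
    (\<integral>\<^sup>+(y, x, w). ennreal ((l / r) ^ k * exp ((r - l) / r * (\<Sum>i<k. x i))) * F (y, (\<lambda>i. x i / r), w) \<partial>lppm)"
proof -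
  interpret B: prob_space "seqm (seqm (expm 1))" by (rule prob_bulk)
  interpret A: prob_space "seqm (expm 1)" by (rule prob_seqm_expm) simp
  define H where "H y x = (\<integral>\<^sup>+w. F (y, x, w) \<partial>seqm (seqm (expm 1)))" for y x
  have [measurable]: "(\<lambda>x. H y x) \<in> borel_measurable (seqm borel)" for y
    unfolding H_def by (measurable, auto simp: space_PiM)
  have [measurable]: "(\<lambda>x. (if i < k then x i / l else x i / r)) \<in> borel_measurable (seqm borel)" for i
    by measurable
  have "(\<integral>\<^sup>+(y, x, w). F (y, (\<lambda>i. if i < k then x i / l else x i / r), w) \<partial>lppm) =
    (\<integral>\<^sup>+y. (\<integral>\<^sup>+x. H y (\<lambda>i. if i < k then x i / l else x i / r) \<partial>seqm (expm 1)) \<partial>seqm (expm 1))"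
    unfolding H_def by (subst nn_integral_lppm) auto
  also have "\<dots> = (\<integral>\<^sup>+y. (\<integral>\<^sup>+x. ennreal ((l / r) ^ k * exp ((r - l) / r * (\<Sum>i<k. x i))) * H y (\<lambda>i. x i / r) \<partial>seqm (expm 1)) \<partial>seqm (expm 1))"
    by (intro nn_integral_cong nn_integral_two_rates assms) measurable
  also have "\<dots> = (\<integral>\<^sup>+y. (\<integral>\<^sup>+x. (\<integral>\<^sup>+w. ennreal ((l / r) ^ k * exp ((r - l) / r * (\<Sum>i<k. x i))) * F (y, (\<lambda>i. x i / r), w) \<partial>seqm (seqm (expm 1))) \<partial>seqm (expm 1)) \<partial>seqm (expm 1))"
    unfolding H_def
    by (intro nn_integral_cong nn_integral_cmult[symmetric]) (measurable, auto simp: space_PiM intro: measurable_ident_sets[OF sets_seqm_seqm_expm])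
  also have "\<dots> = (\<integral>\<^sup>+(y, x, w). ennreal ((l / r) ^ k * exp ((r - l) / r * (\<Sum>i<k. x i))) * F (y, (\<lambda>i. x i / r), w) \<partial>lppm)"
    by (subst nn_integral_lppm) auto
  finally show ?thesis .
qed

text \<open>Split according to whether the density exceeds B. Where it does, it is at most its
  square divided by B, and its second moment is at most exp b.\<close>

lemma lppm_change_of_rate:
  assumes lr: "0 < l" "l \<le> r" "4 * (r - l) \<le> r" "2 * real k * ((r - l) / r)\<^sup>2 \<le> b" and B: "0 < B"
    and A [measurable]: "A \<in> sets (seqm borel \<Otimes>\<^sub>M (seqm borel \<Otimes>\<^sub>M seqm (seqm borel)))"
  shows "L.prob {(y, x, w). (y, (\<lambda>i. if i < k then x i / l else x i / r), w) \<in> A} \<le>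
    B * L.prob {(y, x, w). (y, (\<lambda>i. x i / r), w) \<in> A} + exp b / B"
proof -
  define f where "f x = (l / r) ^ k * exp ((r - l) / r * (\<Sum>i<k. x i))" for x :: "nat \<Rightarrow> real"
  have f0: "0 \<le> f x" for x using lr by (simp add: f_def)
  have [measurable]: "f \<in> borel_measurable (seqm borel)" unfolding f_def by measurable
  have [measurable]: "(\<lambda>x. (if i < k then x i / l else x i / r)) \<in> borel_measurable (seqm borel)" for i
    by measurable
  have m1: "(\<lambda>(y, x, w). (y, (\<lambda>i. if i < k then x i / l else x i / r), w)) \<in> measurable lppm (seqm borel \<Otimes>\<^sub>M (seqm borel \<Otimes>\<^sub>M seqm (seqm borel)))"
    by measurable
  have m2: "(\<lambda>(y, x, w). (y, (\<lambda>i. x i / r), w)) \<in> measurable lppm (seqm borel \<Otimes>\<^sub>M (seqm borel \<Otimes>\<^sub>M seqm (seqm borel)))"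
    by measurable
  let ?A1 = "{(y, x, w). (y, (\<lambda>i. if i < k then x i / l else x i / r), w) \<in> A}"
  let ?A2 = "{(y, x, w). (y, (\<lambda>i. x i / r), w) \<in> A}"
  have s1: "?A1 \<in> L.events" using measurable_sets[OF m1 A] by (simp add: vimage_def case_prod_unfold)
  have s2: "?A2 \<in> L.events" using measurable_sets[OF m2 A] by (simp add: vimage_def case_prod_unfold)
  have sq: "(\<integral>\<^sup>+(y, x, w). ennreal ((f x)\<^sup>2) \<partial>lppm) \<le> ennreal (exp b)"
  proof -
    have "(\<integral>\<^sup>+(y, x, w). ennreal ((f x)\<^sup>2) \<partial>lppm) = (\<integral>\<^sup>+x. ennreal ((f x)\<^sup>2) \<partial>seqm (expm 1))"
      by (subst nn_integral_lppm) (auto simp: nn_integral_prob_const prob_bulk prob_seqm_expm simp del: nn_integral_const)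
    also have "\<dots> \<le> ennreal (exp (2 * real k * ((r - l) / r)\<^sup>2))"
      unfolding f_def using lr by (intro two_rates_density_square) auto
    also have "\<dots> \<le> ennreal (exp b)" using lr by (intro ennreal_leI) simp
    finally show ?thesis .
  qed
  have "emeasure lppm ?A1 = (\<integral>\<^sup>+(y, x, w). indicator A (y, (\<lambda>i. if i < k then x i / l else x i / r), w) \<partial>lppm)"
  proof -
    have "indicator ?A1 = (\<lambda>(y, x, w). indicator A (y, (\<lambda>i. if i < k then x i / l else x i / r), w) :: ennreal)"
      by (simp add: fun_eq_iff indicator_def)
    then show ?thesis using nn_integral_indicator[OF s1] by simp
  qed
  also have "\<dots> = (\<integral>\<^sup>+(y, x, w). ennreal (f x) * indicator A (y, (\<lambda>i. x i / r), w) \<partial>lppm)"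
    unfolding f_def by (rule lppm_two_rates) (use lr in auto)
  also have "\<dots> \<le> (\<integral>\<^sup>+p. ennreal B * indicator ?A2 p + ennreal (1 / B) * (case p of (y, x, w) \<Rightarrow> ennreal ((f x)\<^sup>2)) \<partial>lppm)"
  proof (rule nn_integral_mono, clarify)
    fix y x w
    have "f x * indicator ?A2 (y, x, w) \<le> B * indicator ?A2 (y, x, w) + 1 / B * (f x)\<^sup>2"
    proof (cases "f x \<le> B")
      case True
      then show ?thesis using B by (intro add_increasing2 mult_right_mono) auto
    next
      case False
      then have "f x * B \<le> f x * f x" using f0[of x] by (intro mult_left_mono) auto
      then have "f x \<le> 1 / B * (f x)\<^sup>2" using B by (simp add: power2_eq_square pos_le_divide_eq)
      moreover have "f x * indicator ?A2 (y, x, w) \<le> f x" using f0[of x] by (auto simp: indicator_def)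
      moreover have "0 \<le> B * indicator ?A2 (y, x, w)" using B by simp
      ultimately show ?thesis by linarith
    qed
    then have "ennreal (f x * indicator ?A2 (y, x, w)) \<le> ennreal (B * indicator ?A2 (y, x, w) + 1 / B * (f x)\<^sup>2)"
      by (rule ennreal_leI)
    also have "\<dots> = ennreal B * ennreal (indicator ?A2 (y, x, w)) + ennreal (1 / B) * ennreal ((f x)\<^sup>2)"
      using B by (simp add: ennreal_plus ennreal_mult'[symmetric])
    finally show "ennreal (f x) * indicator A (y, (\<lambda>i. x i / r), w) \<le> ennreal B * indicator ?A2 (y, x, w) + ennreal (1 / B) * ennreal ((f x)\<^sup>2)"
      using f0[of x] by (auto simp: indicator_def split: if_splits)
  qed
  also have "\<dots> = ennreal B * emeasure lppm ?A2 + ennreal (1 / B) * (\<integral>\<^sup>+(y, x, w). ennreal ((f x)\<^sup>2) \<partial>lppm)"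
    using s2 by (subst nn_integral_add, measurable, subst nn_integral_cmult, measurable, subst nn_integral_cmult) auto
  also have "\<dots> \<le> ennreal B * emeasure lppm ?A2 + ennreal (1 / B) * ennreal (exp b)"
    by (intro add_mono mult_left_mono sq) auto
  also have "\<dots> = ennreal (B * L.prob ?A2 + exp b / B)"
    using B by (simp add: L.emeasure_eq_measure ennreal_plus ennreal_mult'[symmetric])
  finally have "ennreal (L.prob ?A1) \<le> ennreal (B * L.prob ?A2 + exp b / B)"
    by (simp only: L.emeasure_eq_measure)
  moreover have "0 \<le> B * L.prob ?A2 + exp b / B" using B by (intro add_nonneg_nonneg) auto
  ultimately show ?thesis by (simp only: ennreal_le_iff)
qed

text \<open>At the density l = \<rho> - 1 / \<tau> the mean is at least \<tau> ^ 3 + 3 \<tau>, so G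
  reaches \<tau> ^ 3 + 2 \<tau> with probability at least p0. It remains to return to \<rho>. On the
  left axis the weights for rate 1 - \<rho> are larger than those for 1 - l, and monotonicity
  suffices. On the bottom axis only the first k weights matter: a path that stays longer would gain
  2 K2 \<tau> when the bottom rate is lowered once more to l', which the tails of G and G' make
  unlikely. The rate of k weights is then changed by comparing densities.\<close>

lemma lppg_lower:
  assumes \<theta>: "0 < \<theta>" "2 * \<theta> \<le> \<rho>" "2 * \<theta> \<le> 1 - \<rho>"
  obtains q \<tau>0 where "0 < q" "\<And>\<tau> m n. near_char \<rho> \<tau> m n \<Longrightarrow> \<tau>0 \<le> \<tau> \<Longrightarrow>
    q \<le> L.prob {p. \<tau> ^ 3 + 2 * \<tau> \<le> lppg \<rho> (1 - \<rho>) m n p}"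
proof -
  have "0 \<le> (2::real)" by simp
  from lppg_right[OF \<theta> this] obtain C0 where C0: "0 < C0"
    "\<And>\<tau> m n z w. near_char \<rho> \<tau> m n \<Longrightarrow> (2 + 1) / \<tau> \<le> \<theta> \<Longrightarrow>
     \<bar>z - \<rho>\<bar> \<le> 2 / \<tau> \<Longrightarrow> \<bar>w - \<rho>\<bar> \<le> 2 / \<tau> \<Longrightarrow>
     (\<integral>\<^sup>+p. ennreal (exp ((lppg z (1 - w) m n p - \<tau> ^ 3) / \<tau>)) \<partial>lppm) \<le> ennreal C0"
    by metis
  \<comment> \<open>Enlarged to have C \<ge> 1, hence K2 \<ge> 1.\<close>
  define C where "C = C0 + 1"
  have right: "(\<integral>\<^sup>+p. ennreal (exp ((lppg z (1 - w) m n p - \<tau> ^ 3) / \<tau>)) \<partial>lppm) \<le> ennreal C"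
    if "near_char \<rho> \<tau> m n" "3 / \<tau> \<le> \<theta>" "\<bar>z - \<rho>\<bar> \<le> 2 / \<tau>" "\<bar>w - \<rho>\<bar> \<le> 2 / \<tau>" for \<tau> m n z w
  proof -
    have "(\<integral>\<^sup>+p. ennreal (exp ((lppg z (1 - w) m n p - \<tau> ^ 3) / \<tau>)) \<partial>lppm) \<le> ennreal C0"
      using that by (intro C0(2)) auto
    also have "\<dots> \<le> ennreal C" by (intro ennreal_leI) (simp add: C_def)
    finally show "(\<integral>\<^sup>+p. ennreal (exp ((lppg z (1 - w) m n p - \<tau> ^ 3) / \<tau>)) \<partial>lppm) \<le> ennreal C" .
  qed
  have C1: "1 \<le> C" using C0(1) by (simp add: C_def)
  \<comment> \<open>K makes the truncation error 2 \<tau> C / K equal to \<tau> / 2, and p0 is 1 /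
    (2 K). K2 makes each of the two tail events of G and G' cost at most C / K2 = p0 / 8.\<close>
  define K where "K = 4 * C"
  define p0 where "p0 = 1 / (8 * C)"
  define K2 where "K2 = 64 * C\<^sup>2"
  have "1 \<le> C\<^sup>2" by (rule one_le_power[OF C1])
  then have K21: "1 \<le> K2" unfolding K2_def by linarith
  then have pos: "0 < K" "0 < p0" "1 \<le> K2" "0 < K2"
    using C1 by (auto simp: K_def p0_def)
  \<comment> \<open>By the exponential Markov inequality, k unit exponentials sum to at most k / 2
    with probability at most r ^ k.\<close>
  define r where "r = exp (1/2) / (2::real)"
  have r: "0 \<le> r" "r < 1"
  proof -
    have "exp (1/2::real) ^ 2 < 4" using exp_le by (simp add: power2_eq_square exp_add[symmetric])
    then have "exp (1/2::real) < 2" using power_less_imp_less_base[of "exp (1/2::real)" 2 2] by simp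
    then show "0 \<le> r" "r < 1" by (auto simp: r_def)
  qed
  obtain k0 where k0: "r ^ k0 \<le> p0 / 8"
    using real_arch_pow_inv[of "p0 / 8" r] pos r by (auto intro: less_imp_le)
  \<comment> \<open>b bounds the exponent 2 k ((\<rho> - l) / \<rho>)^2 for k up to 6 K2 \<tau>^2,
    and B makes the second moment term exp b / B equal to p0 / 4.\<close>
  define b where "b = 12 * K2 / \<rho>\<^sup>2"
  define B where "B = 4 * exp b / p0"
  have B: "0 < B" using pos by (simp add: B_def)
  define q where "q = p0 / (4 * B)"
  define \<tau>0 where "\<tau>0 = 3 / \<theta> + real k0 + K2"
  have main: "q \<le> L.prob {p. \<tau> ^ 3 + 2 * \<tau> \<le> lppg \<rho> (1 - \<rho>) m n p}"
    if nc: "near_char \<rho> \<tau> m n" and \<tau>0: "\<tau>0 \<le> \<tau>" for \<tau> m n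
  proof -
    have \<tau>: "0 < \<tau>" "1 \<le> \<tau>" using nc by (auto simp: near_char_def)
    have "0 < 3 / \<theta>" using \<theta> by simp
    then have tt: "3 / \<theta> \<le> \<tau>" "real k0 \<le> \<tau>" "K2 \<le> \<tau>" using \<tau>0 pos unfolding \<tau>0_def by linarith+
    have t3: "3 / \<tau> \<le> \<theta>" "1 / \<tau> \<le> \<theta>" "2 / \<theta> \<le> \<tau>" using tt(1) \<tau> \<theta> by (auto simp: field_simps)
    define l where "l = \<rho> - 1 / \<tau>"
    define l' where "l' = \<rho> - 2 / \<tau>"
    have l': "0 < l'" "l' < l" "l < \<rho>" "\<rho> < 1" "l < 1" "0 < l"
    proof -
      have "2 / \<tau> < 3 / \<tau>" "0 < 1 / \<tau>" "1 / \<tau> < 2 / \<tau>" using \<tau> by (auto simp: field_simps)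
      then show "0 < l'" "l' < l" "l < \<rho>" "\<rho> < 1" "l < 1" "0 < l"
        using t3(1) \<theta> unfolding l_def l'_def by linarith+
    qed
    have nl: "\<bar>l - \<rho>\<bar> \<le> 2 / \<tau>" "\<bar>l' - \<rho>\<bar> \<le> 2 / \<tau>"
      using \<tau> by (auto simp: l_def l'_def field_simps)
    let ?G = "lppg l (1 - l) m n" and ?G' = "lppg l' (1 - l) m n"
    have iG: "(\<integral>\<^sup>+p. ennreal (exp ((?G p - \<tau> ^ 3) / \<tau>)) \<partial>lppm) \<le> ennreal C"
      by (rule right[OF nc t3(1) nl(1) nl(1)])
    have iG': "(\<integral>\<^sup>+p. ennreal (exp ((?G' p - \<tau> ^ 3) / \<tau>)) \<partial>lppm) \<le> ennreal C"
      by (rule right[OF nc t3(1) nl(2) nl(1)])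
    define \<mu> where "\<mu> = real m / l + real n / (1 - l)"
    have \<mu>: "\<tau> ^ 3 + 3 * \<tau> \<le> \<mu>"
      using stationary_mean_shifted[OF nc \<theta> t3(2)] t3(3) unfolding \<mu>_def l_def by linarith
    have mean: "ennreal \<mu> \<le> (\<integral>\<^sup>+p. ennreal (?G p) \<partial>lppm)"
      using lppg_mean[of l "1 - l" m n] l' by (simp add: \<mu>_def)
    have ev [measurable]: "{p. x \<le> lppg a c m n p} \<in> L.events" "{p. lppg a c m n p \<le> x} \<in> L.events" "{p. x < lppg a c m n p} \<in> L.events" for x a c
      using measurable_sets[of "lppg a c m n" lppm borel "{x..}"] measurable_sets[of "lppg a c m n" lppm borel "{..x}"]
        measurable_sets[of "lppg a c m n" lppm borel "{x<..}"]
      by (auto simp: vimage_def)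
    text \<open>Paley--Zygmund: the mean of \<open>G\<close> at the perturbed density exceeds \<open>\<tau>\<^sup>3\<close> by order \<open>\<tau>\<close>.\<close>
    have PZ: "p0 \<le> L.prob {p. \<tau> ^ 3 + 2 * \<tau> \<le> ?G p}"
    proof -
      let ?A = "{p. \<tau> ^ 3 + 2 * \<tau> \<le> ?G p}"
      have le: "?G p \<le> (\<tau> ^ 3 + 2 * \<tau>) + (K * \<tau>) * indicator ?A p + 2 * \<tau> / K * exp ((?G p - \<tau> ^ 3) / \<tau>)" for p
        using truncation_exp_le[OF \<tau>(1) pos(1), of "?G p - \<tau> ^ 3"] \<tau> pos
        by (auto simp: indicator_def not_le add_increasing2)
      have "\<mu> \<le> (\<tau> ^ 3 + 2 * \<tau>) + (K * \<tau>) * L.prob ?A + 2 * \<tau> / K * C"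
        by (rule L.mean_upper[OF _ _ _ le]) (use \<tau> pos C1 mean iG in auto)
      also have "2 * \<tau> / K * C = \<tau> / 2" using C1 by (simp add: K_def)
      finally have "\<tau> * (1 / 2) \<le> \<tau> * (K * L.prob ?A)" using \<mu> by (simp add: algebra_simps)
      then have "1 / 2 \<le> K * L.prob ?A" using \<tau> by simp
      then show ?thesis using C1 by (simp add: p0_def K_def field_simps)
    qed
    \<comment> \<open>The mean of G exceeds \<tau> ^ 3 and the positive part of G - \<tau> ^ 3 has
      mean at most C \<tau>, so a deficit of K2 \<tau> must be rare.\<close>
    have lowG: "L.prob {p. ?G p \<le> \<tau> ^ 3 - K2 * \<tau>} \<le> C / K2"
    proof -
      let ?A = "{p. \<tau> ^ 3 - K2 * \<tau> < ?G p}"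
      have "K2 * \<tau> \<le> \<tau> * \<tau>" using tt(3) \<tau> by simp
      also have "\<dots> \<le> \<tau> * \<tau> * \<tau>" using \<tau> by simp
      finally have a: "0 \<le> \<tau> ^ 3 - K2 * \<tau>" by (simp add: power3_eq_cube)
      have le: "?G p \<le> (\<tau> ^ 3 - K2 * \<tau>) + (K2 * \<tau>) * indicator ?A p + \<tau> * exp ((?G p - \<tau> ^ 3) / \<tau>)" for p
      proof -
        have "(?G p - \<tau> ^ 3) / \<tau> \<le> exp ((?G p - \<tau> ^ 3) / \<tau>)"
          using exp_ge_add_one_self[of "(?G p - \<tau> ^ 3) / \<tau>"] by linarith
        then have "?G p - \<tau> ^ 3 \<le> \<tau> * exp ((?G p - \<tau> ^ 3) / \<tau>)" using \<tau> by (simp add: divide_le_eq mult.commute)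
        then show ?thesis using \<tau> by (auto simp: indicator_def not_less add_increasing2)
      qed
      have "\<mu> \<le> (\<tau> ^ 3 - K2 * \<tau>) + (K2 * \<tau>) * L.prob ?A + \<tau> * C"
        by (rule L.mean_upper[OF _ _ _ le]) (use a \<tau> pos C1 mean iG in auto)
      moreover have "L.prob ?A = 1 - L.prob {p. ?G p \<le> \<tau> ^ 3 - K2 * \<tau>}"
      proof -
        have "?A = space lppm - {p. ?G p \<le> \<tau> ^ 3 - K2 * \<tau>}" by auto
        then show ?thesis using L.prob_compl[OF ev(2)] by simp
      qed
      ultimately have "\<mu> \<le> (\<tau> ^ 3 - K2 * \<tau>) + (K2 * \<tau>) * (1 - L.prob {p. ?G p \<le> \<tau> ^ 3 - K2 * \<tau>}) + \<tau> * C"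
        by (simp only:)
      moreover
      have "(K2 * \<tau>) * (1 - x) = K2 * \<tau> - \<tau> * (K2 * x)" for x by (simp add: algebra_simps)
      note this[of "L.prob {p. ?G p \<le> \<tau> ^ 3 - K2 * \<tau>}"]
      ultimately have "\<tau> * (K2 * L.prob {p. ?G p \<le> \<tau> ^ 3 - K2 * \<tau>}) \<le> \<tau> * C"
        using \<mu> \<tau> by linarith
      then show ?thesis using \<tau> pos by (simp add: pos_le_divide_eq mult.commute)
    qed
    have highG': "L.prob {p. \<tau> ^ 3 + K2 * \<tau> \<le> ?G' p} \<le> C / K2"
    proof -
      have "L.prob {p. \<tau> ^ 3 + K2 * \<tau> \<le> ?G' p} = L.prob {p \<in> space lppm. K2 * \<tau> \<le> ?G' p - \<tau> ^ 3}"
        by (intro arg_cong[where f=L.prob]) auto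
      also have "\<dots> \<le> C * exp (- (1 / \<tau> * (K2 * \<tau>)))"
        by (rule L.exp_markov) (use iG' \<tau> C1 in auto)
      also have "exp (- (1 / \<tau> * (K2 * \<tau>))) \<le> 1 / K2"
      proof -
        have "K2 \<le> exp K2" using exp_ge_add_one_self[of K2] by linarith
        then show ?thesis using \<tau> pos by (simp add: exp_minus field_simps)
      qed
      finally show ?thesis using C1 by (simp add: mult_left_mono)
    qed
    \<comment> \<open>Passing from rate l to l' adds at least 1 / \<tau> times each unit
      exponential. Outside a rare event the first k of them sum to more than k / 2, which is at
      least 2.5 K2 \<tau>^2, so the gain is at least 2 K2 \<tau>.\<close>
    define k where "k = nat \<lceil>5 * K2 * \<tau>\<^sup>2\<rceil>"
    have \<tau>2: "\<tau> \<le> \<tau>\<^sup>2" "1 \<le> \<tau>\<^sup>2" using \<tau> by (auto simp: power2_eq_square intro: one_le_power[of \<tau> 2, unfolded power2_eq_square])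
    have K\<tau>: "\<tau>\<^sup>2 \<le> K2 * \<tau>\<^sup>2" using mult_right_mono[OF pos(3), of "\<tau>\<^sup>2"] by simp
    have k: "5 * K2 * \<tau>\<^sup>2 \<le> real k" "real k \<le> 6 * K2 * \<tau>\<^sup>2" "k0 \<le> k"
    proof -
      show k1: "5 * K2 * \<tau>\<^sup>2 \<le> real k" unfolding k_def by linarith
      show "real k \<le> 6 * K2 * \<tau>\<^sup>2" unfolding k_def using \<tau>2 K\<tau> by linarith
      have "real k0 \<le> real k" using k1 tt(2) \<tau>2 K\<tau> by linarith
      then show "k0 \<le> k" by simp
    qed
    have sumS: "L.prob {p. (\<Sum>i<k. fst (snd p) i) \<le> real k / 2} \<le> p0 / 8"
    proof -
      have "(\<integral>\<^sup>+p. ennreal (exp (1 * (- (\<Sum>i<k. fst (snd p) i)))) \<partial>lppm) = (\<integral>\<^sup>+x. ennreal (exp ((-1) * (\<Sum>i<k. x i))) \<partial>seqm (expm 1))"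
        by (subst nn_integral_lppm) (auto simp: nn_integral_prob_const prob_bulk prob_seqm_expm simp del: nn_integral_const)
      also have "\<dots> = ennreal ((1 / 2) ^ k)" by (subst nn_integral_exp_sum) auto
      finally have "L.prob {p \<in> space lppm. - (real k / 2) \<le> - (\<Sum>i<k. fst (snd p) i)} \<le> (1 / 2) ^ k * exp (- (1 * (- (real k / 2))))"
        by (intro L.exp_markov) auto
      also have "exp (- (1 * (- (real k / 2)))) = exp (1 / 2 :: real) ^ k"
        by (simp add: exp_of_nat_mult[symmetric])
      also have "(1 / 2) ^ k * exp (1 / 2) ^ k = r ^ k" by (simp add: r_def power_divide)
      also have "r ^ k \<le> r ^ k0" using r k by (intro power_decreasing) auto
      finally show ?thesis using k0 by simp
    qed
    define A where "A = {(y, x, w). \<tau> ^ 3 + 2 * \<tau> \<le> lpp x (\<lambda>j. y j / (1 - \<rho>)) w m n}"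
    have A [measurable]: "A \<in> sets (seqm borel \<Otimes>\<^sub>M (seqm borel \<Otimes>\<^sub>M seqm (seqm borel)))"
    proof -
      have "{p \<in> space (seqm borel \<Otimes>\<^sub>M (seqm borel \<Otimes>\<^sub>M seqm (seqm borel))). \<tau> ^ 3 + 2 * \<tau> \<le> lpp (fst (snd p)) (\<lambda>j. fst p j / (1 - \<rho>)) (snd (snd p)) m n} \<in> sets (seqm borel \<Otimes>\<^sub>M (seqm borel \<Otimes>\<^sub>M seqm (seqm borel)))"
        by measurable
      then show ?thesis by (simp add: A_def case_prod_unfold space_pair_measure space_PiM)
    qed
    let ?A1 = "{(y, x, w). (y, (\<lambda>i. if i < k then x i / l else x i / \<rho>), w) \<in> A}"
    let ?A2 = "{(y, x, w). (y, (\<lambda>i. x i / \<rho>), w) \<in> A}"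
    have change: "L.prob ?A1 \<le> B * L.prob ?A2 + exp b / B"
    proof (rule lppm_change_of_rate)
      have "\<rho> - l = 1 / \<tau>" by (simp add: l_def)
      then show "4 * (\<rho> - l) \<le> \<rho>" using t3 \<theta> by (simp add: field_simps)
      have "2 * real k * ((\<rho> - l) / \<rho>)\<^sup>2 \<le> 2 * (6 * K2 * \<tau>\<^sup>2) * ((1 / \<tau>) / \<rho>)\<^sup>2"
        unfolding \<open>\<rho> - l = 1 / \<tau>\<close> using k by (intro mult_right_mono mult_left_mono) auto
      also have "\<dots> = b" using \<tau> by (simp add: b_def power_divide power_mult_distrib)
      finally show "2 * real k * ((\<rho> - l) / \<rho>)\<^sup>2 \<le> b" .
    qed (use l' B A in auto)
    have A1ev: "?A1 \<in> L.events"
    proof -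
      have "(\<lambda>(y, x, w). (y, (\<lambda>i. if i < k then x i / l else x i / \<rho>), w)) \<in> measurable lppm (seqm borel \<Otimes>\<^sub>M (seqm borel \<Otimes>\<^sub>M seqm (seqm borel)))"
      proof -
        have [measurable]: "(\<lambda>x. (if i < k then x i / l else x i / \<rho>)) \<in> borel_measurable (seqm borel)" for i
          by measurable
        show ?thesis by measurable
      qed
      from measurable_sets[OF this A] show ?thesis by (simp add: vimage_def case_prod_unfold)
    qed
    have Sev [measurable]: "{p. (\<Sum>i<k. fst (snd p) i) \<le> real k / 2} \<in> L.events"
    proof -
      have "{p \<in> space lppm. (\<Sum>i<k. fst (snd p) i) \<le> real k / 2} \<in> L.events" by measurable
      then show ?thesis by simp
    qed
    have "L.prob {p. \<tau> ^ 3 + 2 * \<tau> \<le> ?G p} \<le>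
      L.prob (?A1 \<union> ({p. ?G p \<le> \<tau> ^ 3 - K2 * \<tau>} \<union> ({p. \<tau> ^ 3 + K2 * \<tau> \<le> ?G' p} \<union> {p. (\<Sum>i<k. fst (snd p) i) \<le> real k / 2})))"
    proof (rule L.finite_measure_mono_AE)
      show "AE p in lppm. p \<in> {p. \<tau> ^ 3 + 2 * \<tau> \<le> ?G p} \<longrightarrow>
        p \<in> ?A1 \<union> ({p. ?G p \<le> \<tau> ^ 3 - K2 * \<tau>} \<union> ({p. \<tau> ^ 3 + K2 * \<tau> \<le> ?G' p} \<union> {p. (\<Sum>i<k. fst (snd p) i) \<le> real k / 2}))"
        using AE_lppm_pos
      proof eventually_elim
        case (elim p)
        obtain y x w where p: "p = (y, x, w)" by (cases p) auto
        have xy: "0 < x i" "0 < y i" for i using elim by (auto simp: p)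
        define xm where "xm i = (if i < k then x i / l else x i / \<rho>)" for i
        define d where "d i = x i / l' - x i / l" for i
        have ex: "lpp (\<lambda>i. x i / l) (\<lambda>j. y j / (1 - l)) w m n \<le> lpp xm (\<lambda>j. y j / (1 - l)) w m n \<or>
          lpp (\<lambda>i. x i / l) (\<lambda>j. y j / (1 - l)) w m n + (\<Sum>i<k. d i) \<le>
          lpp (\<lambda>i. x i / l + (if i < k then d i else 0)) (\<lambda>j. y j / (1 - l)) w m n"
          by (rule lpp_exit) (simp add: xm_def)
        have m1: "lpp xm (\<lambda>j. y j / (1 - l)) w m n \<le> lpp xm (\<lambda>j. y j / (1 - \<rho>)) w m n"
          using xy l' by (intro lpp_mono divide_left_mono) (auto intro: less_imp_le)
        have m2: "lpp (\<lambda>i. x i / l + (if i < k then d i else 0)) (\<lambda>j. y j / (1 - l)) w m n \<le> ?G' p"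
          unfolding p lppg_def prod.case
        proof (intro lpp_mono)
          show "x i / l + (if i < k then d i else 0) \<le> x i / l'" for i
            using xy[of i] l' divide_left_mono[of l' l "x i"] by (simp add: d_def)
        qed simp
        have dS: "2 * K2 * \<tau> \<le> (\<Sum>i<k. d i)" if "\<not> (\<Sum>i<k. x i) \<le> real k / 2"
        proof -
          have "1 / \<tau> * x i \<le> d i" for i
          proof -
            have "1 / l' - 1 / l = (1 / \<tau>) / (l' * l)"
              using l' \<tau> by (simp add: diff_frac_eq) (simp add: l_def l'_def)
            also have "\<dots> \<ge> (1 / \<tau>) / 1"
            proof (rule divide_left_mono)
              show "l' * l \<le> 1" using l' by (intro mult_le_one) auto
            qed (use l' \<tau> in auto)
            finally have "1 / \<tau> * x i \<le> (1 / l' - 1 / l) * x i" using xy[of i] by (intro mult_right_mono) auto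
            then show ?thesis by (simp add: d_def left_diff_distrib)
          qed
          then have "1 / \<tau> * (\<Sum>i<k. x i) \<le> (\<Sum>i<k. d i)" unfolding sum_distrib_left by (intro sum_mono)
          moreover have "2 * K2 * \<tau> \<le> 1 / \<tau> * (\<Sum>i<k. x i)"
          proof -
            have "2 * K2 * \<tau>\<^sup>2 \<le> (\<Sum>i<k. x i)" using that k(1) K\<tau> \<tau>2 by linarith
            then show ?thesis using \<tau> by (simp add: pos_le_divide_eq power2_eq_square mult.assoc)
          qed
          ultimately show ?thesis by linarith
        qed
        have G: "?G p = lpp (\<lambda>i. x i / l) (\<lambda>j. y j / (1 - l)) w m n" by (simp add: p lppg_def)
        show ?case
        proof (intro impI, rule ccontr)
          assume hi: "p \<in> {p. \<tau> ^ 3 + 2 * \<tau> \<le> ?G p}" and no: "p \<notin> ?A1 \<union> ({p. ?G p \<le> \<tau> ^ 3 - K2 * \<tau>} \<union> ({p. \<tau> ^ 3 + K2 * \<tau> \<le> ?G' p} \<union> {p. (\<Sum>i<k. fst (snd p) i) \<le> real k / 2}))"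
          have "\<not> \<tau> ^ 3 + 2 * \<tau> \<le> lpp xm (\<lambda>j. y j / (1 - \<rho>)) w m n"
            using no by (auto simp: p A_def xm_def[abs_def])
          with hi ex m1 m2 G have "?G p + (\<Sum>i<k. d i) \<le> ?G' p" by auto
          moreover have "2 * K2 * \<tau> \<le> (\<Sum>i<k. d i)" using no by (intro dS) (auto simp: p)
          ultimately show False using no by auto
        qed
      qed
    qed (use A1ev ev Sev in auto)
    also have "\<dots> \<le> L.prob ?A1 + (L.prob {p. ?G p \<le> \<tau> ^ 3 - K2 * \<tau>} + (L.prob {p. \<tau> ^ 3 + K2 * \<tau> \<le> ?G' p} + L.prob {p. (\<Sum>i<k. fst (snd p) i) \<le> real k / 2}))"
      using A1ev ev Sev by (intro order_trans[OF measure_Un_le] add_left_mono sets.Un) auto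
    also have "\<dots> \<le> L.prob ?A1 + (C / K2 + (C / K2 + p0 / 8))"
      by (intro add_mono order_refl lowG highG' sumS)
    also have "C / K2 = p0 / 8" using C1 by (simp add: K2_def p0_def power2_eq_square)
    finally have "p0 / 2 \<le> L.prob ?A1" using PZ pos by simp
    from this change have "p0 / 2 \<le> B * L.prob ?A2 + exp b / B" by (rule order_trans)
    also have "exp b / B = p0 / 4" by (simp add: B_def)
    finally have "q \<le> L.prob ?A2" using B by (simp add: q_def field_simps)
    moreover have "?A2 = {p. \<tau> ^ 3 + 2 * \<tau> \<le> lppg \<rho> (1 - \<rho>) m n p}"
      by (auto simp: A_def lppg_def)
    ultimately show ?thesis by simp
  qed
  have "0 < q" using pos B by (simp add: q_def)
  from that[OF this main] show ?thesis .
qed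

section \<open>Particle paths as last passage times\<close>

text \<open>With infinitely many particles the jump times need not be well ordered, so there is no
  next jump to induct on. Continuous induction asks only for persistence just to the right and for
  passage to the limit from the left.\<close>

lemma real_induction [consumes 1]:
  fixes P :: "real \<Rightarrow> bool"
  assumes t: "a \<le> t" and 0: "P a" and right: "\<And>t. a \<le> t \<Longrightarrow> P t \<Longrightarrow> \<forall>\<^sub>F s in at_right t. P s"
    and left: "\<And>t. a < t \<Longrightarrow> (\<And>s. a \<le> s \<Longrightarrow> s < t \<Longrightarrow> P s) \<Longrightarrow> P t"
  shows "P t"
proof (rule ccontr)
  assume n: "\<not> P t"
  define B where "B = {s. a \<le> s \<and> s \<le> t \<and> \<not> P s}"
  have B: "B \<noteq> {}" "bdd_below B" using n t by (auto simp: B_def intro!: bdd_belowI[of _ a])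
  define m where "m = Inf B"
  have am: "a \<le> m" unfolding m_def using B by (intro cInf_greatest) (auto simp: B_def)
  have mt: "m \<le> t" unfolding m_def using B n t by (intro cInf_lower) (auto simp: B_def)
  have below: "P s" if "a \<le> s" "s < m" for s
  proof (rule ccontr)
    assume "\<not> P s"
    then have "s \<in> B" using that mt by (auto simp: B_def)
    then have "m \<le> s" unfolding m_def using B by (intro cInf_lower) auto
    then show False using that by simp
  qed
  have Pm: "P m"
    using 0 left[of m] am below by (cases "a = m") auto
  obtain u where u: "m < u" "\<And>s. m < s \<Longrightarrow> s < u \<Longrightarrow> P s"
    using right[OF am Pm] by (auto simp: eventually_at_right_field)
  have "u \<le> m" unfolding m_def
  proof (rule cInf_greatest)
    fix s assume "s \<in> B"
    then have "m \<le> s" "\<not> P s" unfolding m_def using B by (auto intro: cInf_lower simp: B_def)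
    then show "u \<le> s" using u(2)[of s] Pm by (cases "s = m") (auto simp: not_le[symmetric])
  qed (use B in auto)
  with u show False by simp
qed

lemma int_strict_mono_Suc:
  fixes f :: "int \<Rightarrow> int"
  assumes "\<And>i. f i < f (i + 1)"
  shows "strict_mono f"
proof (rule strict_monoI)
  fix i j :: int assume "i < j"
  then show "f i < f j"
  proof (induction rule: int_gr_induct)
    case base show ?case by (rule assms)
  next
    case (step k) then show ?case using assms[of k] by simp
  qed
qed

context
  fixes e :: "int \<Rightarrow> nat \<Rightarrow> real" and r :: "int \<Rightarrow> real \<Rightarrow> int"
  assumes path: "tasep_path e r"
begin

lemma path_right: "0 \<le> t \<Longrightarrow> \<forall>\<^sub>F s in at_right t. r i s = r i t"
  using path unfolding tasep_path_def by blast

lemma path_left: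
  assumes "0 < t"
  obtains l where "\<And>i. \<forall>\<^sub>F s in at_left t. r i s = l i"
    "\<And>i. r i t = (if rings_at (e (l i)) t \<and> \<not> occupied l (l i - 1) then l i - 1 else l i)"
  using path assms unfolding tasep_path_def by blast

lemma left_limit_property:
  assumes ev: "\<And>i. \<forall>\<^sub>F s in at_left t. r i s = l i" and at: "a < t" and P: "\<And>s. a \<le> s \<Longrightarrow> s < t \<Longrightarrow> Q (r i s) (r j s)"
  shows "Q (l i) (l j)"
proof -
  have "\<forall>\<^sub>F s in at_left t. a < s"
    unfolding eventually_at_left_field using at by blast
  moreover have "\<forall>\<^sub>F s in at_left t. s < t"
    unfolding eventually_at_left_field by (rule exI[of _ "t - 1"]) simp
  ultimately have "\<forall>\<^sub>F s in at_left t. Q (l i) (l j)"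
    using ev[of i] ev[of j]
  proof eventually_elim
    case (elim s)
    then show ?case using P[of s] by simp
  qed
  then show ?thesis by (simp add: trivial_limit_at_left_real)
qed

text \<open>The exclusion rule looks at left limits: a particle directly behind its left neighbour
  stays put, whatever the neighbour does at that instant.\<close>

lemma path_order: "0 \<le> t \<Longrightarrow> r i t < r (i + 1) t"
proof (induction t rule: real_induction)
  case 1
  show ?case using path unfolding tasep_path_def strict_mono_def by simp
next
  case (2 t)
  show ?case using path_right[OF 2(1), of i] path_right[OF 2(1), of "i + 1"]
    by eventually_elim (use 2 in simp)
next
  case (3 t)
  obtain l where l: "\<And>i. \<forall>\<^sub>F s in at_left t. r i s = l i"
    "\<And>i. r i t = (if rings_at (e (l i)) t \<and> \<not> occupied l (l i - 1) then l i - 1 else l i)"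
    using path_left[OF 3(1)] by metis
  have "l i < l (i + 1)" by (rule left_limit_property[where Q="(<)", OF l(1) 3(1)]) (rule 3(2))
  moreover have "occupied l (l (i + 1) - 1)" if "l i = l (i + 1) - 1"
    unfolding occupied_def using that by blast
  ultimately have "l i < r (i + 1) t" using l(2)[of "i + 1"] by (cases "l i = l (i + 1) - 1") simp_all
  moreover have "r i t \<le> l i" using l(2)[of i] by simp
  ultimately show ?case by simp
qed

lemma path_strict_mono: "0 \<le> t \<Longrightarrow> strict_mono (\<lambda>i. r i t)"
  by (rule int_strict_mono_Suc) (rule path_order)

lemma path_antimono:
  assumes "0 \<le> s" "s \<le> t"
  shows "r i t \<le> r i s"
  using assms(2)
proof (induction t rule: real_induction)
  case (2 t)
  show ?case using path_right[of t i] 2 assms by (auto elim: eventually_mono)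
next
  case (3 t)
  have "0 < t" using 3 assms by simp
  then obtain l where l: "\<And>i. \<forall>\<^sub>F s in at_left t. r i s = l i"
    "\<And>i. r i t = (if rings_at (e (l i)) t \<and> \<not> occupied l (l i - 1) then l i - 1 else l i)"
    using path_left by metis
  have "l i \<le> r i s" by (rule left_limit_property[where Q="\<lambda>x y. x \<le> r i s", OF l(1) 3(1) 3(2)])
  then show ?case using l(2)[of i] by (auto split: if_splits)
qed simp

text \<open>T1 is the time at which particle i has reached x, and T2 the time at which its left
  neighbour has cleared x - 1. Until both have happened no jump to x - 1 is possible; the first
  later ring of the clock at x triggers it.\<close>

lemma jump_time:
  assumes T1: "0 \<le> T1" "\<And>t. 0 \<le> t \<Longrightarrow> r i t \<le> x \<longleftrightarrow> T1 \<le> t"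
    and T2: "0 \<le> T2" "\<And>t. 0 \<le> t \<Longrightarrow> r (i - 1) t \<le> x - 2 \<longleftrightarrow> T2 \<le> t"
    and init: "x \<le> r i 0"
    and \<tau>: "max T1 T2 < \<tau>" "rings_at (e x) \<tau>" "\<And>t. max T1 T2 < t \<Longrightarrow> t < \<tau> \<Longrightarrow> \<not> rings_at (e x) t"
    and t: "0 \<le> t"
  shows "r i t \<le> x - 1 \<longleftrightarrow> \<tau> \<le> t"
proof -
  define S where "S = max T1 T2"
  have S: "0 \<le> S" "T1 \<le> S" "T2 \<le> S" using T1 T2 by (auto simp: S_def)
  have ord: "r (i - 1) t < r i t" if "0 \<le> t" for t using path_order[OF that, of "i - 1"] by simp
  have before: "x \<le> r i t" if "0 \<le> t" "t < S" for t
  proof (cases "t < T1")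
    case True then show ?thesis using T1(2)[OF that(1)] by simp
  next
    case False
    then have "t < T2" using that by (auto simp: S_def)
    then have "x - 1 \<le> r (i - 1) t" using T2(2)[OF that(1)] by simp
    then show ?thesis using ord[OF that(1)] by simp
  qed
  \<comment> \<open>A ring exactly at S has no effect. Either the particle only arrives at x at that
    instant, or S = T2 and the left limits still show the neighbour at x - 1. This is why the wait
    is counted strictly after S.\<close>
  have atS: "r i S = x"
  proof (rule antisym)
    show "r i S \<le> x" using T1(2)[of S] S by simp
    show "x \<le> r i S"
    proof (cases "S = 0")
      case True then show ?thesis using init by simp
    next
      case False
      then have S0: "0 < S" using S by simp
      then obtain l where l: "\<And>i. \<forall>\<^sub>F s in at_left S. r i s = l i"
        "\<And>i. r i S = (if rings_at (e (l i)) S \<and> \<not> occupied l (l i - 1) then l i - 1 else l i)"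
        using path_left by metis
      have lx: "x \<le> l i"
        by (rule left_limit_property[where Q="\<lambda>a b. x \<le> a", OF l(1) S0 before])
      show ?thesis
      proof (cases "l i = x")
        case False then show ?thesis using l(2)[of i] lx by (auto split: if_splits)
      next
        case True
        have "T1 < S"
        proof (rule ccontr)
          assume "\<not> T1 < S"
          then have "x + 1 \<le> r i t" if "0 \<le> t" "t < S" for t
            using T1(2)[OF that(1)] that by simp
          then have "x + 1 \<le> l i"
            by (rule left_limit_property[where Q="\<lambda>a b. x + 1 \<le> a", OF l(1) S0])
          then show False using True by simp
        qed
        then have "S = T2" by (auto simp: S_def)
        then have "x - 1 \<le> r (i - 1) t" if "0 \<le> t" "t < S" for t
          using T2(2)[OF that(1)] that by simp
        then have "x - 1 \<le> l (i - 1)"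
          by (rule left_limit_property[where Q="\<lambda>a b. x - 1 \<le> a", OF l(1) S0])
        moreover have "l (i - 1) < l i"
          by (rule left_limit_property[where Q="(<)", OF l(1) S0 ord])
        ultimately have "l (i - 1) = l i - 1" using True by simp
        then have "occupied l (l i - 1)" by (auto simp: occupied_def)
        then show ?thesis using l(2)[of i] True by simp
      qed
    qed
  qed
  have stay: "t < \<tau> \<longrightarrow> r i t = x" if "S \<le> t" for t
    using that
  proof (induction t rule: real_induction)
    case 1 show ?case using atS by simp
  next
    case (2 t)
    show ?case
    proof (cases "t < \<tau>")
      case True
      then show ?thesis using path_right[of t i] 2 S by (auto elim: eventually_mono)
    next
      case False
      have "\<forall>\<^sub>F s in at_right t. t < s" by (simp add: eventually_at_right_less)
      then show ?thesis by eventually_elim (use False in auto)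
    qed
  next
    case (3 t)
    show ?case
    proof
      assume t: "t < \<tau>"
      have "0 < t" using 3 S by simp
      then obtain l where l: "\<And>i. \<forall>\<^sub>F s in at_left t. r i s = l i"
        "\<And>i. r i t = (if rings_at (e (l i)) t \<and> \<not> occupied l (l i - 1) then l i - 1 else l i)"
        using path_left by metis
      have "l i = x"
        by (rule left_limit_property[where Q="\<lambda>a b. a = x" and j=i, OF l(1) 3(1)]) (use 3(2) t in auto)
      moreover have "\<not> rings_at (e x) t" using \<tau>(3)[of t] 3(1) t by (simp add: S_def)
      ultimately show "r i t = x" using l(2)[of i] by simp
    qed
  qed
  have S\<tau>: "S < \<tau>" using \<tau>(1) by (simp add: S_def)
  have at\<tau>: "r i \<tau> = x - 1"
  proof -
    have "0 < \<tau>" using S S\<tau> by simp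
    then obtain l where l: "\<And>i. \<forall>\<^sub>F s in at_left \<tau>. r i s = l i"
      "\<And>i. r i \<tau> = (if rings_at (e (l i)) \<tau> \<and> \<not> occupied l (l i - 1) then l i - 1 else l i)"
      using path_left by metis
    have li: "l i = x"
      by (rule left_limit_property[where Q="\<lambda>a b. a = x" and j=i, OF l(1) S\<tau>]) (use stay in auto)
    have li1: "l (i - 1) \<le> x - 2"
      by (rule left_limit_property[where Q="\<lambda>a b. a \<le> x - 2" and j=i, OF l(1) S\<tau>]) (use T2(2) S in auto)
    have "strict_mono l"
    proof (rule int_strict_mono_Suc)
      show "l i < l (i + 1)" for i
        by (rule left_limit_property[where Q="(<)", OF l(1) \<open>0 < \<tau>\<close> path_order])
    qed
    then have "\<not> occupied l (x - 1)"
    proof -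
      assume sm: "strict_mono l"
      have "l j \<noteq> x - 1" for j
      proof (cases "j \<le> i - 1")
        case True
        then have "l j \<le> l (i - 1)" using sm by (simp add: strict_mono_less_eq)
        then show ?thesis using li1 by simp
      next
        case False
        then have "l i \<le> l j" using sm by (simp add: strict_mono_less_eq)
        then show ?thesis using li by simp
      qed
      then show ?thesis by (auto simp: occupied_def)
    qed
    then show ?thesis using l(2)[of i] \<tau>(2) li by simp
  qed
  show ?thesis
  proof
    assume "r i t \<le> x - 1"
    then show "\<tau> \<le> t" using before[OF t] stay[of t] by (cases "t < S") auto
  next
    assume "\<tau> \<le> t"
    then have "r i t \<le> r i \<tau>" using S S\<tau> by (intro path_antimono) auto
    then show "r i t \<le> x - 1" using at\<tau> by simp
  qed
qed

end

text \<open>A cell is a pair \<open>(x, y)\<close> of initial sites with a particle at \<open>x\<close> and a hole at \<open>y < x\<close>;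
  \<open>clear_time \<eta> W x y\<close> is the time at which the last particle starting weakly left of \<open>x\<close> has
  exchanged with the first hole starting weakly right of \<open>y\<close>.\<close>

function clear_time :: "(int \<Rightarrow> bool) \<Rightarrow> (int \<Rightarrow> int \<Rightarrow> real) \<Rightarrow> int \<Rightarrow> int \<Rightarrow> real" where
  "clear_time \<eta> W x y = (if x \<le> y then 0 else if \<not> \<eta> x then clear_time \<eta> W (x - 1) y
    else if \<eta> y then clear_time \<eta> W x (y + 1)
    else max (clear_time \<eta> W (x - 1) y) (clear_time \<eta> W x (y + 1)) + W x y)"
  by auto
termination by (relation "Wellfounded.measure (\<lambda>(\<eta>, W, x, y). nat (x - y))") auto

declare clear_time.simps [simp del]

lemma clear_time_cong:
  assumes "\<And>a b. y \<le> b \<Longrightarrow> b < a \<Longrightarrow> a \<le> x \<Longrightarrow> W a b = W' a b"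
  shows "clear_time \<eta> W x y = clear_time \<eta> W' x y"
  using assms
proof (induction \<eta> W x y rule: clear_time.induct)
  case (1 \<eta> W x y)
  then show ?case
    by (subst (1 2) clear_time.simps) auto
qed

lemma clear_time_empty: "x \<le> y \<Longrightarrow> clear_time \<eta> W x y = 0"
  by (subst clear_time.simps) simp

lemma clear_time_skip:
  assumes "x' \<le> x" "\<And>z. x' < z \<Longrightarrow> z \<le> x \<Longrightarrow> \<not> \<eta> z"
  shows "clear_time \<eta> W x y = clear_time \<eta> W x' y"
  using assms
proof (induction x rule: int_ge_induct)
  case (step z)
  show ?case
  proof (cases "z + 1 \<le> y")
    case True then show ?thesis using step by (simp add: clear_time_empty)
  next
    case False
    then have "clear_time \<eta> W (z + 1) y = clear_time \<eta> W z y"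
      using step by (subst clear_time.simps) simp
    then show ?thesis using step by simp
  qed
qed simp

definition hcount :: "(int \<Rightarrow> bool) \<Rightarrow> int \<Rightarrow> int \<Rightarrow> int" where
  "hcount \<eta> y x = int (card {z. y \<le> z \<and> z < x \<and> \<not> \<eta> z})"

lemma finite_hcount_set [simp]: "finite {z::int. y \<le> z \<and> z < x \<and> \<not> \<eta> z}"
  by (rule finite_subset[of _ "{y..<x}"]) auto

lemma hcount_nonneg [simp]: "0 \<le> hcount \<eta> y x"
  by (simp add: hcount_def)

lemma hcount_empty: "x \<le> y \<Longrightarrow> hcount \<eta> y x = 0"
  by (auto simp: hcount_def)

lemma hcount_split: "y \<le> z \<Longrightarrow> z \<le> x \<Longrightarrow> hcount \<eta> y x = hcount \<eta> y z + hcount \<eta> z x"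
proof -
  assume yz: "y \<le> z" "z \<le> x"
  have "{v. y \<le> v \<and> v < x \<and> \<not> \<eta> v} = {v. y \<le> v \<and> v < z \<and> \<not> \<eta> v} \<union> {v. z \<le> v \<and> v < x \<and> \<not> \<eta> v}"
    using yz by auto
  moreover have "card ({v. y \<le> v \<and> v < z \<and> \<not> \<eta> v} \<union> {v. z \<le> v \<and> v < x \<and> \<not> \<eta> v}) =
    card {v. y \<le> v \<and> v < z \<and> \<not> \<eta> v} + card {v. z \<le> v \<and> v < x \<and> \<not> \<eta> v}"
    by (rule card_Un_disjoint) auto
  ultimately show ?thesis unfolding hcount_def by (simp only: of_nat_add)
qed

lemma hcount_singleton: "hcount \<eta> y (y + 1) = (if \<eta> y then 0 else 1)"
proof -
  have "{z. y \<le> z \<and> z < y + 1 \<and> \<not> \<eta> z} = (if \<eta> y then {} else {y})" by auto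
  then show ?thesis by (simp add: hcount_def)
qed

lemma hcount_first: "y < x \<Longrightarrow> hcount \<eta> y x = (if \<eta> y then 0 else 1) + hcount \<eta> (y + 1) x"
  using hcount_split[of y "y + 1" x \<eta>] by (simp add: hcount_singleton)

lemma hcount_all_holes:
  assumes "y \<le> x" "\<And>z. y \<le> z \<Longrightarrow> z < x \<Longrightarrow> \<not> \<eta> z"
  shows "hcount \<eta> y x = x - y"
proof -
  have "{z. y \<le> z \<and> z < x \<and> \<not> \<eta> z} = {y..<x}" using assms by auto
  then show ?thesis using assms by (simp add: hcount_def)
qed

lemma hcount_skip:
  assumes "y \<le> x'" "x' < x" "\<eta> x'" "\<And>z. x' < z \<Longrightarrow> z < x \<Longrightarrow> \<not> \<eta> z"
  shows "hcount \<eta> y x = hcount \<eta> y x' + (x - x' - 1)"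
proof -
  have "hcount \<eta> (x' + 1) x = x - (x' + 1)" using assms by (intro hcount_all_holes) auto
  then show ?thesis
    using hcount_split[of y x' x \<eta>] hcount_first[of x' x \<eta>] assms by simp
qed

text \<open>The exchange of cell \<open>(x, y)\<close> takes place at \<open>cell_site\<close>, whose clock makes the particle wait for
  the first ring after both neighbouring exchanges.  Sweeping through the cells, \<open>run\<close> records this wait
  in \<open>W\<close> and replaces the clock by its part \<open>post\<close> after the ring, counted from the new base time \<open>b s\<close>.\<close>

definition cell_site :: "(int \<Rightarrow> bool) \<Rightarrow> int \<Rightarrow> int \<Rightarrow> int" where
  "cell_site \<eta> x y = x - hcount \<eta> (y + 1) x"

definition ring_idx :: "(nat \<Rightarrow> real) \<Rightarrow> real \<Rightarrow> nat" where
  "ring_idx s u = (LEAST m. u < (\<Sum>l\<le>m. s l))"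

definition resid :: "(nat \<Rightarrow> real) \<Rightarrow> real \<Rightarrow> real" where
  "resid s u = (\<Sum>l\<le>ring_idx s u. s l) - u"

definition post :: "(nat \<Rightarrow> real) \<Rightarrow> real \<Rightarrow> nat \<Rightarrow> real" where
  "post s u m = s (Suc (ring_idx s u + m))"

definition good_clock :: "(nat \<Rightarrow> real) \<Rightarrow> bool" where
  "good_clock s \<longleftrightarrow> (\<forall>n. 0 < s n) \<and> (\<forall>u. \<exists>m. u < (\<Sum>l\<le>m. s l))"

fun run :: "(int \<Rightarrow> bool) \<Rightarrow> (int \<times> int) list \<Rightarrow> (int \<Rightarrow> int \<Rightarrow> real) \<Rightarrow> (int \<Rightarrow> nat \<Rightarrow> real) \<Rightarrow> (int \<Rightarrow> real) \<Rightarrow> int \<Rightarrow> int \<Rightarrow> real" where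
  "run \<eta> [] W c b = W"
| "run \<eta> ((x, y) # cs) W c b =
    (let s = cell_site \<eta> x y; S = max (clear_time \<eta> W (x - 1) y) (clear_time \<eta> W x (y + 1));
         u = max 0 (S - b s); v = resid (c s) u
     in run \<eta> cs (W(x := (W x)(y := v))) (c(s := post (c s) u)) (b(s := S + v)))"

lemma ring_idx_exceeds: "good_clock s \<Longrightarrow> u < (\<Sum>l\<le>ring_idx s u. s l)"
  unfolding ring_idx_def good_clock_def by (rule LeastI_ex) blast

lemma resid_pos: "good_clock s \<Longrightarrow> 0 < resid s u"
  using ring_idx_exceeds[of s u] by (simp add: resid_def)

lemma sum_atMost_split:
  fixes s :: "nat \<Rightarrow> real"
  shows "(\<Sum>l\<le>Suc (k + m). s l) = (\<Sum>l\<le>k. s l) + (\<Sum>l\<le>m. s (Suc (k + l)))"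
  by (induction m) auto

lemma good_clock_post:
  assumes "good_clock s"
  shows "good_clock (post s u)"
  unfolding good_clock_def
proof (intro conjI allI)
  show "0 < post s u n" for n using assms by (simp add: good_clock_def post_def)
  fix v
  let ?k = "ring_idx s u"
  have pos: "\<And>n. 0 < s n" using assms by (simp add: good_clock_def)
  obtain m where m: "(\<Sum>l\<le>?k. s l) + v < (\<Sum>l\<le>m. s l)" using assms by (auto simp: good_clock_def)
  have "(\<Sum>l\<le>m. s l) \<le> (\<Sum>l\<le>Suc (?k + m). s l)"
    by (rule sum_mono2) (auto intro: less_imp_le pos)
  then show "\<exists>m. v < (\<Sum>l\<le>m. post s u l)"
    using m unfolding sum_atMost_split post_def by (intro exI[of _ m]) auto
qed

lemma rings_at_post:
  assumes g: "good_clock s" and u: "0 \<le> u"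
  shows "rings_at s (u + resid s u)" "\<And>t. u < t \<Longrightarrow> t < u + resid s u \<Longrightarrow> \<not> rings_at s t"
    "{t. u + resid s u < t \<and> rings_at s t} = {u + resid s u + t' | t'. rings_at (post s u) t'}"
proof -
  let ?k = "ring_idx s u"
  have pos: "\<And>n. 0 < s n" using g by (simp add: good_clock_def)
  have mono: "(\<Sum>l\<le>m. s l) \<le> (\<Sum>l\<le>m'. s l)" if "m \<le> m'" for m m'
    using that by (intro sum_mono2) (auto intro: less_imp_le pos)
  have e: "u + resid s u = (\<Sum>l\<le>?k. s l)" by (simp add: resid_def)
  show "rings_at s (u + resid s u)" unfolding e rings_at_def by blast
  show "\<not> rings_at s t" if "u < t" "t < u + resid s u" for t
  proof
    assume "rings_at s t"
    then obtain m where m: "t = (\<Sum>l\<le>m. s l)" by (auto simp: rings_at_def)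
    then have "?k \<le> m" unfolding ring_idx_def using that by (intro Least_le) simp
    then show False using mono[of ?k m] that m e by simp
  qed
  show "{t. u + resid s u < t \<and> rings_at s t} = {u + resid s u + t' | t'. rings_at (post s u) t'}"
    unfolding e
  proof (intro set_eqI iffI; clarsimp)
    fix t assume t: "(\<Sum>l\<le>?k. s l) < t" "rings_at s t"
    then obtain m where m: "t = (\<Sum>l\<le>m. s l)" by (auto simp: rings_at_def)
    then have "?k < m" using mono[of m ?k] t by (auto simp: not_le[symmetric])
    then obtain d where d: "m = Suc (?k + d)" using less_imp_Suc_add by blast
    then show "\<exists>t'. t = (\<Sum>l\<le>?k. s l) + t' \<and> rings_at (post s u) t'"
      unfolding m rings_at_def d sum_atMost_split post_def by blast
  next
    fix t' assume "rings_at (post s u) t'"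
    then obtain m where m: "t' = (\<Sum>l\<le>m. s (Suc (?k + l)))" by (auto simp: rings_at_def post_def)
    have "0 < t'" unfolding m by (rule sum_pos) (auto intro: pos)
    moreover have "rings_at s ((\<Sum>l\<le>?k. s l) + t')"
      unfolding m sum_atMost_split[symmetric] rings_at_def by blast
    ultimately show "0 < t' \<and> rings_at s ((\<Sum>l\<le>?k. s l) + t')" by simp
  qed
qed

text \<open>Each exchange moves particle i one site to the left, so the bound on its position says
  that all holes starting in [y, r i 0) have been overtaken.\<close>

definition clears :: "(int \<Rightarrow> real \<Rightarrow> int) \<Rightarrow> (int \<Rightarrow> bool) \<Rightarrow> (int \<Rightarrow> int \<Rightarrow> real) \<Rightarrow> int \<Rightarrow> int \<Rightarrow> bool" where
  "clears r \<eta> W i y \<longleftrightarrow> 0 \<le> clear_time \<eta> W (r i 0) y \<and>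
    (\<forall>t\<ge>0. r i t \<le> r i 0 - hcount \<eta> y (r i 0) \<longleftrightarrow> clear_time \<eta> W (r i 0) y \<le> t)"

text \<open>The order of the sweep: particles from left to right, and for each particle the holes
  from right to left. Both predecessors of a cell come earlier, and cells with the same
  \<open>cell_site\<close> come in chronological order.\<close>

definition cell_less :: "int \<times> int \<Rightarrow> int \<times> int \<Rightarrow> bool" where
  "cell_less p q \<longleftrightarrow> fst p < fst q \<or> fst p = fst q \<and> snd q < snd p"

section \<open>Correctness of the sweep for a fixed realisation\<close>

context
  fixes e :: "int \<Rightarrow> nat \<Rightarrow> real" and r :: "int \<Rightarrow> real \<Rightarrow> int" and \<eta> :: "int \<Rightarrow> bool"
  assumes path: "tasep_path e r" and \<eta>: "\<eta> = occupied (\<lambda>i. r i 0)"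
begin

lemma clears_base: "r i 0 \<le> y \<Longrightarrow> clears r \<eta> W i y"
  using path_antimono[OF path order_refl, of _ i] unfolding clears_def by (simp add: clear_time_empty hcount_empty)

lemma particle_occupied [simp]: "\<eta> (r i 0)"
  by (auto simp: \<eta> occupied_def)

text \<open>A site carrying a particle changes neither \<open>clear_time\<close> nor the number of
  holes, so only those lower ends that are holes have to be processed.\<close>

lemma clears_extend:
  assumes "\<And>y. a \<le> y \<Longrightarrow> y < r i 0 \<Longrightarrow> \<not> \<eta> y \<Longrightarrow> clears r \<eta> W i y"
  shows "clears r \<eta> W i a"
  using assms
proof (induction "nat (r i 0 - a)" arbitrary: a)
  case 0
  then show ?case by (intro clears_base) simp
next
  case (Suc n)
  show ?case
  proof (cases "\<eta> a")
    case False then show ?thesis using Suc by auto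
  next
    case True
    have "clears r \<eta> W i (a + 1)"     proof (rule Suc.hyps(1))
      show "n = nat (r i 0 - (a + 1))" using Suc.hyps(2) by simp
      show "clears r \<eta> W i y" if "a + 1 \<le> y" "y < r i 0" "\<not> \<eta> y" for y
        by (rule Suc.prems) (use that in auto)
    qed
    moreover have "clear_time \<eta> W (r i 0) a = clear_time \<eta> W (r i 0) (a + 1)"
      using True Suc.hyps(2) by (subst clear_time.simps) simp
    moreover have "hcount \<eta> a (r i 0) = hcount \<eta> (a + 1) (r i 0)"
      using True Suc.hyps(2) by (subst hcount_first) auto
    ultimately show ?thesis by (simp add: clears_def)
  qed
qed

lemma no_particle_between: "r (i - 1) 0 < z \<Longrightarrow> z < r i 0 \<Longrightarrow> \<not> \<eta> z"
proof
  assume z: "r (i - 1) 0 < z" "z < r i 0" "\<eta> z"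
  then obtain j where j: "r j 0 = z" by (auto simp: \<eta> occupied_def)
  have "strict_mono (\<lambda>i. r i 0)" by (rule path_strict_mono[OF path]) simp
  then have "i - 1 < j" "j < i"
    using z(1,2) j strict_mono_less[of "\<lambda>i. r i 0" "i - 1" j] strict_mono_less[of "\<lambda>i. r i 0" j i] by auto
  then show False by simp
qed

text \<open>Once the left neighbour has overtaken the hole y as well, it stands at or left of
  \<open>cell_site\<close> - 2 and the target site of the jump is free. A neighbour that starts to
  the left of y is never in the way.\<close>

lemma clears_left:
  assumes y: "y < r i 0" "\<not> \<eta> y" and c: "y < r (i - 1) 0 \<Longrightarrow> clears r \<eta> W (i - 1) y"
  shows "0 \<le> clear_time \<eta> W (r i 0 - 1) y"
    "0 \<le> t \<Longrightarrow> r (i - 1) t \<le> cell_site \<eta> (r i 0) y - 2 \<longleftrightarrow> clear_time \<eta> W (r i 0 - 1) y \<le> t"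
proof -
  define x where "x = r i 0"
  define x' where "x' = r (i - 1) 0"
  have x': "x' < x" using path_order[OF path, of 0 "i - 1"] by (simp add: x_def x'_def)
  have gap: "\<And>z. x' < z \<Longrightarrow> z < x \<Longrightarrow> \<not> \<eta> z" using no_particle_between by (simp add: x_def x'_def)
  have eq: "clear_time \<eta> W (x - 1) y = clear_time \<eta> W x' y"
    using x' gap by (intro clear_time_skip) auto
  have hs: "cell_site \<eta> x y = x - hcount \<eta> y x + 1"
    using y hcount_first[of y x \<eta>] by (simp add: cell_site_def x_def)
  have "y \<noteq> x'" using y(2) by (auto simp: x'_def)
  then consider "y < x'" | "x' < y" by linarith
  then have "0 \<le> clear_time \<eta> W (x - 1) y \<and> (0 \<le> t \<longrightarrow> (r (i - 1) t \<le> cell_site \<eta> x y - 2 \<longleftrightarrow> clear_time \<eta> W (x - 1) y \<le> t))"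
  proof cases
    case 1
    have "hcount \<eta> y x = hcount \<eta> y x' + (x - x' - 1)"
      using 1 x' gap by (intro hcount_skip) (auto simp: x'_def)
    then have "cell_site \<eta> x y - 2 = x' - hcount \<eta> y x'" unfolding hs by simp
    then show ?thesis using c 1 by (simp add: eq clears_def x'_def)
  next
    case 2
    have "hcount \<eta> y x = x - y" using 2 y gap by (intro hcount_all_holes) (auto simp: x_def)
    then have "cell_site \<eta> x y - 2 = y - 1" unfolding hs by simp
    moreover have "r (i - 1) t \<le> x'" if "0 \<le> t" using path_antimono[OF path, of 0 t "i - 1"] that by (simp add: x'_def)
    ultimately show ?thesis using 2 by (auto simp: eq clear_time_empty)
  qed
  then show "0 \<le> clear_time \<eta> W (r i 0 - 1) y"
    "0 \<le> t \<Longrightarrow> r (i - 1) t \<le> cell_site \<eta> (r i 0) y - 2 \<longleftrightarrow> clear_time \<eta> W (r i 0 - 1) y \<le> t"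
    by (auto simp: x_def)
qed

text \<open>The third clause remembers how b s arose: it is the time until which some processed
  particle had not yet left s. It serves to show that the base time never exceeds the moment from
  which the next cell at s waits.\<close>

definition clock_inv :: "(int \<times> int) list \<Rightarrow> (int \<Rightarrow> int \<Rightarrow> real) \<Rightarrow> (int \<Rightarrow> nat \<Rightarrow> real) \<Rightarrow> (int \<Rightarrow> real) \<Rightarrow> bool" where
  "clock_inv cs W c b \<longleftrightarrow>
    (\<forall>i y. (r i 0, y) \<in> set cs \<longrightarrow> clears r \<eta> W i y) \<and>
    (\<forall>s. good_clock (c s) \<and> 0 \<le> b s \<and> {t. b s < t \<and> rings_at (e s) t} = {b s + t' | t'. rings_at (c s) t'}) \<and>
    (\<forall>s. b s = 0 \<or> (\<exists>i y. (r i 0, y) \<in> set cs \<and> cell_site \<eta> (r i 0) y = s \<and> (\<forall>t. 0 \<le> t \<longrightarrow> t < b s \<longrightarrow> s \<le> r i t)))"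

lemma run_step:
  assumes inv: "clock_inv cs W c b" and i: "r i 0 = x" and y: "y < x" "\<not> \<eta> y"
    and right: "clears r \<eta> W i (y + 1)" and left: "y < r (i - 1) 0 \<Longrightarrow> clears r \<eta> W (i - 1) y"
    and less: "\<And>p. p \<in> set cs \<Longrightarrow> cell_less p (x, y) \<and> snd p < fst p \<and> \<not> \<eta> (snd p)"
    and s: "s = cell_site \<eta> x y" and S: "S = max (clear_time \<eta> W (x - 1) y) (clear_time \<eta> W x (y + 1))"
    and u: "u = max 0 (S - b s)" and v: "v = resid (c s) u"
  shows "clock_inv (cs @ [(x, y)]) (W(x := (W x)(y := v))) (c(s := post (c s) u)) (b(s := S + v))"
proof -
  define W' where "W' = W(x := (W x)(y := v))"
  have inv1: "\<And>i y. (r i 0, y) \<in> set cs \<Longrightarrow> clears r \<eta> W i y"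
    and inv2: "\<And>s. good_clock (c s)" "\<And>s. 0 \<le> b s" "\<And>s. {t. b s < t \<and> rings_at (e s) t} = {b s + t' | t'. rings_at (c s) t'}"
    and inv3: "\<And>s. b s = 0 \<or> (\<exists>i y. (r i 0, y) \<in> set cs \<and> cell_site \<eta> (r i 0) y = s \<and> (\<forall>t. 0 \<le> t \<longrightarrow> t < b s \<longrightarrow> s \<le> r i t))"
    using inv unfolding clock_inv_def by auto
  note lf = clears_left[of y i W, OF y(1)[folded i] y(2) left, unfolded i, folded s]
  have rt: "0 \<le> clear_time \<eta> W x (y + 1)" "\<And>t. 0 \<le> t \<Longrightarrow> r i t \<le> s \<longleftrightarrow> clear_time \<eta> W x (y + 1) \<le> t"
    using right unfolding clears_def i s cell_site_def by auto
  have S0: "0 \<le> S" using rt(1) by (simp add: S)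
  \<comment> \<open>The particle i' that last used the clock at s is not i itself, whose site moves
    strictly left with every further hole. It is therefore strictly to the left of i, hence at or
    left of s - 2 at time S, whereas before time b s it was still at s or to the right of
    it.\<close>
  have bS: "b s \<le> S"
  proof (rule ccontr)
    assume n: "\<not> b s \<le> S"
    then have "b s \<noteq> 0" using S0 by auto
    then obtain i' y' where i': "(r i' 0, y') \<in> set cs" "cell_site \<eta> (r i' 0) y' = s" "\<And>t. 0 \<le> t \<Longrightarrow> t < b s \<Longrightarrow> s \<le> r i' t"
      using inv3 by blast
    have sm: "strict_mono (\<lambda>i. r i 0)" by (rule path_strict_mono[OF path]) simp
    have "i' < i"
    proof (rule ccontr)
      assume "\<not> i' < i"
      then have "x \<le> r i' 0" using sm i by (metis not_less strict_mono_less_eq)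
      then have xx: "r i' 0 = x" "y < y'" using less[OF i'(1)] by (auto simp: cell_less_def)
      have "y' < x" "\<not> \<eta> y'" using less[OF i'(1)] xx by auto
      then have "hcount \<eta> (y + 1) x = hcount \<eta> (y + 1) y' + (1 + hcount \<eta> (y' + 1) x)"
        using xx(2) hcount_split[of "y + 1" y' x \<eta>] hcount_first[of y' x \<eta>] by simp
      then show False using i'(2)[unfolded s cell_site_def xx(1)] hcount_nonneg[of \<eta> "y + 1" y'] by linarith
    qed
    then have "r i' S \<le> r (i - 1) S"
      using strict_mono_less_eq[OF path_strict_mono[OF path S0], of i' "i - 1"] by simp
    also have "\<dots> \<le> s - 2" using lf(2)[OF _ S0] by (simp add: S)
    finally show False using i'(3)[OF S0] n by simp
  qed
  then have uS: "u = S - b s" "0 \<le> u" "b s + u = S" using u by auto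
  have v0: "0 < v" unfolding v by (rule resid_pos) (rule inv2)
  note rp = rings_at_post[OF inv2(1)[of s] uS(2), folded v]
  have ring: "rings_at (e s) (S + v)"
  proof -
    have "b s + (u + v) \<in> {b s + t' | t'. rings_at (c s) t'}" using rp(1) by blast
    then have "b s + (u + v) \<in> {t. b s < t \<and> rings_at (e s) t}" by (simp only: inv2(3))
    then show ?thesis using uS by (simp add: add.assoc[symmetric])
  qed
  have noring: "\<not> rings_at (e s) t" if "S < t" "t < S + v" for t
  proof
    assume "rings_at (e s) t"
    then have "t \<in> {t. b s < t \<and> rings_at (e s) t}" using that bS by simp
    then obtain t' where t': "t = b s + t'" "rings_at (c s) t'" unfolding inv2(3) by blast
    show False using rp(2)[of t'] that t' uS by auto
  qed
  have jump: "r i t \<le> s - 1 \<longleftrightarrow> S + v \<le> t" if "0 \<le> t" for t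
  proof (rule jump_time[OF path rt(1) rt(2) lf(1) lf(2)])
    show "s \<le> r i 0" by (simp add: i s cell_site_def)
    show "max (clear_time \<eta> W x (y + 1)) (clear_time \<eta> W (x - 1) y) < S + v"
      using v0 by (simp add: S max.commute)
    show "rings_at (e s) (S + v)" by (rule ring)
    show "\<not> rings_at (e s) t" if "max (clear_time \<eta> W x (y + 1)) (clear_time \<eta> W (x - 1) y) < t" "t < S + v" for t
      using that by (intro noring) (auto simp: S max.commute)
  qed (use that left in auto)
  \<comment> \<open>The new weight enters only clear times with particle end weakly right of x and
    hole end weakly left of y; the order of the sweep has processed none of these cells.\<close>
  have keep: "clear_time \<eta> W' a d = clear_time \<eta> W a d" if "\<not> (d \<le> y \<and> x \<le> a)" for a d
    using that by (intro clear_time_cong) (auto simp: W'_def)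
  have new: "clear_time \<eta> W' x y = S + v"
  proof -
    have "clear_time \<eta> W' x y = max (clear_time \<eta> W' (x - 1) y) (clear_time \<eta> W' x (y + 1)) + W' x y"
      using y particle_occupied[of i] unfolding i by (subst clear_time.simps) simp
    also have "W' x y = v" by (simp add: W'_def)
    finally show ?thesis by (simp add: keep S)
  qed
  have "clears r \<eta> W' i y"
    unfolding clears_def i new
  proof (intro conjI allI impI)
    show "0 \<le> S + v" using S0 v0 by simp
    have "x - hcount \<eta> y x = s - 1" using y hcount_first[of y x \<eta>] by (simp add: s cell_site_def)
    then show "r i t \<le> x - hcount \<eta> y x \<longleftrightarrow> S + v \<le> t" if "0 \<le> t" for t
      using jump[OF that] by simp
  qed
  moreover have "clears r \<eta> W' j d" if "(r j 0, d) \<in> set cs" for j d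
  proof -
    have "\<not> (d \<le> y \<and> x \<le> r j 0)" using less[OF that] by (auto simp: cell_less_def)
    then show ?thesis using inv1[OF that] by (simp add: clears_def keep)
  qed
  moreover have "j = i" if "r j 0 = x" for j
    using path_strict_mono[OF path, of 0] that i by (metis order_refl strict_mono_eq)
  ultimately have 1: "\<forall>j d. (r j 0, d) \<in> set (cs @ [(x, y)]) \<longrightarrow> clears r \<eta> W' j d"
    by auto
  have 2: "{t. S + v < t \<and> rings_at (e s) t} = {S + v + t' | t'. rings_at (post (c s) u) t'}"
  proof -
    have "{t. S + v < t \<and> rings_at (e s) t} = {t. S + v < t \<and> t \<in> {t. b s < t \<and> rings_at (e s) t}}"
      using bS v0 by auto
    also have "\<dots> = {b s + t' | t'. t' \<in> {t. u + v < t \<and> rings_at (c s) t}}"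
      unfolding inv2(3) using uS by auto
    also have "\<dots> = {S + v + t' | t'. rings_at (post (c s) u) t'}"
      unfolding rp(3) using uS(3)[symmetric] by (auto simp: add.assoc)
    finally show ?thesis .
  qed
  show ?thesis
    unfolding clock_inv_def W'_def[symmetric]
  proof (intro conjI 1)
    show "\<forall>s'. good_clock ((c(s := post (c s) u)) s') \<and> 0 \<le> (b(s := S + v)) s' \<and>
      {t. (b(s := S + v)) s' < t \<and> rings_at (e s') t} = {(b(s := S + v)) s' + t' | t'. rings_at ((c(s := post (c s) u)) s') t'}"
      using inv2 2 S0 v0 good_clock_post[OF inv2(1)] by auto
    show "\<forall>s'. (b(s := S + v)) s' = 0 \<or> (\<exists>i d. (r i 0, d) \<in> set (cs @ [(x, y)]) \<and> cell_site \<eta> (r i 0) d = s' \<and> (\<forall>t. 0 \<le> t \<longrightarrow> t < (b(s := S + v)) s' \<longrightarrow> s' \<le> r i t))"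
    proof
      fix s'
      show "(b(s := S + v)) s' = 0 \<or> (\<exists>i d. (r i 0, d) \<in> set (cs @ [(x, y)]) \<and> cell_site \<eta> (r i 0) d = s' \<and> (\<forall>t. 0 \<le> t \<longrightarrow> t < (b(s := S + v)) s' \<longrightarrow> s' \<le> r i t))"
      proof (cases "s' = s")
        case True
        have "s \<le> r i t" if "0 \<le> t" "t < S + v" for t using jump[OF that(1)] that by simp
        then show ?thesis using True i s by (intro disjI2 exI[of _ i] exI[of _ y]) auto
      next
        case False
        then show ?thesis using inv3[of s'] by auto
      qed
    qed
  qed
qed

text \<open>\<open>cs\<close> is the processed and \<open>ds\<close> the remaining part of the
  sweep; because the list is sorted and complete, both predecessors of the next cell lie in
  \<open>cs\<close>.\<close>

lemma run_correct:
  assumes "clock_inv cs W c b"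
    and "sorted_wrt cell_less (cs @ ds)"
    and "set (cs @ ds) = {(x, y). lo \<le> y \<and> y < x \<and> x \<le> hi \<and> \<eta> x \<and> \<not> \<eta> y}"
    and "lo \<le> a" "r j 0 \<le> hi"
  shows "clears r \<eta> (run \<eta> ds W c b) j a"
  using assms(1-3)
proof (induction ds arbitrary: cs W c b)
  case Nil
  show ?case
  proof (rule clears_extend)
    fix y assume "a \<le> y" "y < r j 0" "\<not> \<eta> y"
    then have "(r j 0, y) \<in> set cs" using Nil(3) assms(4,5) by simp
    then show "clears r \<eta> (run \<eta> [] W c b) j y" using Nil(1) unfolding clock_inv_def by simp
  qed
next
  case (Cons p ds)
  obtain x y where p: "p = (x, y)" by (cases p) auto
  have xy: "lo \<le> y" "y < x" "x \<le> hi" "\<eta> x" "\<not> \<eta> y" using Cons.prems(3) p by auto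
  then obtain i where i: "r i 0 = x" by (auto simp: \<eta> occupied_def)
  have after: "cell_less (x, y) q" if "q \<in> set ds" for q
    using Cons.prems(2) that p by (auto simp: sorted_wrt_append)
  have indone: "q \<in> set cs" if "cell_less q (x, y)" "lo \<le> snd q" "snd q < fst q" "fst q \<le> hi" "\<eta> (fst q)" "\<not> \<eta> (snd q)" for q
  proof -
    have "q \<in> set (cs @ p # ds)" unfolding Cons.prems(3) using that by (cases q) auto
    moreover have "q \<noteq> p" using that(1) p by (auto simp: cell_less_def)
    moreover have "q \<notin> set ds" using after[of q] that(1) by (auto simp: cell_less_def)
    ultimately show ?thesis by simp
  qed
  have inv1: "\<And>i y. (r i 0, y) \<in> set cs \<Longrightarrow> clears r \<eta> W i y"
    using Cons.prems(1) unfolding clock_inv_def by auto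
  have right: "clears r \<eta> W i (y + 1)"
  proof (rule clears_extend)
    fix z assume z: "y + 1 \<le> z" "z < r i 0" "\<not> \<eta> z"
    then have "(r i 0, z) \<in> set cs" using xy i by (intro indone) (auto simp: cell_less_def)
    then show "clears r \<eta> W i z" by (rule inv1)
  qed
  have left: "clears r \<eta> W (i - 1) y" if "y < r (i - 1) 0"
  proof -
    have "r (i - 1) 0 < x" using path_order[OF path, of 0 "i - 1"] i by simp
    then have "(r (i - 1) 0, y) \<in> set cs" using xy that by (intro indone) (auto simp: cell_less_def)
    then show ?thesis by (rule inv1)
  qed
  have less: "cell_less q (x, y) \<and> snd q < fst q \<and> \<not> \<eta> (snd q)" if "q \<in> set cs" for q
  proof -
    have "q \<in> set (cs @ p # ds)" using that by simp
    then have "snd q < fst q \<and> \<not> \<eta> (snd q)" unfolding Cons.prems(3) by auto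
    then show ?thesis using Cons.prems(2) that p by (auto simp: sorted_wrt_append)
  qed
  note st = run_step[OF Cons.prems(1) i xy(2) xy(5) right left less refl refl refl refl]
  show ?case
    unfolding p run.simps Let_def
    by (rule Cons.IH[OF st]) (use Cons.prems(2,3) p in auto)
qed

lemma clock_inv_start:
  assumes "\<And>s. good_clock (e s)"
  shows "clock_inv [] W e (\<lambda>_. 0)"
proof -
  have "0 < t" if "rings_at (e s) t" for s t
    using that assms[of s] by (auto simp: rings_at_def good_clock_def intro!: sum_pos)
  then show ?thesis using assms by (auto simp: clock_inv_def)
qed

end

definition cells :: "(int \<Rightarrow> bool) \<Rightarrow> int \<Rightarrow> int \<Rightarrow> (int \<times> int) list" where
  "cells \<eta> lo hi = concat (map (\<lambda>x. map (Pair x) (filter (\<lambda>y. y < x \<and> \<eta> x \<and> \<not> \<eta> y) (rev [lo..hi]))) [lo..hi])"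

lemma set_cells: "set (cells \<eta> lo hi) = {(x, y). lo \<le> y \<and> y < x \<and> x \<le> hi \<and> \<eta> x \<and> \<not> \<eta> y}"
  unfolding cells_def by (auto simp: image_iff intro!: bexI)

lemma sorted_wrt_concat_map:
  assumes "sorted_wrt (<) xs" "\<And>x. x \<in> set xs \<Longrightarrow> sorted_wrt cell_less (f x)"
    "\<And>x p. p \<in> set (f x) \<Longrightarrow> fst p = (x :: int)"
  shows "sorted_wrt cell_less (concat (map f xs))"
  using assms(1,2)
proof (induction xs)
  case (Cons a xs)
  then show ?case by (auto simp: sorted_wrt_append cell_less_def dest!: assms(3))
qed simp

lemma sorted_cells: "sorted_wrt cell_less (cells \<eta> lo hi)"
  unfolding cells_def
proof (rule sorted_wrt_concat_map)
  show "sorted_wrt (<) [lo..hi]" by simp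
  show "sorted_wrt cell_less (map (Pair x) (filter (\<lambda>y. y < x \<and> \<eta> x \<and> \<not> \<eta> y) (rev [lo..hi])))" for x
    by (auto simp: sorted_wrt_map cell_less_def sorted_wrt_rev intro!: sorted_wrt_filter)
qed auto

lemma clear_time_correct:
  assumes path: "tasep_path e r" and good: "\<And>s. good_clock (e s)" and \<eta>: "\<eta> = occupied (\<lambda>i. r i 0)"
    and a: "lo \<le> a" "r j 0 \<le> hi" and t: "0 \<le> t"
  shows "r j t \<le> r j 0 - hcount \<eta> a (r j 0) \<longleftrightarrow> clear_time \<eta> (run \<eta> (cells \<eta> lo hi) W e (\<lambda>_. 0)) (r j 0) a \<le> t"
  using run_correct[OF path \<eta> clock_inv_start[OF path \<eta> good], of "cells \<eta> lo hi" lo hi a j W] sorted_cells set_cells a t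
  by (simp add: clears_def)

section \<open>The law of the weights revealed by the clocks\<close>

abbreviation fieldm :: "'b measure \<Rightarrow> (int \<Rightarrow> 'b) measure" where
  "fieldm M \<equiv> PiM UNIV (\<lambda>_. M)"

lemma sets_fieldm_seqm_expm [measurable_cong]: "sets (fieldm (seqm (expm r))) = sets (fieldm (seqm borel))"
  by (intro sets_PiM_cong) (auto simp: sets_seqm_expm)

text \<open>For every n the first n waiting times sum to at most N with probability at most 2^(-n)
  exp N, so almost surely the rings of a clock exceed every N.\<close>

lemma AE_good_clock: "AE s in seqm (expm 1). good_clock s"
proof -
  interpret S: prob_space "seqm (expm 1)" by (rule prob_seqm_expm) simp
  have 1: "AE s in seqm (expm 1). \<exists>m. real N < (\<Sum>l\<le>m. s l)" for N
  proof (rule AE_I')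
    define B where "B = {s \<in> space (seqm (expm 1)). \<forall>m. (\<Sum>l\<le>m. s l) \<le> real N}"
    have B [measurable]: "B \<in> S.events" unfolding B_def by measurable
    have bd: "S.prob B \<le> (1 / 2) ^ n * exp (real N)" for n
    proof -
      have "S.prob B \<le> S.prob {s \<in> space (seqm (expm 1)). - real N \<le> - (\<Sum>l<n. s l)}"
      proof (rule S.finite_measure_mono)
        show "B \<subseteq> {s \<in> space (seqm (expm 1)). - real N \<le> - (\<Sum>l<n. s l)}"
        proof
          fix s assume s: "s \<in> B"
          then have "(\<Sum>l<n. s l) \<le> real N"
            by (cases n) (auto simp: B_def lessThan_Suc_atMost)
          then show "s \<in> {s \<in> space (seqm (expm 1)). - real N \<le> - (\<Sum>l<n. s l)}" using s by (auto simp: B_def)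
        qed
      qed measurable
      also have "\<dots> \<le> (1 / 2) ^ n * exp (- (1 * (- real N)))"
      proof (rule S.exp_markov)
        show "(\<integral>\<^sup>+\<omega>. ennreal (exp (1 * - sum \<omega> {..<n})) \<partial>seqm (expm 1)) \<le> ennreal ((1 / 2) ^ n)"
          using nn_integral_exp_sum[of 1 "-1" n] by simp
      qed auto
      finally show ?thesis by simp
    qed
    have lim: "(\<lambda>n. (1 / 2 :: real) ^ n * exp (real N)) \<longlonglongrightarrow> 0 * exp (real N)"
      by (intro tendsto_mult LIMSEQ_realpow_zero tendsto_const) auto
    have "S.prob B \<le> 0 * exp (real N)"
      by (rule LIMSEQ_le_const[OF lim], intro exI allI impI, rule bd)
    then have "S.prob B = 0" using measure_nonneg[of "seqm (expm 1)" B] by simp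
    then show "B \<in> null_sets (seqm (expm 1))" by (simp add: null_sets_def S.emeasure_eq_measure)
    show "{s \<in> space (seqm (expm 1)). \<not> (\<exists>m. real N < (\<Sum>l\<le>m. s l))} \<subseteq> B"
      by (auto simp: B_def not_less)
  qed
  have 2: "AE s in seqm (expm 1). \<forall>N::nat. \<exists>m. real N < (\<Sum>l\<le>m. s l)"
    using 1 by (simp add: AE_all_countable)
  show ?thesis
    using 2 AE_seqm_expm_pos[of 1, simplified]
  proof eventually_elim
    case (elim s)
    have "\<exists>m. u < (\<Sum>l\<le>m. s l)" for u
    proof -
      obtain N :: nat where "u < real N" using reals_Archimedean2 by blast
      then show ?thesis using elim(1)[rule_format, of N] less_trans by blast
    qed
    then show ?case using elim(2) by (simp add: good_clock_def)
  qed
qed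

text \<open>The event that the ring index is m, written without \<open>LEAST\<close> so that waiting
  times can be peeled off one by one.\<close>

definition idx_event :: "nat \<Rightarrow> (nat \<Rightarrow> real) \<Rightarrow> real \<Rightarrow> bool" where
  "idx_event m s u \<longleftrightarrow> (\<forall>k<m. (\<Sum>l\<le>k. s l) \<le> u) \<and> u < (\<Sum>l\<le>m. s l)"

lemma idx_event_unique: "good_clock s \<Longrightarrow> idx_event m s u \<longleftrightarrow> m = ring_idx s u"
proof
  assume g: "good_clock s" and "idx_event m s u"
  then show "m = ring_idx s u" unfolding idx_event_def ring_idx_def
    by (intro Least_equality[symmetric]) (auto simp: not_less[symmetric])
next
  assume g: "good_clock s" and m: "m = ring_idx s u"
  then show "idx_event m s u"
    using ring_idx_exceeds[OF g, of u] unfolding idx_event_def ring_idx_def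
    by (auto dest: not_less_Least simp: not_less)
qed

lemma idx_event_Suc: "idx_event (Suc m) (case_nat x s) u \<longleftrightarrow> x \<le> u \<and> idx_event m s (u - x)"
  unfolding idx_event_def
  by (auto simp: less_Suc_eq_0_disj sum.atMost_Suc_shift algebra_simps simp del: sum.atMost_Suc)

definition clock_part :: "nat \<Rightarrow> real \<Rightarrow> (real \<Rightarrow> (nat \<Rightarrow> real) \<Rightarrow> ennreal) \<Rightarrow> ennreal" where
  "clock_part m u f = (\<integral>\<^sup>+s. indicator {s. idx_event m s u} s * f ((\<Sum>l\<le>m. s l) - u) (\<lambda>k. s (Suc (m + k))) \<partial>seqm (expm 1))"

lemma measurable_idx_event [measurable]:
  assumes [measurable]: "f \<in> measurable M (seqm borel)" "g \<in> borel_measurable M"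
  shows "Measurable.pred M (\<lambda>x. idx_event m (f x) (g x))"
  unfolding idx_event_def by measurable

text \<open>Induction over the rings up to u: each peeled waiting time lowers u, and at the last one
  lack of memory makes the residual wait a fresh unit exponential. So for every fixed ring index the
  residual wait and the later clock have their product law.\<close>

lemma clock_part_factor:
  assumes "0 \<le> u" and f [measurable]: "case_prod f \<in> borel_measurable (borel \<Otimes>\<^sub>M seqm borel)"
  shows "clock_part m u f = clock_part m u (\<lambda>_ _. 1) * (\<integral>\<^sup>+v. (\<integral>\<^sup>+s. f v s \<partial>seqm (expm 1)) \<partial>expm 1)"
  using assms(1)
proof (induction m arbitrary: u)
  interpret S: prob_space "seqm (expm 1)" by (rule prob_seqm_expm) simp
  have p: "prob_space (expm 1)" by (rule prob_space_expm) simp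
  have base: "clock_part 0 u f = ennreal (exp (- 1 * u)) * (\<integral>\<^sup>+v. (\<integral>\<^sup>+s. f v s \<partial>seqm (expm 1)) \<partial>expm 1)"
    if u: "0 \<le> u" and [measurable]: "case_prod f \<in> borel_measurable (borel \<Otimes>\<^sub>M seqm borel)" for u f
  proof -
    have "clock_part 0 u f = (\<integral>\<^sup>+x. (\<integral>\<^sup>+s. indicator {s. idx_event 0 s u} (case_nat x s) * f ((\<Sum>l\<le>0. case_nat x s l) - u) (\<lambda>k. case_nat x s (Suc (0 + k))) \<partial>seqm (expm 1)) \<partial>expm 1)"
      unfolding clock_part_def by (intro nn_integral_seqm p) measurable
    also have "\<dots> = (\<integral>\<^sup>+x. (\<integral>\<^sup>+s. indicator {u<..} x * f (x - u) s \<partial>seqm (expm 1)) \<partial>expm 1)"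
      by (intro nn_integral_cong) (simp add: idx_event_def indicator_def)
    also have "\<dots> = (\<integral>\<^sup>+x. indicator {u<..} x * (\<integral>\<^sup>+s. f (x - u) s \<partial>seqm (expm 1)) \<partial>expm 1)"
      by (intro nn_integral_cong) (auto simp: indicator_def)
    also have "\<dots> = ennreal (exp (- 1 * u)) * (\<integral>\<^sup>+x. (\<integral>\<^sup>+s. f ((u + x) - u) s \<partial>seqm (expm 1)) \<partial>expm 1)"
      by (rule expm_tail_less) (use u in auto)
    finally show ?thesis by simp
  qed
  case 0
  have "clock_part 0 u (\<lambda>_ _. 1) = ennreal (exp (- 1 * u))"
    using base[OF 0, of "\<lambda>_ _. 1"] by (simp add: nn_integral_prob_const prob_seqm_expm prob_space_expm del: nn_integral_const)
  then show ?case using base[OF 0 f] by simp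
next
  interpret S: prob_space "seqm (expm 1)" by (rule prob_seqm_expm) simp
  have p: "prob_space (expm 1)" by (rule prob_space_expm) simp
  case (Suc m)
  have step: "clock_part (Suc m) u f = (\<integral>\<^sup>+x. indicator {..u} x * clock_part m (u - x) f \<partial>expm 1)"
    if [measurable]: "case_prod f \<in> borel_measurable (borel \<Otimes>\<^sub>M seqm borel)" for f
  proof -
    have "clock_part (Suc m) u f = (\<integral>\<^sup>+x. (\<integral>\<^sup>+s. indicator {s. idx_event (Suc m) s u} (case_nat x s) * f ((\<Sum>l\<le>Suc m. case_nat x s l) - u) (\<lambda>k. case_nat x s (Suc (Suc m + k))) \<partial>seqm (expm 1)) \<partial>expm 1)"
      unfolding clock_part_def by (intro nn_integral_seqm p) measurable
    also have "\<dots> = (\<integral>\<^sup>+x. (\<integral>\<^sup>+s. indicator {..u} x * (indicator {s. idx_event m s (u - x)} s * f ((\<Sum>l\<le>m. s l) - (u - x)) (\<lambda>k. s (Suc (m + k)))) \<partial>seqm (expm 1)) \<partial>expm 1)"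
      by (intro nn_integral_cong) (auto simp: idx_event_Suc indicator_def sum.atMost_Suc_shift algebra_simps simp del: sum.atMost_Suc)
    also have "\<dots> = (\<integral>\<^sup>+x. indicator {..u} x * clock_part m (u - x) f \<partial>expm 1)"
      unfolding clock_part_def by (intro nn_integral_cong) (auto simp: indicator_def)
    finally show ?thesis .
  qed
  have [measurable]: "(\<lambda>x. clock_part m (u - x) (\<lambda>_ _. 1)) \<in> borel_measurable borel"
    unfolding clock_part_def by measurable
  have "clock_part (Suc m) u f = (\<integral>\<^sup>+x. indicator {..u} x * (clock_part m (u - x) (\<lambda>_ _. 1) * (\<integral>\<^sup>+v. (\<integral>\<^sup>+s. f v s \<partial>seqm (expm 1)) \<partial>expm 1)) \<partial>expm 1)"
    unfolding step[OF f]
  proof (rule nn_integral_cong)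
    fix x
    show "indicator {..u} x * clock_part m (u - x) f = indicator {..u} x * (clock_part m (u - x) (\<lambda>_ _. 1) * (\<integral>\<^sup>+v. (\<integral>\<^sup>+s. f v s \<partial>seqm (expm 1)) \<partial>expm 1))"
      using Suc.IH[of "u - x"] by (auto simp: indicator_def)
  qed
  also have "\<dots> = clock_part (Suc m) u (\<lambda>_ _. 1) * (\<integral>\<^sup>+v. (\<integral>\<^sup>+s. f v s \<partial>seqm (expm 1)) \<partial>expm 1)"
    by (subst step) (auto simp: nn_integral_multc[symmetric] mult.assoc)
  finally show ?case .
qed

lemma clock_parts_sum:
  assumes [measurable]: "case_prod f \<in> borel_measurable (borel \<Otimes>\<^sub>M seqm borel)"
  shows "(\<integral>\<^sup>+s. f (resid s u) (post s u) \<partial>seqm (expm 1)) = (\<Sum>m. clock_part m u f)"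
proof -
  have "(\<integral>\<^sup>+s. f (resid s u) (post s u) \<partial>seqm (expm 1)) =
    (\<integral>\<^sup>+s. (\<Sum>m. indicator {s. idx_event m s u} s * f ((\<Sum>l\<le>m. s l) - u) (\<lambda>k. s (Suc (m + k)))) \<partial>seqm (expm 1))"
  proof (rule nn_integral_cong_AE)
    show "AE s in seqm (expm 1). f (resid s u) (post s u) =
      (\<Sum>m. indicator {s. idx_event m s u} s * f ((\<Sum>l\<le>m. s l) - u) (\<lambda>k. s (Suc (m + k))))"
      using AE_good_clock
    proof eventually_elim
      case (elim s)
      have "(\<Sum>m. indicator {s. idx_event m s u} s * f ((\<Sum>l\<le>m. s l) - u) (\<lambda>k. s (Suc (m + k)))) =
        (\<Sum>m\<in>{ring_idx s u}. indicator {s. idx_event m s u} s * f ((\<Sum>l\<le>m. s l) - u) (\<lambda>k. s (Suc (m + k))))"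
        by (intro suminf_finite) (auto simp: idx_event_unique[OF elim] indicator_def)
      also have "\<dots> = f (resid s u) (post s u)"
        by (simp add: idx_event_unique[OF elim] resid_def post_def[abs_def])
      finally show ?case by simp
    qed
  qed
  also have "\<dots> = (\<Sum>m. clock_part m u f)"
    unfolding clock_part_def by (intro nn_integral_suminf) measurable
  finally show ?thesis .
qed

text \<open>The factors in \<open>clock_part_factor\<close> are the probabilities of the ring
  indices and add up to 1.\<close>

lemma clock_law:
  assumes u: "0 \<le> u" and f [measurable]: "case_prod f \<in> borel_measurable (borel \<Otimes>\<^sub>M seqm borel)"
  shows "(\<integral>\<^sup>+s. f (resid s u) (post s u) \<partial>seqm (expm 1)) = (\<integral>\<^sup>+v. (\<integral>\<^sup>+s. f v s \<partial>seqm (expm 1)) \<partial>expm 1)"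
proof -
  have "(\<Sum>m. clock_part m u (\<lambda>_ _. 1)) = 1"
    using clock_parts_sum[of "\<lambda>_ _. 1" u] by (simp add: nn_integral_prob_const prob_seqm_expm del: nn_integral_const)
  then show ?thesis
    unfolding clock_parts_sum[OF f] clock_part_factor[OF u f] by (simp add: ennreal_suminf_multc)
qed

text \<open>Replacing one coordinate by an independent copy preserves a product law. In this form
  the product space need not be decomposed around the coordinate that a step uses.\<close>

lemma PiM_resample:
  fixes M :: "'i \<Rightarrow> 'b measure"
  assumes M: "\<And>i. prob_space (M i)" and f [measurable]: "f \<in> borel_measurable (PiM UNIV M)"
  shows "(\<integral>\<^sup>+w. f w \<partial>PiM UNIV M) = (\<integral>\<^sup>+w. (\<integral>\<^sup>+x. f (w(i := x)) \<partial>M i) \<partial>PiM UNIV M)"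
proof -
  interpret P: prob_space "PiM UNIV M" by (intro prob_space_PiM M)
  have eq: "distr (M i \<Otimes>\<^sub>M PiM UNIV M) (PiM UNIV M) (\<lambda>(x, X). X(i := x)) = PiM UNIV M"
    using distr_pair_PiM_eq_PiM[of UNIV M i] M by simp
  have [measurable]: "(\<lambda>(x, X). X(i := x)) \<in> measurable (M i \<Otimes>\<^sub>M PiM UNIV M) (PiM UNIV M)"
    unfolding split_beta' by (rule measurable_fun_upd[where J=UNIV]) auto
  have "(\<integral>\<^sup>+w. f w \<partial>PiM UNIV M) = (\<integral>\<^sup>+w. f w \<partial>distr (M i \<Otimes>\<^sub>M PiM UNIV M) (PiM UNIV M) (\<lambda>(x, X). X(i := x)))"
    by (simp add: eq)
  also have "\<dots> = (\<integral>\<^sup>+p. f (case p of (x, X) \<Rightarrow> X(i := x)) \<partial>(M i \<Otimes>\<^sub>M PiM UNIV M))"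
    by (subst nn_integral_distr) auto
  also have "\<dots> = (\<integral>\<^sup>+x. (\<integral>\<^sup>+X. f (X(i := x)) \<partial>PiM UNIV M) \<partial>M i)"
    by (subst P.nn_integral_fst[symmetric]) auto
  also have "\<dots> = (\<integral>\<^sup>+X. (\<integral>\<^sup>+x. f (X(i := x)) \<partial>M i) \<partial>PiM UNIV M)"
  proof (rule nn_integral_swap[OF M P.prob_space_axioms])
    have "(\<lambda>p. f (case p of (x, X) \<Rightarrow> X(i := x))) \<in> borel_measurable (M i \<Otimes>\<^sub>M PiM UNIV M)" by measurable
    then show "(\<lambda>(x, X). f (X(i := x))) \<in> borel_measurable (M i \<Otimes>\<^sub>M PiM UNIV M)" by (simp add: split_beta')
  qed
  finally show ?thesis .
qed

lemma measurable_ring_idx [measurable]: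
  assumes [measurable]: "f \<in> measurable M (seqm borel)" "g \<in> borel_measurable M"
  shows "(\<lambda>x. ring_idx (f x) (g x)) \<in> measurable M (count_space UNIV)"
  unfolding ring_idx_def by measurable

lemma measurable_resid [measurable (raw)]:
  assumes [measurable]: "f \<in> measurable M (seqm borel)" "g \<in> borel_measurable M"
  shows "(\<lambda>x. resid (f x) (g x)) \<in> borel_measurable M"
proof -
  have "(\<lambda>x. (\<Sum>l\<le>ring_idx (f x) (g x). f x l)) \<in> borel_measurable M"
    by (rule measurable_compose_countable[where f="\<lambda>i x. (\<Sum>l\<le>i. f x l)"]) measurable
  then show ?thesis unfolding resid_def by measurable
qed

lemma measurable_post [measurable (raw)]:
  assumes [measurable]: "f \<in> measurable M (seqm borel)" "g \<in> borel_measurable M"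
  shows "(\<lambda>x. post (f x) (g x)) \<in> measurable M (seqm borel)"
proof (rule measurable_abs_UNIV)
  fix n
  show "(\<lambda>x. post (f x) (g x) n) \<in> borel_measurable M"
    unfolding post_def
    by (rule measurable_compose_countable[where f="\<lambda>i x. f x (Suc (i + n))" and g="\<lambda>x. ring_idx (f x) (g x)"]) measurable
qed

lemma measurable_update:
  fixes f :: "'a \<Rightarrow> 'i \<Rightarrow> 'b"
  assumes f: "f \<in> measurable N (PiM UNIV (\<lambda>_. M))" and h: "h \<in> measurable N M"
  shows "(\<lambda>x. (f x)(i := h x)) \<in> measurable N (PiM UNIV (\<lambda>_. M))"
  by (rule measurable_fun_upd[where J=UNIV]) (use assms in auto)

lemma measurable_field2:
  assumes "f \<in> measurable M (fieldm (fieldm borel))"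
  shows "(\<lambda>x. f x i j) \<in> borel_measurable M"
  using measurable_compose[OF measurable_compose[OF assms measurable_component_singleton[of i]] measurable_component_singleton[of j]] by simp

lemma measurable_clear_time [measurable (raw)]:
  assumes W: "f \<in> measurable M (fieldm (fieldm borel))"
  shows "(\<lambda>p. clear_time \<eta> (f p) x y) \<in> borel_measurable M"
proof (induction \<eta> "\<lambda>_::int. \<lambda>_::int. 0::real" x y rule: clear_time.induct)
  case (1 \<eta> x y)
  note [measurable] = measurable_field2[OF W]
  consider "x \<le> y" | "y < x" "\<not> \<eta> x" | "y < x" "\<eta> x" "\<eta> y" | "y < x" "\<eta> x" "\<not> \<eta> y" by linarith
  then show ?case
  proof cases
    case 4
    then have [measurable]: "(\<lambda>p. clear_time \<eta> (f p) (x - 1) y) \<in> borel_measurable M" "(\<lambda>p. clear_time \<eta> (f p) x (y + 1)) \<in> borel_measurable M"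
      using 1(3,4) by auto
    have "clear_time \<eta> (f p) x y = max (clear_time \<eta> (f p) (x - 1) y) (clear_time \<eta> (f p) x (y + 1)) + f p x y" for p
      using 4 by (subst clear_time.simps) simp
    then show ?thesis by simp
  qed (use 1 in \<open>subst clear_time.simps, simp\<close>)+
qed

lemma measurable_run:
  assumes "f \<in> measurable M (fieldm (fieldm borel))" "g \<in> measurable M (fieldm (seqm borel))" "h \<in> measurable M (fieldm borel)"
  shows "(\<lambda>x. run \<eta> cs (f x) (g x) (h x)) \<in> measurable M (fieldm (fieldm borel))"
  using assms
proof (induction cs arbitrary: f g h)
  case (Cons p cs)
  note [measurable] = Cons.prems
  obtain x y where p: "p = (x, y)" by (cases p) auto
  define s where "s = cell_site \<eta> x y"
  define S where "S q = max (clear_time \<eta> (f q) (x - 1) y) (clear_time \<eta> (f q) x (y + 1))" for q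
  have [measurable]: "S \<in> borel_measurable M" unfolding S_def by measurable
  define u where "u q = max 0 (S q - h q s)" for q
  have [measurable]: "u \<in> borel_measurable M" unfolding u_def by measurable
  define v where "v q = resid (g q s) (u q)" for q
  have [measurable]: "v \<in> borel_measurable M" unfolding v_def by measurable
  have "(\<lambda>q. run \<eta> cs ((f q)(x := (f q x)(y := v q))) ((g q)(s := post (g q s) (u q))) ((h q)(s := S q + v q))) \<in> measurable M (fieldm (fieldm borel))"
    by (intro Cons.IH measurable_update) measurable
  then show ?case
    unfolding p run.simps Let_def s_def S_def u_def v_def by simp
qed simp

fun cell_integral :: "(int \<times> int) list \<Rightarrow> ((int \<Rightarrow> int \<Rightarrow> real) \<Rightarrow> ennreal) \<Rightarrow> (int \<Rightarrow> int \<Rightarrow> real) \<Rightarrow> ennreal" where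
  "cell_integral [] F W = F W"
| "cell_integral ((x, y) # cs) F W = (\<integral>\<^sup>+v. cell_integral cs F (W(x := (W x)(y := v))) \<partial>expm 1)"

text \<open>Induction on the cells. The time u from which a cell waits depends only on weights
  already fixed, so \<open>clock_law\<close> applies to the clock at its site. The remaining clock
  is independent of the revealed weight and has its old law, hence the sweep continues with a fresh
  field of clocks, and the base times drop out.\<close>

lemma run_law:
  assumes F: "F \<in> borel_measurable (fieldm (fieldm borel))"
  shows "(\<integral>\<^sup>+c. F (run \<eta> cs W c b) \<partial>fieldm (seqm (expm 1))) = cell_integral cs F W"
proof (induction cs arbitrary: W b)
  have pE: "prob_space (expm 1)" "prob_space (seqm (expm 1))" "prob_space (fieldm (seqm (expm 1)))"
    by (auto intro!: prob_space_expm prob_seqm_expm prob_space_PiM)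
  interpret E: prob_space "expm 1" by fact
  interpret S: prob_space "seqm (expm 1)" by fact
  interpret C: prob_space "fieldm (seqm (expm 1))" by fact
  {
    case Nil show ?case using pE(3) by (simp add: nn_integral_prob_const del: nn_integral_const)
  next
    case (Cons p cs)
    obtain x y where p: "p = (x, y)" by (cases p) auto
    define s where "s = cell_site \<eta> x y"
    define S where "S = max (clear_time \<eta> W (x - 1) y) (clear_time \<eta> W x (y + 1))"
    define u where "u = max 0 (S - b s)"
    define G where "G v c = F (run \<eta> cs (W(x := (W x)(y := v))) c (b(s := S + v)))" for v c
    have G [measurable]: "(\<lambda>q. G (f q) (g q)) \<in> borel_measurable M"
      if [measurable]: "f \<in> borel_measurable M" "g \<in> measurable M (fieldm (seqm borel))" for f g and M :: "'z measure"
      unfolding G_def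
      by (rule measurable_compose[OF _ F], intro measurable_run measurable_update)
         (measurable, auto simp: space_PiM)
    have G2 [measurable]: "(\<lambda>q. G (f q) ((g q)(s := h q))) \<in> borel_measurable M"
      if [measurable]: "f \<in> borel_measurable M" "g \<in> measurable M (fieldm (seqm borel))" "h \<in> measurable M (seqm borel)" for f g h and M :: "'z measure"
      by (intro G measurable_update) measurable
    have "(\<integral>\<^sup>+c. F (run \<eta> (p # cs) W c b) \<partial>fieldm (seqm (expm 1))) =
      (\<integral>\<^sup>+c. G (resid (c s) u) (c(s := post (c s) u)) \<partial>fieldm (seqm (expm 1)))"
      unfolding p run.simps Let_def G_def s_def S_def u_def ..
    \<comment> \<open>The clock at s is resampled, so that \<open>clock_law\<close> can act on it
      while all other clocks are frozen; the reverse resampling below restores the field.\<close>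
    also have "\<dots> = (\<integral>\<^sup>+c. (\<integral>\<^sup>+\<sigma>. G (resid ((c(s := \<sigma>)) s) u) ((c(s := \<sigma>))(s := post ((c(s := \<sigma>)) s) u)) \<partial>seqm (expm 1)) \<partial>fieldm (seqm (expm 1)))"
    proof (rule PiM_resample[OF pE(2)], rule G2)
      have cs: "(\<lambda>c. c s) \<in> measurable (fieldm (seqm (expm 1))) (seqm borel)"
        using measurable_component_singleton[of s UNIV "\<lambda>_. seqm (expm 1)"] by (simp cong: measurable_cong_sets add: measurable_cong_sets[OF refl sets_seqm_expm])
      show "(\<lambda>c. resid (c s) u) \<in> borel_measurable (fieldm (seqm (expm 1)))"
        "(\<lambda>c. post (c s) u) \<in> measurable (fieldm (seqm (expm 1))) (seqm borel)"
        by (intro measurable_resid measurable_post cs; simp)+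
    qed (rule measurable_ident_sets[OF sets_fieldm_seqm_expm])
    also have "\<dots> = (\<integral>\<^sup>+c. (\<integral>\<^sup>+\<sigma>. G (resid \<sigma> u) (c(s := post \<sigma> u)) \<partial>seqm (expm 1)) \<partial>fieldm (seqm (expm 1)))"
      by simp
    also have "\<dots> = (\<integral>\<^sup>+c. (\<integral>\<^sup>+v. (\<integral>\<^sup>+\<sigma>. G v (c(s := \<sigma>)) \<partial>seqm (expm 1)) \<partial>expm 1) \<partial>fieldm (seqm (expm 1)))"
      by (intro nn_integral_cong clock_law) (auto simp: u_def split_beta' space_PiM intro!: G2)
    also have "\<dots> = (\<integral>\<^sup>+v. (\<integral>\<^sup>+c. (\<integral>\<^sup>+\<sigma>. G v (c(s := \<sigma>)) \<partial>seqm (expm 1)) \<partial>fieldm (seqm (expm 1))) \<partial>expm 1)"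
      by (intro nn_integral_swap pE) measurable
    also have "\<dots> = (\<integral>\<^sup>+v. (\<integral>\<^sup>+c. G v c \<partial>fieldm (seqm (expm 1))) \<partial>expm 1)"
    proof (rule nn_integral_cong)
      fix v
      show "(\<integral>\<^sup>+c. (\<integral>\<^sup>+\<sigma>. G v (c(s := \<sigma>)) \<partial>seqm (expm 1)) \<partial>fieldm (seqm (expm 1))) = (\<integral>\<^sup>+c. G v c \<partial>fieldm (seqm (expm 1)))"
        by (rule PiM_resample[OF pE(2), symmetric], rule G) (auto intro: measurable_ident_sets[OF sets_fieldm_seqm_expm])
    qed
    also have "\<dots> = cell_integral (p # cs) F W"
      unfolding G_def p by (simp only: Cons.IH cell_integral.simps)
    finally show ?case .
  }
qed

text \<open>The three indices are the region, the line and the position in it, as \<open>lab\<close>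
  will supply them.\<close>

definition upd3 :: "(nat \<Rightarrow> nat \<Rightarrow> nat \<Rightarrow> real) \<Rightarrow> nat \<times> nat \<times> nat \<Rightarrow> real \<Rightarrow> nat \<Rightarrow> nat \<Rightarrow> nat \<Rightarrow> real" where
  "upd3 w = (\<lambda>(k, d, l) v. w(k := (w k)(d := (w k d)(l := v))))"

definition get3 :: "(nat \<Rightarrow> nat \<Rightarrow> nat \<Rightarrow> real) \<Rightarrow> nat \<times> nat \<times> nat \<Rightarrow> real" where
  "get3 w = (\<lambda>(k, d, l). w k d l)"

lemma get3_upd3: "get3 (upd3 w p v) q = (if p = q then v else get3 w q)"
  by (cases p; cases q) (auto simp: get3_def upd3_def)

abbreviation weightm :: "(nat \<Rightarrow> nat \<Rightarrow> nat \<Rightarrow> real) measure" where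
  "weightm \<equiv> seqm (seqm (seqm (expm 1)))"

lemma sets_weightm [measurable_cong]: "sets weightm = sets (seqm (seqm (seqm borel)))"
  by (intro sets_PiM_cong) (auto simp: sets_seqm_seqm_expm)

lemma prob_weightm: "prob_space weightm"
  by (intro prob_space_seqm prob_bulk)

text \<open>A resampling that preserves the law of one component also preserves the law of a
  sequence when applied inside one component. Three applications reach a single entry of a triple
  array.\<close>

lemma resample_lift:
  assumes M: "prob_space M" and N: "prob_space N" and up [measurable]: "case_prod up \<in> measurable (M \<Otimes>\<^sub>M N) M"
    and res: "\<And>g. g \<in> borel_measurable M \<Longrightarrow> (\<integral>\<^sup>+m. g m \<partial>M) = (\<integral>\<^sup>+m. (\<integral>\<^sup>+v. g (up m v) \<partial>N) \<partial>M)"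
    and f [measurable]: "f \<in> borel_measurable (seqm M)"
  shows "(\<integral>\<^sup>+w. f w \<partial>seqm M) = (\<integral>\<^sup>+w. (\<integral>\<^sup>+v. f (w(i := up (w i) v)) \<partial>N) \<partial>seqm M)"
proof -
  interpret N: prob_space N by fact
  have u1 [measurable]: "(\<lambda>q. f ((g q)(i := h q))) \<in> borel_measurable L"
    if "g \<in> measurable L (seqm M)" "h \<in> measurable L M" for g h and L :: "'z measure"
    by (rule measurable_compose[OF measurable_update[OF that] f])
  have u2 [measurable]: "(\<lambda>q. up (g q) (h q)) \<in> measurable L M"
    if "g \<in> measurable L M" "h \<in> measurable L N" for g h and L :: "'z measure"
    using measurable_compose[OF measurable_Pair[OF that] up] by simp
  have "(\<integral>\<^sup>+w. f w \<partial>seqm M) = (\<integral>\<^sup>+w. (\<integral>\<^sup>+x. f (w(i := x)) \<partial>M) \<partial>seqm M)"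
    by (rule PiM_resample[OF M f])
  also have "\<dots> = (\<integral>\<^sup>+w. (\<integral>\<^sup>+x. (\<integral>\<^sup>+v. f (w(i := up x v)) \<partial>N) \<partial>M) \<partial>seqm M)"
    by (intro nn_integral_cong res) measurable
  also have "\<dots> = (\<integral>\<^sup>+w. (\<integral>\<^sup>+x. (\<integral>\<^sup>+v. f ((w(i := x))(i := up ((w(i := x)) i) v)) \<partial>N) \<partial>M) \<partial>seqm M)"
    by simp
  also have "\<dots> = (\<integral>\<^sup>+w. (\<integral>\<^sup>+v. f (w(i := up (w i) v)) \<partial>N) \<partial>seqm M)"
    by (rule PiM_resample[OF M, symmetric]) measurable
  finally show ?thesis .
qed

lemma measurable_upd_nested:
  assumes "case_prod up \<in> measurable (M \<Otimes>\<^sub>M N) M"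
  shows "(\<lambda>(w, v). w(i := up (w i) v)) \<in> measurable (seqm M \<Otimes>\<^sub>M N) (seqm M)"
  unfolding split_beta'
proof (rule measurable_update)
  have "(\<lambda>x. (fst x i, snd x)) \<in> measurable (seqm M \<Otimes>\<^sub>M N) (M \<Otimes>\<^sub>M N)" by measurable
  from measurable_compose[OF this assms] show "(\<lambda>x. up (fst x i) (snd x)) \<in> measurable (seqm M \<Otimes>\<^sub>M N) M" by simp
qed measurable

lemma weightm_resample:
  assumes f: "f \<in> borel_measurable weightm"
  shows "(\<integral>\<^sup>+w. f w \<partial>weightm) = (\<integral>\<^sup>+w. (\<integral>\<^sup>+v. f (upd3 w p v) \<partial>expm 1) \<partial>weightm)"
    and "(\<lambda>(w, v). upd3 w p v) \<in> measurable (weightm \<Otimes>\<^sub>M expm 1) weightm"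
proof -
  obtain k d l where p: "p = (k, d, l)" by (cases p) auto
  have E: "prob_space (expm 1)" by (rule prob_space_expm) simp
  have m0: "(\<lambda>(m, v). v) \<in> measurable (expm 1 \<Otimes>\<^sub>M expm 1) (expm 1)" by measurable
  note m1 = measurable_upd_nested[OF m0, of l]
  note m2 = measurable_upd_nested[OF m1, of d]
  note m3 = measurable_upd_nested[OF m2, of k]
  have r0: "(\<integral>\<^sup>+m. g m \<partial>expm 1) = (\<integral>\<^sup>+m. (\<integral>\<^sup>+v. g v \<partial>expm 1) \<partial>expm 1)" for g :: "real \<Rightarrow> ennreal"
    using E by (simp add: nn_integral_prob_const del: nn_integral_const)
  have r1: "(\<integral>\<^sup>+w. g w \<partial>seqm (expm 1)) = (\<integral>\<^sup>+w. (\<integral>\<^sup>+v. g (w(l := v)) \<partial>expm 1) \<partial>seqm (expm 1))"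
    if "g \<in> borel_measurable (seqm (expm 1))" for g
    using resample_lift[OF E E m0 r0 that, of l] by simp
  have r2: "(\<integral>\<^sup>+w. g w \<partial>seqm (seqm (expm 1))) = (\<integral>\<^sup>+w. (\<integral>\<^sup>+v. g (w(d := (w d)(l := v))) \<partial>expm 1) \<partial>seqm (seqm (expm 1)))"
    if "g \<in> borel_measurable (seqm (seqm (expm 1)))" for g
    by (rule resample_lift[OF _ E m1 _ that]) (auto intro: prob_seqm_expm r1)
  have r3: "(\<integral>\<^sup>+w. g w \<partial>weightm) = (\<integral>\<^sup>+w. (\<integral>\<^sup>+v. g (w(k := (w k)(d := (w k d)(l := v)))) \<partial>expm 1) \<partial>weightm)"
    if "g \<in> borel_measurable weightm" for g
    by (rule resample_lift[OF prob_bulk E m2 _ that]) (rule r2)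
  show "(\<integral>\<^sup>+w. f w \<partial>weightm) = (\<integral>\<^sup>+w. (\<integral>\<^sup>+v. f (upd3 w p v) \<partial>expm 1) \<partial>weightm)"
    using r3[OF f] by (simp add: upd3_def p)
  show "(\<lambda>(w, v). upd3 w p v) \<in> measurable (weightm \<Otimes>\<^sub>M expm 1) weightm"
    using m3 by (simp add: upd3_def p)
qed

text \<open>Each nested integral introduces its own variable. With an injective labelling these
  variables can all be read from one fixed array: installing the variable of the next cell is a
  resampling of an entry that no other cell uses.\<close>

lemma cell_integral_weights:
  assumes F: "F \<in> borel_measurable (fieldm (fieldm borel))" and "distinct cs" "inj_on lab (set cs)"
  shows "cell_integral cs F W = (\<integral>\<^sup>+w. F (\<lambda>x y. if (x, y) \<in> set cs then get3 w (lab (x, y)) else W x y) \<partial>weightm)"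
  using assms(2,3)
proof (induction cs arbitrary: W)
  case Nil
  show ?case using prob_weightm by (simp add: nn_integral_prob_const del: nn_integral_const)
next
  case (Cons p cs)
  obtain x y where p: "p = (x, y)" by (cases p) auto
  have E: "prob_space (expm 1)" by (rule prob_space_expm) simp
  interpret Q: prob_space weightm by (rule prob_weightm)
  have g3: "(\<lambda>q. get3 (g q) (k, d, l)) \<in> borel_measurable M" if "g \<in> measurable M weightm" for g k d l and M :: "'z measure"
    unfolding get3_def
    using measurable_compose[OF measurable_compose[OF measurable_compose[OF that measurable_component_singleton[of k]] measurable_component_singleton[of d]] measurable_component_singleton[of l]]
    by (simp add: measurable_cong_sets[OF refl sets_expm])
  then have g3 [measurable]: "(\<lambda>q. get3 (g q) t) \<in> borel_measurable M" if "g \<in> measurable M weightm" for g t and M :: "'z measure"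
    using that by (cases t) auto
  have mF: "(\<lambda>q. F (\<lambda>x' y'. if (x', y') \<in> A then get3 (g q) (lab (x', y')) else (if (x', y') = (x, y) then h q else W x' y'))) \<in> borel_measurable M"
    if [measurable]: "g \<in> measurable M weightm" "h \<in> borel_measurable M" for g h A and M :: "'z measure"
  proof (rule measurable_compose[OF _ F], intro measurable_abs_UNIV)
    fix a b
    show "(\<lambda>q. if (a, b) \<in> A then get3 (g q) (lab (a, b)) else if (a, b) = (x, y) then h q else W a b) \<in> borel_measurable M"
      by measurable
  qed
  have mF': "(\<lambda>w. F (\<lambda>x' y'. if (x', y') \<in> A then get3 w (lab (x', y')) else W x' y')) \<in> borel_measurable weightm" for A
  proof -
    have "(\<lambda>w. F (\<lambda>x' y'. if (x', y') \<in> A then get3 w (lab (x', y')) else W x' y')) =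
      (\<lambda>w. F (\<lambda>x' y'. if (x', y') \<in> A then get3 w (lab (x', y')) else (if (x', y') = (x, y) then W x y else W x' y')))"
      by (intro ext arg_cong[where f=F]) auto
    then show ?thesis using mF[of "\<lambda>w. w" weightm "\<lambda>_. W x y" A] by simp
  qed
  have "cell_integral (p # cs) F W = (\<integral>\<^sup>+v. (\<integral>\<^sup>+w. F (\<lambda>x' y'. if (x', y') \<in> set cs then get3 w (lab (x', y')) else (W(x := (W x)(y := v))) x' y') \<partial>weightm) \<partial>expm 1)"
    unfolding p cell_integral.simps using Cons.prems by (intro nn_integral_cong Cons.IH) auto
  also have "\<dots> = (\<integral>\<^sup>+v. (\<integral>\<^sup>+w. F (\<lambda>x' y'. if (x', y') \<in> set cs then get3 w (lab (x', y')) else (if (x', y') = (x, y) then v else W x' y')) \<partial>weightm) \<partial>expm 1)"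
    by (intro nn_integral_cong arg_cong[where f=F] ext) auto
  also have "\<dots> = (\<integral>\<^sup>+w. (\<integral>\<^sup>+v. F (\<lambda>x' y'. if (x', y') \<in> set cs then get3 w (lab (x', y')) else (if (x', y') = (x, y) then v else W x' y')) \<partial>expm 1) \<partial>weightm)"
    by (rule nn_integral_swap[OF E prob_weightm]) (unfold split_beta', rule mF, measurable)
  also have "\<dots> = (\<integral>\<^sup>+w. (\<integral>\<^sup>+v. F (\<lambda>x' y'. if (x', y') \<in> set (p # cs) then get3 (upd3 w (lab p) v) (lab (x', y')) else W x' y') \<partial>expm 1) \<partial>weightm)"
  proof (intro nn_integral_cong arg_cong[where f=F] ext)
    fix w v x' y'
    have "lab p \<noteq> lab (x', y')" if "(x', y') \<in> set cs"
      using Cons.prems that by (auto simp: inj_on_def)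
    moreover have "p \<notin> set cs" using Cons.prems by simp
    ultimately show "(if (x', y') \<in> set cs then get3 w (lab (x', y')) else (if (x', y') = (x, y) then v else W x' y')) =
      (if (x', y') \<in> set (p # cs) then get3 (upd3 w (lab p) v) (lab (x', y')) else W x' y')"
      by (auto simp: get3_upd3 p)
  qed
  also have "\<dots> = (\<integral>\<^sup>+w. F (\<lambda>x' y'. if (x', y') \<in> set (p # cs) then get3 w (lab (x', y')) else W x' y') \<partial>weightm)"
    by (rule weightm_resample(1)[OF mF', symmetric])
  finally show ?case .
qed

section \<open>Bernoulli boundaries\<close>

text \<open>Departure times of a single server queue with arrival times \<open>a\<close> and service
  times \<open>w\<close>.\<close>

fun queue :: "(nat \<Rightarrow> real) \<Rightarrow> (nat \<Rightarrow> real) \<Rightarrow> nat \<Rightarrow> real" where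
  "queue a w 0 = max (a 0) 0 + w 0"
| "queue a w (Suc j) = max (a (Suc j)) (queue a w j) + w (Suc j)"

text \<open>Passage times along the row next to a boundary that is read off coin by coin: a \<open>True\<close> coin adds a
  further line of the recursion, a \<open>False\<close> coin inserts a line of length one that contributes the time \<open>0\<close>.\<close>

fun arr :: "bool list \<Rightarrow> (nat \<Rightarrow> nat \<Rightarrow> real) \<Rightarrow> (nat \<Rightarrow> real) \<Rightarrow> nat \<Rightarrow> real" where
  "arr [] w a = a"
| "arr (True # c) w a = queue (arr c (\<lambda>d. w (Suc d)) a) (w 0)"
| "arr (False # c) w a = case_nat 0 (arr c (\<lambda>d. w (Suc d)) a)"

definition psum :: "(nat \<Rightarrow> real) \<Rightarrow> nat \<Rightarrow> real" where
  "psum s j = (\<Sum>l\<le>j. s l)"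

text \<open>The boundary before any site has been read. For s of rate b and \<tau> of rate 1 - b its
  law turns out to be invariant under reading one more coin.\<close>

definition initseq :: "real \<Rightarrow> (nat \<Rightarrow> real) \<Rightarrow> nat \<Rightarrow> real" where
  "initseq \<tau> s j = max 0 (psum s j - \<tau>)"

primrec coinsum :: "real \<Rightarrow> nat \<Rightarrow> (bool list \<Rightarrow> ennreal) \<Rightarrow> ennreal" where
  "coinsum p 0 f = f []"
| "coinsum p (Suc m) f = ennreal p * coinsum p m (\<lambda>c. f (True # c)) + ennreal (1 - p) * coinsum p m (\<lambda>c. f (False # c))"

lemma psum_case_nat: "psum (case_nat x s) = case_nat x (\<lambda>j. x + psum s j)"
  by (rule ext) (auto simp: psum_def sum.atMost_Suc_shift simp del: sum.atMost_Suc split: nat.split)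

lemma measurable_psum' [measurable (raw)]:
  assumes [measurable]: "f \<in> measurable M (seqm borel)"
  shows "(\<lambda>x. psum (f x) j) \<in> borel_measurable M"
  unfolding psum_def by measurable

lemma measurable_initseq' [measurable (raw)]:
  assumes [measurable]: "f \<in> borel_measurable M" "g \<in> measurable M (seqm borel)"
  shows "(\<lambda>x. initseq (f x) (g x) j) \<in> borel_measurable M"
  unfolding initseq_def by measurable

lemma measurable_queue' [measurable (raw)]:
  assumes [measurable]: "f \<in> measurable M (seqm borel)" "g \<in> measurable M (seqm borel)"
  shows "(\<lambda>x. queue (f x) (g x) j) \<in> borel_measurable M"
  by (induction j) auto

lemma measurable_queue [measurable (raw)]:
  assumes [measurable]: "f \<in> measurable M (seqm borel)" "g \<in> measurable M (seqm borel)"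
  shows "(\<lambda>x. queue (f x) (g x)) \<in> measurable M (seqm borel)"
  by (rule measurable_abs_UNIV) measurable

lemma measurable_shift2:
  assumes "f \<in> measurable M (seqm (seqm borel))"
  shows "(\<lambda>x d. f x (Suc d)) \<in> measurable M (seqm (seqm borel))"
  by (rule measurable_abs_UNIV) (rule measurable_compose[OF assms measurable_component_singleton], simp)

lemma measurable_head2:
  assumes "f \<in> measurable M (seqm (seqm borel))"
  shows "(\<lambda>x. f x i) \<in> measurable M (seqm borel)"
  by (rule measurable_compose[OF assms measurable_component_singleton]) simp

lemma measurable_arr [measurable (raw)]:
  assumes "f \<in> measurable M (seqm (seqm borel))" "g \<in> measurable M (seqm borel)"
  shows "(\<lambda>x. arr c (f x) (g x)) \<in> measurable M (seqm borel)"
  using assms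
proof (induction c arbitrary: f)
  case (Cons s c)
  show ?case
  proof (cases s)
    case True
    then show ?thesis
      using measurable_queue[OF Cons.IH[OF measurable_shift2[OF Cons.prems(1)] Cons.prems(2)] measurable_head2[OF Cons.prems(1)]] by simp
  next
    case False
    have "(\<lambda>x. case_nat 0 (arr c (\<lambda>d. f x (Suc d)) (g x))) \<in> measurable M (seqm borel)"
    proof (rule measurable_abs_UNIV)
      fix n show "(\<lambda>x. case_nat 0 (arr c (\<lambda>d. f x (Suc d)) (g x)) n) \<in> borel_measurable M"
        using measurable_compose[OF Cons.IH[OF measurable_shift2[OF Cons.prems(1)] Cons.prems(2)] measurable_component_singleton[of "n - 1"]]
        by (cases n) simp_all
    qed
    then show ?thesis using False by simp
  qed
qed simp

lemma colu_balance: "colu u y w j = u + (\<Sum>l<j. col u y w l) - (\<Sum>l<j. y l)"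
  by (induction j) (auto simp: col_def max_def)

text \<open>The maximum taken in a line absorbs the truncation at 0: running the truncated sequence
  through it amounts to feeding \<open>s\<close> into a column whose first horizontal increment is
  \<tau>.\<close>

lemma queue_initseq:
  assumes w: "\<And>j. 0 \<le> w j"
  shows "queue (initseq \<tau> s) w j = psum (col \<tau> s w) j"
proof (induction j)
  case 0
  show ?case by (simp add: initseq_def psum_def col_def max_def)
next
  case (Suc j)
  have nn: "0 \<le> psum (col \<tau> s w) j"
    unfolding psum_def by (intro sum_nonneg) (auto simp: col_def w intro!: add_nonneg_nonneg)
  have c: "col \<tau> s w (Suc j) = w (Suc j) + max 0 (s (Suc j) - (\<tau> + psum (col \<tau> s w) j - psum s j))"
    unfolding col_def[of \<tau> s w "Suc j"] colu_balance[of \<tau> s w "Suc j"] psum_def lessThan_Suc_atMost ..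
  have "queue (initseq \<tau> s) w (Suc j) = max (max 0 (psum s j + s (Suc j) - \<tau>)) (psum (col \<tau> s w) j) + w (Suc j)"
    by (simp add: Suc initseq_def psum_def)
  also have "\<dots> = psum (col \<tau> s w) j + col \<tau> s w (Suc j)"
    unfolding c using nn by (auto simp: max_def)
  finally show ?case by (simp add: psum_def)
qed

text \<open>With rates 1 - b and b that column is stationary, so a single line removes both \<tau>
  and the truncation.\<close>

lemma queue_law:
  assumes b: "0 < b" "b < 1" and F [measurable]: "F \<in> borel_measurable (seqm borel)"
  shows "(\<integral>\<^sup>+\<tau>. (\<integral>\<^sup>+s. (\<integral>\<^sup>+w. F (queue (initseq \<tau> s) w) \<partial>seqm (expm 1)) \<partial>seqm (expm b)) \<partial>expm (1 - b)) =
    (\<integral>\<^sup>+s. F (psum s) \<partial>seqm (expm b))"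
proof -
  have "(\<integral>\<^sup>+w. F (queue (initseq \<tau> s) w) \<partial>seqm (expm 1)) = (\<integral>\<^sup>+w. F (psum (col \<tau> s w)) \<partial>seqm (expm 1))" for \<tau> s
  proof (rule nn_integral_cong_AE)
    have "AE w in seqm (expm 1). \<forall>i. 0 < w i" by (rule AE_seqm_expm_pos) simp
    then show "AE w in seqm (expm 1). F (queue (initseq \<tau> s) w) = F (psum (col \<tau> s w))"
    proof eventually_elim
      case (elim w)
      have "queue (initseq \<tau> s) w = psum (col \<tau> s w)"
        by (rule ext, rule queue_initseq) (use elim in \<open>auto intro: less_imp_le\<close>)
      then show ?case by simp
    qed
  qed
  then show ?thesis using b by (simp add: col_law[of "1 - b" b "\<lambda>y. F (psum y)"])
qed

text \<open>The time \<open>0\<close> inserted by a coin of the right bias is the atom at which \<open>psum s j - \<tau>\<close> is truncated,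
  which makes \<open>initseq\<close> invariant under the coin step.\<close>

lemma initseq_coin:
  assumes b: "0 < b" "b < 1" and F [measurable]: "F \<in> borel_measurable (seqm borel)"
  shows "ennreal (1 - b) * (\<integral>\<^sup>+s. F (psum s) \<partial>seqm (expm b)) +
    ennreal b * (\<integral>\<^sup>+\<tau>. (\<integral>\<^sup>+s. F (case_nat 0 (initseq \<tau> s)) \<partial>seqm (expm b)) \<partial>expm (1 - b)) =
    (\<integral>\<^sup>+\<tau>. (\<integral>\<^sup>+s. F (initseq \<tau> s) \<partial>seqm (expm b)) \<partial>expm (1 - b))"
proof -
  have p: "prob_space (expm b)" "prob_space (expm 1)" "prob_space (expm (1 - b))" "prob_space (seqm (expm b))"
    using b by (auto intro: prob_space_expm prob_seqm_expm)
  interpret S: prob_space "seqm (expm b)" by fact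
  define \<Phi> where "\<Phi> u v = (\<integral>\<^sup>+s. F (initseq u (case_nat v s)) \<partial>seqm (expm b))" for u v
  have "(\<integral>\<^sup>+\<tau>. (\<integral>\<^sup>+s. F (initseq \<tau> s) \<partial>seqm (expm b)) \<partial>expm (1 - b)) = (\<integral>\<^sup>+u. (\<integral>\<^sup>+v. \<Phi> u v \<partial>expm b) \<partial>expm (1 - b))"
    unfolding \<Phi>_def by (intro nn_integral_cong nn_integral_seqm p) measurable
  \<comment> \<open>In the first term the first increment is smaller than \<tau>: the sequence
    starts with 0 and \<tau> is replaced by its excess. In the second \<tau> is smaller, the
    truncation never acts and plain partial sums remain.\<close>
  also have "\<dots> = ennreal b * (\<integral>\<^sup>+m. (\<integral>\<^sup>+d. \<Phi> (m + d) m \<partial>expm (1 - b)) \<partial>expm 1) +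
    ennreal (1 - b) * (\<integral>\<^sup>+m. (\<integral>\<^sup>+d. \<Phi> m (m + d) \<partial>expm b) \<partial>expm 1)"
    using b by (intro expm_split) (auto simp: \<Phi>_def)
  also have "(\<integral>\<^sup>+m. (\<integral>\<^sup>+d. \<Phi> (m + d) m \<partial>expm (1 - b)) \<partial>expm 1) =
    (\<integral>\<^sup>+m. (\<integral>\<^sup>+\<tau>. (\<integral>\<^sup>+s. F (case_nat 0 (initseq \<tau> s)) \<partial>seqm (expm b)) \<partial>expm (1 - b)) \<partial>expm 1)"
  proof (rule nn_integral_cong)
    fix m :: real
    show "(\<integral>\<^sup>+d. \<Phi> (m + d) m \<partial>expm (1 - b)) = (\<integral>\<^sup>+\<tau>. (\<integral>\<^sup>+s. F (case_nat 0 (initseq \<tau> s)) \<partial>seqm (expm b)) \<partial>expm (1 - b))"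
    proof (rule nn_integral_cong_AE)
      have "AE d in expm (1 - b). 0 < d" using b by (intro AE_expm_pos) simp
      then show "AE d in expm (1 - b). \<Phi> (m + d) m = (\<integral>\<^sup>+s. F (case_nat 0 (initseq d s)) \<partial>seqm (expm b))"
      proof eventually_elim
        case (elim d)
        have "initseq (m + d) (case_nat m s) = case_nat 0 (initseq d s)" for s
          using elim by (auto simp: initseq_def psum_case_nat split: nat.split)
        then show ?case by (simp add: \<Phi>_def)
      qed
    qed
  qed
  also have "\<dots> = (\<integral>\<^sup>+\<tau>. (\<integral>\<^sup>+s. F (case_nat 0 (initseq \<tau> s)) \<partial>seqm (expm b)) \<partial>expm (1 - b))"
    by (rule nn_integral_prob_const[OF p(2)])
  also have "(\<integral>\<^sup>+m. (\<integral>\<^sup>+d. \<Phi> m (m + d) \<partial>expm b) \<partial>expm 1) = (\<integral>\<^sup>+m. (\<integral>\<^sup>+s. F (psum s) \<partial>seqm (expm b)) \<partial>expm 1)"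
  proof (rule nn_integral_cong)
    fix m :: real
    have "(\<integral>\<^sup>+s. F (psum s) \<partial>seqm (expm b)) = (\<integral>\<^sup>+d. (\<integral>\<^sup>+s. F (psum (case_nat d s)) \<partial>seqm (expm b)) \<partial>expm b)"
      by (intro nn_integral_seqm p) measurable
    also have "\<dots> = (\<integral>\<^sup>+d. \<Phi> m (m + d) \<partial>expm b)"
    proof (rule nn_integral_cong_AE)
      have "AE d in expm b. 0 < d" using b by (intro AE_expm_pos) simp
      then show "AE d in expm b. (\<integral>\<^sup>+s. F (psum (case_nat d s)) \<partial>seqm (expm b)) = \<Phi> m (m + d)"
      proof eventually_elim
        case (elim d)
        show ?case unfolding \<Phi>_def
        proof (rule nn_integral_cong_AE)
          have "AE s in seqm (expm b). \<forall>i. 0 < s i" using b by (intro AE_seqm_expm_pos) simp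
          then show "AE s in seqm (expm b). F (psum (case_nat d s)) = F (initseq m (case_nat (m + d) s))"
          proof eventually_elim
            case (elim s)
            have "0 \<le> psum s j" for j unfolding psum_def by (intro sum_nonneg) (use elim in \<open>auto intro: less_imp_le\<close>)
            then have "psum (case_nat d s) = initseq m (case_nat (m + d) s)"
              using \<open>0 < d\<close> by (auto simp: initseq_def psum_case_nat fun_eq_iff split: nat.split)
            then show ?case by simp
          qed
        qed
      qed
    qed
    finally show "(\<integral>\<^sup>+d. \<Phi> m (m + d) \<partial>expm b) = (\<integral>\<^sup>+s. F (psum s) \<partial>seqm (expm b))" by simp
  qed
  also have "\<dots> = (\<integral>\<^sup>+s. F (psum s) \<partial>seqm (expm b))"
    by (rule nn_integral_prob_const[OF p(2)])
  finally show ?thesis by (simp add: add.commute)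
qed

text \<open>Induction on the outermost coin. After the inner coins the sequence is again
  \<open>initseq\<close>; a \<open>True\<close> coin turns it into plain partial sums by
  \<open>queue_law\<close>, a \<open>False\<close> coin prepends 0, and \<open>initseq_coin\<close>
  says that the mixture is \<open>initseq\<close>.\<close>

lemma arr_law:
  assumes b: "0 < b" "b < 1" and F: "F \<in> borel_measurable (seqm borel)"
  shows "coinsum (1 - b) m (\<lambda>c. \<integral>\<^sup>+w. (\<integral>\<^sup>+\<tau>. (\<integral>\<^sup>+s. F (arr c w (initseq \<tau> s)) \<partial>seqm (expm b)) \<partial>expm (1 - b)) \<partial>seqm (seqm (expm 1))) =
    (\<integral>\<^sup>+\<tau>. (\<integral>\<^sup>+s. F (initseq \<tau> s) \<partial>seqm (expm b)) \<partial>expm (1 - b))"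
  using F
proof (induction m arbitrary: F)
  case 0
  show ?case by (simp add: nn_integral_prob_const prob_bulk del: nn_integral_const)
next
  case (Suc m)
  note [measurable] = Suc.prems
  have p: "prob_space (expm b)" "prob_space (seqm (expm 1))" "prob_space (expm (1 - b))" "prob_space (seqm (expm b))" "prob_space (seqm (seqm (expm 1)))"
    using b by (auto intro: prob_space_expm prob_seqm_expm prob_bulk)
  interpret S: prob_space "seqm (expm b)" by fact
  interpret W: prob_space "seqm (expm 1)" by fact
  interpret E: prob_space "expm (1 - b)" by fact
  define F1 where "F1 a = (\<integral>\<^sup>+w. F (queue a w) \<partial>seqm (expm 1))" for a
  have [measurable]: "F1 \<in> borel_measurable (seqm borel)" unfolding F1_def by measurable
  have F0 [measurable]: "(\<lambda>a. F (case_nat 0 a)) \<in> borel_measurable (seqm borel)" by measurable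
  have T: "(\<integral>\<^sup>+w. (\<integral>\<^sup>+\<tau>. (\<integral>\<^sup>+s. F (arr (True # c) w (initseq \<tau> s)) \<partial>seqm (expm b)) \<partial>expm (1 - b)) \<partial>seqm (seqm (expm 1))) =
    (\<integral>\<^sup>+w. (\<integral>\<^sup>+\<tau>. (\<integral>\<^sup>+s. F1 (arr c w (initseq \<tau> s)) \<partial>seqm (expm b)) \<partial>expm (1 - b)) \<partial>seqm (seqm (expm 1)))" for c
  proof -
    have "(\<integral>\<^sup>+w. (\<integral>\<^sup>+\<tau>. (\<integral>\<^sup>+s. F (arr (True # c) w (initseq \<tau> s)) \<partial>seqm (expm b)) \<partial>expm (1 - b)) \<partial>seqm (seqm (expm 1))) =
      (\<integral>\<^sup>+w0. (\<integral>\<^sup>+w. (\<integral>\<^sup>+\<tau>. (\<integral>\<^sup>+s. F (arr (True # c) (case_nat w0 w) (initseq \<tau> s)) \<partial>seqm (expm b)) \<partial>expm (1 - b)) \<partial>seqm (seqm (expm 1))) \<partial>seqm (expm 1))"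
      by (intro nn_integral_seqm p) measurable
    also have "\<dots> = (\<integral>\<^sup>+w. (\<integral>\<^sup>+w0. (\<integral>\<^sup>+\<tau>. (\<integral>\<^sup>+s. F (queue (arr c w (initseq \<tau> s)) w0) \<partial>seqm (expm b)) \<partial>expm (1 - b)) \<partial>seqm (expm 1)) \<partial>seqm (seqm (expm 1)))"
      unfolding arr.simps nat.case by (intro nn_integral_swap p) measurable
    also have "\<dots> = (\<integral>\<^sup>+w. (\<integral>\<^sup>+\<tau>. (\<integral>\<^sup>+w0. (\<integral>\<^sup>+s. F (queue (arr c w (initseq \<tau> s)) w0) \<partial>seqm (expm b)) \<partial>seqm (expm 1)) \<partial>expm (1 - b)) \<partial>seqm (seqm (expm 1)))"
      by (intro nn_integral_cong nn_integral_swap p) (auto simp: space_PiM intro!: measurable_arr measurable_ident_sets[OF sets_seqm_seqm_expm])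
    also have "\<dots> = (\<integral>\<^sup>+w. (\<integral>\<^sup>+\<tau>. (\<integral>\<^sup>+s. (\<integral>\<^sup>+w0. F (queue (arr c w (initseq \<tau> s)) w0) \<partial>seqm (expm 1)) \<partial>seqm (expm b)) \<partial>expm (1 - b)) \<partial>seqm (seqm (expm 1)))"
      by (intro nn_integral_cong nn_integral_swap p) (auto simp: space_PiM intro!: measurable_arr measurable_ident_sets[OF sets_seqm_seqm_expm])
    finally show ?thesis unfolding F1_def .
  qed
  have N: "(\<integral>\<^sup>+w. (\<integral>\<^sup>+\<tau>. (\<integral>\<^sup>+s. F (arr (False # c) w (initseq \<tau> s)) \<partial>seqm (expm b)) \<partial>expm (1 - b)) \<partial>seqm (seqm (expm 1))) =
    (\<integral>\<^sup>+w. (\<integral>\<^sup>+\<tau>. (\<integral>\<^sup>+s. F (case_nat 0 (arr c w (initseq \<tau> s))) \<partial>seqm (expm b)) \<partial>expm (1 - b)) \<partial>seqm (seqm (expm 1)))" for c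
  proof -
    have "(\<integral>\<^sup>+w. (\<integral>\<^sup>+\<tau>. (\<integral>\<^sup>+s. F (arr (False # c) w (initseq \<tau> s)) \<partial>seqm (expm b)) \<partial>expm (1 - b)) \<partial>seqm (seqm (expm 1))) =
      (\<integral>\<^sup>+w0. (\<integral>\<^sup>+w. (\<integral>\<^sup>+\<tau>. (\<integral>\<^sup>+s. F (arr (False # c) (case_nat w0 w) (initseq \<tau> s)) \<partial>seqm (expm b)) \<partial>expm (1 - b)) \<partial>seqm (seqm (expm 1))) \<partial>seqm (expm 1))"
      by (intro nn_integral_seqm p) measurable
    also have "\<dots> = (\<integral>\<^sup>+w. (\<integral>\<^sup>+\<tau>. (\<integral>\<^sup>+s. F (case_nat 0 (arr c w (initseq \<tau> s))) \<partial>seqm (expm b)) \<partial>expm (1 - b)) \<partial>seqm (seqm (expm 1)))"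
      unfolding arr.simps nat.case by (rule nn_integral_prob_const[OF p(2)])
    finally show ?thesis .
  qed
  have "coinsum (1 - b) m (\<lambda>c. \<integral>\<^sup>+w. (\<integral>\<^sup>+\<tau>. (\<integral>\<^sup>+s. F1 (arr c w (initseq \<tau> s)) \<partial>seqm (expm b)) \<partial>expm (1 - b)) \<partial>seqm (seqm (expm 1))) =
    (\<integral>\<^sup>+\<tau>. (\<integral>\<^sup>+s. F1 (initseq \<tau> s) \<partial>seqm (expm b)) \<partial>expm (1 - b))"
    by (rule Suc.IH) measurable
  also have "\<dots> = (\<integral>\<^sup>+s. F (psum s) \<partial>seqm (expm b))"
    unfolding F1_def by (rule queue_law[OF b]) measurable
  finally have 1: "coinsum (1 - b) m (\<lambda>c. \<integral>\<^sup>+w. (\<integral>\<^sup>+\<tau>. (\<integral>\<^sup>+s. F1 (arr c w (initseq \<tau> s)) \<partial>seqm (expm b)) \<partial>expm (1 - b)) \<partial>seqm (seqm (expm 1))) =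
    (\<integral>\<^sup>+s. F (psum s) \<partial>seqm (expm b))" .
  show ?case
    unfolding coinsum.simps T N 1 using Suc.IH[OF F0] initseq_coin[OF b Suc.prems] by simp
qed

section \<open>Clear times as passage times in a quadrant\<close>

definition cnt :: "(nat \<Rightarrow> bool) \<Rightarrow> nat \<Rightarrow> nat \<Rightarrow> nat" where
  "cnt c d m = card {j. d \<le> j \<and> j < m \<and> \<not> c j}"

text \<open>Shifted by one: with no hole to overtake the time is 0, and the (l + 1)-st hole has the
  time \<open>a l\<close>.\<close>

definition val :: "(nat \<Rightarrow> real) \<Rightarrow> nat \<Rightarrow> real" where
  "val a h = (case h of 0 \<Rightarrow> 0 | Suc l \<Rightarrow> a l)"

lemma cnt_empty: "m \<le> d \<Longrightarrow> cnt c d m = 0"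
  by (auto simp: cnt_def)

lemma cnt_Suc: "d \<le> m \<Longrightarrow> cnt c d (Suc m) = cnt c d m + (if c m then 0 else 1)"
proof -
  assume "d \<le> m"
  then have "{j. d \<le> j \<and> j < Suc m \<and> \<not> c j} = {j. d \<le> j \<and> j < m \<and> \<not> c j} \<union> (if c m then {} else {m})"
    by (auto simp: less_Suc_eq)
  then show ?thesis by (auto simp: cnt_def)
qed

lemma cnt_first: "d < m \<Longrightarrow> cnt c d m = (if c d then 0 else 1) + cnt c (Suc d) m"
proof -
  assume "d < m"
  then have "{j. d \<le> j \<and> j < m \<and> \<not> c j} = (if c d then {} else {d}) \<union> {j. Suc d \<le> j \<and> j < m \<and> \<not> c j}"
    by (auto simp: Suc_le_eq order.order_iff_strict split: if_split_asm)
  then show ?thesis by (auto simp: cnt_def)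
qed

text \<open>The hypotheses are the recursion of \<open>clear_time\<close> on a half line read away
  from the origin. Stated for an abstract table, the lemma serves the left half line and, with
  particles and holes exchanged, the right one. \<open>base\<close> stands for what lies beyond the
  window and is arbitrary.\<close>

lemma arr_table:
  assumes empty: "\<And>d m. m \<le> d \<Longrightarrow> T d m = 0"
    and skip: "\<And>d m. d < m \<Longrightarrow> m \<le> M \<Longrightarrow> \<not> c d \<Longrightarrow> T d m = T (Suc d) m"
    and same: "\<And>d m. d \<le> m \<Longrightarrow> m < M \<Longrightarrow> c d \<Longrightarrow> c m \<Longrightarrow> T d (Suc m) = T d m"
    and step: "\<And>d m. d \<le> m \<Longrightarrow> m < M \<Longrightarrow> c d \<Longrightarrow> \<not> c m \<Longrightarrow> T d (Suc m) = max (T (Suc d) (Suc m)) (T d m) + v d (cnt c d m)"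
    and d: "d \<le> M" and m: "m \<le> M"
  shows "T d m = val (arr (drop d (map c [0..<M])) (\<lambda>d'. v (d + d')) base) (cnt c d m)"
  using d m
proof (induction "M - d" arbitrary: d m)
  case 0
  then show ?case by (simp add: empty cnt_empty val_def)
next
  case (Suc k)
  then have dM: "d < M" "k = M - Suc d" "Suc d \<le> M" by auto
  have IH: "T (Suc d) m = val (arr (drop (Suc d) (map c [0..<M])) (\<lambda>d'. v (Suc d + d')) base) (cnt c (Suc d) m)" if "m \<le> M" for m
    using Suc.hyps(1)[OF dM(2,3) that] .
  have drop: "drop d (map c [0..<M]) = c d # drop (Suc d) (map c [0..<M])"
    using dM by (subst Cons_nth_drop_Suc[symmetric]) auto
  define A where "A = arr (drop (Suc d) (map c [0..<M])) (\<lambda>d'. v (Suc d + d')) base"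
  show ?case
  proof (cases "c d")
    case False
    have e: "arr (drop d (map c [0..<M])) (\<lambda>d'. v (d + d')) base = case_nat 0 A"
      using False by (simp add: drop A_def)
    show ?thesis
    proof (cases "m \<le> d")
      case True then show ?thesis by (simp add: empty cnt_empty val_def)
    next
      case dm: False
      then have "T d m = val A (cnt c (Suc d) m)" using False Suc.prems IH by (simp add: skip A_def)
      moreover have "cnt c d m = Suc (cnt c (Suc d) m)" using dm False by (simp add: cnt_first)
      ultimately show ?thesis by (simp add: e val_def)
    qed
  next
    case True
    have e: "arr (drop d (map c [0..<M])) (\<lambda>d'. v (d + d')) base = queue A (v d)"
      using True by (simp add: drop A_def)
    show ?thesis
      unfolding e using Suc.prems(2)
    proof (induction m)
      case 0 then show ?case by (simp add: empty cnt_empty val_def)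
    next
      case (Suc m)
      show ?case
      proof (cases "Suc m \<le> d")
        case True then show ?thesis by (simp add: empty cnt_empty val_def)
      next
        case dm: False
        show ?thesis
        proof (cases "c m")
          case cm: True
          then show ?thesis using Suc dm True by (simp add: same cnt_Suc)
        next
          case cm: False
          define l where "l = cnt c d m"
          have c1: "cnt c d (Suc m) = Suc l" using dm cm by (simp add: cnt_Suc l_def)
          then have c2: "cnt c (Suc d) (Suc m) = Suc l" using dm True cnt_first[of d "Suc m" c] by simp
          have "T d (Suc m) = max (T (Suc d) (Suc m)) (T d m) + v d l"
            using dm cm True Suc.prems by (simp add: step l_def)
          also have "T (Suc d) (Suc m) = A l" using IH[OF Suc.prems] by (simp add: c2 A_def val_def)
          also have "T d m = val (queue A (v d)) l" using Suc by (simp add: l_def)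
          finally show ?thesis unfolding c1 by (cases l) (auto simp: val_def)
        qed
      qed
    qed
  qed
qed

text \<open>In contrast to \<open>lpp\<close> the axes carry passage times rather than weights:
  \<open>D\<close> on the left and \<open>a\<close> on the bottom.\<close>

fun quad :: "(nat \<Rightarrow> real) \<Rightarrow> (nat \<Rightarrow> real) \<Rightarrow> (nat \<Rightarrow> nat \<Rightarrow> real) \<Rightarrow> nat \<Rightarrow> nat \<Rightarrow> real" where
  "quad D a w i 0 = val a i"
| "quad D a w 0 (Suc j) = D j"
| "quad D a w (Suc i) (Suc j) = max (quad D a w i (Suc j)) (quad D a w (Suc i) j) + w i j"

text \<open>Only cells with particle right of and hole left of the origin form a deterministic quadrant (label 2);
  cells on the left of the origin (label 0) and on its right (label 1) produce its boundary values.\<close>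

definition lab :: "(int \<Rightarrow> bool) \<Rightarrow> int \<times> int \<Rightarrow> nat \<times> nat \<times> nat" where
  "lab \<eta> = (\<lambda>(x, y). if x \<le> 0 then (0, nat (- x), nat (hcount \<eta> (y + 1) x))
     else if 0 < y then (1, nat (y - 1), nat (hcount (\<lambda>z. \<not> \<eta> z) (y + 1) x))
     else (2, nat (hcount (\<lambda>z. \<not> \<eta> z) 1 x), nat (hcount \<eta> (y + 1) 0)))"

lemma hcount_cnt_left: "hcount \<eta> (1 - int m) (1 - int d) = int (cnt (\<lambda>j. \<eta> (- int j)) d m)"
proof -
  have "{z. 1 - int m \<le> z \<and> z < 1 - int d \<and> \<not> \<eta> z} = (\<lambda>j. - int j) ` {j. d \<le> j \<and> j < m \<and> \<not> \<eta> (- int j)}"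
  proof (intro set_eqI iffI)
    fix z assume "z \<in> {z. 1 - int m \<le> z \<and> z < 1 - int d \<and> \<not> \<eta> z}"
    then show "z \<in> (\<lambda>j. - int j) ` {j. d \<le> j \<and> j < m \<and> \<not> \<eta> (- int j)}"
      by (intro image_eqI[of _ _ "nat (- z)"]) auto
  qed auto
  then show ?thesis by (simp add: hcount_def cnt_def card_image inj_on_def)
qed

lemma hcount_cnt_right: "hcount (\<lambda>z. \<not> \<eta> z) (1 + int d) (1 + int m) = int (cnt (\<lambda>j. \<not> \<eta> (1 + int j)) d m)"
proof -
  have "{z. 1 + int d \<le> z \<and> z < 1 + int m \<and> \<not> \<not> \<eta> z} = (\<lambda>j. 1 + int j) ` {j. d \<le> j \<and> j < m \<and> \<not> \<not> \<eta> (1 + int j)}"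
  proof (intro set_eqI iffI)
    fix z assume "z \<in> {z. 1 + int d \<le> z \<and> z < 1 + int m \<and> \<not> \<not> \<eta> z}"
    then show "z \<in> (\<lambda>j. 1 + int j) ` {j. d \<le> j \<and> j < m \<and> \<not> \<not> \<eta> (1 + int j)}"
      by (intro image_eqI[of _ _ "nat (z - 1)"]) auto
  qed auto
  then show ?thesis by (simp add: hcount_def cnt_def card_image inj_on_def)
qed

lemma hcount_strict_right:
  assumes "y \<le> x'" "x' < x" "\<not> \<eta> x'"
  shows "hcount \<eta> y x' < hcount \<eta> y x"
proof -
  have "hcount \<eta> x' x = 1 + hcount \<eta> (x' + 1) x" using assms by (subst hcount_first) auto
  moreover have "hcount \<eta> y x = hcount \<eta> y x' + hcount \<eta> x' x" using assms by (intro hcount_split) auto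
  moreover have "0 \<le> hcount \<eta> (x' + 1) x" by (rule hcount_nonneg)
  ultimately show ?thesis by linarith
qed

text \<open>Within a region each entry of the label is a site or a count from a fixed end, and such
  counts are strictly monotone along holes, respectively along particles. Injectivity is what makes
  the weights of different cells independent.\<close>

lemma lab_inj:
  assumes \<eta>0: "\<eta> 0"
  shows "inj_on (lab \<eta>) {(x, y). y < x \<and> \<eta> x \<and> \<not> \<eta> y}"
proof (rule inj_onI, clarsimp)
  fix x y x' y'
  assume l: "lab \<eta> (x, y) = lab \<eta> (x', y')" and c: "y < x" "y' < x'" "\<eta> x" "\<eta> x'" "\<not> \<eta> y" "\<not> \<eta> y'"
  have nz: "y \<noteq> 0" "y' \<noteq> 0" using \<eta>0 c by auto
  have A: "y = y'" if "hcount \<eta> (y + 1) z = hcount \<eta> (y' + 1) z" "y < z" "y' < z" for z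
  proof (rule ccontr)
    assume "y \<noteq> y'"
    then consider "y < y'" | "y' < y" by linarith
    then show False
    proof cases
      case 1
      have "hcount \<eta> (y' + 1) z < hcount \<eta> (y + 1) z"
        using hcount_first[of y' z \<eta>] hcount_split[of "y + 1" y' z \<eta>] hcount_nonneg[of \<eta> "y + 1" y'] 1 that c by (simp del: hcount_nonneg)
      then show ?thesis using that by simp
    next
      case 2
      have "hcount \<eta> (y + 1) z < hcount \<eta> (y' + 1) z"
        using hcount_first[of y z \<eta>] hcount_split[of "y' + 1" y z \<eta>] hcount_nonneg[of \<eta> "y' + 1" y] 2 that c by (simp del: hcount_nonneg)
      then show ?thesis using that by simp
    qed
  qed
  have B: "x = x'" if "hcount (\<lambda>z. \<not> \<eta> z) u x = hcount (\<lambda>z. \<not> \<eta> z) u x'" "u \<le> x" "u \<le> x'" for u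
  proof (rule ccontr)
    assume "x \<noteq> x'"
    then consider "x < x'" | "x' < x" by linarith
    then show False
      using hcount_strict_right[of u x x' "\<lambda>z. \<not> \<eta> z"] hcount_strict_right[of u x' x "\<lambda>z. \<not> \<eta> z"] that c by cases auto
  qed
  consider "x \<le> 0" | "0 < x" "0 < y" | "0 < x" "y < 0" using nz by linarith
  then show "x = x' \<and> y = y'"
  proof cases
    case 1
    then have "x' \<le> 0" "nat (- x) = nat (- x')" "nat (hcount \<eta> (y + 1) x) = nat (hcount \<eta> (y' + 1) x')"
      using l by (auto simp: lab_def split: if_splits)
    then have "x = x'" "hcount \<eta> (y + 1) x = hcount \<eta> (y' + 1) x'" using 1 by (auto simp: eq_nat_nat_iff)
    then show ?thesis using A[of x] c by auto
  next
    case 2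
    then have "0 < x'" "0 < y'" "nat (y - 1) = nat (y' - 1)" "nat (hcount (\<lambda>z. \<not> \<eta> z) (y + 1) x) = nat (hcount (\<lambda>z. \<not> \<eta> z) (y' + 1) x')"
      using l by (auto simp: lab_def split: if_splits)
    then have "y = y'" "hcount (\<lambda>z. \<not> \<eta> z) (y + 1) x = hcount (\<lambda>z. \<not> \<eta> z) (y' + 1) x'" using 2 by (auto simp: eq_nat_nat_iff)
    then show ?thesis using B[of "y + 1"] c by auto
  next
    case 3
    then have "0 < x'" "y' < 0" "hcount (\<lambda>z. \<not> \<eta> z) 1 x = hcount (\<lambda>z. \<not> \<eta> z) 1 x'" "hcount \<eta> (y + 1) 0 = hcount \<eta> (y' + 1) 0"
      using l nz by (auto simp: lab_def eq_nat_nat_iff split: if_splits)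
    then show ?thesis using A[of 0] B[of 1] 3 by auto
  qed
qed

text \<open>On the left the boundary values come from the sites 0, -1, ..., -M, and on the right
  from 1, ..., M with particles and holes exchanged. The cells that straddle the origin then follow
  the recursion of \<open>quad\<close>, advancing in i only at particles and in m only at
  holes.\<close>

lemma clear_time_quad:
  assumes \<eta>0: "\<eta> 0"
    and W: "\<And>x y. - int M \<le> y \<Longrightarrow> y < x \<Longrightarrow> x \<le> int M \<Longrightarrow> \<eta> x \<Longrightarrow> \<not> \<eta> y \<Longrightarrow> W x y = get3 w (lab \<eta> (x, y))"
    and xm: "i \<le> M" "m \<le> M"
  shows "clear_time \<eta> W (int i) (- int m) =
    quad (arr (map (\<lambda>d. \<eta> (- int d)) [0..<Suc M]) (w 0) base) (arr (map (\<lambda>d. \<not> \<eta> (1 + int d)) [0..<M]) (w 1) base') (w 2)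
      (cnt (\<lambda>d. \<not> \<eta> (1 + int d)) 0 i) (cnt (\<lambda>d. \<eta> (- int d)) 0 (Suc m))"
proof -
  define cL where "cL d = \<eta> (- int d)" for d
  define cR where "cR d = (\<not> \<eta> (1 + int d))" for d
  define D where "D = arr (map cL [0..<Suc M]) (w 0) base"
  define A where "A = arr (map cR [0..<M]) (w 1) base'"
  have left: "clear_time \<eta> W 0 (1 - int m) = val D (cnt cL 0 m)" if "m \<le> Suc M" for m
  proof -
    have "clear_time \<eta> W (- int 0) (1 - int m) = val (arr (drop 0 (map cL [0..<Suc M])) (\<lambda>d'. w 0 (0 + d')) base) (cnt cL 0 m)"
    proof (rule arr_table[where T="\<lambda>d m. clear_time \<eta> W (- int d) (1 - int m)" and M="Suc M" and c=cL and v="w 0"])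
      fix d m :: nat
      show "clear_time \<eta> W (- int d) (1 - int m) = 0" if "m \<le> d"
        using that by (intro clear_time_empty) simp
      show "clear_time \<eta> W (- int d) (1 - int m) = clear_time \<eta> W (- int (Suc d)) (1 - int m)" if "d < m" "m \<le> Suc M" "\<not> cL d"
      proof (cases "m = Suc d")
        case True then show ?thesis by (simp add: clear_time_empty)
      next
        case False
        then have "clear_time \<eta> W (- int d) (1 - int m) = clear_time \<eta> W (- int d - 1) (1 - int m)"
          using that by (subst clear_time.simps) (simp add: cL_def)
        also have "- int d - 1 = - int (Suc d)" by simp
        finally show ?thesis .
      qed
      show "clear_time \<eta> W (- int d) (1 - int (Suc m)) = clear_time \<eta> W (- int d) (1 - int m)" if "d \<le> m" "m < Suc M" "cL d" "cL m"
      proof (cases "d = m")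
        case True then show ?thesis by (simp add: clear_time_empty)
      next
        case False
        then show ?thesis using that by (subst clear_time.simps) (auto simp: cL_def algebra_simps)
      qed
      show "clear_time \<eta> W (- int d) (1 - int (Suc m)) = max (clear_time \<eta> W (- int (Suc d)) (1 - int (Suc m))) (clear_time \<eta> W (- int d) (1 - int m)) + w 0 d (cnt cL d m)"
        if "d \<le> m" "m < Suc M" "cL d" "\<not> cL m"
      proof -
        have dm: "d < m" using that by (cases "d = m") auto
        have "hcount \<eta> (- int m + 1) (- int d) = int (cnt cL d m)"
          using hcount_cnt_left[of \<eta> m "Suc d"] cnt_first[OF dm, of cL] that by (simp add: cL_def[abs_def] algebra_simps)
        then have "W (- int d) (- int m) = w 0 d (cnt cL d m)"
          using that dm by (subst W) (auto simp: cL_def lab_def get3_def)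
        moreover have "clear_time \<eta> W (- int d) (- int m) = max (clear_time \<eta> W (- int d - 1) (- int m)) (clear_time \<eta> W (- int d) (- int m + 1)) + W (- int d) (- int m)"
          using that dm by (subst clear_time.simps) (simp add: cL_def)
        moreover have "- int (Suc d) = - int d - 1" "1 - int (Suc m) = - int m" "- int m + 1 = 1 - int m" by simp_all
        ultimately show ?thesis by (simp only:)
      qed
    qed (use that in auto)
    then show ?thesis by (simp add: D_def)
  qed
  have right: "clear_time \<eta> W (int m) 1 = val A (cnt cR 0 m)" if "m \<le> M" for m
  proof -
    have "clear_time \<eta> W (int m) (1 + int 0) = val (arr (drop 0 (map cR [0..<M])) (\<lambda>d'. w 1 (0 + d')) base') (cnt cR 0 m)"
    proof (rule arr_table[where T="\<lambda>d m. clear_time \<eta> W (int m) (1 + int d)" and M=M and c=cR and v="w 1"])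
      fix d m :: nat
      show "clear_time \<eta> W (int m) (1 + int d) = 0" if "m \<le> d"
        using that by (intro clear_time_empty) simp
      show "clear_time \<eta> W (int m) (1 + int d) = clear_time \<eta> W (int m) (1 + int (Suc d))" if "d < m" "m \<le> M" "\<not> cR d"
      proof (cases "Suc d = m")
        case True
        then show ?thesis by (simp add: clear_time_empty)
      next
        case False
        have e: "\<eta> (1 + int d)" using that by (simp add: cR_def)
        have "clear_time \<eta> W z (1 + int d) = clear_time \<eta> W z (1 + int (Suc d))" if "1 + int d \<le> z" for z
          using that
        proof (induction z rule: int_ge_induct)
          case base show ?case by (simp add: clear_time_empty)
        next
          case (step z)
          show ?case
          proof (cases "\<eta> (z + 1)")
            case True
            then show ?thesis using step e by (subst clear_time.simps) (simp add: algebra_simps)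
          next
            case False
            show ?thesis
            proof (cases "z + 1 \<le> 1 + int (Suc d)")
              case True
              then have "z = 1 + int d" using step by simp
              then show ?thesis using False by (subst clear_time.simps) (simp add: clear_time_empty)
            next
              case b: False
              then show ?thesis using step False by (subst (1 2) clear_time.simps) simp
            qed
          qed
        qed
        then show ?thesis using that by simp
      qed
      show "clear_time \<eta> W (int (Suc m)) (1 + int d) = clear_time \<eta> W (int m) (1 + int d)" if "d \<le> m" "m < M" "cR d" "cR m"
        using that by (cases "d = m") (auto simp: clear_time_empty cR_def clear_time.simps[of _ _ "1 + int m"])
      show "clear_time \<eta> W (int (Suc m)) (1 + int d) = max (clear_time \<eta> W (int (Suc m)) (1 + int (Suc d))) (clear_time \<eta> W (int m) (1 + int d)) + w 1 d (cnt cR d m)"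
        if "d \<le> m" "m < M" "cR d" "\<not> cR m"
      proof -
        have dm: "d < m" using that by (cases "d = m") auto
        have "hcount (\<lambda>z. \<not> \<eta> z) (2 + int d) (1 + int m) = int (cnt cR d m)"
          using hcount_cnt_right[of \<eta> "Suc d" m] cnt_first[OF dm, of cR] that by (simp add: cR_def[abs_def])
        then have "W (1 + int m) (1 + int d) = w 1 d (cnt cR d m)"
          using that dm by (subst W) (auto simp: cR_def lab_def get3_def algebra_simps)
        then show ?thesis using that dm by (subst clear_time.simps) (auto simp: cR_def algebra_simps max.commute)
      qed
    qed (use that in auto)
    then show ?thesis by (simp add: A_def)
  qed
  \<comment> \<open>Site 0 carries a particle, so it makes no difference whether the holes are
    counted from 0 or from 1.\<close>
  have row0: "clear_time \<eta> W (int i) 0 = val A (cnt cR 0 i)" if "i \<le> M" for i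
  proof -
    have "clear_time \<eta> W (int i) 0 = clear_time \<eta> W (int i) 1"
    proof (induction i)
      case 0 show ?case by (simp add: clear_time_empty)
    next
      case (Suc i)
      show ?case
      proof (cases "\<eta> (1 + int i)")
        case True
        then show ?thesis using \<eta>0 by (subst clear_time.simps) simp
      next
        case False
        show ?thesis
        proof (cases "i = 0")
          case True then show ?thesis using False by (subst clear_time.simps) (simp add: clear_time_empty)
        next
          case i0: False
          then show ?thesis using Suc False by (subst (1 2) clear_time.simps) simp
        qed
      qed
    qed
    then show ?thesis using right[OF that] by simp
  qed
  have cL0: "cnt cL 0 (Suc 0) = 0" using \<eta>0 by (simp add: cnt_Suc cnt_empty cL_def)
  have "clear_time \<eta> W (int i) (- int m) = quad D A (w 2) (cnt cR 0 i) (cnt cL 0 (Suc m))"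
    using xm
  proof (induction i m rule: grid_induct)
    case (row i)
    then show ?case using row0[of i] cL0 by simp
  next
    case (column j)
    have "clear_time \<eta> W 0 (1 - int (Suc (Suc j))) = val D (cnt cL 0 (Suc (Suc j)))" using column by (intro left) simp
    then show ?case by (cases "cnt cL 0 (Suc (Suc j))") (auto simp: cnt_empty val_def)
  next
    case (step i j)
    show ?case
    proof (cases "\<eta> (1 + int i)")
      case False
      then have "clear_time \<eta> W (int (Suc i)) (- int (Suc j)) = clear_time \<eta> W (int i) (- int (Suc j))"
        by (subst clear_time.simps) simp
      then show ?thesis using step False by (simp add: cnt_Suc cR_def)
    next
      case True
      show ?thesis
      proof (cases "\<eta> (- int (Suc j))")
        case e: True
        then have "clear_time \<eta> W (int (Suc i)) (- int (Suc j)) = clear_time \<eta> W (int (Suc i)) (- int j)"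
          using True by (subst clear_time.simps) (simp add: algebra_simps)
        then show ?thesis using step e by (simp add: cnt_Suc cL_def)
      next
        case e: False
        have c1: "cnt cR 0 (Suc i) = Suc (cnt cR 0 i)" using True by (simp add: cnt_Suc cR_def)
        have c2: "cnt cL 0 (Suc (Suc j)) = Suc (cnt cL 0 (Suc j))" using e by (subst cnt_Suc) (auto simp: cL_def)
        have h1: "hcount (\<lambda>z. \<not> \<eta> z) 1 (1 + int i) = int (cnt cR 0 i)"
          using hcount_cnt_right[of \<eta> 0 i] by (simp add: cR_def[abs_def])
        have h2: "hcount \<eta> (- int j) 0 = int (cnt cL 0 (Suc j))"
          using hcount_cnt_left[of \<eta> "Suc j" 1] cnt_first[of 0 "Suc j" cL] \<eta>0 by (simp add: cL_def[abs_def])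
        have "W (1 + int i) (- int (Suc j)) = w 2 (cnt cR 0 i) (cnt cL 0 (Suc j))"
          using step.prems True e h1 h2 by (subst W) (auto simp: lab_def get3_def)
        moreover have "clear_time \<eta> W (int (Suc i)) (- int (Suc j)) = max (clear_time \<eta> W (int i) (- int (Suc j))) (clear_time \<eta> W (int (Suc i)) (- int j)) + W (1 + int i) (- int (Suc j))"
          using True e by (subst clear_time.simps) (simp add: algebra_simps)
        ultimately show ?thesis using step c1 c2 by simp
      qed
    qed
  qed
  then show ?thesis by (simp add: D_def A_def cL_def[abs_def] cR_def[abs_def])
qed

section \<open>Locality in a finite window\<close>

lemma clear_time_conf_cong:
  assumes "\<And>z. y \<le> z \<Longrightarrow> z \<le> x \<Longrightarrow> \<eta> z = \<eta>' z"
  shows "clear_time \<eta> W x y = clear_time \<eta>' W x y"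
  using assms
proof (induction \<eta> W x y rule: clear_time.induct)
  case (1 \<eta> W x y)
  show ?case
  proof (cases "x \<le> y")
    case True then show ?thesis by (simp add: clear_time_empty)
  next
    case False
    have "\<eta> x = \<eta>' x" "\<eta> y = \<eta>' y" using 1(5) False by auto
    moreover have "\<not> \<eta> x \<or> \<not> \<eta> y \<Longrightarrow> clear_time \<eta> W (x - 1) y = clear_time \<eta>' W (x - 1) y"
      using 1(1,3) 1(5) False by auto
    moreover have "\<eta> x \<Longrightarrow> clear_time \<eta> W x (y + 1) = clear_time \<eta>' W x (y + 1)"
      using 1(2,4) 1(5) False by auto
    ultimately show ?thesis using False by (subst (1 2) clear_time.simps) auto
  qed
qed

lemma hcount_conf_cong:
  assumes "\<And>z. y \<le> z \<Longrightarrow> z < x \<Longrightarrow> \<eta> z = \<eta>' z"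
  shows "hcount \<eta> y x = hcount \<eta>' y x"
  unfolding hcount_def using assms by (intro arg_cong[where f="\<lambda>A. int (card A)"]) auto

lemma run_conf_cong:
  assumes ag: "\<And>z. lo \<le> z \<Longrightarrow> z \<le> hi \<Longrightarrow> \<eta> z = \<eta>' z"
    and cs: "\<And>x y. (x, y) \<in> set cs \<Longrightarrow> lo \<le> y \<and> x \<le> hi"
  shows "run \<eta> cs W c b = run \<eta>' cs W c b"
  using cs
proof (induction cs arbitrary: W c b)
  case (Cons p cs)
  obtain x y where p: "p = (x, y)" by (cases p) auto
  have xy: "lo \<le> y" "x \<le> hi" using Cons.prems[of x y] p by auto
  have "cell_site \<eta> x y = cell_site \<eta>' x y"
    unfolding cell_site_def using xy by (auto intro!: hcount_conf_cong ag)
  moreover have "clear_time \<eta> W (x - 1) y = clear_time \<eta>' W (x - 1) y" "clear_time \<eta> W x (y + 1) = clear_time \<eta>' W x (y + 1)"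
    using xy by (auto intro!: clear_time_conf_cong ag)
  ultimately show ?case
    unfolding p run.simps Let_def by (simp only:) (rule Cons.IH, use Cons.prems in auto)
qed simp

lemma cells_conf_cong:
  assumes "\<And>z. lo \<le> z \<Longrightarrow> z \<le> hi \<Longrightarrow> \<eta> z = \<eta>' z"
  shows "cells \<eta> lo hi = cells \<eta>' lo hi"
  unfolding cells_def using assms
  by (intro arg_cong[where f=concat] map_cong filter_cong arg_cong[where f="map _"]) auto

lemma hcount_complement: "y \<le> x \<Longrightarrow> hcount \<eta> y x + hcount (\<lambda>z. \<not> \<eta> z) y x = x - y"
proof (induction x rule: int_ge_induct)
  case base show ?case by (simp add: hcount_empty)
next
  case (step x)
  then show ?case
    using hcount_split[of y x "x + 1" \<eta>] hcount_split[of y x "x + 1" "\<lambda>z. \<not> \<eta> z"] by (simp add: hcount_singleton)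
qed

text \<open>Translates a label into a count of occupied sites, the form in which finite patterns see
  it.\<close>

lemma strict_mono_count:
  fixes f :: "int \<Rightarrow> int"
  assumes sm: "strict_mono f" and f0: "f 0 = 0"
  shows "hcount (\<lambda>z. \<not> (\<exists>i. f i = z)) 1 (f (int n) + 1) = int n"
proof (induction n)
  case 0 show ?case using f0 by (simp add: hcount_empty)
next
  case (Suc n)
  let ?c = "\<lambda>z. \<not> (\<exists>i. f i = z)"
  have lt: "f (int n) < f (int (Suc n))" using sm by (simp add: strict_mono_def)
  have "0 \<le> f (int n)" using sm f0 by (metis of_nat_0_le_iff strict_mono_less_eq)
  have "{z. f (int n) + 1 \<le> z \<and> z < f (int (Suc n)) \<and> \<not> ?c z} = {}"
  proof -
    have False if "f (int n) < f j" "f j < f (int (Suc n))" for j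
    proof -
      have "int n < j" "j < int (Suc n)" using that sm by (simp_all add: strict_mono_less)
      then show False by simp
    qed
    then show ?thesis by fastforce
  qed
  then have 1: "hcount ?c (f (int n) + 1) (f (int (Suc n))) = 0" unfolding hcount_def by (simp only: card.empty of_nat_0)
  have 2: "hcount ?c (f (int (Suc n))) (f (int (Suc n)) + 1) = 1"
    by (subst hcount_singleton) auto
  show ?case
    using hcount_split[of 1 "f (int n) + 1" "f (int (Suc n)) + 1" ?c]
      hcount_split[of "f (int n) + 1" "f (int (Suc n))" "f (int (Suc n)) + 1" ?c] 1 2 Suc lt \<open>0 \<le> f (int n)\<close> by simp
qed

lemma cnt_reaches:
  assumes "n \<le> cnt f 0 M"
  obtains i where "i \<le> M" "cnt f 0 i = n" "i = 0 \<or> \<not> f (i - 1)"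
  using assms
proof (induction M arbitrary: thesis)
  case 0 then show ?case by (simp add: cnt_empty)
next
  case (Suc M)
  show ?case
  proof (cases "n \<le> cnt f 0 M")
    case True
    show ?thesis
    proof (rule Suc.IH[OF _ True])
      fix i assume "i \<le> M" "cnt f 0 i = n" "i = 0 \<or> \<not> f (i - 1)"
      then show thesis by (intro Suc.prems(1)[of i]) auto
    qed
  next
    case False
    then have "cnt f 0 (Suc M) = n" "\<not> f M" using Suc.prems(2) by (auto simp: cnt_Suc split: if_splits)
    then show ?thesis by (intro Suc.prems(1)[of "Suc M"]) auto
  qed
qed

text \<open>The lists describe the two half lines read away from the origin; on the left \<open>True\<close> is a particle,
  on the right it is a hole, because the recursion exchanges the roles of the two species there.\<close>

definition conf :: "bool list \<Rightarrow> bool list \<Rightarrow> int \<Rightarrow> bool" where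
  "conf c c' z \<longleftrightarrow> z = 0 \<or> (z < 0 \<and> nat (- z - 1) < length c \<and> c ! nat (- z - 1)) \<or>
     (0 < z \<and> nat (z - 1) < length c' \<and> \<not> c' ! nat (z - 1))"

lemma conf_0 [simp]: "conf c c' 0" by (simp add: conf_def)

lemma conf_left: "map (\<lambda>d. conf c c' (- int d)) [0..<Suc (length c)] = True # c"
proof (rule nth_equalityI)
  fix i assume "i < length (map (\<lambda>d. conf c c' (- int d)) [0..<Suc (length c)])"
  then have i: "i < Suc (length c)" by simp
  then have "map (\<lambda>d. conf c c' (- int d)) [0..<Suc (length c)] ! i = conf c c' (- int i)"
    by (subst nth_map) (auto simp del: upt_Suc)
  then show "map (\<lambda>d. conf c c' (- int d)) [0..<Suc (length c)] ! i = (True # c) ! i"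
    using i by (cases i) (auto simp: conf_def)
qed simp

lemma conf_right: "map (\<lambda>d. \<not> conf c c' (1 + int d)) [0..<length c'] = c'"
  by (rule nth_equalityI) (simp_all add: conf_def)

definition nfalse :: "bool list \<Rightarrow> nat" where "nfalse c = length (filter Not c)"

lemma cnt_nfalse: "cnt f 0 M = nfalse (map f [0..<M])"
  by (induction M) (auto simp: nfalse_def cnt_empty cnt_Suc)

text \<open>The two coordinates of the site of particle \<open>n\<close> and of the \<open>k\<close>-th hole left of the origin.\<close>

lemma conf_targets:
  assumes c: "length c = M" "length c' = M" and n: "n \<le> nfalse c'" and k: "1 \<le> k" "k \<le> nfalse c"
  obtains i m where "i \<le> M" "m \<le> M"
    "cnt (\<lambda>d. \<not> conf c c' (1 + int d)) 0 i = n" "cnt (\<lambda>d. conf c c' (- int d)) 0 (Suc m) = k"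
    "i = 0 \<or> conf c c' (int i)" "\<not> conf c c' (- int m)"
proof -
  let ?R = "\<lambda>d. \<not> conf c c' (1 + int d)" and ?L = "\<lambda>d. conf c c' (- int d)"
  have "n \<le> cnt ?R 0 M" unfolding cnt_nfalse using conf_right[of c c'] c n by simp
  then obtain i where i: "i \<le> M" "cnt ?R 0 i = n" "i = 0 \<or> \<not> ?R (i - 1)" by (rule cnt_reaches)
  have "k \<le> cnt ?L 0 (Suc M)" unfolding cnt_nfalse using conf_left[of c c'] c k by (simp add: nfalse_def)
  then obtain m' where m': "m' \<le> Suc M" "cnt ?L 0 m' = k" "m' = 0 \<or> \<not> ?L (m' - 1)" by (rule cnt_reaches)
  then have "m' \<noteq> 0" using k(1) cnt_empty[of 0 0 ?L] by (cases "m' = 0") auto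
  then obtain m where "m' = Suc m" by (cases m') auto
  moreover have "i = 0 \<or> conf c c' (int i)" using i(3) by (cases i) auto
  ultimately show ?thesis using m' i by (intro that[of i m]) auto
qed

text \<open>With enough particles on the right and holes on the left, the clear time never looks
  beyond the window, so the base sequences are free. Later they are filled with
  \<open>initseq\<close>, which brings in the stationary boundary.\<close>

lemma quad_base_indep:
  assumes c: "length c = M" "length c' = M" and n: "n \<le> nfalse c'" and k: "1 \<le> k" "k \<le> nfalse c"
    and im: "i \<le> M" "m \<le> M" "cnt (\<lambda>d. \<not> conf c c' (1 + int d)) 0 i = n" "cnt (\<lambda>d. conf c c' (- int d)) 0 (Suc m) = k"
  shows "quad (arr (True # c) (w 0) base) (arr c' (w 1) base') (w 2) n k =
    clear_time (conf c c') (\<lambda>x y. if (x, y) \<in> set (cells (conf c c') (- int M) (int M)) then get3 w (lab (conf c c') (x, y)) else 0) (int i) (- int m)"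
  using clear_time_quad[of "conf c c'" M "\<lambda>x y. if (x, y) \<in> set (cells (conf c c') (- int M) (int M)) then get3 w (lab (conf c c') (x, y)) else 0" w i m base base']
    conf_left[of c c'] conf_right[of c c'] c im
  by (simp add: set_cells)

text \<open>The infinite configuration agrees with \<eta> only on the window, which contains
  everything that matters. Particle n starts at i and there are k + i - n holes in [-m, i), so
  overtaking all of them leads to n - k.\<close>

lemma path_event:
  assumes path: "tasep_path e r" and good: "\<And>s. good_clock (e s)"
    and ag: "\<And>z. - int M \<le> z \<Longrightarrow> z \<le> int M \<Longrightarrow> occupied (\<lambda>i. r i 0) z = \<eta> z"
    and im: "i \<le> M" "m \<le> M" "cnt (\<lambda>d. \<not> \<eta> (1 + int d)) 0 i = n" "cnt (\<lambda>d. \<eta> (- int d)) 0 (Suc m) = k"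
      "i = 0 \<or> \<eta> (int i)" and t: "0 \<le> t"
  shows "r (int n) t \<le> int n - int k \<longleftrightarrow>
    clear_time \<eta> (run \<eta> (cells \<eta> (- int M) (int M)) W e (\<lambda>_. 0)) (int i) (- int m) \<le> t"
proof -
  define \<eta>' where "\<eta>' = occupied (\<lambda>i. r i 0)"
  have r0: "r 0 0 = 0" and sm: "strict_mono (\<lambda>i. r i 0)" using path by (auto simp: tasep_path_def)
  have \<eta>'0: "\<eta>' 0" using r0 by (auto simp: \<eta>'_def occupied_def)
  have ag': "\<eta>' z = \<eta> z" if "- int M \<le> z" "z \<le> int M" for z using ag[OF that] by (simp add: \<eta>'_def)
  have cR: "hcount (\<lambda>z. \<not> \<eta>' z) 1 (1 + int i) = int n"
  proof -
    have "hcount (\<lambda>z. \<not> \<eta>' z) 1 (1 + int i) = hcount (\<lambda>z. \<not> \<eta> z) 1 (1 + int i)"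
      using im by (intro hcount_conf_cong) (auto simp: ag')
    then show ?thesis using hcount_cnt_right[of \<eta> 0 i] im(3) by simp
  qed
  have cL: "hcount \<eta>' (- int m) 1 = int k"
  proof -
    have "hcount \<eta>' (- int m) 1 = hcount \<eta> (- int m) 1"
    proof (rule hcount_conf_cong)
      fix z assume "- int m \<le> z" "z < 1"
      then show "\<eta>' z = \<eta> z" using im by (intro ag') auto
    qed
    then show ?thesis using hcount_cnt_left[of \<eta> "Suc m" 0] im(4) by simp
  qed
  have i\<eta>': "i = 0 \<or> \<eta>' (int i)" using im by (auto simp: ag')
  then have i\<eta>': "\<eta>' (int i)" using \<eta>'0 by auto
  have count: "hcount (\<lambda>z. \<not> \<eta>' z) 1 (r (int n) 0 + 1) = int n"
    using strict_mono_count[OF sm r0, of n] by (simp add: \<eta>'_def occupied_def[abs_def])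
  have rn: "\<eta>' (r (int n) 0)" by (auto simp: \<eta>'_def occupied_def)
  have rn0: "0 \<le> r (int n) 0" using sm r0 by (metis of_nat_0_le_iff strict_mono_less_eq)
  have pos: "r (int n) 0 = int i"
  proof (rule ccontr)
    assume "r (int n) 0 \<noteq> int i"
    then consider "r (int n) 0 < int i" | "int i < r (int n) 0" by linarith
    then show False
    proof cases
      case 1
      have "hcount (\<lambda>z. \<not> \<eta>' z) 1 (r (int n) 0 + 1) \<le> hcount (\<lambda>z. \<not> \<eta>' z) 1 (int i)"
        using hcount_split[of 1 "r (int n) 0 + 1" "int i" "\<lambda>z. \<not> \<eta>' z"] 1 rn0 by simp
      also have "\<dots> < hcount (\<lambda>z. \<not> \<eta>' z) 1 (1 + int i)"
        using 1 rn0 i\<eta>' by (intro hcount_strict_right) auto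
      finally show ?thesis using count cR by simp
    next
      case 2
      have "hcount (\<lambda>z. \<not> \<eta>' z) 1 (1 + int i) \<le> hcount (\<lambda>z. \<not> \<eta>' z) 1 (r (int n) 0)"
        using hcount_split[of 1 "1 + int i" "r (int n) 0" "\<lambda>z. \<not> \<eta>' z"] 2 by simp
      also have "\<dots> < hcount (\<lambda>z. \<not> \<eta>' z) 1 (r (int n) 0 + 1)"
        using 2 rn by (intro hcount_strict_right) auto
      finally show ?thesis using count cR by simp
    qed
  qed
  have "hcount \<eta>' (- int m) (int i) = int k + (int i - int n)"
  proof -
    have "hcount \<eta>' (- int m) (1 + int i) = hcount \<eta>' (- int m) (int i) + hcount \<eta>' (int i) (1 + int i)"
      by (rule hcount_split) auto
    also have "hcount \<eta>' (int i) (1 + int i) = 0" using hcount_singleton[of \<eta>' "int i"] i\<eta>' by (simp add: add.commute)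
    finally have "hcount \<eta>' (- int m) (int i) = hcount \<eta>' (- int m) (1 + int i)" by simp
    also have "\<dots> = hcount \<eta>' (- int m) 1 + hcount \<eta>' 1 (1 + int i)" by (rule hcount_split) auto
    also have "hcount \<eta>' 1 (1 + int i) = int i - int n" using hcount_complement[of 1 "1 + int i" \<eta>'] cR by simp
    finally show ?thesis using cL by simp
  qed
  then have "r (int n) t \<le> int n - int k \<longleftrightarrow> r (int n) t \<le> r (int n) 0 - hcount \<eta>' (- int m) (r (int n) 0)"
    by (simp add: pos)
  also have "\<dots> \<longleftrightarrow> clear_time \<eta>' (run \<eta>' (cells \<eta>' (- int M) (int M)) W e (\<lambda>_. 0)) (r (int n) 0) (- int m) \<le> t"
    using im pos t by (intro clear_time_correct[OF path good \<eta>'_def]) auto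
  also have "cells \<eta>' (- int M) (int M) = cells \<eta> (- int M) (int M)"
    by (rule cells_conf_cong) (auto simp: ag')
  also have "run \<eta>' (cells \<eta> (- int M) (int M)) W e (\<lambda>_. 0) = run \<eta> (cells \<eta> (- int M) (int M)) W e (\<lambda>_. 0)"
    by (rule run_conf_cong[of "- int M" "int M"]) (auto simp: ag' set_cells)
  also have "clear_time \<eta>' W' (r (int n) 0) (- int m) = clear_time \<eta> W' (int i) (- int m)" for W'
    unfolding pos using im by (intro clear_time_conf_cong ag') auto
  finally show ?thesis .
qed

section \<open>Averaging over finite coin patterns\<close>

fun wt :: "real \<Rightarrow> bool list \<Rightarrow> real" where
  "wt p [] = 1"
| "wt p (b # c) = (if b then p else 1 - p) * wt p c"

lemma wt_nonneg: "0 \<le> p \<Longrightarrow> p \<le> 1 \<Longrightarrow> 0 \<le> wt p c"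
  by (induction c) auto

lemma wt_prod: "wt p c = (\<Prod>d<length c. if c ! d then p else 1 - p)"
  by (induction c) (auto simp: prod.lessThan_Suc_shift simp del: prod.lessThan_Suc)

lemma finite_bool_lists: "finite {c :: bool list. length c = m}"
  using finite_lists_length_eq[of "UNIV :: bool set" m] by simp

lemma coinsum_sum:
  assumes p: "0 \<le> p" "p \<le> 1"
  shows "coinsum p m f = (\<Sum>c | length c = m. ennreal (wt p c) * f c)"
proof (induction m arbitrary: f)
  case 0
  have "{c :: bool list. length c = 0} = {[]}" by auto
  then show ?case by simp
next
  case (Suc m)
  have e: "{c :: bool list. length c = Suc m} = Cons True ` {c. length c = m} \<union> Cons False ` {c. length c = m}"
    by (auto simp: length_Suc_conv image_iff)
  have "(\<Sum>c | length c = Suc m. ennreal (wt p c) * f c) =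
    (\<Sum>c | length c = m. ennreal (wt p (True # c)) * f (True # c)) + (\<Sum>c | length c = m. ennreal (wt p (False # c)) * f (False # c))"
    unfolding e using finite_bool_lists
    by (subst sum.union_disjoint) (auto simp: sum.reindex inj_on_def)
  also have "\<dots> = coinsum p (Suc m) f"
    using p wt_nonneg[OF p] by (simp add: Suc sum_distrib_left ennreal_mult mult.assoc)
  finally show ?case by simp
qed

lemma coinsum_add: "coinsum p m (\<lambda>c. f c + g c) = coinsum p m f + coinsum p m g"
  by (induction m arbitrary: f g) (auto simp: distrib_left ac_simps)

lemma coinsum_mono: "(\<And>c. f c \<le> g c) \<Longrightarrow> coinsum p m f \<le> coinsum p m g"
  by (induction m arbitrary: f g) (auto intro!: add_mono mult_left_mono)

lemma coinsum_cmult: "coinsum p m (\<lambda>c. a * f c) = a * coinsum p m f"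
  by (induction m arbitrary: f) (auto simp: distrib_left ac_simps)

lemma coinsum_const: "0 \<le> p \<Longrightarrow> p \<le> 1 \<Longrightarrow> coinsum p m (\<lambda>c. a) = a"
proof (induction m)
  case (Suc m)
  have "ennreal p + ennreal (1 - p) = 1" using Suc.prems by (subst ennreal_plus[symmetric]) auto
  then have "(ennreal p + ennreal (1 - p)) * a = a" by simp
  then show ?case using Suc by (simp add: distrib_right)
qed simp

lemma coinsum_nn_integral:
  assumes "\<And>c. f c \<in> borel_measurable M"
  shows "coinsum p m (\<lambda>c. \<integral>\<^sup>+x. f c x \<partial>M) = (\<integral>\<^sup>+x. coinsum p m (\<lambda>c. f c x) \<partial>M) \<and> (\<lambda>x. coinsum p m (\<lambda>c. f c x)) \<in> borel_measurable M"
  using assms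
proof (induction m arbitrary: f)
  case (Suc m)
  have 1: "coinsum p m (\<lambda>c. \<integral>\<^sup>+x. f (b # c) x \<partial>M) = (\<integral>\<^sup>+x. coinsum p m (\<lambda>c. f (b # c) x) \<partial>M)"
    and 2 [measurable]: "(\<lambda>x. coinsum p m (\<lambda>c. f (b # c) x)) \<in> borel_measurable M" for b
    using Suc.IH[of "\<lambda>c. f (b # c)"] Suc.prems by auto
  show ?case unfolding coinsum.simps 1 by (auto simp: nn_integral_add nn_integral_cmult)
qed simp

text \<open>Exponential Markov inequality for the number of \<open>False\<close> coins; p + (1 - p)
  exp (-1) is the contribution of one coin.\<close>

lemma coinsum_few_le:
  assumes p: "0 \<le> p" "p < 1"
  shows "coinsum p m (\<lambda>c. indicator {c. nfalse c < k} c) \<le> ennreal (exp (real k) * (p + (1 - p) * exp (- 1)) ^ m)"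
proof -
  define q where "q = p + (1 - p) * exp (- 1)"
  have q: "0 \<le> q" using p by (simp add: q_def)
  have e: "coinsum p m (\<lambda>c. ennreal (exp (- real (nfalse c)))) = ennreal (q ^ m)" for m
  proof (induction m)
    case (Suc m)
    have F: "ennreal (exp (- real (nfalse (False # c)))) = ennreal (exp (- 1)) * ennreal (exp (- real (nfalse c)))" for c
      by (simp add: nfalse_def ennreal_mult'[symmetric] exp_add[symmetric])
    have T: "nfalse (True # c) = nfalse c" for c by (simp add: nfalse_def)
    have "ennreal p * ennreal (q ^ m) + ennreal (1 - p) * (ennreal (exp (- 1)) * ennreal (q ^ m)) =
      ennreal (p * q ^ m) + ennreal ((1 - p) * (exp (- 1) * q ^ m))"
      using p q by (simp only: ennreal_mult[symmetric] exp_ge_zero zero_le_power mult_nonneg_nonneg diff_ge_0_iff_ge less_imp_le)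
    also have "\<dots> = ennreal (p * q ^ m + (1 - p) * (exp (- 1) * q ^ m))"
      using p q by (intro ennreal_plus[symmetric]) auto
    also have "p * q ^ m + (1 - p) * (exp (- 1) * q ^ m) = q ^ Suc m"
      by (simp add: q_def algebra_simps)
    finally show ?case unfolding coinsum.simps F T coinsum_cmult Suc .
  qed (simp add: nfalse_def)
  have "coinsum p m (\<lambda>c. indicator {c. nfalse c < k} c) \<le> coinsum p m (\<lambda>c. ennreal (exp (real k)) * ennreal (exp (- real (nfalse c))))"
    by (rule coinsum_mono)
       (auto simp: indicator_def ennreal_mult'[symmetric] exp_add[symmetric] simp flip: ennreal_1 intro!: ennreal_leI)
  also have "\<dots> = ennreal (exp (real k) * q ^ m)" unfolding coinsum_cmult e using q by (simp add: ennreal_mult'[symmetric])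
  finally show ?thesis by (simp only: q_def)
qed

lemma coinsum_few:
  assumes p: "0 \<le> p" "p < 1"
  shows "(\<lambda>m. coinsum p m (\<lambda>c. indicator {c. nfalse c < k} c)) \<longlonglongrightarrow> 0"
proof -
  define q where "q = p + (1 - p) * exp (- 1)"
  have q: "0 \<le> q" "q < 1"
  proof -
    show "0 \<le> q" using p by (simp add: q_def)
    have "(1 - p) * exp (- 1) < (1 - p) * 1" using p by (intro mult_strict_left_mono) auto
    then show "q < 1" by (simp add: q_def)
  qed
  have "(\<lambda>m. exp (real k) * q ^ m) \<longlonglongrightarrow> exp (real k) * 0"
    using q by (intro tendsto_mult tendsto_const LIMSEQ_realpow_zero)
  then have "(\<lambda>m. ennreal (exp (real k) * q ^ m)) \<longlonglongrightarrow> ennreal 0" by (intro tendsto_ennrealI) simp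
  then have lim: "(\<lambda>m. ennreal (exp (real k) * q ^ m)) \<longlonglongrightarrow> 0" by simp
  show ?thesis
    by (rule tendsto_sandwich[OF _ _ tendsto_const lim])
       (auto intro: always_eventually coinsum_few_le[OF p, folded q_def])
qed

lemma measurable_val [measurable (raw)]:
  assumes [measurable]: "f \<in> measurable M (seqm borel)"
  shows "(\<lambda>x. val (f x) i) \<in> borel_measurable M"
  unfolding val_def by (cases i) auto

lemma measurable_quad [measurable (raw)]:
  assumes [measurable]: "f \<in> measurable M (seqm borel)" "g \<in> measurable M (seqm borel)" "h \<in> measurable M (seqm (seqm borel))"
  shows "(\<lambda>x. quad (f x) (g x) (h x) i j) \<in> borel_measurable M"
proof (induction i j rule: grid_induct)
  case (step i j)
  note [measurable] = step measurable_component2[OF assms(3)]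
  show ?case unfolding quad.simps by measurable
qed auto

definition quad_le :: "nat \<Rightarrow> nat \<Rightarrow> real \<Rightarrow> (nat \<Rightarrow> real) \<Rightarrow> (nat \<Rightarrow> real) \<Rightarrow> (nat \<Rightarrow> nat \<Rightarrow> real) \<Rightarrow> ennreal" where
  "quad_le n k t D a w = indicator {..t} (quad D a w n k)"

lemma measurable_quad_le [measurable (raw)]:
  assumes [measurable]: "f \<in> measurable M (seqm borel)" "g \<in> measurable M (seqm borel)" "h \<in> measurable M (seqm (seqm borel))"
  shows "(\<lambda>x. quad_le n k t (f x) (g x) (h x)) \<in> borel_measurable M"
  unfolding quad_le_def by measurable

text \<open>Given the times \<open>D\<close> on the left axis, the probability of passage by time t
  when the whole right half line is summarised by \<open>initseq\<close>.\<close>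

definition row_int :: "real \<Rightarrow> nat \<Rightarrow> nat \<Rightarrow> real \<Rightarrow> (nat \<Rightarrow> real) \<Rightarrow> ennreal" where
  "row_int \<alpha> n k t D = (\<integral>\<^sup>+\<tau>. (\<integral>\<^sup>+s. (\<integral>\<^sup>+w. quad_le n k t D (initseq \<tau> s) w \<partial>seqm (seqm (expm 1))) \<partial>seqm (expm \<alpha>)) \<partial>expm (1 - \<alpha>))"

definition row_coin :: "real \<Rightarrow> nat \<Rightarrow> nat \<Rightarrow> real \<Rightarrow> bool list \<Rightarrow> (nat \<Rightarrow> real) \<Rightarrow> ennreal" where
  "row_coin \<alpha> n k t c D = (\<integral>\<^sup>+w1. (\<integral>\<^sup>+\<tau>. (\<integral>\<^sup>+s. (\<integral>\<^sup>+w. quad_le n k t D (arr c w1 (initseq \<tau> s)) w \<partial>seqm (seqm (expm 1))) \<partial>seqm (expm \<alpha>)) \<partial>expm (1 - \<alpha>)) \<partial>seqm (seqm (expm 1)))"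

text \<open>The probability of passage by time t for fixed patterns on both sides. The additional
  \<open>queue\<close> on the left is the line of the particle at the origin, which is always
  present.\<close>

definition both_coin :: "real \<Rightarrow> nat \<Rightarrow> nat \<Rightarrow> real \<Rightarrow> bool list \<Rightarrow> bool list \<Rightarrow> ennreal" where
  "both_coin \<alpha> n k t c c' = (\<integral>\<^sup>+w0. (\<integral>\<^sup>+\<tau>. (\<integral>\<^sup>+s. (\<integral>\<^sup>+v. row_coin \<alpha> n k t c' (queue (arr c w0 (initseq \<tau> s)) v) \<partial>seqm (expm 1)) \<partial>seqm (expm (1 - \<alpha>))) \<partial>expm \<alpha>) \<partial>seqm (seqm (expm 1)))"

context
  fixes \<alpha> :: real
  assumes \<alpha>: "0 < \<alpha>" "\<alpha> < 1"
begin

lemma coin_probs: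
  "prob_space (expm \<alpha>)" "prob_space (expm (1 - \<alpha>))" "prob_space (seqm (expm \<alpha>))" "prob_space (seqm (expm (1 - \<alpha>)))"
  "prob_space (seqm (expm 1))" "prob_space (seqm (seqm (expm 1)))" "prob_space (expm 1)"
  using \<alpha> by (auto intro: prob_space_expm prob_seqm_expm prob_bulk)

lemma measurable_row_int:
  assumes [measurable]: "f \<in> measurable M (seqm borel)"
  shows "(\<lambda>x. row_int \<alpha> n k t (f x)) \<in> borel_measurable M"
proof -
  interpret S: prob_space "seqm (expm \<alpha>)" by (rule coin_probs)
  interpret E: prob_space "expm (1 - \<alpha>)" by (rule coin_probs)
  interpret B: prob_space "seqm (seqm (expm 1))" by (rule coin_probs)
  show ?thesis unfolding row_int_def by measurable
qed

lemma measurable_row_coin: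
  assumes [measurable]: "f \<in> measurable M (seqm borel)"
  shows "(\<lambda>x. row_coin \<alpha> n k t c (f x)) \<in> borel_measurable M"
proof -
  interpret S: prob_space "seqm (expm \<alpha>)" by (rule coin_probs)
  interpret E: prob_space "expm (1 - \<alpha>)" by (rule coin_probs)
  interpret B: prob_space "seqm (seqm (expm 1))" by (rule coin_probs)
  show ?thesis unfolding row_coin_def by measurable
qed

lemma row_coinsum: "coinsum (1 - \<alpha>) m (\<lambda>c. row_coin \<alpha> n k t c D) = row_int \<alpha> n k t D"
proof -
  interpret B: prob_space "seqm (seqm (expm 1))" by (rule coin_probs)
  have [measurable]: "(\<lambda>a. \<integral>\<^sup>+w. quad_le n k t D a w \<partial>seqm (seqm (expm 1))) \<in> borel_measurable (seqm borel)"
    by (measurable, auto simp: space_PiM)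
  show ?thesis unfolding row_coin_def row_int_def using \<alpha> by (intro arr_law) auto
qed

text \<open>The coins of both half lines disappear by \<open>arr_law\<close>. On the left the line
  of the origin also removes \<tau> through \<open>queue_law\<close> and leaves exact exponential
  increments of rate 1 - \<alpha>; on the right \<tau> survives inside
  \<open>row_int\<close>.\<close>

lemma both_coinsum:
  "coinsum \<alpha> m (\<lambda>c. coinsum (1 - \<alpha>) m (\<lambda>c'. both_coin \<alpha> n k t c c')) = (\<integral>\<^sup>+s. row_int \<alpha> n k t (psum s) \<partial>seqm (expm (1 - \<alpha>)))"
proof -
  interpret B: prob_space "seqm (seqm (expm 1))" by (rule coin_probs)
  interpret S: prob_space "seqm (expm (1 - \<alpha>))" by (rule coin_probs)
  interpret E: prob_space "expm \<alpha>" by (rule coin_probs)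
  interpret V: prob_space "seqm (expm 1)" by (rule coin_probs)
  note [measurable] = measurable_row_coin measurable_row_int
  have inner: "coinsum (1 - \<alpha>) m (\<lambda>c'. both_coin \<alpha> n k t c c') =
    (\<integral>\<^sup>+w0. (\<integral>\<^sup>+\<tau>. (\<integral>\<^sup>+s. (\<integral>\<^sup>+v. row_int \<alpha> n k t (queue (arr c w0 (initseq \<tau> s)) v) \<partial>seqm (expm 1)) \<partial>seqm (expm (1 - \<alpha>))) \<partial>expm \<alpha>) \<partial>seqm (seqm (expm 1)))" for c
  proof -
    have "coinsum (1 - \<alpha>) m (\<lambda>c'. both_coin \<alpha> n k t c c') =
      (\<integral>\<^sup>+w0. coinsum (1 - \<alpha>) m (\<lambda>c'. (\<integral>\<^sup>+\<tau>. (\<integral>\<^sup>+s. (\<integral>\<^sup>+v. row_coin \<alpha> n k t c' (queue (arr c w0 (initseq \<tau> s)) v) \<partial>seqm (expm 1)) \<partial>seqm (expm (1 - \<alpha>))) \<partial>expm \<alpha>)) \<partial>seqm (seqm (expm 1)))"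
      unfolding both_coin_def by (intro coinsum_nn_integral[THEN conjunct1]) measurable
    also have "\<dots> = (\<integral>\<^sup>+w0. (\<integral>\<^sup>+\<tau>. coinsum (1 - \<alpha>) m (\<lambda>c'. (\<integral>\<^sup>+s. (\<integral>\<^sup>+v. row_coin \<alpha> n k t c' (queue (arr c w0 (initseq \<tau> s)) v) \<partial>seqm (expm 1)) \<partial>seqm (expm (1 - \<alpha>)))) \<partial>expm \<alpha>) \<partial>seqm (seqm (expm 1)))"
      by (intro nn_integral_cong coinsum_nn_integral[THEN conjunct1]) (measurable, auto simp: space_PiM)
    also have "\<dots> = (\<integral>\<^sup>+w0. (\<integral>\<^sup>+\<tau>. (\<integral>\<^sup>+s. coinsum (1 - \<alpha>) m (\<lambda>c'. (\<integral>\<^sup>+v. row_coin \<alpha> n k t c' (queue (arr c w0 (initseq \<tau> s)) v) \<partial>seqm (expm 1))) \<partial>seqm (expm (1 - \<alpha>))) \<partial>expm \<alpha>) \<partial>seqm (seqm (expm 1)))"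
      by (intro nn_integral_cong coinsum_nn_integral[THEN conjunct1]) (measurable, auto simp: space_PiM)
    also have "\<dots> = (\<integral>\<^sup>+w0. (\<integral>\<^sup>+\<tau>. (\<integral>\<^sup>+s. (\<integral>\<^sup>+v. coinsum (1 - \<alpha>) m (\<lambda>c'. row_coin \<alpha> n k t c' (queue (arr c w0 (initseq \<tau> s)) v)) \<partial>seqm (expm 1)) \<partial>seqm (expm (1 - \<alpha>))) \<partial>expm \<alpha>) \<partial>seqm (seqm (expm 1)))"
      by (intro nn_integral_cong coinsum_nn_integral[THEN conjunct1]) (measurable, auto simp: space_PiM)
    finally show ?thesis by (simp only: row_coinsum)
  qed
  have b: "0 < 1 - \<alpha>" "1 - \<alpha> < 1" using \<alpha> by auto
  have F1: "(\<lambda>a. \<integral>\<^sup>+v. row_int \<alpha> n k t (queue a v) \<partial>seqm (expm 1)) \<in> borel_measurable (seqm borel)" by measurable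
  have "coinsum \<alpha> m (\<lambda>c. coinsum (1 - \<alpha>) m (\<lambda>c'. both_coin \<alpha> n k t c c')) =
    (\<integral>\<^sup>+\<tau>. (\<integral>\<^sup>+s. (\<integral>\<^sup>+v. row_int \<alpha> n k t (queue (initseq \<tau> s) v) \<partial>seqm (expm 1)) \<partial>seqm (expm (1 - \<alpha>))) \<partial>expm \<alpha>)"
    unfolding inner using arr_law[OF b F1, of m] by simp
  also have "\<dots> = (\<integral>\<^sup>+s. row_int \<alpha> n k t (psum s) \<partial>seqm (expm (1 - \<alpha>)))"
    using queue_law[OF b, of "row_int \<alpha> n k t"] measurable_row_int[of "\<lambda>x. x"] by simp
  finally show ?thesis .
qed

lemma both_coin_le_1: "both_coin \<alpha> n k t c c' \<le> 1"
proof -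
  have le: "(\<integral>\<^sup>+x. f x \<partial>N) \<le> 1" if "prob_space N" "\<And>x. f x \<le> 1" for f and N :: "'z measure"
  proof -
    have "(\<integral>\<^sup>+x. f x \<partial>N) \<le> (\<integral>\<^sup>+x. 1 \<partial>N)" by (intro nn_integral_mono that)
    also have "\<dots> = 1" by (rule nn_integral_prob_const) fact
    finally show ?thesis .
  qed
  show ?thesis
    unfolding both_coin_def row_coin_def by (intro le coin_probs) (auto simp: quad_le_def indicator_def)
qed

text \<open>The sweep turns the clocks into independent weights, and these determine a value of
  \<open>quad\<close> for which the base sequences are irrelevant: \<open>X\<close> sets them to 0,
  and integrating over any other choice gives the same result.\<close>

lemma good_pattern:
  assumes c: "length c = M" "length c' = M" and n: "n \<le> nfalse c'" and k: "1 \<le> k" "k \<le> nfalse c"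
    and im: "i \<le> M" "m \<le> M" "cnt (\<lambda>d. \<not> conf c c' (1 + int d)) 0 i = n" "cnt (\<lambda>d. conf c c' (- int d)) 0 (Suc m) = k"
  shows "(\<integral>\<^sup>+e. indicator {..t} (clear_time (conf c c') (run (conf c c') (cells (conf c c') (- int M) (int M)) (\<lambda>_ _. 0) e (\<lambda>_. 0)) (int i) (- int m)) \<partial>fieldm (seqm (expm 1))) =
    both_coin \<alpha> n k t c c'"
proof -
  interpret B: prob_space "seqm (seqm (expm 1))" by (rule coin_probs)
  interpret V: prob_space "seqm (expm 1)" by (rule coin_probs)
  interpret W: prob_space weightm by (rule prob_weightm)
  let ?\<eta> = "conf c c'" and ?cs = "cells (conf c c') (- int M) (int M)"
  define X where "X v w0 w1 w2 = quad_le n k t (queue (arr c w0 (\<lambda>_. 0)) v) (arr c' w1 (\<lambda>_. 0)) w2" for v w0 w1 w2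
  have X: "quad_le n k t (queue (arr c w0 base) v) (arr c' w1 base') w2 = X v w0 w1 w2" for v w0 w1 w2 base base'
    using quad_base_indep[OF c n k im, of "\<lambda>j. if j = 0 then case_nat v w0 else if j = 1 then w1 else w2" base base']
      quad_base_indep[OF c n k im, of "\<lambda>j. if j = 0 then case_nat v w0 else if j = 1 then w1 else w2" "\<lambda>_. 0" "\<lambda>_. 0"]
    by (simp add: X_def quad_le_def)
  have mX [measurable]: "(\<lambda>x. X (f x) (g x) (h x) (l x)) \<in> borel_measurable N"
    if [measurable]: "f \<in> measurable N (seqm borel)" "g \<in> measurable N (seqm (seqm borel))" "h \<in> measurable N (seqm (seqm borel))" "l \<in> measurable N (seqm (seqm borel))"
    for f g h l and N :: "'z measure"
    unfolding X_def by measurable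
  have "(\<integral>\<^sup>+e. indicator {..t} (clear_time ?\<eta> (run ?\<eta> ?cs (\<lambda>_ _. 0) e (\<lambda>_. 0)) (int i) (- int m)) \<partial>fieldm (seqm (expm 1))) =
    cell_integral ?cs (\<lambda>W. indicator {..t} (clear_time ?\<eta> W (int i) (- int m))) (\<lambda>_ _. 0)"
    by (intro run_law) measurable
  also have "\<dots> = (\<integral>\<^sup>+w. indicator {..t} (clear_time ?\<eta> (\<lambda>x y. if (x, y) \<in> set ?cs then get3 w (lab ?\<eta> (x, y)) else 0) (int i) (- int m)) \<partial>weightm)"
  proof (intro cell_integral_weights)
    have "distinct (l :: (int \<times> int) list)" if "sorted_wrt cell_less l" for l
      using that by (induction l) (auto simp: cell_less_def)
    then show "distinct ?cs" by (simp add: sorted_cells)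
    show "inj_on (lab ?\<eta>) (set ?cs)"
      by (rule inj_on_subset[OF lab_inj]) (auto simp: set_cells)
  qed measurable
  also have "\<dots> = (\<integral>\<^sup>+w. X (w 0 0) (\<lambda>d. w 0 (Suc d)) (w 1) (w 2) \<partial>weightm)"
    unfolding quad_base_indep[OF c n k im, symmetric, where base="\<lambda>_. 0" and base'="\<lambda>_. 0"]
    by (simp add: X_def quad_le_def)
  also have "\<dots> = (\<integral>\<^sup>+w0. (\<integral>\<^sup>+w. X (w0 0) (\<lambda>d. w0 (Suc d)) (w 0) (w 1) \<partial>weightm) \<partial>seqm (seqm (expm 1)))"
  proof (subst nn_integral_seqm[OF coin_probs(6)])
    show "(\<lambda>w. X (w 0 0) (\<lambda>d. w 0 (Suc d)) (w 1) (w 2)) \<in> borel_measurable weightm"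
    proof (rule mX)
      have 0: "(\<lambda>x. x i) \<in> measurable weightm (seqm (seqm borel))" for i
        using measurable_component_singleton[of i UNIV "\<lambda>_. seqm (seqm (expm 1))"]
        by (simp add: measurable_cong_sets[OF refl sets_seqm_seqm_expm])
      show "(\<lambda>x. x 0 0) \<in> measurable weightm (seqm borel)" by (rule measurable_head2[OF 0])
      show "(\<lambda>x d. x 0 (Suc d)) \<in> measurable weightm (seqm (seqm borel))" by (rule measurable_shift2[OF 0])
      show "(\<lambda>x. x 1) \<in> measurable weightm (seqm (seqm borel))" "(\<lambda>x. x 2) \<in> measurable weightm (seqm (seqm borel))" by (rule 0)+
    qed
  qed (simp add: numeral_2_eq_2)
  also have "\<dots> = (\<integral>\<^sup>+w0. (\<integral>\<^sup>+w1. (\<integral>\<^sup>+w2. X (w0 0) (\<lambda>d. w0 (Suc d)) w1 w2 \<partial>seqm (seqm (expm 1))) \<partial>seqm (seqm (expm 1))) \<partial>seqm (seqm (expm 1)))"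
  proof (rule nn_integral_cong)
    fix w0 :: "nat \<Rightarrow> nat \<Rightarrow> real"
    have 0: "(\<lambda>x. x i) \<in> measurable weightm (seqm (seqm borel))" for i
      using measurable_component_singleton[of i UNIV "\<lambda>_. seqm (seqm (expm 1))"]
      by (simp add: measurable_cong_sets[OF refl sets_seqm_seqm_expm])
    have "(\<integral>\<^sup>+w. X (w0 0) (\<lambda>d. w0 (Suc d)) (w 0) (w 1) \<partial>weightm) = (\<integral>\<^sup>+w1. (\<integral>\<^sup>+w. X (w0 0) (\<lambda>d. w0 (Suc d)) w1 (w 0) \<partial>weightm) \<partial>seqm (seqm (expm 1)))"
      by (subst nn_integral_seqm[OF coin_probs(6)], rule mX) (auto simp: space_PiM intro: 0)
    also have "\<dots> = (\<integral>\<^sup>+w1. (\<integral>\<^sup>+w2. (\<integral>\<^sup>+w. X (w0 0) (\<lambda>d. w0 (Suc d)) w1 w2 \<partial>weightm) \<partial>seqm (seqm (expm 1))) \<partial>seqm (seqm (expm 1)))"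
    proof (rule nn_integral_cong)
      fix w1 :: "nat \<Rightarrow> nat \<Rightarrow> real"
      show "(\<integral>\<^sup>+w. X (w0 0) (\<lambda>d. w0 (Suc d)) w1 (w 0) \<partial>weightm) = (\<integral>\<^sup>+w2. (\<integral>\<^sup>+w. X (w0 0) (\<lambda>d. w0 (Suc d)) w1 w2 \<partial>weightm) \<partial>seqm (seqm (expm 1)))"
        by (subst nn_integral_seqm[OF coin_probs(6)], rule mX) (auto simp: space_PiM intro: 0)
    qed
    also have "\<dots> = (\<integral>\<^sup>+w1. (\<integral>\<^sup>+w2. X (w0 0) (\<lambda>d. w0 (Suc d)) w1 w2 \<partial>seqm (seqm (expm 1))) \<partial>seqm (seqm (expm 1)))"
      by (simp only: nn_integral_prob_const[OF prob_weightm])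
    finally show "(\<integral>\<^sup>+w. X (w0 0) (\<lambda>d. w0 (Suc d)) (w 0) (w 1) \<partial>weightm) = (\<integral>\<^sup>+w1. (\<integral>\<^sup>+w2. X (w0 0) (\<lambda>d. w0 (Suc d)) w1 w2 \<partial>seqm (seqm (expm 1))) \<partial>seqm (seqm (expm 1)))" .
  qed
  also have "\<dots> = (\<integral>\<^sup>+v. (\<integral>\<^sup>+w0. (\<integral>\<^sup>+w1. (\<integral>\<^sup>+w2. X v w0 w1 w2 \<partial>seqm (seqm (expm 1))) \<partial>seqm (seqm (expm 1))) \<partial>seqm (seqm (expm 1))) \<partial>seqm (expm 1))"
  proof (subst nn_integral_seqm[OF coin_probs(5)])
    have 0: "(\<lambda>x. x) \<in> measurable (seqm (seqm (expm 1))) (seqm (seqm borel))"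
      by (rule measurable_ident_sets[OF sets_seqm_seqm_expm])
    have [measurable]: "(\<lambda>x d. fst (fst x) (Suc d)) \<in> measurable ((seqm (seqm (expm 1)) \<Otimes>\<^sub>M seqm (seqm (expm 1))) \<Otimes>\<^sub>M seqm (seqm (expm 1))) (seqm (seqm borel))"
      "(\<lambda>x. fst (fst x) 0) \<in> measurable ((seqm (seqm (expm 1)) \<Otimes>\<^sub>M seqm (seqm (expm 1))) \<Otimes>\<^sub>M seqm (seqm (expm 1))) (seqm borel)"
      by (intro measurable_shift2 measurable_head2; measurable)+
    show "(\<lambda>w0. \<integral>\<^sup>+w1. (\<integral>\<^sup>+w2. X (w0 0) (\<lambda>d. w0 (Suc d)) w1 w2 \<partial>seqm (seqm (expm 1))) \<partial>seqm (seqm (expm 1))) \<in> borel_measurable (seqm (seqm (expm 1)))"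
      by measurable
  qed simp
  also have "\<dots> = (\<integral>\<^sup>+w0. (\<integral>\<^sup>+v. (\<integral>\<^sup>+w1. (\<integral>\<^sup>+w2. X v w0 w1 w2 \<partial>seqm (seqm (expm 1))) \<partial>seqm (seqm (expm 1))) \<partial>seqm (expm 1)) \<partial>seqm (seqm (expm 1)))"
    by (intro nn_integral_swap coin_probs) measurable
  also have "\<dots> = both_coin \<alpha> n k t c c'"
    unfolding both_coin_def row_coin_def X
    by (simp only: nn_integral_prob_const[OF coin_probs(1)] nn_integral_prob_const[OF coin_probs(2)]
      nn_integral_prob_const[OF coin_probs(3)] nn_integral_prob_const[OF coin_probs(4)])
  finally show ?thesis .
qed

end

text \<open>The inverse map is easier: its image law is computed on cylinders, grouped by the first
  index, and currying back gives the claim.\<close>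

lemma curry_law:
  assumes N: "prob_space N"
  shows "distr (PiM UNIV (\<lambda>_ :: int \<times> nat. N)) (fieldm (seqm N)) (\<lambda>f x k. f (x, k)) = fieldm (seqm N)"
proof -
  interpret N: prob_space N by fact
  interpret S: product_prob_space "\<lambda>_. N" "UNIV :: nat set" ..
  interpret Sp: prob_space "seqm N" by (rule prob_space_seqm) fact
  interpret F: product_prob_space "\<lambda>_. seqm N" "UNIV :: int set" ..
  interpret P: product_prob_space "\<lambda>_. N" "UNIV :: (int \<times> nat) set" ..
  have u [measurable]: "(\<lambda>g p. g (fst p) (snd p)) \<in> measurable (fieldm (seqm N)) (PiM UNIV (\<lambda>_ :: int \<times> nat. N))"
  proof (rule measurable_abs_UNIV)
    fix p :: "int \<times> nat"
    show "(\<lambda>g. g (fst p) (snd p)) \<in> measurable (fieldm (seqm N)) N"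
      by (rule measurable_compose[OF measurable_component_singleton[of "fst p"] measurable_component_singleton[of "snd p"]]) auto
  qed
  have c [measurable]: "(\<lambda>f x k. f (x, k)) \<in> measurable (PiM UNIV (\<lambda>_ :: int \<times> nat. N)) (fieldm (seqm N))"
    by (intro measurable_abs_UNIV measurable_component_singleton) simp
  have "distr (fieldm (seqm N)) (PiM UNIV (\<lambda>_ :: int \<times> nat. N)) (\<lambda>g p. g (fst p) (snd p)) = PiM UNIV (\<lambda>_ :: int \<times> nat. N)"
  proof (rule P.PiM_eq)
    fix J :: "(int \<times> nat) set" and A assume J: "finite J" and A: "\<And>j. j \<in> J \<Longrightarrow> A j \<in> sets N"
    define B where "B x = {s \<in> space (seqm N). \<forall>k\<in>{k. (x, k) \<in> J}. s k \<in> A (x, k)}" for x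
    have fin: "finite {k. (x, k) \<in> J}" for x
      by (rule finite_subset[of _ "snd ` J"]) (use J in \<open>auto simp: image_iff\<close>, force)
    have Am: "k \<in> {k. (x, k) \<in> J} \<Longrightarrow> A (x, k) \<in> sets N" for x k using A by auto
    have B: "B x \<in> sets (seqm N)" for x
      unfolding B_def using fin Am by (intro sets.sets_Collect_finite_All) auto
    have eB: "emeasure (seqm N) (B x) = (\<Prod>k\<in>{k. (x, k) \<in> J}. emeasure N (A (x, k)))" for x
      unfolding B_def using fin Am by (intro S.emeasure_PiM_Collect) auto
    have "emeasure (distr (fieldm (seqm N)) (PiM UNIV (\<lambda>_ :: int \<times> nat. N)) (\<lambda>g p. g (fst p) (snd p))) (prod_emb UNIV (\<lambda>_. N) J (Pi\<^sub>E J A)) =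
      emeasure (fieldm (seqm N)) {g \<in> space (fieldm (seqm N)). \<forall>x\<in>fst ` J. g x \<in> B x}"
    proof (subst emeasure_distr[OF u])
      show "prod_emb UNIV (\<lambda>_. N) J (Pi\<^sub>E J A) \<in> sets (PiM UNIV (\<lambda>_ :: int \<times> nat. N))"
        using J A by (intro sets_PiM_I) auto
      show "emeasure (fieldm (seqm N)) ((\<lambda>g p. g (fst p) (snd p)) -` prod_emb UNIV (\<lambda>_. N) J (Pi\<^sub>E J A) \<inter> space (fieldm (seqm N))) =
        emeasure (fieldm (seqm N)) {g \<in> space (fieldm (seqm N)). \<forall>x\<in>fst ` J. g x \<in> B x}"
        by (intro arg_cong2[where f=emeasure] refl) (auto simp: prod_emb_def space_PiM PiE_iff B_def, force+)
    qed
    also have "\<dots> = (\<Prod>x\<in>fst ` J. emeasure (seqm N) (B x))"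
      using J B by (intro F.emeasure_PiM_Collect) auto
    also have "\<dots> = (\<Prod>p\<in>(SIGMA x:fst ` J. {k. (x, k) \<in> J}). emeasure N (A p))"
      unfolding eB using J fin by (subst prod.Sigma) (auto simp: case_prod_unfold)
    also have "(SIGMA x:fst ` J. {k. (x, k) \<in> J}) = J" by (auto simp: image_iff) force
    finally show "emeasure (distr (fieldm (seqm N)) (PiM UNIV (\<lambda>_ :: int \<times> nat. N)) (\<lambda>g p. g (fst p) (snd p))) (prod_emb UNIV (\<lambda>_. N) J (Pi\<^sub>E J A)) = (\<Prod>p\<in>J. emeasure N (A p))" .
  qed simp
  then have "distr (PiM UNIV (\<lambda>_ :: int \<times> nat. N)) (fieldm (seqm N)) (\<lambda>f x k. f (x, k)) =
    distr (distr (fieldm (seqm N)) (PiM UNIV (\<lambda>_ :: int \<times> nat. N)) (\<lambda>g p. g (fst p) (snd p))) (fieldm (seqm N)) (\<lambda>f x k. f (x, k))" by simp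
  also have "\<dots> = distr (fieldm (seqm N)) (fieldm (seqm N)) (\<lambda>g. g)"
    by (subst distr_distr[OF c u]) (simp add: comp_def)
  also have "\<dots> = fieldm (seqm N)" by (rule distr_id2) simp
  finally show ?thesis .
qed

section \<open>The law of a particle position\<close>

lemma prod_symmetric_interval:
  fixes f :: "int \<Rightarrow> 'b::comm_monoid_mult"
  shows "(\<Prod>z=-int K..int K. f z) = f 0 * (\<Prod>d<K. f (- 1 - int d)) * (\<Prod>d<K. f (1 + int d))"
proof (induction K)
  case (Suc K)
  have "{- int (Suc K)..int (Suc K)} = insert (- 1 - int K) (insert (1 + int K) {- int K..int K})" by auto
  then show ?case using Suc by (simp add: ac_simps)
qed simp

abbreviation cfield :: "(int \<Rightarrow> bool) measure" where
  "cfield \<equiv> PiM UNIV (\<lambda>_. count_space UNIV)"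

text \<open>Conditioning on an occupied origin cancels the factor \<alpha> of site 0. On the right
  \<open>True\<close> stands for a hole, whence the weight with 1 - \<alpha>.\<close>

lemma cylinder_bernoulli:
  assumes a: "0 < \<alpha>" "\<alpha> < 1" and c: "length c = K" "length c' = K"
  shows "emeasure (bernoulli_origin_occupied \<alpha>) {\<omega>. \<forall>z\<in>{-int K..int K}. \<omega> z = conf c c' z} = ennreal (wt \<alpha> c * wt (1 - \<alpha>) c')"
proof -
  let ?P = "\<Pi>\<^sub>M x\<in>(UNIV :: int set). measure_pmf (bernoulli_pmf \<alpha>)"
  let ?B = "{\<omega>. \<forall>z\<in>{-int K..int K}. \<omega> z = conf c c' z}"
  interpret P: product_prob_space "\<lambda>_. measure_pmf (bernoulli_pmf \<alpha>)" "UNIV :: int set" ..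
  have sp: "space ?P = UNIV" by (simp add: space_PiM)
  have cyl: "emeasure ?P {\<omega>. \<forall>z\<in>J. \<omega> z = g z} = (\<Prod>z\<in>J. ennreal (pmf (bernoulli_pmf \<alpha>) (g z)))" if "finite J" for J g
    using P.emeasure_PiM_Collect[of J "\<lambda>z. {g z}"] that by (simp add: sp emeasure_pmf_single)
  have m [measurable]: "{\<omega>. \<forall>z\<in>J. \<omega> z = g z} \<in> sets ?P" if "finite J" for J g
  proof -
    have "{\<omega> \<in> space ?P. \<forall>z\<in>J. \<omega> z \<in> {g z}} \<in> sets ?P" using that by (intro sets.sets_Collect_finite_All) auto
    then show ?thesis by (simp add: sp)
  qed
  have o: "{\<omega>. \<omega> 0} = {\<omega>. \<forall>z\<in>{0::int}. \<omega> z = True}" by simp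
  have o1: "emeasure ?P {\<omega>. \<omega> 0} = ennreal \<alpha>" unfolding o by (subst cyl) (use a in auto)
  have L: "(\<Prod>d<K. pmf (bernoulli_pmf \<alpha>) (conf c c' (- 1 - int d))) = wt \<alpha> c"
    unfolding wt_prod c(1) by (intro prod.cong refl) (use a c in \<open>auto simp: conf_def\<close>)
  have R: "(\<Prod>d<K. pmf (bernoulli_pmf \<alpha>) (conf c c' (1 + int d))) = wt (1 - \<alpha>) c'"
    unfolding wt_prod c(2) by (intro prod.cong refl) (use a c in \<open>auto simp: conf_def\<close>)
  have "emeasure (bernoulli_origin_occupied \<alpha>) ?B = emeasure ?P ({\<omega>. \<omega> 0} \<inter> ?B) / emeasure ?P {\<omega>. \<omega> 0}"
    unfolding bernoulli_origin_occupied_def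
    by (rule emeasure_uniform_measure) (use m[of "{0}" "\<lambda>_. True"] m in auto)
  also have "{\<omega>. \<omega> 0} \<inter> ?B = ?B"
  proof -
    have "\<omega> 0" if "\<forall>z\<in>{-int K..int K}. \<omega> z = conf c c' z" for \<omega> using bspec[OF that, of 0] by simp
    then show ?thesis by blast
  qed
  also have "emeasure ?P ?B = ennreal (\<Prod>z=-int K..int K. pmf (bernoulli_pmf \<alpha>) (conf c c' z))"
    by (subst cyl) (auto simp: prod_ennreal)
  also have "(\<Prod>z=-int K..int K. pmf (bernoulli_pmf \<alpha>) (conf c c' z)) = (wt \<alpha> c * wt (1 - \<alpha>) c') * \<alpha>"
    unfolding prod_symmetric_interval L R using a by simp
  also have "ennreal ((wt \<alpha> c * wt (1 - \<alpha>) c') * \<alpha>) / emeasure ?P {\<omega>. \<omega> 0} = ennreal (wt \<alpha> c * wt (1 - \<alpha>) c')"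
    unfolding o1 using a wt_nonneg[of \<alpha> c] wt_nonneg[of "1 - \<alpha>" c'] by (subst divide_ennreal) auto
  finally show ?thesis .
qed

section \<open>Occupation variables and clocks of the process\<close>

context bernoulli_tasep
begin

definition occ :: "'a \<Rightarrow> int \<Rightarrow> bool" where "occ w = occupied (\<lambda>i. R i 0 w)"

definition clk :: "'a \<Rightarrow> int \<Rightarrow> nat \<Rightarrow> real" where "clk w x k = E x k w"

lemma measurable_occ [measurable]: "occ \<in> measurable M cfield"
proof (rule measurable_PiM_single')
  fix z :: int
  have [measurable]: "R i 0 \<in> measurable M (count_space UNIV)" for i using measurable_positions[of 0] by simp
  show "(\<lambda>w. occ w z) \<in> measurable M (count_space UNIV)"
    unfolding occ_def occupied_def by measurable
qed simp

lemma measurable_E [measurable]: "E x k \<in> borel_measurable M"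
  using distributed_measurable[OF waiting_times_exponential[of x k]] by simp

lemma measurable_clk [measurable]: "clk \<in> measurable M (fieldm (seqm borel))"
  unfolding clk_def by (intro measurable_abs_UNIV measurable_E)

lemma distr_E: "distr M borel (E x k) = expm 1"
  using distributed_distr_eq_density[OF waiting_times_exponential[of x k]]
  by (simp add: expm_def cong: distr_cong)

lemma clock_field_law: "distr M (fieldm (seqm borel)) clk = fieldm (seqm (expm 1))"
proof -
  let ?X = "\<lambda>(x, k). E x k"
  let ?c = "\<lambda>f x k. f (x, k)"
  have X [measurable]: "(\<lambda>w p. ?X p w) \<in> measurable M (PiM UNIV (\<lambda>_ :: int \<times> nat. borel))"
    by (rule measurable_abs_UNIV) (auto split: prod.split)
  have c: "?c \<in> measurable (PiM UNIV (\<lambda>_ :: int \<times> nat. borel)) (fieldm (seqm borel))"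
    by (intro measurable_abs_UNIV measurable_component_singleton) simp
  have "distr M (PiM UNIV (\<lambda>_ :: int \<times> nat. borel)) (\<lambda>w p. ?X p w) = PiM UNIV (\<lambda>p. distr M borel (?X p))"
  proof -
    have "random_variable borel (?X i)" for i by (cases i) auto
    then show ?thesis
      using waiting_times_indep by (subst (asm) indep_vars_iff_distr_eq_PiM) (auto simp: restrict_UNIV)
  qed
  also have "\<dots> = PiM UNIV (\<lambda>_. expm 1)"
    by (intro PiM_cong refl) (auto simp: distr_E split: prod.split)
  finally have j: "distr M (PiM UNIV (\<lambda>_ :: int \<times> nat. borel)) (\<lambda>w p. ?X p w) = PiM UNIV (\<lambda>_ :: int \<times> nat. expm 1)" .
  have "distr M (fieldm (seqm borel)) clk = distr M (fieldm (seqm borel)) (?c \<circ> (\<lambda>w p. ?X p w))"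
    by (intro distr_cong refl) (auto simp: clk_def[abs_def])
  also have "\<dots> = distr (PiM UNIV (\<lambda>_ :: int \<times> nat. expm 1)) (fieldm (seqm borel)) ?c"
    unfolding j[symmetric] by (rule distr_distr[OF c X, symmetric])
  also have "\<dots> = distr (PiM UNIV (\<lambda>_ :: int \<times> nat. expm 1)) (fieldm (seqm (expm 1))) ?c"
    by (intro distr_cong refl sets_fieldm_seqm_expm[symmetric])
  also have "\<dots> = fieldm (seqm (expm 1))" by (rule curry_law) (simp add: prob_space_expm)
  finally show ?thesis .
qed

lemma occ_clk_indep:
  assumes A: "A \<in> sets cfield" and B: "B \<in> sets (fieldm (seqm borel))"
  shows "emeasure M {w \<in> space M. occ w \<in> A \<and> clk w \<in> B} = emeasure M {w \<in> space M. occ w \<in> A} * emeasure (fieldm (seqm (expm 1))) B"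
proof -
  let ?c = "\<lambda>f x k. f (x, k)"
  have c: "?c \<in> measurable (PiM UNIV (\<lambda>_ :: int \<times> nat. borel)) (fieldm (seqm borel))"
    by (intro measurable_abs_UNIV measurable_component_singleton) simp
  have 1: "{w \<in> space M. occ w \<in> A} \<in> sets (vimage_algebra (space M) (\<lambda>w. occupied (\<lambda>i. R i 0 w)) cfield)"
    using in_vimage_algebra[OF A, of "\<lambda>w. occupied (\<lambda>i. R i 0 w)" "space M"]
    by (simp add: occ_def vimage_def Int_def conj_commute)
  have 2: "{w \<in> space M. clk w \<in> B} \<in> sets (vimage_algebra (space M) (\<lambda>w (x, k). E x k w) (PiM UNIV (\<lambda>_ :: int \<times> nat. borel)))"
  proof -
    have "{w \<in> space M. clk w \<in> B} = (\<lambda>w (x, k). E x k w) -` (?c -` B \<inter> space (PiM UNIV (\<lambda>_ :: int \<times> nat. borel))) \<inter> space M"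
      by (auto simp: clk_def[abs_def] space_PiM)
    then show ?thesis using in_vimage_algebra[OF measurable_sets[OF c B]] by simp
  qed
  have "prob ({w \<in> space M. occ w \<in> A} \<inter> {w \<in> space M. clk w \<in> B}) = prob {w \<in> space M. occ w \<in> A} * prob {w \<in> space M. clk w \<in> B}"
    by (rule indep_setD[OF initial_indep_clocks 1 2])
  also have "{w \<in> space M. occ w \<in> A} \<inter> {w \<in> space M. clk w \<in> B} = {w \<in> space M. occ w \<in> A \<and> clk w \<in> B}" by auto
  finally have "emeasure M {w \<in> space M. occ w \<in> A \<and> clk w \<in> B} = emeasure M {w \<in> space M. occ w \<in> A} * emeasure M {w \<in> space M. clk w \<in> B}"
    by (simp add: emeasure_eq_measure ennreal_mult')
  also have "emeasure M {w \<in> space M. clk w \<in> B} = emeasure (distr M (fieldm (seqm borel)) clk) B"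
    using B by (subst emeasure_distr) (auto intro!: arg_cong[where f="emeasure M"])
  finally show ?thesis by (simp add: clock_field_law)
qed

lemma AE_clk_good: "AE w in M. \<forall>s. good_clock (clk w s)"
proof -
  have "AE e in fieldm (seqm (expm 1)). \<forall>s. good_clock (e s)"
    by (subst AE_all_countable, intro allI AE_PiM_component) (auto intro: AE_good_clock prob_seqm_expm)
  then have "AE e in distr M (fieldm (seqm borel)) clk. \<forall>s. good_clock (e s)"
    unfolding clock_field_law .
  then show ?thesis by (rule AE_distrD[rotated]) measurable
qed

definition lpat :: "nat \<Rightarrow> 'a \<Rightarrow> bool list" where "lpat K w = map (\<lambda>d. occ w (- 1 - int d)) [0..<K]"

definition rpat :: "nat \<Rightarrow> 'a \<Rightarrow> bool list" where "rpat K w = map (\<lambda>d. \<not> occ w (1 + int d)) [0..<K]"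

lemma length_pat [simp]: "length (lpat K w) = K" "length (rpat K w) = K" by (auto simp: lpat_def rpat_def)

lemma pat_iff:
  assumes "occ w 0" "length c = K" "length c' = K"
  shows "lpat K w = c \<and> rpat K w = c' \<longleftrightarrow> (\<forall>z\<in>{-int K..int K}. occ w z = conf c c' z)"
proof
  assume e: "lpat K w = c \<and> rpat K w = c'"
  have l: "d < K \<Longrightarrow> c ! d = occ w (- 1 - int d)" and r: "d < K \<Longrightarrow> c' ! d = (\<not> occ w (1 + int d))" for d
    using e by (auto simp: lpat_def rpat_def)
  show "\<forall>z\<in>{-int K..int K}. occ w z = conf c c' z"
  proof
    fix z assume z: "z \<in> {-int K..int K}"
    consider "z = 0" | "z < 0" | "0 < z" by linarith
    then show "occ w z = conf c c' z"
    proof cases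
      case 1 then show ?thesis using assms by simp
    next
      case 2
      then have "nat (- z - 1) < K" "z = - 1 - int (nat (- z - 1))" using z by auto
      then show ?thesis using l[of "nat (- z - 1)"] 2 assms by (auto simp: conf_def)
    next
      case 3
      then have "nat (z - 1) < K" "z = 1 + int (nat (z - 1))" using z by auto
      then show ?thesis using r[of "nat (z - 1)"] 3 assms by (auto simp: conf_def)
    qed
  qed
next
  assume e: "\<forall>z\<in>{-int K..int K}. occ w z = conf c c' z"
  have "lpat K w = c" using e assms by (intro nth_equalityI) (auto simp: lpat_def conf_def)
  moreover have "rpat K w = c'" using e assms by (intro nth_equalityI) (auto simp: rpat_def conf_def)
  ultimately show "lpat K w = c \<and> rpat K w = c'" by simp
qed

lemma AE_occ0: "AE w in M. occ w 0"
  using paths by eventually_elim (auto simp: occ_def occupied_def tasep_path_def)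

lemma sets_cylinder: "{\<omega>. \<forall>z\<in>{-int K..int K}. \<omega> z = conf c c' z} \<in> sets cfield"
proof -
  have "{\<omega> \<in> space cfield. \<forall>z\<in>{-int K..int K}. \<omega> z \<in> {conf c c' z}} \<in> sets cfield"
    by (intro sets.sets_Collect_finite_All) auto
  then show ?thesis by (simp add: space_PiM)
qed

lemma emeasure_cylinder:
  assumes a: "0 < \<alpha>" "\<alpha> < 1" and c: "length c = K" "length c' = K"
  shows "emeasure M {w \<in> space M. occ w \<in> {\<omega>. \<forall>z\<in>{-int K..int K}. \<omega> z = conf c c' z}} = ennreal (wt \<alpha> c * wt (1 - \<alpha>) c')"
proof -
  have "emeasure M {w \<in> space M. occ w \<in> {\<omega>. \<forall>z\<in>{-int K..int K}. \<omega> z = conf c c' z}} =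
    emeasure (distr M cfield (\<lambda>w. occupied (\<lambda>i. R i 0 w))) {\<omega>. \<forall>z\<in>{-int K..int K}. \<omega> z = conf c c' z}"
    using measurable_occ sets_cylinder by (subst emeasure_distr) (auto simp: occ_def[abs_def] intro!: arg_cong[where f="emeasure M"])
  then show ?thesis unfolding initial_law using cylinder_bernoulli[OF a c] by simp
qed

end

context bernoulli_tasep
begin

text \<open>On the cylinder the event is decided by the clocks alone, and these are independent of
  the initial configuration.\<close>

lemma event_cylinder:
  assumes a: "0 < \<alpha>" "\<alpha> < 1" and t: "0 \<le> t" and c: "length c = K" "length c' = K"
    and n: "n \<le> nfalse c'" and k: "1 \<le> k" "k \<le> nfalse c"
  shows "emeasure M {w \<in> space M. R (int n) t w \<le> int n - int k \<and> occ w \<in> {\<omega>. \<forall>z\<in>{-int K..int K}. \<omega> z = conf c c' z}} =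
    ennreal (wt \<alpha> c * wt (1 - \<alpha>) c') * both_coin \<alpha> n k t c c'"
proof -
  let ?\<eta> = "conf c c'" and ?C = "{\<omega>. \<forall>z\<in>{-int K..int K}. \<omega> z = conf c c' z}"
  obtain i m where im: "i \<le> K" "m \<le> K"
    "cnt (\<lambda>d. \<not> conf c c' (1 + int d)) 0 i = n" "cnt (\<lambda>d. conf c c' (- int d)) 0 (Suc m) = k"
    "i = 0 \<or> conf c c' (int i)" "\<not> conf c c' (- int m)"
    by (rule conf_targets[OF c n k])
  define T where "T e = clear_time ?\<eta> (run ?\<eta> (cells ?\<eta> (- int K) (int K)) (\<lambda>_ _. 0) e (\<lambda>_. 0)) (int i) (- int m)" for e :: "int \<Rightarrow> nat \<Rightarrow> real"
  have T [measurable]: "T \<in> borel_measurable (fieldm (seqm borel))"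
    unfolding T_def by (rule measurable_clear_time, rule measurable_run) measurable
  have [measurable]: "R (int n) t \<in> measurable M (count_space UNIV)" by (rule measurable_positions[OF t])
  have [measurable]: "?C \<in> sets cfield" by (rule sets_cylinder)
  have B: "{e. T e \<le> t} \<in> sets (fieldm (seqm borel))"
  proof -
    have "{e \<in> space (fieldm (seqm borel)). T e \<le> t} \<in> sets (fieldm (seqm borel))" by measurable
    then show ?thesis by (simp add: space_PiM)
  qed
  have "emeasure M {w \<in> space M. R (int n) t w \<le> int n - int k \<and> occ w \<in> ?C} = emeasure M {w \<in> space M. occ w \<in> ?C \<and> clk w \<in> {e. T e \<le> t}}"
  proof (rule emeasure_eq_AE)
    show "AE w in M. (w \<in> {w \<in> space M. R (int n) t w \<le> int n - int k \<and> occ w \<in> ?C}) = (w \<in> {w \<in> space M. occ w \<in> ?C \<and> clk w \<in> {e. T e \<le> t}})"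
      using paths AE_clk_good
    proof eventually_elim
      case (elim w)
      have p: "tasep_path (clk w) (\<lambda>i t. R i t w)" using elim(1) by (simp add: clk_def[abs_def])
      have "R (int n) t w \<le> int n - int k \<longleftrightarrow> T (clk w) \<le> t" if "occ w \<in> ?C"
        unfolding T_def
        by (rule path_event[OF p _ _ im(1-5) t]) (use elim(2) that in \<open>auto simp: occ_def\<close>)
      then show ?case by auto
    qed
    show "{w \<in> space M. R (int n) t w \<le> int n - int k \<and> occ w \<in> ?C} \<in> sets M" by measurable
    have "{w \<in> space M. occ w \<in> ?C \<and> T (clk w) \<le> t} \<in> sets M" by measurable
    then show "{w \<in> space M. occ w \<in> ?C \<and> clk w \<in> {e. T e \<le> t}} \<in> sets M" by simp
  qed
  also have "\<dots> = ennreal (wt \<alpha> c * wt (1 - \<alpha>) c') * emeasure (fieldm (seqm (expm 1))) {e. T e \<le> t}"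
    by (subst occ_clk_indep[OF sets_cylinder B]) (simp only: emeasure_cylinder[OF a c])
  also have "emeasure (fieldm (seqm (expm 1))) {e. T e \<le> t} = (\<integral>\<^sup>+e. indicator {e. T e \<le> t} e \<partial>fieldm (seqm (expm 1)))"
    using B by (simp add: sets_fieldm_seqm_expm)
  also have "\<dots> = (\<integral>\<^sup>+e. indicator {..t} (T e) \<partial>fieldm (seqm (expm 1)))"
    by (intro nn_integral_cong) (auto simp: indicator_def)
  also have "\<dots> = both_coin \<alpha> n k t c c'"
    unfolding T_def by (rule good_pattern[OF a c n k im(1-4)])
  finally show ?thesis .
qed

lemma cylinder_partition:
  assumes "occ w 0"
  shows "(\<Sum>c | length c = K. \<Sum>c' | length c' = K. indicator {\<omega>. \<forall>z\<in>{-int K..int K}. \<omega> z = conf c c' z} (occ w)) = (1 :: ennreal)"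
proof -
  have "(\<Sum>c | length c = K. \<Sum>c' | length c' = K. indicator {\<omega>. \<forall>z\<in>{-int K..int K}. \<omega> z = conf c c' z} (occ w)) =
    (\<Sum>c | length c = K. \<Sum>c' | length c' = K. if c' = rpat K w then if c = lpat K w then 1 else 0 else (0 :: ennreal))"
  proof (intro sum.cong refl)
    fix c c' :: "bool list" assume "c \<in> {c. length c = K}" "c' \<in> {c'. length c' = K}"
    then have "occ w \<in> {\<omega>. \<forall>z\<in>{-int K..int K}. \<omega> z = conf c c' z} \<longleftrightarrow> c = lpat K w \<and> c' = rpat K w"
      using pat_iff[OF assms, of c K c'] by (simp only: mem_Collect_eq) metis
    then show "indicator {\<omega>. \<forall>z\<in>{-int K..int K}. \<omega> z = conf c c' z} (occ w) = (if c' = rpat K w then if c = lpat K w then 1 else 0 else (0 :: ennreal))"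
      unfolding indicator_def by (simp only: split: if_split) simp
  qed
  also have "\<dots> = 1" using finite_bool_lists by simp
  finally show ?thesis .
qed

lemma sum_bool_lists:
  assumes a: "0 < \<alpha>" "\<alpha> < 1"
  shows "(\<Sum>c | length c = K. \<Sum>c' | length c' = K. ennreal (wt \<alpha> c * wt (1 - \<alpha>) c') * f c c') = coinsum \<alpha> K (\<lambda>c. coinsum (1 - \<alpha>) K (f c))"
proof -
  have "coinsum \<alpha> K (\<lambda>c. coinsum (1 - \<alpha>) K (f c)) = (\<Sum>c | length c = K. ennreal (wt \<alpha> c) * (\<Sum>c' | length c' = K. ennreal (wt (1 - \<alpha>) c') * f c c'))"
    using a by (simp add: coinsum_sum)
  also have "\<dots> = (\<Sum>c | length c = K. \<Sum>c' | length c' = K. ennreal (wt \<alpha> c * wt (1 - \<alpha>) c') * f c c')"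
    using a wt_nonneg[of \<alpha>] wt_nonneg[of "1 - \<alpha>"] by (simp add: sum_distrib_left ennreal_mult mult.assoc)
  finally show ?thesis by simp
qed

text \<open>Sum over the patterns on [-K, K]. For patterns with at least n particles on the right
  and k holes on the left the contributions agree exactly; the other patterns have total probability
  tending to 0 as K grows, while neither side depends on K.\<close>

lemma position_law:
  assumes a: "0 < \<alpha>" "\<alpha> < 1" and t: "0 \<le> t" and k: "1 \<le> k"
  shows "emeasure M {w \<in> space M. R (int n) t w \<le> int n - int k} = (\<integral>\<^sup>+s. row_int \<alpha> n k t (psum s) \<partial>seqm (expm (1 - \<alpha>)))"
    (is "?P = ?\<Lambda>")
proof -
  let ?C = "\<lambda>K c c'. {\<omega>. \<forall>z\<in>{-int K..int K}. \<omega> z = conf c c' z}"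
  define A where "A = {w \<in> space M. R (int n) t w \<le> int n - int k}"
  define g where "g K c c' = emeasure M {w \<in> space M. R (int n) t w \<le> int n - int k \<and> occ w \<in> ?C K c c'}" for K c c'
  define bad where "bad K = coinsum \<alpha> K (\<lambda>c. indicator {c. nfalse c < k} c) + coinsum (1 - \<alpha>) K (\<lambda>c'. indicator {c'. nfalse c' < n} c')" for K
  have [measurable]: "R (int n) t \<in> measurable M (count_space UNIV)" by (rule measurable_positions[OF t])
  have [measurable]: "?C K c c' \<in> sets cfield" for K c c' by (rule sets_cylinder)
  have [measurable]: "A \<in> sets M" unfolding A_def by measurable
  have P: "?P = (\<Sum>c | length c = K. \<Sum>c' | length c' = K. g K c c')" for K
  proof -
    have "?P = (\<integral>\<^sup>+w. indicator A w \<partial>M)" by (simp add: A_def[symmetric])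
    also have "\<dots> = (\<integral>\<^sup>+w. (\<Sum>c | length c = K. \<Sum>c' | length c' = K. indicator {w \<in> space M. R (int n) t w \<le> int n - int k \<and> occ w \<in> ?C K c c'} w) \<partial>M)"
    proof (rule nn_integral_cong_AE, use AE_occ0 in eventually_elim)
      case (elim w)
      have "indicator A w = indicator A w * (\<Sum>c | length c = K. \<Sum>c' | length c' = K. indicator (?C K c c') (occ w) :: ennreal)"
        unfolding cylinder_partition[OF elim] by simp
      also have "\<dots> = (\<Sum>c | length c = K. \<Sum>c' | length c' = K. indicator {w \<in> space M. R (int n) t w \<le> int n - int k \<and> occ w \<in> ?C K c c'} w)"
        unfolding sum_distrib_left by (intro sum.cong refl) (auto simp: A_def indicator_def)
      finally show ?case .
    qed
    also have "\<dots> = (\<Sum>c | length c = K. \<Sum>c' | length c' = K. g K c c')"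
      proof -
      have "{w \<in> space M. R (int n) t w \<le> int n - int k \<and> occ w \<in> ?C K c c'} \<in> sets M" for c c' by measurable
      then show ?thesis unfolding g_def by (simp add: nn_integral_sum)
    qed
    finally show ?thesis .
  qed
  have L: "?\<Lambda> = (\<Sum>c | length c = K. \<Sum>c' | length c' = K. ennreal (wt \<alpha> c * wt (1 - \<alpha>) c') * both_coin \<alpha> n k t c c')" for K
    unfolding sum_bool_lists[OF a] by (rule both_coinsum[OF a, symmetric])
  have bad: "(\<Sum>c | length c = K. \<Sum>c' | length c' = K. ennreal (wt \<alpha> c * wt (1 - \<alpha>) c') * (indicator {c. nfalse c < k} c + indicator {c'. nfalse c' < n} c')) = bad K" for K
    unfolding sum_bool_lists[OF a] coinsum_add bad_def using a by (simp add: coinsum_const)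
  have g_le: "g K c c' \<le> ennreal (wt \<alpha> c * wt (1 - \<alpha>) c')" if "length c = K" "length c' = K" for K c c'
    unfolding g_def emeasure_cylinder[OF a that, symmetric] by (intro emeasure_mono) (auto, measurable)
  have cmp: "g K c c' \<le> ennreal (wt \<alpha> c * wt (1 - \<alpha>) c') * both_coin \<alpha> n k t c c' + ennreal (wt \<alpha> c * wt (1 - \<alpha>) c') * (indicator {c. nfalse c < k} c + indicator {c'. nfalse c' < n} c')"
    "ennreal (wt \<alpha> c * wt (1 - \<alpha>) c') * both_coin \<alpha> n k t c c' \<le> g K c c' + ennreal (wt \<alpha> c * wt (1 - \<alpha>) c') * (indicator {c. nfalse c < k} c + indicator {c'. nfalse c' < n} c')"
    if cc: "length c = K" "length c' = K" for K c c'
  proof -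
    have both: "ennreal (wt \<alpha> c * wt (1 - \<alpha>) c') * both_coin \<alpha> n k t c c' \<le> ennreal (wt \<alpha> c * wt (1 - \<alpha>) c') * 1"
      by (intro mult_left_mono both_coin_le_1 a) simp
    have "g K c c' \<le> ennreal (wt \<alpha> c * wt (1 - \<alpha>) c') * both_coin \<alpha> n k t c c' + ennreal (wt \<alpha> c * wt (1 - \<alpha>) c') * (indicator {c. nfalse c < k} c + indicator {c'. nfalse c' < n} c') \<and>
      ennreal (wt \<alpha> c * wt (1 - \<alpha>) c') * both_coin \<alpha> n k t c c' \<le> g K c c' + ennreal (wt \<alpha> c * wt (1 - \<alpha>) c') * (indicator {c. nfalse c < k} c + indicator {c'. nfalse c' < n} c')"
    proof (cases "n \<le> nfalse c' \<and> k \<le> nfalse c")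
      case True
      then show ?thesis using event_cylinder[OF a t cc _ k] by (simp add: g_def)
    next
      case False
      then have "(1 :: ennreal) \<le> indicator {c. nfalse c < k} c + indicator {c'. nfalse c' < n} c'"
        by (auto simp: indicator_def)
      then have "ennreal (wt \<alpha> c * wt (1 - \<alpha>) c') * 1 \<le> ennreal (wt \<alpha> c * wt (1 - \<alpha>) c') * (indicator {c. nfalse c < k} c + indicator {c'. nfalse c' < n} c')"
        by (intro mult_left_mono) auto
      then show ?thesis using g_le[OF cc] both by (auto intro: order_trans add_increasing)
    qed
    then show "g K c c' \<le> ennreal (wt \<alpha> c * wt (1 - \<alpha>) c') * both_coin \<alpha> n k t c c' + ennreal (wt \<alpha> c * wt (1 - \<alpha>) c') * (indicator {c. nfalse c < k} c + indicator {c'. nfalse c' < n} c')"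
    "ennreal (wt \<alpha> c * wt (1 - \<alpha>) c') * both_coin \<alpha> n k t c c' \<le> g K c c' + ennreal (wt \<alpha> c * wt (1 - \<alpha>) c') * (indicator {c. nfalse c < k} c + indicator {c'. nfalse c' < n} c')"
      by auto
  qed
  have PL: "?P \<le> ?\<Lambda> + bad K" for K
    unfolding P[of K] L[of K] bad[symmetric] sum.distrib[symmetric] using cmp(1) by (intro sum_mono) auto
  have LP: "?\<Lambda> \<le> ?P + bad K" for K
    unfolding P[of K] L[of K] bad[symmetric] sum.distrib[symmetric] using cmp(2) by (intro sum_mono) auto
  have "bad \<longlonglongrightarrow> 0 + 0"
    unfolding bad_def using a by (intro tendsto_add coinsum_few) auto
  then have lim: "(\<lambda>K. x + bad K) \<longlonglongrightarrow> x" for x by (intro tendsto_eq_intros) auto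
  show ?thesis
  proof (rule antisym)
    show "?P \<le> ?\<Lambda>" by (rule LIMSEQ_le_const[OF lim]) (use PL in auto)
    show "?\<Lambda> \<le> ?P" by (rule LIMSEQ_le_const[OF lim]) (use LP in auto)
  qed
qed

end

text \<open>\<open>initseq\<close> lowers the values on the bottom axis by at most \<tau>, and the
  recursion preserves both inequalities.\<close>

lemma quad_lpp:
  assumes x: "\<And>i. 0 \<le> x i" and \<tau>: "0 \<le> \<tau>"
  shows "lpp x y w i j - \<tau> \<le> quad (psum y) (initseq \<tau> x) w i j \<and> quad (psum y) (initseq \<tau> x) w i j \<le> lpp x y w i j"
proof (induction i j rule: grid_induct)
  case (row i)
  then show ?case
    using \<tau> x by (cases i) (auto simp: val_def initseq_def psum_def lessThan_Suc_atMost intro!: sum_nonneg)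
next
  case (column j)
  then show ?case using \<tau> by (auto simp: psum_def lessThan_Suc_atMost)
next
  case (step i j)
  then show ?case by auto
qed

lemma lpp_prob:
  assumes a: "0 < a" "0 < b"
  shows "emeasure lppm {p. lppg a b m n p \<le> t} =
    (\<integral>\<^sup>+y. (\<integral>\<^sup>+x. (\<integral>\<^sup>+w. indicator {..t} (lpp x y w m n) \<partial>seqm (seqm (expm 1))) \<partial>seqm (expm a)) \<partial>seqm (expm b))"
proof -
  have m: "{p. lppg a b m n p \<le> t} \<in> sets lppm"
  proof -
    have "{p \<in> space lppm. lppg a b m n p \<le> t} \<in> sets lppm" by measurable
    then show ?thesis by simp
  qed
  have "emeasure lppm {p. lppg a b m n p \<le> t} = (\<integral>\<^sup>+p. indicator {p. lppg a b m n p \<le> t} p \<partial>lppm)" using m by simp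
  also have "\<dots> = (\<integral>\<^sup>+(y, x, w). (case (\<lambda>j. y j / b, \<lambda>i. x i / a, w) of (y, x, w) \<Rightarrow> indicator {..t} (lpp x y w m n)) \<partial>lppm)"
    by (intro nn_integral_cong) (auto simp: lppg_def indicator_def)
  also have "\<dots> = (\<integral>\<^sup>+y. (\<integral>\<^sup>+x. (\<integral>\<^sup>+w. indicator {..t} (lpp x y w m n) \<partial>seqm (seqm (expm 1))) \<partial>seqm (expm a)) \<partial>seqm (expm b))"
    using a by (subst nn_integral_lppm_scaled) auto
  finally show ?thesis .
qed

text \<open>By \<open>quad_lpp\<close> the two passage times differ by at most \<tau>, so a slack u
  in time fails only for \<tau> > u.\<close>

lemma row_int_bounds:
  fixes n k :: nat
  assumes a: "0 < \<alpha>" "\<alpha> < 1" and u: "0 \<le> u"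
  defines "I t \<equiv> \<lambda>y. (\<integral>\<^sup>+x. (\<integral>\<^sup>+w. indicator {..t} (lpp x y w n k) \<partial>seqm (seqm (expm 1))) \<partial>seqm (expm \<alpha>))"
  shows "I t y \<le> row_int \<alpha> n k t (psum y)"
    and "row_int \<alpha> n k t (psum y) \<le> I (t + u) y + ennreal (exp (- ((1 - \<alpha>) * u)))"
proof -
  let ?T = "\<lambda>\<tau>. (\<integral>\<^sup>+s. (\<integral>\<^sup>+w. quad_le n k t (psum y) (initseq \<tau> s) w \<partial>seqm (seqm (expm 1))) \<partial>seqm (expm \<alpha>))"
  interpret S: prob_space "seqm (expm \<alpha>)" by (rule coin_probs[OF a])
  interpret E: prob_space "expm (1 - \<alpha>)" by (rule coin_probs[OF a])
  interpret B: prob_space "seqm (seqm (expm 1))" by (rule coin_probs[OF a])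
  have pos: "AE x in seqm (expm \<alpha>). \<forall>i. 0 < x i" using a by (intro AE_seqm_expm_pos)
  have pos': "AE \<tau> in expm (1 - \<alpha>). 0 < \<tau>" using a by (intro AE_expm_pos) simp
  have lower: "I t y \<le> ?T \<tau>" if "0 < \<tau>" for \<tau>
    unfolding I_def
  proof (rule nn_integral_mono_AE, use pos in eventually_elim, rule nn_integral_mono)
    fix x :: "nat \<Rightarrow> real" and w :: "nat \<Rightarrow> nat \<Rightarrow> real" assume "\<forall>i. 0 < x i"
    then show "indicator {..t} (lpp x y w n k) \<le> quad_le n k t (psum y) (initseq \<tau> x) w"
      using quad_lpp[of x \<tau> y w n k] that by (auto simp: quad_le_def indicator_def less_imp_le)
  qed
  have "I t y = (\<integral>\<^sup>+\<tau>. I t y \<partial>expm (1 - \<alpha>))" by (simp add: nn_integral_prob_const[OF E.prob_space_axioms] del: nn_integral_const)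
  also have "\<dots> \<le> row_int \<alpha> n k t (psum y)"
    unfolding row_int_def by (rule nn_integral_mono_AE, use pos' in eventually_elim) (rule lower)
  finally show "I t y \<le> row_int \<alpha> n k t (psum y)" .
  have T1: "?T \<tau> \<le> 1" for \<tau>
  proof -
    have "?T \<tau> \<le> (\<integral>\<^sup>+s. (\<integral>\<^sup>+w. 1 \<partial>seqm (seqm (expm 1))) \<partial>seqm (expm \<alpha>))"
      by (intro nn_integral_mono) (simp add: quad_le_def indicator_def)
    also have "\<dots> = 1" by (simp add: S.emeasure_space_1 B.emeasure_space_1)
    finally show ?thesis .
  qed
  have upper: "?T \<tau> \<le> I (t + u) y + indicator {u<..} \<tau>" if "0 < \<tau>" for \<tau>
  proof (cases "\<tau> \<le> u")
    case True
    have "?T \<tau> \<le> I (t + u) y"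
      unfolding I_def
    proof (rule nn_integral_mono_AE, use pos in eventually_elim, rule nn_integral_mono)
      fix x :: "nat \<Rightarrow> real" and w :: "nat \<Rightarrow> nat \<Rightarrow> real" assume "\<forall>i. 0 < x i"
      then show "quad_le n k t (psum y) (initseq \<tau> x) w \<le> indicator {..t + u} (lpp x y w n k)"
        using quad_lpp[of x \<tau> y w n k] that True by (auto simp: quad_le_def indicator_def less_imp_le)
    qed
    then show ?thesis by (simp add: add_increasing2)
  next
    case False
    then show ?thesis using T1[of \<tau>] by (simp add: add_increasing)
  qed
  have "row_int \<alpha> n k t (psum y) \<le> (\<integral>\<^sup>+\<tau>. I (t + u) y + indicator {u<..} \<tau> \<partial>expm (1 - \<alpha>))"
    unfolding row_int_def by (rule nn_integral_mono_AE, use pos' in eventually_elim) (rule upper)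
  also have "\<dots> = I (t + u) y + (\<integral>\<^sup>+\<tau>. indicator {u<..} \<tau> * 1 \<partial>expm (1 - \<alpha>))"
    by (subst nn_integral_add) (auto simp: nn_integral_prob_const[OF E.prob_space_axioms] simp del: nn_integral_const nn_integral_indicator)
  also have "(\<integral>\<^sup>+\<tau>. indicator {u<..} \<tau> * 1 \<partial>expm (1 - \<alpha>)) = ennreal (exp (- ((1 - \<alpha>) * u)))"
    using a u by (subst expm_tail_less) (auto simp: nn_integral_prob_const[OF E.prob_space_axioms] algebra_simps simp del: nn_integral_const)
  finally show "row_int \<alpha> n k t (psum y) \<le> I (t + u) y + ennreal (exp (- ((1 - \<alpha>) * u)))" .
qed

section \<open>Comparison of the position with the stationary passage time\<close>

context bernoulli_tasep
begin

lemma prob_position_ge: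
  assumes a: "0 < \<alpha>" "\<alpha> < 1" and t: "0 \<le> t" and k: "1 \<le> k"
  shows "L.prob {p. lppg \<alpha> (1 - \<alpha>) n k p \<le> t} \<le> prob {w \<in> space M. R (int n) t w \<le> int n - int k}"
proof -
  have "emeasure lppm {p. lppg \<alpha> (1 - \<alpha>) n k p \<le> t} \<le> emeasure M {w \<in> space M. R (int n) t w \<le> int n - int k}"
    unfolding position_law[OF a t k] using a
    by (subst lpp_prob) (auto intro!: nn_integral_mono row_int_bounds(1)[where u=0])
  then show ?thesis by (simp add: L.emeasure_eq_measure emeasure_eq_measure)
qed

lemma prob_position_le:
  assumes a: "0 < \<alpha>" "\<alpha> < 1" and t: "0 \<le> t" and k: "1 \<le> k" and u: "0 \<le> u"
  shows "prob {w \<in> space M. R (int n) t w \<le> int n - int k} \<le> L.prob {p. lppg \<alpha> (1 - \<alpha>) n k p \<le> t + u} + exp (- ((1 - \<alpha>) * u))"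
proof -
  interpret S: prob_space "seqm (expm \<alpha>)" by (rule coin_probs[OF a])
  interpret Y: prob_space "seqm (expm (1 - \<alpha>))" by (rule coin_probs[OF a])
  interpret B: prob_space "seqm (seqm (expm 1))" by (rule coin_probs[OF a])
  have "emeasure M {w \<in> space M. R (int n) t w \<le> int n - int k} \<le>
    (\<integral>\<^sup>+y. (\<integral>\<^sup>+x. (\<integral>\<^sup>+w. indicator {..t + u} (lpp x y w n k) \<partial>seqm (seqm (expm 1))) \<partial>seqm (expm \<alpha>)) + ennreal (exp (- ((1 - \<alpha>) * u))) \<partial>seqm (expm (1 - \<alpha>)))"
    unfolding position_law[OF a t k] by (intro nn_integral_mono row_int_bounds(2) a u)
  also have "\<dots> = emeasure lppm {p. lppg \<alpha> (1 - \<alpha>) n k p \<le> t + u} + ennreal (exp (- ((1 - \<alpha>) * u)))"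
    using a by (subst lpp_prob, simp, simp, subst nn_integral_add) (auto simp: nn_integral_prob_const[OF Y.prob_space_axioms] simp del: nn_integral_const)
  finally show ?thesis by (simp add: L.emeasure_eq_measure emeasure_eq_measure ennreal_plus[symmetric] del: ennreal_plus)
qed

text \<open>If particle n starts beyond q, every particle at the sites 1, ..., q has a label
  strictly between 0 and n.\<close>

lemma initial_sparse:
  assumes "tasep_path (clk w) (\<lambda>i t. R i t w)" and q: "int q < R (int n) 0 w"
  shows "nfalse (rpat q w) < n"
proof -
  have sm: "strict_mono (\<lambda>i. R i 0 w)" and r0: "R 0 0 w = 0" using assms(1) by (auto simp: tasep_path_def)
  define D where "D = {d. d < q \<and> occ w (1 + int d)}"
  have "nfalse (rpat q w) = card D"
  proof -
    have "filter Not (rpat q w) = map (\<lambda>d. \<not> occ w (1 + int d)) (filter (\<lambda>d. occ w (1 + int d)) [0..<q])"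
      by (simp add: rpat_def filter_map comp_def)
    then have "nfalse (rpat q w) = length (filter (\<lambda>d. occ w (1 + int d)) [0..<q])" by (simp add: nfalse_def)
    also have "\<dots> = card (set (filter (\<lambda>d. occ w (1 + int d)) [0..<q]))" by (rule distinct_card[symmetric]) simp
    finally show ?thesis by (simp add: D_def conj_commute)
  qed
  also have "card D \<le> card {1..<int n}"
  proof -
    have "\<exists>i\<in>{1..<int n}. R i 0 w = 1 + int d" if d: "d \<in> D" for d
    proof -
      obtain i where i: "R i 0 w = 1 + int d" using d by (auto simp: D_def occ_def occupied_def)
      have "R 0 0 w < R i 0 w" "R i 0 w < R (int n) 0 w" using i r0 d q by (auto simp: D_def)
      then have "0 < i" "i < int n" using strict_mono_less[OF sm] by auto
      then show ?thesis using i by (intro bexI[of _ i]) auto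
    qed
    then obtain f where f: "\<And>d. d \<in> D \<Longrightarrow> f d \<in> {1..<int n} \<and> R (f d) 0 w = 1 + int d" by metis
    have "inj_on f D"
    proof (rule inj_onI)
      fix d d' assume "d \<in> D" "d' \<in> D" "f d = f d'"
      then have "1 + int d = 1 + int d'" using f by metis
      then show "d = d'" by simp
    qed
    moreover have "f ` D \<subseteq> {1..<int n}" using f by blast
    ultimately show ?thesis by (rule card_inj_on_le) simp
  qed
  also have "\<dots> < n"
  proof -
    have "n \<noteq> 0" using q r0 by (intro notI) simp
    then show ?thesis by simp
  qed
  finally show ?thesis .
qed

lemma prob_initial_far:
  assumes a: "0 < \<alpha>" "\<alpha> < 1"
  shows "prob {w \<in> space M. int q < R (int n) 0 w} \<le> exp (real n) * (1 - \<alpha> + \<alpha> * exp (- 1)) ^ q"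
proof -
  let ?C = "\<lambda>c c'. {\<omega>. \<forall>z\<in>{-int q..int q}. \<omega> z = conf c c' z}"
  have [measurable]: "R (int n) 0 \<in> measurable M (count_space UNIV)" by (rule measurable_positions) simp
  have cyl [measurable]: "?C c c' \<in> sets cfield" for c c' by (rule sets_cylinder)
  have "emeasure M {w \<in> space M. int q < R (int n) 0 w} = (\<integral>\<^sup>+w. indicator {w \<in> space M. int q < R (int n) 0 w} w \<partial>M)"
    by (rule nn_integral_indicator[symmetric]) measurable
  also have "\<dots> \<le> (\<integral>\<^sup>+w. (\<Sum>c | length c = q. \<Sum>c' | length c' = q. indicator {c'. nfalse c' < n} c' * indicator {w \<in> space M. occ w \<in> ?C c c'} w) \<partial>M)"
  proof (rule nn_integral_mono_AE, use AE_occ0 paths AE_space in eventually_elim)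
    case (elim w)
    have p: "tasep_path (clk w) (\<lambda>i t. R i t w)" using elim(2) by (simp add: clk_def[abs_def])
    have "(indicator {w \<in> space M. int q < R (int n) 0 w} w :: ennreal) \<le> indicator {c'. nfalse c' < n} (rpat q w) * (\<Sum>c | length c = q. \<Sum>c' | length c' = q. indicator (?C c c') (occ w))"
      unfolding cylinder_partition[OF elim(1)] using initial_sparse[OF p, of q n] by (auto simp: indicator_def)
    also have "\<dots> = (\<Sum>c | length c = q. \<Sum>c' | length c' = q. indicator {c'. nfalse c' < n} c' * indicator {w \<in> space M. occ w \<in> ?C c c'} w)"
      unfolding sum_distrib_left
    proof (intro sum.cong refl)
      fix c c' :: "bool list" assume "c \<in> {c. length c = q}" "c' \<in> {c'. length c' = q}"
      then have "occ w \<in> ?C c c' \<longleftrightarrow> lpat q w = c \<and> rpat q w = c'"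
        using pat_iff[OF elim(1), of c q c'] by (simp only: mem_Collect_eq)
      then show "indicator {c'. nfalse c' < n} (rpat q w) * indicator (?C c c') (occ w) = (indicator {c'. nfalse c' < n} c' * indicator {w \<in> space M. occ w \<in> ?C c c'} w :: ennreal)"
        using elim(3) unfolding indicator_def by (simp only: mem_Collect_eq split: if_split) simp
    qed
    finally show ?case .
  qed
  also have "\<dots> = (\<Sum>c | length c = q. \<Sum>c' | length c' = q. indicator {c'. nfalse c' < n} c' * ennreal (wt \<alpha> c * wt (1 - \<alpha>) c'))"
  proof -
    have m: "{w \<in> space M. occ w \<in> ?C c c'} \<in> sets M" for c c' by measurable
    have "(\<integral>\<^sup>+w. (\<Sum>c | length c = q. \<Sum>c' | length c' = q. indicator {c'. nfalse c' < n} c' * indicator {w \<in> space M. occ w \<in> ?C c c'} w) \<partial>M) =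
      (\<Sum>c | length c = q. \<Sum>c' | length c' = q. indicator {c'. nfalse c' < n} c' * emeasure M {w \<in> space M. occ w \<in> ?C c c'})"
      using m by (simp add: nn_integral_sum nn_integral_cmult)
    also have "\<dots> = (\<Sum>c | length c = q. \<Sum>c' | length c' = q. indicator {c'. nfalse c' < n} c' * ennreal (wt \<alpha> c * wt (1 - \<alpha>) c'))"
      by (intro sum.cong refl) (subst emeasure_cylinder[OF a], simp_all)
    finally show ?thesis .
  qed
  also have "\<dots> = coinsum \<alpha> q (\<lambda>c. coinsum (1 - \<alpha>) q (\<lambda>c'. indicator {c'. nfalse c' < n} c'))"
    unfolding sum_bool_lists[OF a, symmetric] by (simp add: mult.commute)
  also have "\<dots> = coinsum (1 - \<alpha>) q (\<lambda>c'. indicator {c'. nfalse c' < n} c')"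
    using a by (simp add: coinsum_const)
  also have "\<dots> \<le> ennreal (exp (real n) * (1 - \<alpha> + \<alpha> * exp (- 1)) ^ q)"
    using coinsum_few_le[of "1 - \<alpha>" q n] a by simp
  finally show ?thesis using a by (simp add: emeasure_eq_measure)
qed

lemma AE_path_antimono: "0 \<le> t \<Longrightarrow> AE w in M. R i t w \<le> R i 0 w"
  using paths by eventually_elim (use path_antimono in blast)

end

section \<open>Fluctuations of the position\<close>

lemma nn_integral_shifted_exp_sum:
  assumes "0 < b" "c < b"
  shows "(\<integral>\<^sup>+y. ennreal (exp (c * (\<Sum>j<s. y (k + j)))) \<partial>seqm (expm b)) = ennreal ((b / (b - c)) ^ s)"
proof (induction k)
  case 0 show ?case using nn_integral_exp_sum[OF assms] by simp
next
  case (Suc k)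
  have p: "prob_space (expm b)" using assms by (intro prob_space_expm)
  have "(\<integral>\<^sup>+y. ennreal (exp (c * (\<Sum>j<s. y (Suc k + j)))) \<partial>seqm (expm b)) =
    (\<integral>\<^sup>+x. (\<integral>\<^sup>+y. ennreal (exp (c * (\<Sum>j<s. y (k + j)))) \<partial>seqm (expm b)) \<partial>expm b)"
    by (subst nn_integral_seqm[OF p]) auto
  then show ?case unfolding Suc using nn_integral_prob_const[OF p] by (simp del: nn_integral_const)
qed

lemma vinc_sum_mgf:
  assumes "0 < a" "0 < b" "a + b = 1" "c < b"
  shows "(\<integral>\<^sup>+p. ennreal (exp (c * (\<Sum>j<s. vinc a b m p (k + j)))) \<partial>lppm) = ennreal ((b / (b - c)) ^ s)"
  using assms by (subst vinc_law[where F="\<lambda>y. ennreal (exp (c * (\<Sum>j<s. y (k + j))))"]) (auto simp: nn_integral_shifted_exp_sum)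

text \<open>The level is a quarter of the mean. Tilting by - b gives (1/2)^s exp (s / 4), and exp
  (1/2) is at most 2.\<close>

lemma vinc_sum_lower:
  assumes "0 < a" "0 < b" "a + b = 1"
  shows "L.prob {p. (\<Sum>j<s. vinc a b m p (k + j)) \<le> real s / (4 * b)} \<le> exp (- (real s / 4))"
proof -
  have "L.prob {p \<in> space lppm. - (real s / (4 * b)) \<le> - (\<Sum>j<s. vinc a b m p (k + j))} \<le> (1 / 2) ^ s * exp (- (b * - (real s / (4 * b))))"
  proof (rule L.exp_markov)
    show "(\<integral>\<^sup>+p. ennreal (exp (b * - (\<Sum>j<s. vinc a b m p (k + j)))) \<partial>lppm) \<le> ennreal ((1 / 2) ^ s)"
      using vinc_sum_mgf[OF assms, of "- b" m k s] assms by simp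
  qed (use assms in auto)
  also have "(1 / 2) ^ s * exp (- (b * - (real s / (4 * b)))) \<le> exp (- (real s / 4))"
  proof -
    have "exp (1 / 2 :: real) \<le> 2"
    proof (rule power2_le_imp_le)
      have "(exp (1 / 2 :: real))\<^sup>2 = exp 1" by (simp add: exp_double[symmetric])
      then show "(exp (1 / 2 :: real))\<^sup>2 \<le> 2\<^sup>2" using exp_le by simp
    qed simp
    then have "inverse 2 \<le> inverse (exp (1 / 2 :: real))" by (intro le_imp_inverse_le) auto
    then have "(1 / 2 :: real) \<le> exp (- (1 / 2))" by (simp add: exp_minus)
    then have "(1 / 2 :: real) ^ s \<le> exp (- (1 / 2)) ^ s" by (intro power_mono) auto
    also have "\<dots> = exp (- (real s / 2))" by (simp add: exp_of_nat_mult[symmetric])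
    finally have "(1 / 2 :: real) ^ s * exp (real s / 4) \<le> exp (- (real s / 2)) * exp (real s / 4)" by (intro mult_right_mono) auto
    also have "\<dots> = exp (- (real s / 4))" by (simp add: exp_add[symmetric])
    finally show ?thesis using assms by simp
  qed
  finally show ?thesis by simp
qed

text \<open>The hypothesis places x at four times the mean or above. Tilting by b / 2 costs only 2 ^
  s.\<close>

lemma vinc_sum_upper:
  assumes "0 < a" "0 < b" "a + b = 1" and s: "real s \<le> b * x / 4"
  shows "L.prob {p. x \<le> (\<Sum>j<s. vinc a b m p (k + j))} \<le> exp (- (b * x / 4))"
proof -
  have "L.prob {p \<in> space lppm. x \<le> (\<Sum>j<s. vinc a b m p (k + j))} \<le> 2 ^ s * exp (- (b / 2 * x))"
  proof (rule L.exp_markov)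
    have "b / (b - b / 2) = 2" using assms by (simp add: field_simps)
    then show "(\<integral>\<^sup>+p. ennreal (exp (b / 2 * (\<Sum>j<s. vinc a b m p (k + j)))) \<partial>lppm) \<le> ennreal (2 ^ s)"
      using vinc_sum_mgf[OF assms(1-3), of "b / 2" m k s] assms by simp
  qed (use assms in auto)
  also have "2 ^ s * exp (- (b / 2 * x)) \<le> exp (b * x / 4) * exp (- (b / 2 * x))"
  proof (intro mult_right_mono)
    have "(2 :: real) ^ s \<le> exp 1 ^ s" using exp_ge_add_one_self[of "1::real"] by (intro power_mono) auto
    also have "\<dots> = exp (real s)" by (simp add: exp_of_nat_mult[symmetric])
    also have "\<dots> \<le> exp (b * x / 4)" using s by simp
    finally show "(2 :: real) ^ s \<le> exp (b * x / 4)" .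
  qed simp
  also have "\<dots> = exp (- (b * x / 4))" by (simp add: exp_add[symmetric])
  finally show ?thesis by simp
qed

lemma sets_lppm_Collect [measurable]: "f \<in> borel_measurable lppm \<Longrightarrow> {p. f p \<le> (x::real)} \<in> sets lppm" "f \<in> borel_measurable lppm \<Longrightarrow> {p. x \<le> f p} \<in> sets lppm"
  by (frule measurable_sets[of _ _ borel "{..x}"], simp_all add: vimage_def)
     (drule measurable_sets[of _ _ borel "{x..}"], simp_all add: vimage_def)

lemma exp_div_mono: "1 \<le> (\<tau>::real) \<Longrightarrow> c \<le> d \<Longrightarrow> 0 \<le> d \<Longrightarrow> 0 \<le> s \<Longrightarrow> exp (- (d * s)) \<le> exp (- (c * s / \<tau>))"
proof -
  assume h: "1 \<le> (\<tau>::real)" "c \<le> d" "0 \<le> d" "0 \<le> (s::real)"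
  have "c * s / \<tau> \<le> d * s / \<tau>" using h by (intro divide_right_mono mult_right_mono) auto
  also have "\<dots> \<le> d * s / 1" using h by (intro divide_left_mono) auto
  finally show ?thesis by simp
qed

text \<open>Between k and k + s the passage time typically grows by s / (4 b) or more, b = 1 -
  \<alpha>, twice the allowed excess. Otherwise the passage time at k, which is on the
  characteristic, lies s / (8 b) below \<tau> ^ 3, and \<open>lppg_left\<close> applies.\<close>

lemma lpp_lower_tail:
  assumes a: "0 < \<alpha>" "\<alpha> < 1"
  obtains C c \<tau>0 where "0 < C" "0 < c" "1 \<le> \<tau>0" "\<And>\<tau> n k s. near_char \<alpha> \<tau> n k \<Longrightarrow> \<tau>0 \<le> \<tau> \<Longrightarrow>
    L.prob {p. lppg \<alpha> (1 - \<alpha>) n (k + s) p \<le> \<tau> ^ 3 + real s / (8 * (1 - \<alpha>))} \<le> C * exp (- (c * real s / \<tau>))"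
proof -
  define b where "b = 1 - \<alpha>"
  define \<theta> where "\<theta> = min \<alpha> b / 2"
  have b: "0 < b" "\<alpha> + b = 1" using a by (auto simp: b_def)
  have \<theta>: "0 < \<theta>" "2 * \<theta> \<le> \<alpha>" "2 * \<theta> \<le> 1 - \<alpha>" using a by (auto simp: \<theta>_def b_def)
  obtain C where C: "0 < C" and int: "\<And>\<tau> m n. near_char \<alpha> \<tau> m n \<Longrightarrow> 3 / \<tau> \<le> \<theta> \<Longrightarrow>
     (\<integral>\<^sup>+p. ennreal (exp ((\<tau> ^ 3 - lppg \<alpha> (1 - \<alpha>) m n p) / (8 * \<tau>))) \<partial>lppm) \<le> ennreal C"
    by (rule lppg_left[OF \<theta>]) blast
  define c where "c = min (1 / 4) (1 / (64 * b))"
  show thesis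
  proof (rule that[of "C + 1" c "max 1 (3 / \<theta>)"])
    show "0 < C + 1" "0 < c" using C b by (auto simp: c_def)
    fix \<tau> n k s assume nc: "near_char \<alpha> \<tau> n k" and \<tau>0: "max 1 (3 / \<theta>) \<le> \<tau>"
    have "1 \<le> \<tau>" "3 / \<theta> \<le> \<tau>" using \<tau>0 by auto
    then have \<tau>: "1 \<le> \<tau>" "0 < \<tau>" "3 / \<tau> \<le> \<theta>" using \<theta>(1) by (simp_all add: field_simps)
    have "L.prob {p. lppg \<alpha> b n (k + s) p \<le> \<tau> ^ 3 + real s / (8 * b)} \<le>
      L.prob ({p. real s / (8 * b) \<le> \<tau> ^ 3 - lppg \<alpha> b n k p} \<union> {p. (\<Sum>j<s. vinc \<alpha> b n p (k + j)) \<le> real s / (4 * b)})"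
    proof (rule L.finite_measure_mono)
      have "real s / (4 * b) = real s / (8 * b) + real s / (8 * b)" using b by (simp add: field_simps)
      then show "{p. lppg \<alpha> b n (k + s) p \<le> \<tau> ^ 3 + real s / (8 * b)} \<subseteq>
        {p. real s / (8 * b) \<le> \<tau> ^ 3 - lppg \<alpha> b n k p} \<union> {p. (\<Sum>j<s. vinc \<alpha> b n p (k + j)) \<le> real s / (4 * b)}"
        unfolding lppg_vinc by auto
    qed measurable
    also have "\<dots> \<le> L.prob {p. real s / (8 * b) \<le> \<tau> ^ 3 - lppg \<alpha> b n k p} + L.prob {p. (\<Sum>j<s. vinc \<alpha> b n p (k + j)) \<le> real s / (4 * b)}"
      by (rule measure_Un_le) measurable
    also have "\<dots> \<le> C * exp (- (c * real s / \<tau>)) + exp (- (c * real s / \<tau>))"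
    proof (rule add_mono)
      have "L.prob {p \<in> space lppm. real s / (8 * b) \<le> \<tau> ^ 3 - lppg \<alpha> b n k p} \<le> C * exp (- (1 / (8 * \<tau>) * (real s / (8 * b))))"
        by (rule L.exp_markov) (use int[OF nc \<tau>(3)] C \<tau> in \<open>auto simp: b_def\<close>)
      also have "\<dots> \<le> C * exp (- (c * real s / \<tau>))"
      proof -
        have "c * (real s / \<tau>) \<le> 1 / (64 * b) * (real s / \<tau>)" using \<tau> by (intro mult_right_mono) (auto simp: c_def)
        then show ?thesis using C by (simp add: ac_simps)
      qed
      finally show "L.prob {p. real s / (8 * b) \<le> \<tau> ^ 3 - lppg \<alpha> b n k p} \<le> C * exp (- (c * real s / \<tau>))" by simp
      have "L.prob {p. (\<Sum>j<s. vinc \<alpha> b n p (k + j)) \<le> real s / (4 * b)} \<le> exp (- (1 / 4 * real s))"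
        using vinc_sum_lower[OF a(1) b] by simp
      also have "\<dots> \<le> exp (- (c * real s / \<tau>))" using \<tau> by (intro exp_div_mono) (auto simp: c_def)
      finally show "L.prob {p. (\<Sum>j<s. vinc \<alpha> b n p (k + j)) \<le> real s / (4 * b)} \<le> exp (- (c * real s / \<tau>))" .
    qed
    finally show "L.prob {p. lppg \<alpha> (1 - \<alpha>) n (k + s) p \<le> \<tau> ^ 3 + real s / (8 * (1 - \<alpha>))} \<le> (C + 1) * exp (- (c * real s / \<tau>))"
      by (simp add: b_def distrib_right)
  qed simp
qed

text \<open>Now k + s is on the characteristic: a passage time of at least \<tau> ^ 3 already at k
  typically leads to an excess of s / (4 b) at k + s, b = 1 - \<alpha>, which
  \<open>lppg_right\<close> makes unlikely.\<close>

lemma lpp_upper_tail: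
  assumes a: "0 < \<alpha>" "\<alpha> < 1"
  obtains C c \<tau>0 where "0 < C" "0 < c" "1 \<le> \<tau>0" "\<And>\<tau> n k s. near_char \<alpha> \<tau> n (k + s) \<Longrightarrow> \<tau>0 \<le> \<tau> \<Longrightarrow>
    L.prob {p. \<tau> ^ 3 \<le> lppg \<alpha> (1 - \<alpha>) n k p} \<le> C * exp (- (c * real s / \<tau>))"
proof -
  define b where "b = 1 - \<alpha>"
  define \<theta> where "\<theta> = min \<alpha> b / 2"
  have b: "0 < b" "\<alpha> + b = 1" using a by (auto simp: b_def)
  have \<theta>: "0 < \<theta>" "2 * \<theta> \<le> \<alpha>" "2 * \<theta> \<le> 1 - \<alpha>" using a by (auto simp: \<theta>_def b_def)
  obtain C where C: "0 < C" and int: "\<And>\<tau> m n z w. near_char \<alpha> \<tau> m n \<Longrightarrow> (0 + 1) / \<tau> \<le> \<theta> \<Longrightarrow>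
     \<bar>z - \<alpha>\<bar> \<le> 0 / \<tau> \<Longrightarrow> \<bar>w - \<alpha>\<bar> \<le> 0 / \<tau> \<Longrightarrow>
     (\<integral>\<^sup>+p. ennreal (exp ((lppg z (1 - w) m n p - \<tau> ^ 3) / \<tau>)) \<partial>lppm) \<le> ennreal C"
    by (rule lppg_right[OF \<theta> order_refl]) blast
  define c where "c = min (1 / 4) (1 / (4 * b))"
  show thesis
  proof (rule that[of "C + 1" c "max 1 (1 / \<theta>)"])
    show "0 < C + 1" "0 < c" using C b by (auto simp: c_def)
    fix \<tau> n k s assume nc: "near_char \<alpha> \<tau> n (k + s)" and \<tau>0: "max 1 (1 / \<theta>) \<le> \<tau>"
    have "1 \<le> \<tau>" "1 / \<theta> \<le> \<tau>" using \<tau>0 by auto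
    then have \<tau>: "1 \<le> \<tau>" "0 < \<tau>" "(0 + 1) / \<tau> \<le> \<theta>" using \<theta>(1) by (simp_all add: field_simps)
    have "L.prob {p. \<tau> ^ 3 \<le> lppg \<alpha> b n k p} \<le>
      L.prob ({p. real s / (4 * b) \<le> lppg \<alpha> b n (k + s) p - \<tau> ^ 3} \<union> {p. (\<Sum>j<s. vinc \<alpha> b n p (k + j)) \<le> real s / (4 * b)})"
    proof (rule L.finite_measure_mono)
      show "{p. \<tau> ^ 3 \<le> lppg \<alpha> b n k p} \<subseteq>
        {p. real s / (4 * b) \<le> lppg \<alpha> b n (k + s) p - \<tau> ^ 3} \<union> {p. (\<Sum>j<s. vinc \<alpha> b n p (k + j)) \<le> real s / (4 * b)}"
        unfolding lppg_vinc by auto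
    qed measurable
    also have "\<dots> \<le> L.prob {p. real s / (4 * b) \<le> lppg \<alpha> b n (k + s) p - \<tau> ^ 3} + L.prob {p. (\<Sum>j<s. vinc \<alpha> b n p (k + j)) \<le> real s / (4 * b)}"
      by (rule measure_Un_le) measurable
    also have "\<dots> \<le> C * exp (- (c * real s / \<tau>)) + exp (- (c * real s / \<tau>))"
    proof (rule add_mono)
      have "L.prob {p \<in> space lppm. real s / (4 * b) \<le> lppg \<alpha> b n (k + s) p - \<tau> ^ 3} \<le> C * exp (- (1 / \<tau> * (real s / (4 * b))))"
        by (rule L.exp_markov) (use int[OF nc \<tau>(3), of \<alpha> \<alpha>] C \<tau> in \<open>auto simp: b_def\<close>)
      also have "\<dots> \<le> C * exp (- (c * real s / \<tau>))"
      proof -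
        have "c * (real s / \<tau>) \<le> 1 / (4 * b) * (real s / \<tau>)" using \<tau> by (intro mult_right_mono) (auto simp: c_def)
        then show ?thesis using C by (simp add: mult.commute)
      qed
      finally show "L.prob {p. real s / (4 * b) \<le> lppg \<alpha> b n (k + s) p - \<tau> ^ 3} \<le> C * exp (- (c * real s / \<tau>))" by simp
      have "L.prob {p. (\<Sum>j<s. vinc \<alpha> b n p (k + j)) \<le> real s / (4 * b)} \<le> exp (- (1 / 4 * real s))"
        using vinc_sum_lower[OF a(1) b] by simp
      also have "\<dots> \<le> exp (- (c * real s / \<tau>))" using \<tau> by (intro exp_div_mono) (auto simp: c_def)
      finally show "L.prob {p. (\<Sum>j<s. vinc \<alpha> b n p (k + j)) \<le> real s / (4 * b)} \<le> exp (- (c * real s / \<tau>))" .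
    qed
    finally show "L.prob {p. \<tau> ^ 3 \<le> lppg \<alpha> (1 - \<alpha>) n k p} \<le> (C + 1) * exp (- (c * real s / \<tau>))"
      by (simp add: b_def distrib_right)
  qed simp
qed

text \<open>Layer cake: X^2 is at most the sum of 2 (s + 1) over s < |X|. The derivative of the
  geometric series gives a bound of order 1 / (1 - x)^2, and 1 - x is at least c / (2
  \<tau>).\<close>

lemma (in prob_space) second_moment_tail:
  fixes X :: "'a \<Rightarrow> int"
  assumes X [measurable]: "X \<in> measurable M (count_space UNIV)"
    and tail: "\<And>s. prob {w \<in> space M. int s < \<bar>X w\<bar>} \<le> C * exp (- (c * real s / \<tau>))"
    and c: "0 < c" "c \<le> \<tau>" and C: "0 \<le> C"
  shows "integrable M (\<lambda>w. (real_of_int (X w))\<^sup>2)" "expectation (\<lambda>w. (real_of_int (X w))\<^sup>2) \<le> 8 * C / c\<^sup>2 * \<tau>\<^sup>2"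
proof -
  have \<tau>: "0 < \<tau>" using c by simp
  define x where "x = exp (- (c / \<tau>))"
  have x: "0 < x" "x < 1" using c \<tau> by (auto simp: x_def)
  have [measurable]: "{w \<in> space M. int s < \<bar>X w\<bar>} \<in> sets M" for s
    using measurable_sets[OF X, of "{x. int s < \<bar>x\<bar>}"] by (simp add: vimage_def Int_def conj_commute)
  have gap: "c / (2 * \<tau>) \<le> 1 - x"
  proof -
    define y where "y = c / \<tau>"
    have y: "0 < y" "y \<le> 1" using c \<tau> by (auto simp: y_def)
    have "x = inverse (exp y)" by (simp add: x_def y_def exp_minus)
    also have "\<dots> \<le> inverse (1 + y)" using y exp_ge_add_one_self[of y] by (intro le_imp_inverse_le) auto
    also have "\<dots> \<le> 1 - y / 2"
    proof -
      have "1 \<le> (1 - y / 2) * (1 + y)" using y by (simp add: algebra_simps power2_eq_square[symmetric]) (simp add: power2_eq_square mult_left_le)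
      then show ?thesis using y by (simp add: inverse_eq_divide pos_divide_le_eq)
    qed
    finally show ?thesis by (simp add: y_def)
  qed
  have xs: "exp (- (c * real s / \<tau>)) = x ^ s" for s
    by (simp add: x_def exp_of_nat_mult[symmetric] mult.commute)
  have "(\<integral>\<^sup>+w. ennreal ((real_of_int (X w))\<^sup>2) \<partial>M) \<le> (\<integral>\<^sup>+w. (\<Sum>s. ennreal (2 * real (Suc s)) * indicator {w \<in> space M. int s < \<bar>X w\<bar>} w) \<partial>M)"
  proof (rule nn_integral_mono)
    fix w assume w: "w \<in> space M"
    define m where "m = nat \<bar>X w\<bar>"
    have m: "int s < \<bar>X w\<bar> \<longleftrightarrow> s < m" for s by (auto simp: m_def)
    have "(real_of_int (X w))\<^sup>2 = (real m)\<^sup>2" by (simp add: m_def)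
    also have "\<dots> \<le> (\<Sum>s<m. 2 * real (Suc s))"
      by (induction m) (auto simp: power2_eq_square algebra_simps)
    finally have "ennreal ((real_of_int (X w))\<^sup>2) \<le> ennreal (\<Sum>s<m. 2 * real (Suc s))" by (rule ennreal_leI)
    also have "\<dots> = (\<Sum>s<m. ennreal (2 * real (Suc s)))" by (rule sum_ennreal[symmetric]) simp
    also have "\<dots> = (\<Sum>s<m. ennreal (2 * real (Suc s)) * indicator {w \<in> space M. int s < \<bar>X w\<bar>} w)"
      by (intro sum.cong refl) (use w m in auto)
    also have "\<dots> \<le> (\<Sum>s. ennreal (2 * real (Suc s)) * indicator {w \<in> space M. int s < \<bar>X w\<bar>} w)"
      by (rule sum_le_suminf) auto
    finally show "ennreal ((real_of_int (X w))\<^sup>2) \<le> (\<Sum>s. ennreal (2 * real (Suc s)) * indicator {w \<in> space M. int s < \<bar>X w\<bar>} w)" .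
  qed
  also have "\<dots> = (\<Sum>s. ennreal (2 * real (Suc s)) * emeasure M {w \<in> space M. int s < \<bar>X w\<bar>})"
    by (subst nn_integral_suminf) (auto simp: nn_integral_cmult)
  also have "\<dots> \<le> (\<Sum>s. ennreal (2 * C * (real (Suc s) * x ^ s)))"
  proof (rule suminf_le)
    fix s
    have "ennreal (2 * real (Suc s)) * emeasure M {w \<in> space M. int s < \<bar>X w\<bar>} \<le> ennreal (2 * real (Suc s)) * ennreal (C * x ^ s)"
      using tail[of s] unfolding xs by (intro mult_left_mono) (auto simp: emeasure_eq_measure intro!: ennreal_leI)
    also have "\<dots> = ennreal (2 * real (Suc s) * (C * x ^ s))" using C x by (intro ennreal_mult[symmetric]) auto
    also have "2 * real (Suc s) * (C * x ^ s) = 2 * C * (real (Suc s) * x ^ s)" by (simp only: ac_simps)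
    finally show "ennreal (2 * real (Suc s)) * emeasure M {w \<in> space M. int s < \<bar>X w\<bar>} \<le> ennreal (2 * C * (real (Suc s) * x ^ s))" .
  qed auto
  also have "\<dots> = ennreal (2 * C * (1 / (1 - x)\<^sup>2))"
  proof (rule sums_unique[symmetric])
    have "(\<lambda>s. real (Suc s) * x ^ s) sums (1 / (1 - x)\<^sup>2)" using geometric_deriv_sums[of x] x by simp
    then have "(\<lambda>s. 2 * C * (real (Suc s) * x ^ s)) sums (2 * C * (1 / (1 - x)\<^sup>2))" by (rule sums_mult)
    then show "(\<lambda>s. ennreal (2 * C * (real (Suc s) * x ^ s))) sums ennreal (2 * C * (1 / (1 - x)\<^sup>2))"
      using C x by (subst sums_ennreal) auto
  qed
  also have "\<dots> \<le> ennreal (8 * C / c\<^sup>2 * \<tau>\<^sup>2)"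
  proof (rule ennreal_leI)
    have "1 / (1 - x)\<^sup>2 \<le> 1 / (c / (2 * \<tau>))\<^sup>2"
      using gap c \<tau> x by (intro divide_left_mono power_mono mult_pos_pos zero_less_power) auto
    also have "\<dots> = 4 * \<tau>\<^sup>2 / c\<^sup>2" by (simp add: power_divide power_mult_distrib)
    finally have "2 * C * (1 / (1 - x)\<^sup>2) \<le> 2 * C * (4 * \<tau>\<^sup>2 / c\<^sup>2)" using C by (intro mult_left_mono) auto
    then show "2 * C * (1 / (1 - x)\<^sup>2) \<le> 8 * C / c\<^sup>2 * \<tau>\<^sup>2" by simp
  qed
  finally have bd: "(\<integral>\<^sup>+w. ennreal ((real_of_int (X w))\<^sup>2) \<partial>M) \<le> ennreal (8 * C / c\<^sup>2 * \<tau>\<^sup>2)" .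
  show int: "integrable M (\<lambda>w. (real_of_int (X w))\<^sup>2)"
    using bd by (intro integrableI_bounded) (auto intro: le_less_trans)
  have "ennreal (expectation (\<lambda>w. (real_of_int (X w))\<^sup>2)) \<le> ennreal (8 * C / c\<^sup>2 * \<tau>\<^sup>2)"
    using bd by (subst nn_integral_eq_integral[OF int, symmetric]) auto
  then show "expectation (\<lambda>w. (real_of_int (X w))\<^sup>2) \<le> 8 * C / c\<^sup>2 * \<tau>\<^sup>2"
    using C by (subst (asm) ennreal_le_iff) auto
qed

text \<open>Wherever the mean lies, one of the two events keeps X at distance at least \<delta> / 2
  from it; Chebyshev's inequality then bounds the variance from below.\<close>

lemma (in prob_space) variance_spread:
  assumes X [measurable]: "X \<in> borel_measurable M" and int: "integrable M (\<lambda>w. (X w)\<^sup>2)"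
    and p1: "p \<le> prob {w \<in> space M. x1 \<le> X w}" and p2: "p \<le> prob {w \<in> space M. X w \<le> x2}"
    and \<delta>: "0 < \<delta>" "x2 + \<delta> \<le> x1"
  shows "p * (\<delta> / 2)\<^sup>2 \<le> variance X"
proof -
  have "p \<le> prob {w \<in> space M. \<delta> / 2 \<le> \<bar>X w - expectation X\<bar>}"
  proof (cases "expectation X + \<delta> / 2 \<le> x1")
    case True
    then have "prob {w \<in> space M. x1 \<le> X w} \<le> prob {w \<in> space M. \<delta> / 2 \<le> \<bar>X w - expectation X\<bar>}"
      by (intro finite_measure_mono) (auto simp: abs_if field_simps, measurable)
    then show ?thesis using p1 by simp
  next
    case False
    then have "x2 \<le> expectation X - \<delta> / 2" using \<delta> by (simp add: field_simps)
    then have "prob {w \<in> space M. X w \<le> x2} \<le> prob {w \<in> space M. \<delta> / 2 \<le> \<bar>X w - expectation X\<bar>}"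
      by (intro finite_measure_mono) (auto simp: abs_if field_simps, measurable)
    then show ?thesis using p2 by simp
  qed
  also have "\<dots> \<le> variance X / (\<delta> / 2)\<^sup>2"
    using \<delta> int by (intro Chebyshev_inequality) auto
  finally show ?thesis using \<delta> by (simp add: pos_le_divide_eq)
qed

lemma near_char_bounds:
  assumes "near_char \<alpha> \<tau> n k" "0 < \<alpha>" "\<alpha> < 1"
  shows "real n \<le> 2 * \<tau> ^ 3" "real k \<le> 2 * \<tau> ^ 3" "(1 - \<alpha>)\<^sup>2 * \<tau> ^ 3 - 1 \<le> real k" "1 \<le> \<tau> ^ 3" "\<tau> \<le> \<tau> ^ 3"
proof -
  have \<tau>: "1 \<le> \<tau>" using assms by (simp add: near_char_def)
  show \<tau>3: "1 \<le> \<tau> ^ 3" using \<tau> by simp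
  show "\<tau> \<le> \<tau> ^ 3" using power_increasing[of 1 3 \<tau>] \<tau> by simp
  have "\<alpha>\<^sup>2 \<le> 1" "(1 - \<alpha>)\<^sup>2 \<le> 1" using assms by (auto simp: power_le_one_iff abs_square_le_1)
  then have "\<alpha>\<^sup>2 * \<tau> ^ 3 \<le> 1 * \<tau> ^ 3" "(1 - \<alpha>)\<^sup>2 * \<tau> ^ 3 \<le> 1 * \<tau> ^ 3" using \<tau> by (auto intro!: mult_right_mono)
  then show "real n \<le> 2 * \<tau> ^ 3" "real k \<le> 2 * \<tau> ^ 3" "(1 - \<alpha>)\<^sup>2 * \<tau> ^ 3 - 1 \<le> real k"
    using assms(1) \<tau>3 unfolding near_char_def by linarith+
qed

section \<open>Tails of the displacement\<close>

context bernoulli_tasep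
begin

lemma displacement_left_tail:
  assumes a: "0 < \<alpha>" "\<alpha> < 1"
  obtains C c \<tau>0 where "0 < C" "0 < c" "\<And>\<tau> n k s. near_char \<alpha> \<tau> n k \<Longrightarrow> \<tau>0 \<le> \<tau> \<Longrightarrow> 1 \<le> k \<Longrightarrow>
    prob {w \<in> space M. R (int n) (\<tau> ^ 3) w \<le> int n - int (k + s)} \<le> C * exp (- (c * real s / \<tau>))"
proof -
  obtain C c \<tau>0 where C: "0 < C" "0 < c" "1 \<le> \<tau>0" and tail: "\<And>\<tau> n k s. near_char \<alpha> \<tau> n k \<Longrightarrow> \<tau>0 \<le> \<tau> \<Longrightarrow>
    L.prob {p. lppg \<alpha> (1 - \<alpha>) n (k + s) p \<le> \<tau> ^ 3 + real s / (8 * (1 - \<alpha>))} \<le> C * exp (- (c * real s / \<tau>))"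
    by (rule lpp_lower_tail[OF a]) blast
  define c' where "c' = min c (1 / 8)"
  show thesis
  proof (rule that[of "C + 1" c' \<tau>0])
    show "0 < C + 1" "0 < c'" using C by (auto simp: c'_def)
    fix \<tau> n k s assume nc: "near_char \<alpha> \<tau> n k" and \<tau>0: "\<tau>0 \<le> \<tau>" and k: "1 \<le> k"
    have \<tau>: "1 \<le> \<tau>" using \<tau>0 C by simp
    have "prob {w \<in> space M. R (int n) (\<tau> ^ 3) w \<le> int n - int (k + s)} \<le>
      L.prob {p. lppg \<alpha> (1 - \<alpha>) n (k + s) p \<le> \<tau> ^ 3 + real s / (8 * (1 - \<alpha>))} + exp (- ((1 - \<alpha>) * (real s / (8 * (1 - \<alpha>)))))"
      using a \<tau> k by (intro prob_position_le) auto
    also have "\<dots> \<le> C * exp (- (c' * real s / \<tau>)) + exp (- (c' * real s / \<tau>))"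
    proof (rule add_mono)
      have "c' * real s / \<tau> \<le> c * real s / \<tau>" using \<tau> by (intro divide_right_mono mult_right_mono) (auto simp: c'_def)
      then have "C * exp (- (c * real s / \<tau>)) \<le> C * exp (- (c' * real s / \<tau>))" using C by simp
      then show "L.prob {p. lppg \<alpha> (1 - \<alpha>) n (k + s) p \<le> \<tau> ^ 3 + real s / (8 * (1 - \<alpha>))} \<le> C * exp (- (c' * real s / \<tau>))"
        using tail[OF nc \<tau>0, of s] by simp
      have "exp (- ((1 - \<alpha>) * (real s / (8 * (1 - \<alpha>))))) = exp (- (1 / 8 * real s))" using a by (simp add: field_simps)
      also have "\<dots> \<le> exp (- (c' * real s / \<tau>))" using \<tau> by (intro exp_div_mono) (auto simp: c'_def)
      finally show "exp (- ((1 - \<alpha>) * (real s / (8 * (1 - \<alpha>))))) \<le> exp (- (c' * real s / \<tau>))" .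
    qed
    finally show "prob {w \<in> space M. R (int n) (\<tau> ^ 3) w \<le> int n - int (k + s)} \<le> (C + 1) * exp (- (c' * real s / \<tau>))"
      by (simp add: distrib_right)
  qed
qed

text \<open>The range s < k comes from \<open>position_law\<close>, which describes the overtaking
  of at least one hole from the left of the origin, here k - s of them.\<close>

lemma displacement_right_tail_near:
  assumes a: "0 < \<alpha>" "\<alpha> < 1"
  obtains C c \<tau>0 where "0 < C" "0 < c" "1 \<le> \<tau>0" "\<And>\<tau> n k s. near_char \<alpha> \<tau> n k \<Longrightarrow> \<tau>0 \<le> \<tau> \<Longrightarrow> s < k \<Longrightarrow>
    prob {w \<in> space M. int n - int k + int s < R (int n) (\<tau> ^ 3) w} \<le> C * exp (- (c * real s / \<tau>))"
proof -
  obtain C c \<tau>0 where C: "0 < C" "0 < c" "1 \<le> \<tau>0" and tail: "\<And>\<tau> n k s. near_char \<alpha> \<tau> n (k + s) \<Longrightarrow> \<tau>0 \<le> \<tau> \<Longrightarrow>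
    L.prob {p. \<tau> ^ 3 \<le> lppg \<alpha> (1 - \<alpha>) n k p} \<le> C * exp (- (c * real s / \<tau>))"
    by (rule lpp_upper_tail[OF a]) blast
  show thesis
  proof (rule that[OF C])
    fix \<tau> n k s assume nc: "near_char \<alpha> \<tau> n k" and \<tau>0: "\<tau>0 \<le> \<tau>" and s: "s < k"
    have t: "0 \<le> \<tau> ^ 3" using \<tau>0 C by simp
    have [measurable]: "R (int n) (\<tau> ^ 3) \<in> measurable M (count_space UNIV)" by (rule measurable_positions[OF t])
    have "prob {w \<in> space M. int n - int k + int s < R (int n) (\<tau> ^ 3) w} = prob (space M - {w \<in> space M. R (int n) (\<tau> ^ 3) w \<le> int n - int (k - s)})"
      using s by (intro arg_cong[where f=prob]) (auto simp: of_nat_diff)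
    also have "\<dots> = 1 - prob {w \<in> space M. R (int n) (\<tau> ^ 3) w \<le> int n - int (k - s)}" by (rule prob_compl) measurable
    also have "\<dots> \<le> 1 - L.prob {p. lppg \<alpha> (1 - \<alpha>) n (k - s) p \<le> \<tau> ^ 3}"
      using prob_position_ge[OF a t, of "k - s" n] s by simp
    also have "\<dots> = L.prob (space lppm - {p. lppg \<alpha> (1 - \<alpha>) n (k - s) p \<le> \<tau> ^ 3})" by (rule L.prob_compl[symmetric]) measurable
    also have "\<dots> \<le> L.prob {p. \<tau> ^ 3 \<le> lppg \<alpha> (1 - \<alpha>) n (k - s) p}" by (rule L.finite_measure_mono) (auto, measurable)
    also have "\<dots> \<le> C * exp (- (c * real s / \<tau>))" using nc s by (intro tail[OF _ \<tau>0]) simp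
    finally show "prob {w \<in> space M. int n - int k + int s < R (int n) (\<tau> ^ 3) w} \<le> C * exp (- (c * real s / \<tau>))" .
  qed
qed

text \<open>Particles only move to the left, so a position this far to the right is inherited from a
  sparse initial configuration.\<close>

lemma displacement_far:
  assumes a: "0 < \<alpha>" "\<alpha> < 1"
  obtains K c where "1 \<le> K" "0 < c" "\<And>\<tau> n k s. near_char \<alpha> \<tau> n k \<Longrightarrow> K * \<tau> ^ 3 \<le> real s \<Longrightarrow>
    prob {w \<in> space M. int n - int k + int s < R (int n) (\<tau> ^ 3) w} \<le> exp (- (c * real s / \<tau>))"
proof -
  define r where "r = 1 - \<alpha> + \<alpha> * exp (- 1)"
  define l where "l = - ln r"
  have r: "0 < r" "r < 1"
  proof -
    have "\<alpha> * exp (- 1) < \<alpha> * 1" using a by (intro mult_strict_left_mono) auto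
    then show "r < 1" by (simp add: r_def)
    show "0 < r" using a by (simp add: r_def add_pos_pos)
  qed
  then have l: "0 < l" "r = exp (- l)" by (auto simp: l_def)
  \<comment> \<open>Chosen so that n + l k, which is at most 2 (1 + l) \<tau> ^ 3, stays below l s /
    2.\<close>
  define K where "K = 4 * (1 + l) / l"
  have K: "4 \<le> K" "(1 + l) / K = l / 4" using l by (auto simp: K_def field_simps)
  show thesis
  proof (rule that[of K "l / 2"])
    show "1 \<le> K" "0 < l / 2" using K l by auto
    fix \<tau> n k s assume nc: "near_char \<alpha> \<tau> n k" and s: "K * \<tau> ^ 3 \<le> real s"
    note nk = near_char_bounds[OF nc a]
    have \<tau>: "1 \<le> \<tau>" using nc by (simp add: near_char_def)
    then have t: "0 \<le> \<tau> ^ 3" by simp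
    have [measurable]: "R (int n) (\<tau> ^ 3) \<in> measurable M (count_space UNIV)" "R (int n) 0 \<in> measurable M (count_space UNIV)"
      using t by (auto intro: measurable_positions)
    have sK: "\<tau> ^ 3 \<le> real s / K" using s K by (simp add: pos_le_divide_eq mult.commute)
    have "k \<le> s"
    proof -
      have "real k \<le> 4 * \<tau> ^ 3" using nk by simp
      also have "\<dots> \<le> K * \<tau> ^ 3" using K t by (intro mult_right_mono)
      finally show ?thesis using s by linarith
    qed
    have "prob {w \<in> space M. int n - int k + int s < R (int n) (\<tau> ^ 3) w} \<le> prob {w \<in> space M. int (s - k) < R (int n) 0 w}"
    proof (rule finite_measure_mono_AE)
      show "AE w in M. w \<in> {w \<in> space M. int n - int k + int s < R (int n) (\<tau> ^ 3) w} \<longrightarrow> w \<in> {w \<in> space M. int (s - k) < R (int n) 0 w}"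
        using AE_path_antimono[OF t, of "int n"] by eventually_elim (use \<open>k \<le> s\<close> in \<open>auto simp: of_nat_diff\<close>)
    qed measurable
    also have "\<dots> \<le> exp (real n) * r ^ (s - k)" unfolding r_def by (rule prob_initial_far[OF a])
    also have "\<dots> = exp (real n - l * (real s - real k))"
      unfolding l(2) using \<open>k \<le> s\<close> by (simp add: exp_of_nat_mult[symmetric] exp_add[symmetric] of_nat_diff algebra_simps)
    also have "\<dots> \<le> exp (- (l / 2 * real s))"
    proof -
      have "real n + l * real k \<le> 2 * \<tau> ^ 3 + l * (2 * \<tau> ^ 3)" using nk l by (intro add_mono mult_left_mono) auto
      also have "\<dots> = 2 * (1 + l) * \<tau> ^ 3" by (simp add: algebra_simps)
      also have "\<dots> \<le> 2 * (1 + l) * (real s / K)" using sK l by (intro mult_left_mono) auto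
      also have "\<dots> = 2 * ((1 + l) / K) * real s" by simp
      also have "\<dots> = l / 2 * real s" unfolding K(2) by simp
      finally show ?thesis by (simp add: algebra_simps)
    qed
    also have "\<dots> \<le> exp (- (l / 2 * real s / \<tau>))" using \<tau> l by (intro exp_div_mono) auto
    finally show "prob {w \<in> space M. int n - int k + int s < R (int n) (\<tau> ^ 3) w} \<le> exp (- (l / 2 * real s / \<tau>))" .
  qed
qed

text \<open>On the right, the range from k to K \<tau> ^ 3 is covered by neither bound. There the
  tail is dominated by its value at k - 1; as k - 1 is at least a fixed multiple of \<tau> ^ 3, only
  the constant in the exponent suffers.\<close>

lemma displacement_tail:
  assumes a: "0 < \<alpha>" "\<alpha> < 1"
  obtains C c \<tau>0 where "0 < C" "0 < c" "\<And>\<tau> n k s. near_char \<alpha> \<tau> n k \<Longrightarrow> \<tau>0 \<le> \<tau> \<Longrightarrow>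
    prob {w \<in> space M. int s < \<bar>R (int n) (\<tau> ^ 3) w - (int n - int k)\<bar>} \<le> C * exp (- (c * real s / \<tau>))"
proof -
  obtain C1 c1 \<tau>1 where C1: "0 < C1" "0 < c1" and left: "\<And>\<tau> n k s. near_char \<alpha> \<tau> n k \<Longrightarrow> \<tau>1 \<le> \<tau> \<Longrightarrow> 1 \<le> k \<Longrightarrow>
    prob {w \<in> space M. R (int n) (\<tau> ^ 3) w \<le> int n - int (k + s)} \<le> C1 * exp (- (c1 * real s / \<tau>))"
    by (rule displacement_left_tail[OF a]) blast
  obtain C2 c2 \<tau>2 where C2: "0 < C2" "0 < c2" "1 \<le> \<tau>2" and right: "\<And>\<tau> n k s. near_char \<alpha> \<tau> n k \<Longrightarrow> \<tau>2 \<le> \<tau> \<Longrightarrow> s < k \<Longrightarrow>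
    prob {w \<in> space M. int n - int k + int s < R (int n) (\<tau> ^ 3) w} \<le> C2 * exp (- (c2 * real s / \<tau>))"
    by (rule displacement_right_tail_near[OF a]) blast
  obtain K c3 where K: "1 \<le> K" "0 < c3" and far: "\<And>\<tau> n k s. near_char \<alpha> \<tau> n k \<Longrightarrow> K * \<tau> ^ 3 \<le> real s \<Longrightarrow>
    prob {w \<in> space M. int n - int k + int s < R (int n) (\<tau> ^ 3) w} \<le> exp (- (c3 * real s / \<tau>))"
    by (rule displacement_far[OF a]) blast
  define b where "b = (1 - \<alpha>)\<^sup>2"
  have b: "0 < b" "b \<le> 1" using a by (auto simp: b_def abs_square_le_1)
  define c where "c = Min {c1, c2, c2 * b / (2 * K), c3}"
  have c: "0 < c" "c \<le> c1" "c \<le> c2" "c \<le> c2 * b / (2 * K)" "c \<le> c3" using C1 C2 K b by (auto simp: c_def)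
  show thesis
  proof (rule that[of "C1 + (C2 + 1)" c "Max {\<tau>1, \<tau>2, 4 / b}"])
    show "0 < C1 + (C2 + 1)" "0 < c" using C1 C2 c by auto
    fix \<tau> n k s assume nc: "near_char \<alpha> \<tau> n k" and "Max {\<tau>1, \<tau>2, 4 / b} \<le> \<tau>"
    then have \<tau>: "\<tau>1 \<le> \<tau>" "\<tau>2 \<le> \<tau>" "4 / b \<le> \<tau>" "1 \<le> \<tau>" using C2 by auto
    note nk = near_char_bounds[OF nc a]
    have t: "0 \<le> \<tau> ^ 3" using \<tau> by simp
    have [measurable]: "R (int n) (\<tau> ^ 3) \<in> measurable M (count_space UNIV)"
      using t by (auto intro: measurable_positions)
    have "4 \<le> b * \<tau>" using \<tau> b by (simp add: field_simps)
    also have "\<dots> \<le> b * \<tau> ^ 3" using nk b by (intro mult_left_mono) auto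
    finally have b4: "4 \<le> b * \<tau> ^ 3" .
    have k: "b * \<tau> ^ 3 / 2 \<le> real k - 1" "1 \<le> k" using nk(3) b4 unfolding b_def[symmetric] by linarith+
    have weaken: "exp (- (d * real s / \<tau>)) \<le> exp (- (c * real s / \<tau>))" if "c \<le> d" for d
      using that \<tau> by (simp add: divide_right_mono mult_right_mono)
    have R: "prob {w \<in> space M. int n - int k + int s < R (int n) (\<tau> ^ 3) w} \<le> (C2 + 1) * exp (- (c * real s / \<tau>))"
    proof -
      consider "s < k" | "k \<le> s" "real s < K * \<tau> ^ 3" | "K * \<tau> ^ 3 \<le> real s" by linarith
      then show ?thesis
      proof cases
        case 1
        have "prob {w \<in> space M. int n - int k + int s < R (int n) (\<tau> ^ 3) w} \<le> C2 * exp (- (c2 * real s / \<tau>))"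
          by (rule right[OF nc \<tau>(2) 1])
        also have "\<dots> \<le> (C2 + 1) * exp (- (c * real s / \<tau>))" using C2 weaken[OF c(3)] by (intro mult_mono) auto
        finally show ?thesis .
      next
        case 2
        have "prob {w \<in> space M. int n - int k + int s < R (int n) (\<tau> ^ 3) w} \<le> prob {w \<in> space M. int n - int k + int (k - 1) < R (int n) (\<tau> ^ 3) w}"
          using 2 k by (intro finite_measure_mono) (auto simp: of_nat_diff)
        also have "\<dots> \<le> C2 * exp (- (c2 * real (k - 1) / \<tau>))" using k by (intro right[OF nc \<tau>(2)]) simp
        also have "\<dots> \<le> (C2 + 1) * exp (- (c * real s / \<tau>))"
        proof (intro mult_mono)
          have "c * real s \<le> c2 * b / (2 * K) * (K * \<tau> ^ 3)" using 2 c by (intro mult_mono) auto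
          also have "\<dots> = c2 * (b * \<tau> ^ 3 / 2)" using K by simp
          also have "\<dots> \<le> c2 * real (k - 1)" using k C2 by (intro mult_left_mono) (auto simp: of_nat_diff)
          finally show "exp (- (c2 * real (k - 1) / \<tau>)) \<le> exp (- (c * real s / \<tau>))" using \<tau> by (simp add: divide_right_mono)
        qed (use C2 in auto)
        finally show ?thesis .
      next
        case 3
        have "prob {w \<in> space M. int n - int k + int s < R (int n) (\<tau> ^ 3) w} \<le> 1 * exp (- (c3 * real s / \<tau>))"
          using far[OF nc 3] by simp
        also have "\<dots> \<le> (C2 + 1) * exp (- (c * real s / \<tau>))" using C2 weaken[OF c(5)] by (intro mult_mono) auto
        finally show ?thesis .
      qed
    qed
    have "prob {w \<in> space M. int s < \<bar>R (int n) (\<tau> ^ 3) w - (int n - int k)\<bar>} \<le>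
      prob ({w \<in> space M. R (int n) (\<tau> ^ 3) w \<le> int n - int (k + s)} \<union> {w \<in> space M. int n - int k + int s < R (int n) (\<tau> ^ 3) w})"
      by (rule finite_measure_mono) auto
    also have "\<dots> \<le> prob {w \<in> space M. R (int n) (\<tau> ^ 3) w \<le> int n - int (k + s)} + prob {w \<in> space M. int n - int k + int s < R (int n) (\<tau> ^ 3) w}"
      by (rule measure_Un_le) measurable
    also have "\<dots> \<le> C1 * exp (- (c * real s / \<tau>)) + (C2 + 1) * exp (- (c * real s / \<tau>))"
    proof (rule add_mono[OF _ R])
      have "prob {w \<in> space M. R (int n) (\<tau> ^ 3) w \<le> int n - int (k + s)} \<le> C1 * exp (- (c1 * real s / \<tau>))"
        by (rule left[OF nc \<tau>(1) k(2)])
      also have "\<dots> \<le> C1 * exp (- (c * real s / \<tau>))" using C1 weaken[OF c(2)] by (intro mult_left_mono) auto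
      finally show "prob {w \<in> space M. R (int n) (\<tau> ^ 3) w \<le> int n - int (k + s)} \<le> C1 * exp (- (c * real s / \<tau>))" .
    qed
    finally show "prob {w \<in> space M. int s < \<bar>R (int n) (\<tau> ^ 3) w - (int n - int k)\<bar>} \<le> (C1 + (C2 + 1)) * exp (- (c * real s / \<tau>))"
      by (simp add: distrib_right)
  qed
qed

end

lemma exp_minus_le_inverse: "0 < x \<Longrightarrow> exp (- x) \<le> 1 / (x::real)"
  by (auto simp: exp_minus inverse_eq_divide intro!: frac_le order_trans[OF _ exp_ge_add_one_self])

text \<open>\<open>lppg_lower\<close> and \<open>lppg_mid\<close> give both bounds at k + s, and the
  s increments in between carry them to k. With b = 1 - \<alpha>, at most b \<tau> / 4 increments
  add less than \<tau> with high probability, and at least b \<tau> / 16 of them add more than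
  \<tau> / 64, the excess allowed in \<open>lppg_mid\<close>.\<close>

lemma lpp_spread:
  assumes a: "0 < \<alpha>" "\<alpha> < 1"
  obtains q \<tau>0 where "0 < q" "1 \<le> \<tau>0"
    "\<And>\<tau> n k s. near_char \<alpha> \<tau> n (k + s) \<Longrightarrow> \<tau>0 \<le> \<tau> \<Longrightarrow> real s \<le> (1 - \<alpha>) * \<tau> / 4 \<Longrightarrow>
      L.prob {p. lppg \<alpha> (1 - \<alpha>) n k p \<le> \<tau> ^ 3 + \<tau>} \<le> 1 - q"
    "\<And>\<tau> n k s. near_char \<alpha> \<tau> n (k + s) \<Longrightarrow> \<tau>0 \<le> \<tau> \<Longrightarrow> (1 - \<alpha>) * \<tau> / 16 \<le> real s \<Longrightarrow>
      q \<le> L.prob {p. lppg \<alpha> (1 - \<alpha>) n k p \<le> \<tau> ^ 3}"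
proof -
  define b where "b = 1 - \<alpha>"
  define \<theta> where "\<theta> = min \<alpha> b / 2"
  have b: "0 < b" "\<alpha> + b = 1" using a by (auto simp: b_def)
  have \<theta>: "0 < \<theta>" "2 * \<theta> \<le> \<alpha>" "2 * \<theta> \<le> 1 - \<alpha>" using a by (auto simp: \<theta>_def b_def)
  have c: "0 < (1 / 64 :: real)" by simp
  obtain q1 \<tau>1 where q1: "0 < q1" and low: "\<And>\<tau> m n. near_char \<alpha> \<tau> m n \<Longrightarrow> \<tau>1 \<le> \<tau> \<Longrightarrow>
    q1 \<le> L.prob {p. \<tau> ^ 3 + 2 * \<tau> \<le> lppg \<alpha> (1 - \<alpha>) m n p}"
    by (rule lppg_lower[OF \<theta>]) blast
  obtain q2 \<tau>2 where q2: "0 < q2" and mid: "\<And>\<tau> m n. near_char \<alpha> \<tau> m n \<Longrightarrow> \<tau>2 \<le> \<tau> \<Longrightarrow>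
    q2 \<le> L.prob {p. lppg \<alpha> (1 - \<alpha>) m n p \<le> \<tau> ^ 3 + 1 / 64 * \<tau>}"
    by (rule lppg_mid[OF \<theta> c]) blast
  define q where "q = min q1 q2 / 2"
  have q: "0 < q" "2 * q \<le> q1" "2 * q \<le> q2" using q1 q2 by (auto simp: q_def)
  show thesis
  proof (rule that[of q "Max {1, \<tau>1, \<tau>2, 64 / (b * q)}"])
    show "0 < q" "1 \<le> Max {1, \<tau>1, \<tau>2, 64 / (b * q)}" using q by auto
  next
    fix \<tau> n k s assume nc: "near_char \<alpha> \<tau> n (k + s)" and "Max {1, \<tau>1, \<tau>2, 64 / (b * q)} \<le> \<tau>" and s: "real s \<le> (1 - \<alpha>) * \<tau> / 4"
    then have \<tau>: "1 \<le> \<tau>" "\<tau>1 \<le> \<tau>" "64 / (b * q) \<le> \<tau>" by auto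
    have small: "exp (- (b * \<tau> / 4)) \<le> q"
    proof -
      have "exp (- (b * \<tau> / 4)) \<le> 1 / (b * \<tau> / 4)" using b \<tau> by (intro exp_minus_le_inverse) auto
      also have "\<dots> \<le> q" using \<tau> b q by (simp add: field_simps)
      finally show ?thesis .
    qed
    have "q1 \<le> L.prob {p. \<tau> ^ 3 + 2 * \<tau> \<le> lppg \<alpha> b n (k + s) p}" using low[OF nc \<tau>(2)] by (simp add: b_def)
    also have "\<dots> \<le> L.prob ((space lppm - {p. lppg \<alpha> b n k p \<le> \<tau> ^ 3 + \<tau>}) \<union> {p. \<tau> \<le> (\<Sum>j<s. vinc \<alpha> b n p (k + j))})"
    proof (rule L.finite_measure_mono)
      show "{p. \<tau> ^ 3 + 2 * \<tau> \<le> lppg \<alpha> b n (k + s) p} \<subseteq> (space lppm - {p. lppg \<alpha> b n k p \<le> \<tau> ^ 3 + \<tau>}) \<union> {p. \<tau> \<le> (\<Sum>j<s. vinc \<alpha> b n p (k + j))}"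
        by (auto simp: lppg_vinc)
      show "(space lppm - {p. lppg \<alpha> b n k p \<le> \<tau> ^ 3 + \<tau>}) \<union> {p. \<tau> \<le> (\<Sum>j<s. vinc \<alpha> b n p (k + j))} \<in> L.events"
        by (intro sets.Un sets.Diff sets.top) measurable
    qed
    also have "\<dots> \<le> L.prob (space lppm - {p. lppg \<alpha> b n k p \<le> \<tau> ^ 3 + \<tau>}) + L.prob {p. \<tau> \<le> (\<Sum>j<s. vinc \<alpha> b n p (k + j))}"
      by (rule measure_Un_le) measurable
    also have "L.prob (space lppm - {p. lppg \<alpha> b n k p \<le> \<tau> ^ 3 + \<tau>}) = 1 - L.prob {p. lppg \<alpha> b n k p \<le> \<tau> ^ 3 + \<tau>}"
      by (rule L.prob_compl) measurable
    also have "L.prob {p. \<tau> \<le> (\<Sum>j<s. vinc \<alpha> b n p (k + j))} \<le> exp (- (b * \<tau> / 4))"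
      using s by (intro vinc_sum_upper a b) (simp add: b_def)
    finally show "L.prob {p. lppg \<alpha> (1 - \<alpha>) n k p \<le> \<tau> ^ 3 + \<tau>} \<le> 1 - q"
      using small q unfolding b_def by linarith
  next
    fix \<tau> n k s assume nc: "near_char \<alpha> \<tau> n (k + s)" and "Max {1, \<tau>1, \<tau>2, 64 / (b * q)} \<le> \<tau>" and s: "(1 - \<alpha>) * \<tau> / 16 \<le> real s"
    then have \<tau>: "1 \<le> \<tau>" "\<tau>2 \<le> \<tau>" "64 / (b * q) \<le> \<tau>" by auto
    have small: "exp (- (real s / 4)) \<le> q"
    proof -
      have "exp (- (real s / 4)) \<le> exp (- (b * \<tau> / 64))" using s by (simp add: b_def mult.commute)
      also have "\<dots> \<le> 1 / (b * \<tau> / 64)" using b \<tau> by (intro exp_minus_le_inverse) auto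
      also have "\<dots> \<le> q" using \<tau> b q by (simp add: field_simps)
      finally show ?thesis .
    qed
    have sb: "1 / 64 * \<tau> \<le> real s / (4 * b)" using s b by (simp add: b_def[symmetric] field_simps mult.commute)
    have "q2 \<le> L.prob {p. lppg \<alpha> b n (k + s) p \<le> \<tau> ^ 3 + 1 / 64 * \<tau>}" using mid[OF nc \<tau>(2)] by (simp add: b_def)
    also have "\<dots> \<le> L.prob ({p. lppg \<alpha> b n k p \<le> \<tau> ^ 3} \<union> {p. (\<Sum>j<s. vinc \<alpha> b n p (k + j)) \<le> real s / (4 * b)})"
      by (rule L.finite_measure_mono) (use sb in \<open>auto simp: lppg_vinc\<close>)
    also have "\<dots> \<le> L.prob {p. lppg \<alpha> b n k p \<le> \<tau> ^ 3} + L.prob {p. (\<Sum>j<s. vinc \<alpha> b n p (k + j)) \<le> real s / (4 * b)}"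
      by (rule measure_Un_le) measurable
    also have "L.prob {p. (\<Sum>j<s. vinc \<alpha> b n p (k + j)) \<le> real s / (4 * b)} \<le> exp (- (real s / 4))"
      by (intro vinc_sum_lower a b)
    finally show "q \<le> L.prob {p. lppg \<alpha> (1 - \<alpha>) n k p \<le> \<tau> ^ 3}"
      using small q unfolding b_def by linarith
  qed
qed

section \<open>Spread and variance of the displacement\<close>

context bernoulli_tasep
begin

text \<open>Passage at k - s later than \<tau> ^ 3 leaves the particle more than s to the right of n
  - k, and passage by that time puts it at most s to the right. Taking s near b \<tau> / 4 for the
  first and near b \<tau> / 8 for the second, b = 1 - \<alpha>, leaves a gap of order
  \<tau>.\<close>

lemma displacement_spread:
  assumes a: "0 < \<alpha>" "\<alpha> < 1"
  obtains p \<tau>0 where "0 < p" "\<And>\<tau> n k. near_char \<alpha> \<tau> n k \<Longrightarrow> \<tau>0 \<le> \<tau> \<Longrightarrow>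
    p \<le> prob {w \<in> space M. (1 - \<alpha>) * \<tau> / 4 \<le> real_of_int (R (int n) (\<tau> ^ 3) w - (int n - int k))} \<and>
    p \<le> prob {w \<in> space M. real_of_int (R (int n) (\<tau> ^ 3) w - (int n - int k)) \<le> (1 - \<alpha>) * \<tau> / 8}"
proof -
  obtain q \<tau>1 where q: "0 < q" "1 \<le> \<tau>1"
    and far: "\<And>\<tau> n k s. near_char \<alpha> \<tau> n (k + s) \<Longrightarrow> \<tau>1 \<le> \<tau> \<Longrightarrow> real s \<le> (1 - \<alpha>) * \<tau> / 4 \<Longrightarrow>
      L.prob {p. lppg \<alpha> (1 - \<alpha>) n k p \<le> \<tau> ^ 3 + \<tau>} \<le> 1 - q"
    and near: "\<And>\<tau> n k s. near_char \<alpha> \<tau> n (k + s) \<Longrightarrow> \<tau>1 \<le> \<tau> \<Longrightarrow> (1 - \<alpha>) * \<tau> / 16 \<le> real s \<Longrightarrow>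
      q \<le> L.prob {p. lppg \<alpha> (1 - \<alpha>) n k p \<le> \<tau> ^ 3}"
    by (rule lpp_spread[OF a]) blast
  define b where "b = 1 - \<alpha>"
  have b: "0 < b" "b \<le> 1" using a by (auto simp: b_def)
  show thesis
  proof (rule that[of "q / 2" "Max {\<tau>1, 16 / b, 4 / b\<^sup>2, 2 / (b * q)}"])
    show "0 < q / 2" using q by simp
    fix \<tau> n k assume nc: "near_char \<alpha> \<tau> n k" and "Max {\<tau>1, 16 / b, 4 / b\<^sup>2, 2 / (b * q)} \<le> \<tau>"
    then have \<tau>: "\<tau>1 \<le> \<tau>" "16 / b \<le> \<tau>" "4 / b\<^sup>2 \<le> \<tau>" "2 / (b * q) \<le> \<tau>" "1 \<le> \<tau>" using q by auto
    have t: "0 \<le> \<tau> ^ 3" using \<tau> by simp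
    have [measurable]: "R (int n) (\<tau> ^ 3) \<in> measurable M (count_space UNIV)" by (rule measurable_positions[OF t])
    have k: "b * \<tau> / 4 + 1 \<le> real k"
    proof -
      have "4 * \<tau> \<le> (b\<^sup>2 * \<tau>) * \<tau>" using \<tau> b by (intro mult_right_mono) (auto simp: field_simps)
      also have "\<dots> \<le> (b\<^sup>2 * \<tau>) * \<tau> * \<tau>" using mult_left_mono[of 1 \<tau> "b\<^sup>2 * \<tau> * \<tau>"] \<tau> by simp
      also have "\<dots> = b\<^sup>2 * \<tau> ^ 3" by (simp add: power3_eq_cube)
      also have "\<dots> \<le> real k + 1" using near_char_bounds(3)[OF nc a] by (simp add: b_def)
      finally have "4 * \<tau> \<le> real k + 1" .
      moreover have "b * \<tau> \<le> 1 * \<tau>" using b \<tau> by (intro mult_right_mono) auto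
      ultimately show ?thesis using \<tau> by linarith
    qed
    have "q / 2 \<le> prob {w \<in> space M. b * \<tau> / 4 \<le> real_of_int (R (int n) (\<tau> ^ 3) w - (int n - int k))}"
    proof -
      define s where "s = nat \<lfloor>b * \<tau> / 4\<rfloor>"
      have s: "real s \<le> b * \<tau> / 4" "b * \<tau> / 4 < real s + 1" using b \<tau> by (auto simp: s_def) linarith+
      then have sk: "s + 1 \<le> k" using k by linarith
      \<comment> \<open>The slack u = \<tau> absorbs the exponential variable of the right boundary;
        this is why the first bound of \<open>lpp_spread\<close> is stated at \<tau> ^ 3 +
        \<tau>.\<close>
      have "prob {w \<in> space M. R (int n) (\<tau> ^ 3) w \<le> int n - int (k - s)} \<le>
        L.prob {p. lppg \<alpha> (1 - \<alpha>) n (k - s) p \<le> \<tau> ^ 3 + \<tau>} + exp (- ((1 - \<alpha>) * \<tau>))"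
        using sk \<tau> by (intro prob_position_le a t) auto
      also have "\<dots> \<le> (1 - q) + q / 2"
      proof (rule add_mono)
        show "L.prob {p. lppg \<alpha> (1 - \<alpha>) n (k - s) p \<le> \<tau> ^ 3 + \<tau>} \<le> 1 - q"
          using s sk nc \<tau> by (intro far[of _ _ _ s]) (auto simp: b_def)
        have "exp (- (b * \<tau>)) \<le> 1 / (b * \<tau>)" using b \<tau> by (intro exp_minus_le_inverse) auto
        also have "\<dots> \<le> q / 2" using \<tau> b q by (simp add: field_simps)
        finally show "exp (- ((1 - \<alpha>) * \<tau>)) \<le> q / 2" by (simp add: b_def)
      qed
      finally have "q / 2 \<le> 1 - prob {w \<in> space M. R (int n) (\<tau> ^ 3) w \<le> int n - int (k - s)}" by simp
      also have "\<dots> = prob (space M - {w \<in> space M. R (int n) (\<tau> ^ 3) w \<le> int n - int (k - s)})" by (rule prob_compl[symmetric]) measurable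
      also have "\<dots> \<le> prob {w \<in> space M. b * \<tau> / 4 \<le> real_of_int (R (int n) (\<tau> ^ 3) w - (int n - int k))}"
      proof (rule finite_measure_mono)
        show "space M - {w \<in> space M. R (int n) (\<tau> ^ 3) w \<le> int n - int (k - s)} \<subseteq>
          {w \<in> space M. b * \<tau> / 4 \<le> real_of_int (R (int n) (\<tau> ^ 3) w - (int n - int k))}"
        proof
          fix w assume w: "w \<in> space M - {w \<in> space M. R (int n) (\<tau> ^ 3) w \<le> int n - int (k - s)}"
          then have "int s + 1 \<le> R (int n) (\<tau> ^ 3) w - (int n - int k)" using sk by (auto simp: of_nat_diff)
          then have "real_of_int (int s + 1) \<le> real_of_int (R (int n) (\<tau> ^ 3) w - (int n - int k))" by (simp only: of_int_le_iff)
          then show "w \<in> {w \<in> space M. b * \<tau> / 4 \<le> real_of_int (R (int n) (\<tau> ^ 3) w - (int n - int k))}" using s w by auto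
        qed
      qed measurable
      finally show ?thesis .
    qed
    moreover have "q / 2 \<le> prob {w \<in> space M. real_of_int (R (int n) (\<tau> ^ 3) w - (int n - int k)) \<le> b * \<tau> / 8}"
    proof -
      define s where "s = nat \<lfloor>b * \<tau> / 8\<rfloor>"
      have s: "real s \<le> b * \<tau> / 8" "b * \<tau> / 8 < real s + 1" using b \<tau> by (auto simp: s_def) linarith+
      \<comment> \<open>Taking the integer part of b \<tau> / 8 loses less than 1, which is at most
        b \<tau> / 16.\<close>
      have "16 \<le> b * \<tau>" using \<tau> b by (simp add: field_simps)
      then have s': "b * \<tau> / 16 \<le> real s" using s by linarith
      have sk: "s + 1 \<le> k" using k s \<open>16 \<le> b * \<tau>\<close> by linarith
      have "q \<le> L.prob {p. lppg \<alpha> (1 - \<alpha>) n (k - s) p \<le> \<tau> ^ 3}"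
        using s' sk nc \<tau> by (intro near[of _ _ _ s]) (auto simp: b_def)
      also have "\<dots> \<le> prob {w \<in> space M. R (int n) (\<tau> ^ 3) w \<le> int n - int (k - s)}"
        using sk by (intro prob_position_ge a t) simp
      also have "\<dots> \<le> prob {w \<in> space M. real_of_int (R (int n) (\<tau> ^ 3) w - (int n - int k)) \<le> b * \<tau> / 8}"
      proof (rule finite_measure_mono)
        show "{w \<in> space M. R (int n) (\<tau> ^ 3) w \<le> int n - int (k - s)} \<subseteq>
          {w \<in> space M. real_of_int (R (int n) (\<tau> ^ 3) w - (int n - int k)) \<le> b * \<tau> / 8}"
        proof
          fix w assume w: "w \<in> {w \<in> space M. R (int n) (\<tau> ^ 3) w \<le> int n - int (k - s)}"
          then have "R (int n) (\<tau> ^ 3) w - (int n - int k) \<le> int s" using sk by (auto simp: of_nat_diff)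
          then have "real_of_int (R (int n) (\<tau> ^ 3) w - (int n - int k)) \<le> real_of_int (int s)" by (simp only: of_int_le_iff)
          then show "w \<in> {w \<in> space M. real_of_int (R (int n) (\<tau> ^ 3) w - (int n - int k)) \<le> b * \<tau> / 8}" using s w by auto
        qed
      qed measurable
      finally show ?thesis using q by simp
    qed
    ultimately show "q / 2 \<le> prob {w \<in> space M. (1 - \<alpha>) * \<tau> / 4 \<le> real_of_int (R (int n) (\<tau> ^ 3) w - (int n - int k))} \<and>
      q / 2 \<le> prob {w \<in> space M. real_of_int (R (int n) (\<tau> ^ 3) w - (int n - int k)) \<le> (1 - \<alpha>) * \<tau> / 8}"
      by (simp add: b_def)
  qed
qed

text \<open>Centring at n - k does not change the variance. The second moment about n - k bounds it
  from above; the gap b \<tau> / 8 between the two events of \<open>displacement_spread\<close>, b =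
  1 - \<alpha>, bounds it from below.\<close>

lemma variance_bounds:
  assumes a: "0 < \<alpha>" "\<alpha> < 1"
  obtains lo hi \<tau>0 where "0 < lo" "\<And>\<tau> n k. near_char \<alpha> \<tau> n k \<Longrightarrow> \<tau>0 \<le> \<tau> \<Longrightarrow>
    lo * \<tau>\<^sup>2 \<le> variance (\<lambda>w. real_of_int (R (int n) (\<tau> ^ 3) w)) \<and> variance (\<lambda>w. real_of_int (R (int n) (\<tau> ^ 3) w)) \<le> hi * \<tau>\<^sup>2"
proof -
  obtain C c \<tau>1 where C: "0 < C" "0 < c" and tail: "\<And>\<tau> n k s. near_char \<alpha> \<tau> n k \<Longrightarrow> \<tau>1 \<le> \<tau> \<Longrightarrow>
    prob {w \<in> space M. int s < \<bar>R (int n) (\<tau> ^ 3) w - (int n - int k)\<bar>} \<le> C * exp (- (c * real s / \<tau>))"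
    by (rule displacement_tail[OF a]) blast
  obtain p \<tau>2 where p: "0 < p" and spread: "\<And>\<tau> n k. near_char \<alpha> \<tau> n k \<Longrightarrow> \<tau>2 \<le> \<tau> \<Longrightarrow>
    p \<le> prob {w \<in> space M. (1 - \<alpha>) * \<tau> / 4 \<le> real_of_int (R (int n) (\<tau> ^ 3) w - (int n - int k))} \<and>
    p \<le> prob {w \<in> space M. real_of_int (R (int n) (\<tau> ^ 3) w - (int n - int k)) \<le> (1 - \<alpha>) * \<tau> / 8}"
    by (rule displacement_spread[OF a]) blast
  show thesis
  proof (rule that[of "p * ((1 - \<alpha>) / 16)\<^sup>2" "Max {\<tau>1, \<tau>2, c}" "8 * C / c\<^sup>2"])
    show "0 < p * ((1 - \<alpha>) / 16)\<^sup>2" using p a by simp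
    fix \<tau> n k assume nc: "near_char \<alpha> \<tau> n k" and "Max {\<tau>1, \<tau>2, c} \<le> \<tau>"
    then have \<tau>: "\<tau>1 \<le> \<tau>" "\<tau>2 \<le> \<tau>" "c \<le> \<tau>" "0 < \<tau>" using C by auto
    have [measurable]: "R (int n) (\<tau> ^ 3) \<in> measurable M (count_space UNIV)" using \<tau> by (intro measurable_positions) simp
    define D where "D w = R (int n) (\<tau> ^ 3) w - (int n - int k)" for w
    have D [measurable]: "D \<in> measurable M (count_space UNIV)" unfolding D_def by measurable
    have D' [measurable]: "(\<lambda>w. real_of_int (D w)) \<in> borel_measurable M" by measurable
    note second = second_moment_tail[OF D, of C c \<tau>]
    have int2: "integrable M (\<lambda>w. (real_of_int (D w))\<^sup>2)"
      and bound: "expectation (\<lambda>w. (real_of_int (D w))\<^sup>2) \<le> 8 * C / c\<^sup>2 * \<tau>\<^sup>2"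
      using second tail[OF nc \<tau>(1)] C \<tau> by (auto simp: D_def)
    have int1: "integrable M (\<lambda>w. real_of_int (D w))"
      by (rule square_integrable_imp_integrable[OF D' int2])
    have R: "real_of_int (R (int n) (\<tau> ^ 3) w) = real_of_int (D w) + (real n - real k)" for w by (simp add: D_def)
    have var: "variance (\<lambda>w. real_of_int (R (int n) (\<tau> ^ 3) w)) = variance (\<lambda>w. real_of_int (D w))"
    proof -
      have "expectation (\<lambda>w. real_of_int (R (int n) (\<tau> ^ 3) w)) = expectation (\<lambda>w. real_of_int (D w)) + (real n - real k)"
        unfolding R using int1 by (simp add: prob_space)
      then show ?thesis unfolding R by simp
    qed
    have "variance (\<lambda>w. real_of_int (D w)) \<le> expectation (\<lambda>w. (real_of_int (D w))\<^sup>2)"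
      using variance_eq[OF int1 int2] by simp
    moreover have "p * ((1 - \<alpha>) * \<tau> / 8 / 2)\<^sup>2 \<le> variance (\<lambda>w. real_of_int (D w))"
      by (rule variance_spread[OF D' int2, of _ "(1 - \<alpha>) * \<tau> / 4" "(1 - \<alpha>) * \<tau> / 8"])
         (use spread[OF nc \<tau>(2)] a \<tau> in \<open>auto simp: D_def\<close>)
    ultimately show "p * ((1 - \<alpha>) / 16)\<^sup>2 * \<tau>\<^sup>2 \<le> variance (\<lambda>w. real_of_int (R (int n) (\<tau> ^ 3) w)) \<and>
      variance (\<lambda>w. real_of_int (R (int n) (\<tau> ^ 3) w)) \<le> 8 * C / c\<^sup>2 * \<tau>\<^sup>2"
      unfolding var using bound by (simp add: power_mult_distrib power_divide)
  qed
qed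

end

lemma near_char_floor:
  assumes "1 \<le> \<tau>"
  shows "near_char \<rho> \<tau> (nat \<lfloor>\<rho>\<^sup>2 * \<tau> ^ 3\<rfloor>) (nat \<lfloor>(1 - \<rho>)\<^sup>2 * \<tau> ^ 3\<rfloor>)"
proof -
  have f: "\<bar>real (nat \<lfloor>x\<rfloor>) - x\<bar> \<le> 1" if "0 \<le> x" for x :: real using that by linarith
  show ?thesis unfolding near_char_def using assms by (intro conjI f) auto
qed

theorem mainTheorem4:
  fixes M :: "'a measure" and \<alpha> \<rho> V :: real
    and E :: "int \<Rightarrow> nat \<Rightarrow> 'a \<Rightarrow> real"
    and R :: "int \<Rightarrow> real \<Rightarrow> 'a \<Rightarrow> int"
  assumes "0 < \<alpha>" and "\<alpha> < 1"
    and "bernoulli_tasep M \<alpha> E R"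
    and "\<rho> = 1 / \<alpha> - 1"
    and "V = 1 / (1 + \<rho>)\<^sup>2"
  shows "\<exists>C::real. 0 < C \<and>
    ereal (inverse C) \<le> Liminf at_top (\<lambda>t::real. ereal
      (prob_space.variance M (\<lambda>w. real_of_int (R (toward_origin (V * t)) t w)) / t powr (2/3))) \<and>
    Liminf at_top (\<lambda>t::real. ereal
      (prob_space.variance M (\<lambda>w. real_of_int (R (toward_origin (V * t)) t w)) / t powr (2/3))) \<le>
    Limsup at_top (\<lambda>t::real. ereal
      (prob_space.variance M (\<lambda>w. real_of_int (R (toward_origin (V * t)) t w)) / t powr (2/3))) \<and>
    Limsup at_top (\<lambda>t::real. ereal
      (prob_space.variance M (\<lambda>w. real_of_int (R (toward_origin (V * t)) t w)) / t powr (2/3))) \<le>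
    ereal C"
proof -
  interpret bernoulli_tasep M \<alpha> E R by fact
  have V: "V = \<alpha>\<^sup>2" using assms(1,4,5) by (simp add: power_divide)
  obtain lo hi \<tau>0 where lo: "0 < lo" and var: "\<And>\<tau> n k. near_char \<alpha> \<tau> n k \<Longrightarrow> \<tau>0 \<le> \<tau> \<Longrightarrow>
    lo * \<tau>\<^sup>2 \<le> variance (\<lambda>w. real_of_int (R (int n) (\<tau> ^ 3) w)) \<and> variance (\<lambda>w. real_of_int (R (int n) (\<tau> ^ 3) w)) \<le> hi * \<tau>\<^sup>2"
    by (rule variance_bounds[OF assms(1,2)]) blast
  define v where "v t = variance (\<lambda>w. real_of_int (R (toward_origin (V * t)) t w)) / t powr (2/3)" for t :: real
  define \<tau>1 where "\<tau>1 = max 1 \<tau>0"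
  have bounds: "lo \<le> v t \<and> v t \<le> hi" if t: "\<tau>1 ^ 3 \<le> t" for t
  proof -
    \<comment> \<open>In this scale the normalisation t^(2/3) is \<tau>^2, and the rounded index V t
      is the integer part that \<open>near_char_floor\<close> places on the characteristic.\<close>
    define \<tau> where "\<tau> = t powr (1 / 3)"
    have "1 \<le> \<tau>1 ^ 3" by (simp add: \<tau>1_def)
    then have t0: "0 < t" using t by simp
    have \<tau>3: "\<tau> ^ 3 = t" using t0 by (simp add: \<tau>_def powr_realpow[symmetric] powr_powr)
    have \<tau>2: "\<tau>\<^sup>2 = t powr (2 / 3)" using t0 by (simp add: \<tau>_def powr_realpow[symmetric] powr_powr)
    have "\<tau>1 \<le> \<tau>"
      by (rule power_le_imp_le_base[of _ 2]) (use t \<tau>3 in \<open>auto simp: \<tau>_def numeral_3_eq_3 numeral_2_eq_2\<close>)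
    then have \<tau>: "1 \<le> \<tau>" "\<tau>0 \<le> \<tau>" "0 < \<tau>" by (auto simp: \<tau>1_def)
    have n: "toward_origin (V * t) = int (nat \<lfloor>\<alpha>\<^sup>2 * \<tau> ^ 3\<rfloor>)" using t0 by (simp add: toward_origin_def V \<tau>3)
    have "lo * \<tau>\<^sup>2 \<le> variance (\<lambda>w. real_of_int (R (toward_origin (V * t)) t w)) \<and> variance (\<lambda>w. real_of_int (R (toward_origin (V * t)) t w)) \<le> hi * \<tau>\<^sup>2"
      using var[OF near_char_floor[OF \<tau>(1)] \<tau>(2)] unfolding n \<tau>3 .
    then show ?thesis unfolding v_def \<tau>2[symmetric] using \<tau> by (simp add: pos_le_divide_eq pos_divide_le_eq)
  qed
  have "0 < hi" using bounds[OF order_refl] lo by linarith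
  define C where "C = max (inverse lo) hi"
  have C: "0 < C" "inverse C \<le> lo" "hi \<le> C"
  proof -
    show "0 < C" "hi \<le> C" using lo \<open>0 < hi\<close> by (auto simp: C_def max_def)
    have "inverse C \<le> inverse (inverse lo)" using lo by (intro le_imp_inverse_le) (auto simp: C_def)
    then show "inverse C \<le> lo" by simp
  qed
  have ev: "eventually (\<lambda>t. ereal (inverse C) \<le> ereal (v t)) at_top" "eventually (\<lambda>t. ereal (v t) \<le> ereal C) at_top"
    using eventually_ge_at_top[of "\<tau>1 ^ 3"] by (eventually_elim, use bounds C in force)+
  have "ereal (inverse C) \<le> Liminf at_top (\<lambda>t. ereal (v t))" by (rule Liminf_bounded[OF ev(1)])
  moreover have "Limsup at_top (\<lambda>t. ereal (v t)) \<le> ereal C" by (rule Limsup_bounded[OF ev(2)])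
  moreover have "Liminf at_top (\<lambda>t. ereal (v t)) \<le> Limsup at_top (\<lambda>t. ereal (v t))" by (rule Liminf_le_Limsup) simp
  ultimately show ?thesis using C(1) unfolding v_def by blast
qed

end
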